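(* Let $\gamma>0$, $0<\alpha<1$, $\delta>1/2$, $H=H(\delta)$, and let $\eta>0$ be an arbitrary fixed constant. Let $\Pi$ be the law on $L^2$ of the random series $$G_\gamma=\sum_{l\ge J_0-1}\sum_{k=0}^{2^l-1}2^{-l(\gamma+1/2)}g_{lk}\psi_{lk},$$ where the $g_{lk}$ are i.i.d. real random variables that possess a bounded positive density $\varphi$ and satisfy $\mathrm{Var}(g_{lk})<\infty$, and $\{\psi_{lk}\}$ is an $S$-regular Cohen--Daubechies--Vial wavelet basis of $L^2$, $S>\max(\gamma,1/2)$. Consider observations $\mathbb X^{(n)}=f_0+n^{-1/2}\mathbb W\sim P_{f_0}^n$ for a fixed $f_0\in C^\gamma$. Let $\Pi_n=\Pi(\cdot\mid\mathbb X^{(n)})$ be the posterior distribution, $\bar f_n$ its mean, let $R_n$ be such that $\Pi_n(f:\|f-\bar f_n\|_H\le R_n/\sqrt n)=1-\alpha$, let $\delta_n=(\log n)^{-1/4}$ and $$M_n=\inf\{M>0:\ \Pi_n(f:\,|\,\|f\|_{\gamma,2,1}-M|\le\eta)\ge1-\delta_n\}$$ (with $M_n=\infty$ if the set is empty), and let $$C_n''=\{f:\ \|f\|_{\gamma,2,1}\le M_n+4\eta,\ \|f-\bar f_n\|_H\le R_n/\sqrt n\}.$$ Then, as $n\to\infty$, $$P_{f_0}^n(f_0\in C_n'')\to1-\alpha,\qquad \Pi_n(C_n'')=1-\alpha+o_P(1),$$ and the $L^2$-diameter $|C_n''|_2$ of $C_n''$ satisfies, for some $\kappa>0$, $$|C_n''|_2=O_P\big(n^{-\gamma/(2\gamma+1)}(\log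 n)^\kappa\big).$$ Additionally, both $M_n$ and $R_n$ are bounded in probability.
   Context: $L^2=L^2([0,1])$ with $\langle f,g\rangle=\int_0^1 f\bar g$. The $S$-regular Cohen--Daubechies--Vial (CDV) wavelet basis $\{\psi_{lk}: l\ge J_0-1,\ 0\le k\le 2^l-1\}$ is an orthonormal basis of $L^2$ of boundary-corrected wavelets, all $S$-times differentiable with derivatives in $L^2$; the functions with $l=J_0-1$ denote the scaling functions; $J_0\in\mathbb N$ with $J_0-1\ge1$. Put $a_l=2^l$. Norms. $C^\gamma=\{f\in C([0,1]):\sup_{l,k}2^{l(\gamma+1/2)}|\langle\psi_{lk},f\rangle|<\infty\}$. $\|f\|_{\gamma,2,1}^2=\sum_l a_l^{2\gamma}(\log a_l)^{-2}\sum_k|\langle\psi_{lk},f\rangle|^2$. For $\delta>1/2$, $H(\delta)$ is the Hilbert space of linear forms $f$ on $\mathrm{span}\{\psi_{lk}\}$ (identified with their coefficients $\langle f,\psi_{lk}\rangle$) with $\|f\|_{H(\delta)}^2=\sum_l a_l^{-1}(\log a_l)^{-2\delta}\sum_k|\langle f,\psi_{lk}\rangle|^2<\infty$; it contains $L^2$. Model. $\mathbb W$ is standard white noise (i.i.d. $N(0,1)$ coefficients in the basis), a tight Gaussian random variable in $H(\delta)$. For $f\in L^2$, $P_f^n$ is the law of $\mathbb X^{(n)}=f+n^{-1/2}\mathbb W$. The posterior $\Pi(\cdot\mid\mathbb X^{(n)})$ is the conditional law of $f$ given $\mathbb X^{(n)}$ when $f\sim\Pi$ and $\mathbb X^{(n)}\mid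 f\sim P_f^n$, given by Bayes' formula with likelihood $dP_f^n/dP_0^n=\exp(n\langle f,\mathbb X^{(n)}\rangle-\tfrac n2\|f\|_2^2)$. The posterior mean is the Bochner integral $\bar f_n=\int f\,d\Pi(f\mid\mathbb X^{(n)})$. $o_P,O_P$ refer to $P_{f_0}^n$.
   Formalization: The density φ is additionally assumed continuous (with a merely bounded positive density R_n can be unbounded and coverage can fail), and the level l = J_0−1 carries 2^{J_0} scaling functions instead of 2^{J_0−1}. *)

theory Defs
  imports "HOL-Probability.Probability"
begin

section \<open>The Hilbert space of square-integrable functions on the unit interval\<close>

abbreviation unit_leb :: "real measure" where
  "unit_leb \<equiv> restrict_space lborel {0..1}"

definition sq_int :: "(real \<Rightarrow> real) \<Rightarrow> bool" where
  "sq_int f \<longleftrightarrow> f \<in> borel_measurable unit_leb \<and> integrable unit_leb (\<lambda>x. (f x)\<^sup>2)"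

lemma sq_int_mult:
  assumes "sq_int f" "sq_int g"
  shows "integrable unit_leb (\<lambda>x. f x * g x)"
proof (rule Bochner_Integration.integrable_bound)
  show "integrable unit_leb (\<lambda>x. (f x)\<^sup>2 + (g x)\<^sup>2)"
    using assms by (auto simp: sq_int_def)
  show "(\<lambda>x. f x * g x) \<in> borel_measurable unit_leb"
    using assms by (auto simp: sq_int_def)
  have "\<bar>a * b\<bar> \<le> a\<^sup>2 + b\<^sup>2" for a b :: real
  proof -
    have "2 * (\<bar>a\<bar> * \<bar>b\<bar>) \<le> a\<^sup>2 + b\<^sup>2"
      using sum_squares_bound[of "\<bar>a\<bar>" "\<bar>b\<bar>"] by (simp add: mult.assoc)
    moreover have "0 \<le> \<bar>a\<bar> * \<bar>b\<bar>" by simp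
    ultimately show ?thesis unfolding abs_mult by linarith
  qed
  then show "AE x in unit_leb. norm (f x * g x) \<le> norm ((f x)\<^sup>2 + (g x)\<^sup>2)"
    by (intro AE_I2) (simp add: real_norm_def)
qed

lemma sq_int_zero: "sq_int (\<lambda>_. 0)"
  by (simp add: sq_int_def)

lemma sq_int_add: assumes "sq_int f" "sq_int g" shows "sq_int (\<lambda>x. f x + g x)"
  using assms sq_int_mult[OF assms]
  by (auto simp: sq_int_def power2_sum mult.assoc)

lemma sq_int_scale: assumes "sq_int f" shows "sq_int (\<lambda>x. c * f x)"
  using assms by (auto simp: sq_int_def power_mult_distrib)

lemma sq_int_diff: assumes "sq_int f" "sq_int g" shows "sq_int (\<lambda>x. f x - g x)"
  using sq_int_add[OF assms(1) sq_int_scale[OF assms(2), of "-1"]] by simp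

definition L2_rel :: "(real \<Rightarrow> real) \<Rightarrow> (real \<Rightarrow> real) \<Rightarrow> bool" where
  "L2_rel f g \<longleftrightarrow> sq_int f \<and> sq_int g \<and> (AE x in unit_leb. f x = g x)"

lemma part_equivp_L2_rel: "part_equivp L2_rel"
proof (rule part_equivpI)
  show "\<exists>x. L2_rel x x"
    using sq_int_zero by (auto simp: L2_rel_def intro: exI[of _ "\<lambda>_. 0"])
  show "symp L2_rel"
    by (auto simp: symp_def L2_rel_def elim: eventually_mono)
  show "transp L2_rel"
    unfolding transp_def L2_rel_def by (auto elim: eventually_elim2)
qed

quotient_type L2 = "real \<Rightarrow> real" / partial: L2_rel
  by (rule part_equivp_L2_rel)

text \<open>\<open>to_L2 f\<close> is the class of \<open>f\<close>; it is only meaningful if \<open>sq_int f\<close>.\<close>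

definition to_L2 :: "(real \<Rightarrow> real) \<Rightarrow> L2" where
  "to_L2 f = abs_L2 f"

lemma L2_cases: obtains f where "sq_int f" "x = to_L2 f"
proof -
  have "L2_rel (rep_L2 x) (rep_L2 x)"
    using Quotient_rep_reflp[OF Quotient_L2] .
  moreover have "x = abs_L2 (rep_L2 x)"
    using Quotient_abs_rep[OF Quotient_L2] by simp
  ultimately show ?thesis
    using that by (auto simp: L2_rel_def to_L2_def)
qed

instantiation L2 :: real_vector
begin

lift_definition zero_L2 :: L2 is "\<lambda>_. 0"
  by (auto simp: L2_rel_def sq_int_zero)

lift_definition plus_L2 :: "L2 \<Rightarrow> L2 \<Rightarrow> L2" is "\<lambda>f g x. f x + g x"
  by (auto simp: L2_rel_def sq_int_add elim: eventually_elim2)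

lift_definition scaleR_L2 :: "real \<Rightarrow> L2 \<Rightarrow> L2" is "\<lambda>c f x. c * f x"
  by (auto simp: L2_rel_def sq_int_scale)

definition uminus_L2 :: "L2 \<Rightarrow> L2" where "uminus_L2 f = (-1) *\<^sub>R f"
definition minus_L2 :: "L2 \<Rightarrow> L2 \<Rightarrow> L2" where "minus_L2 f g = f + (- g)"

instance
proof
  fix a b c :: L2 and r s :: real
  show "a + b + c = a + (b + c)"
    by transfer (auto simp: L2_rel_def sq_int_add add.assoc)
  show "a + b = b + a"
    by transfer (auto simp: L2_rel_def sq_int_add add.commute)
  show "0 + a = a"
    by transfer (auto simp: L2_rel_def)
  show "- a + a = 0"
    unfolding uminus_L2_def
    by transfer (auto simp: L2_rel_def sq_int_zero)
  show "a - b = a + - b"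
    by (simp add: minus_L2_def)
  show "r *\<^sub>R (a + b) = r *\<^sub>R a + r *\<^sub>R b"
    by transfer (auto simp: L2_rel_def sq_int_add sq_int_scale distrib_left)
  show "(r + s) *\<^sub>R a = r *\<^sub>R a + s *\<^sub>R a"
    by transfer (auto simp: L2_rel_def sq_int_add sq_int_scale distrib_right)
  show "r *\<^sub>R s *\<^sub>R a = (r * s) *\<^sub>R a"
    by transfer (auto simp: L2_rel_def sq_int_scale mult.assoc)
  show "1 *\<^sub>R a = a"
    by transfer (auto simp: L2_rel_def)
qed

end

instantiation L2 :: real_inner
begin

lift_definition inner_L2 :: "L2 \<Rightarrow> L2 \<Rightarrow> real" is "\<lambda>f g. LINT x|unit_leb. f x * g x"
proof -
  fix f f' g g' :: "real \<Rightarrow> real"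
  assume "L2_rel f f'" "L2_rel g g'"
  then have [measurable]: "f \<in> borel_measurable unit_leb" "f' \<in> borel_measurable unit_leb"
      "g \<in> borel_measurable unit_leb" "g' \<in> borel_measurable unit_leb"
    and "AE x in unit_leb. f x = f' x" "AE x in unit_leb. g x = g' x"
    by (auto simp: L2_rel_def sq_int_def)
  then have "AE x in unit_leb. f x * g x = f' x * g' x" by (auto elim: eventually_elim2)
  then show "(LINT x|unit_leb. f x * g x) = (LINT x|unit_leb. f' x * g' x)"
    by (intro integral_cong_AE) auto
qed

definition norm_L2 :: "L2 \<Rightarrow> real" where "norm_L2 f = sqrt (inner f f)"
definition dist_L2 :: "L2 \<Rightarrow> L2 \<Rightarrow> real" where "dist_L2 f g = norm (f - g)"
definition sgn_L2 :: "L2 \<Rightarrow> L2" where "sgn_L2 f = inverse (norm f) *\<^sub>R f"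
definition uniformity_L2 :: "(L2 \<times> L2) filter" where
  "uniformity_L2 = (INF e\<in>{0<..}. principal {(x, y). dist x y < e})"
definition open_L2 :: "L2 set \<Rightarrow> bool" where
  "open_L2 U = (\<forall>x\<in>U. eventually (\<lambda>(x', y). x' = x \<longrightarrow> y \<in> U) uniformity)"

instance
proof
  fix x y z :: L2 and r :: real and U :: "L2 set"
  show "dist x y = norm (x - y)" by (simp add: dist_L2_def)
  show "sgn x = x /\<^sub>R norm x" by (simp add: sgn_L2_def)
  show "(uniformity :: (L2 \<times> L2) filter) = (INF e\<in>{0<..}. principal {(x, y). dist x y < e})"
    by (simp add: uniformity_L2_def)
  show "open U = (\<forall>x\<in>U. eventually (\<lambda>(x', y). x' = x \<longrightarrow> y \<in> U) uniformity)"
    by (simp add: open_L2_def)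
  show "inner x y = inner y x"
    by transfer (simp add: mult.commute)
  show "inner (x + y) z = inner x z + inner y z"
    by transfer (auto simp: L2_rel_def distrib_right intro!: Bochner_Integration.integral_add sq_int_mult)
  show "inner (r *\<^sub>R x) y = r * inner x y"
    by transfer (simp add: mult.assoc)
  show "0 \<le> inner x x"
    by transfer (auto intro!: integral_nonneg)
  show "(inner x x = 0) = (x = 0)"
  proof transfer
    fix f assume "L2_rel f f"
    then have f: "integrable unit_leb (\<lambda>x. f x * f x)" "sq_int f"
      by (auto simp: L2_rel_def sq_int_def power2_eq_square)
    show "(LINT x|unit_leb. f x * f x) = 0 \<longleftrightarrow> L2_rel f (\<lambda>_. 0)"
      using f integral_nonneg_eq_0_iff_AE[OF f(1)] by (auto simp: L2_rel_def sq_int_zero)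
  qed
  show "norm x = sqrt (inner x x)" by (simp add: norm_L2_def)
qed

end

lemma inner_to_L2:
  "sq_int f \<Longrightarrow> sq_int g \<Longrightarrow> inner (to_L2 f) (to_L2 g) = (LINT x|unit_leb. f x * g x)"
  unfolding to_L2_def by (subst inner_L2.abs_eq) (auto simp: L2_rel_def)

lemma to_L2_add: "sq_int f \<Longrightarrow> sq_int g \<Longrightarrow> to_L2 f + to_L2 g = to_L2 (\<lambda>x. f x + g x)"
  unfolding to_L2_def by (subst plus_L2.abs_eq) (auto simp: L2_rel_def)

lemma to_L2_scale: "sq_int f \<Longrightarrow> c *\<^sub>R to_L2 f = to_L2 (\<lambda>x. c * f x)"
  unfolding to_L2_def by (subst scaleR_L2.abs_eq) (auto simp: L2_rel_def)

lemma to_L2_eq_iff: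
  "sq_int f \<Longrightarrow> sq_int g \<Longrightarrow> to_L2 f = to_L2 g \<longleftrightarrow> (AE x in unit_leb. f x = g x)"
  unfolding to_L2_def using Quotient_rel[OF Quotient_L2, of f g] by (auto simp: L2_rel_def)

lemma to_L2_diff:
  assumes "sq_int f" "sq_int g" shows "to_L2 f - to_L2 g = to_L2 (\<lambda>x. f x - g x)"
proof -
  have "to_L2 f - to_L2 g = to_L2 f + (-1) *\<^sub>R to_L2 g" by simp
  also have "\<dots> = to_L2 (\<lambda>x. f x + (-1) * g x)"
    using assms sq_int_scale[OF assms(2), of "-1"] by (simp only: to_L2_scale to_L2_add)
  finally show ?thesis by simp
qed

lemma norm_to_L2:
  "sq_int f \<Longrightarrow> norm (to_L2 f) = sqrt (LINT x|unit_leb. (f x)\<^sup>2)"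
  by (simp add: norm_eq_sqrt_inner inner_to_L2 power2_eq_square)

lemma finite_measure_unit_leb: "finite_measure unit_leb"
  by (rule finite_measureI) (simp add: emeasure_restrict_space space_restrict_space)

lemma space_unit_leb [simp]: "space unit_leb = {0..1}"
  by (simp add: space_restrict_space)

instance L2 :: complete_space
proof
  fix X :: "nat \<Rightarrow> L2"
  assume C: "Cauchy X"
  interpret finite_measure unit_leb by (rule finite_measure_unit_leb)
  have m1: "measure unit_leb {0..1} = 1"
    by (simp add: measure_restrict_space)
  have "\<forall>n. \<exists>f. sq_int f \<and> X n = to_L2 f" by (metis L2_cases)
  then obtain u where u: "\<And>n. sq_int (u n)" "\<And>n. X n = to_L2 (u n)" by metis
  note ud = sq_int_diff[OF u(1) u(1)]
  have um [measurable]: "u n \<in> borel_measurable unit_leb" for n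
    using u(1) by (simp add: sq_int_def)
  have one: "sq_int (\<lambda>_. 1)" by (simp add: sq_int_def)
  have uint: "integrable unit_leb (u n)" for n
    using sq_int_mult[OF u(1)[of n] one] by simp
  have distX: "(dist (X n) (X m))\<^sup>2 = (LINT x|unit_leb. (u n x - u m x)\<^sup>2)" for n m
    by (simp add: dist_norm u(2) to_L2_diff u(1) norm_to_L2 ud)
  have L1: "(LINT x|unit_leb. norm (u n x - u m x)) \<le> dist (X n) (X m)" for n m
  proof -
    let ?g = "\<lambda>x. \<bar>u n x - u m x\<bar>"
    have g: "sq_int ?g" using ud[of n m] by (auto simp: sq_int_def)
    have "(LINT x|unit_leb. ?g x) = inner (to_L2 ?g) (to_L2 (\<lambda>_. 1))"
      by (simp add: inner_to_L2 g one)
    also have "\<dots> \<le> norm (to_L2 ?g) * norm (to_L2 (\<lambda>_. 1))"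
      by (rule norm_cauchy_schwarz)
    also have "norm (to_L2 (\<lambda>_. 1)) = 1"
      by (simp add: norm_to_L2 one m1)
    also have "norm (to_L2 ?g) = dist (X n) (X m)"
      by (simp add: norm_to_L2 g dist_norm u(2) to_L2_diff u(1) ud)
    finally show ?thesis by simp
  qed
  have cau1: "\<exists>N. \<forall>i\<ge>N. \<forall>j\<ge>N. (LINT x|unit_leb. norm (u i x - u j x)) < e" if "e > 0" for e
  proof -
    from C that obtain N where "\<forall>m\<ge>N. \<forall>n\<ge>N. dist (X m) (X n) < e"
      unfolding Cauchy_def by blast
    then show ?thesis using L1 by (meson le_less_trans)
  qed
  obtain r where r: "strict_mono r" and Cr: "AE x in unit_leb. Cauchy (\<lambda>i. u (r i) x)"
    using cauchy_L1_AE_cauchy_subseq[OF uint cau1] by blast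
  define f where "f x = lim (\<lambda>i. u (r i) x)" for x
  have fm [measurable]: "f \<in> borel_measurable unit_leb"
    unfolding f_def by (rule borel_measurable_lim_metric) simp
  have flim: "AE x in unit_leb. (\<lambda>i. u (r i) x) \<longlonglongrightarrow> f x"
    using Cr by eventually_elim (simp add: f_def Cauchy_convergent_iff convergent_LIMSEQ_iff)
  have key: "(\<integral>\<^sup>+x. ennreal ((f x - u n x)\<^sup>2) \<partial>unit_leb) \<le> ennreal (e\<^sup>2)"
    if e: "0 < e" and N: "\<And>m. m \<ge> N \<Longrightarrow> dist (X m) (X n) < e" for e n N
  proof -
    have "(\<integral>\<^sup>+x. ennreal ((f x - u n x)\<^sup>2) \<partial>unit_leb)
        = (\<integral>\<^sup>+x. liminf (\<lambda>i. ennreal ((u (r i) x - u n x)\<^sup>2)) \<partial>unit_leb)"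
    proof (rule nn_integral_cong_AE)
      show "AE x in unit_leb. ennreal ((f x - u n x)\<^sup>2) = liminf (\<lambda>i. ennreal ((u (r i) x - u n x)\<^sup>2))"
        using flim
      proof eventually_elim
        fix x assume "(\<lambda>i. u (r i) x) \<longlonglongrightarrow> f x"
        then have "(\<lambda>i. ennreal ((u (r i) x - u n x)\<^sup>2)) \<longlonglongrightarrow> ennreal ((f x - u n x)\<^sup>2)"
          by (intro tendsto_intros tendsto_ennrealI)
        from lim_imp_Liminf[OF _ this]
        show "ennreal ((f x - u n x)\<^sup>2) = liminf (\<lambda>i. ennreal ((u (r i) x - u n x)\<^sup>2))" by simp
      qed
    qed
    also have "\<dots> \<le> liminf (\<lambda>i. \<integral>\<^sup>+x. ennreal ((u (r i) x - u n x)\<^sup>2) \<partial>unit_leb)"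
      by (rule nn_integral_liminf) simp
    also have "\<dots> = liminf (\<lambda>i. ennreal ((dist (X (r i)) (X n))\<^sup>2))"
    proof -
      have "(\<integral>\<^sup>+x. ennreal ((u m x - u n x)\<^sup>2) \<partial>unit_leb) = ennreal ((dist (X m) (X n))\<^sup>2)" for m
        unfolding distX using ud[of m n]
        by (intro nn_integral_eq_integral) (auto simp: sq_int_def)
      then show ?thesis by simp
    qed
    also have "\<dots> \<le> liminf (\<lambda>i::nat. ennreal (e\<^sup>2))"
    proof (rule Liminf_mono, rule eventually_sequentiallyI)
      fix i assume "N \<le> i"
      then have "N \<le> r i" using seq_suble[OF r, of i] by simp
      then show "ennreal ((dist (X (r i)) (X n))\<^sup>2) \<le> ennreal (e\<^sup>2)"
        using N[of "r i"] by (intro ennreal_leI power_mono) auto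
    qed
    also have "\<dots> = ennreal (e\<^sup>2)" by (simp add: Liminf_const)
    finally show ?thesis .
  qed
  have sqd: "sq_int (\<lambda>x. f x - u n x) \<and> norm (to_L2 (\<lambda>x. f x - u n x)) \<le> e"
    if e: "0 < e" and N: "\<And>m. m \<ge> N \<Longrightarrow> dist (X m) (X n) < e" for e n N
  proof -
    have k: "(\<integral>\<^sup>+x. ennreal ((f x - u n x)\<^sup>2) \<partial>unit_leb) \<le> ennreal (e\<^sup>2)"
      using key[OF that] .
    then have "(\<integral>\<^sup>+x. ennreal (norm ((f x - u n x)\<^sup>2)) \<partial>unit_leb) < \<infinity>"
      by (auto simp: less_top[symmetric] top_unique)
    then have i: "integrable unit_leb (\<lambda>x. (f x - u n x)\<^sup>2)"
      by (intro integrableI_bounded) auto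
    then have s: "sq_int (\<lambda>x. f x - u n x)" by (simp add: sq_int_def)
    have "ennreal (LINT x|unit_leb. (f x - u n x)\<^sup>2) \<le> ennreal (e\<^sup>2)"
      using k nn_integral_eq_integral[OF i] by simp
    then have "(LINT x|unit_leb. (f x - u n x)\<^sup>2) \<le> e\<^sup>2"
      by (subst (asm) ennreal_le_iff) auto
    then have "norm (to_L2 (\<lambda>x. f x - u n x)) \<le> sqrt (e\<^sup>2)"
      unfolding norm_to_L2[OF s] by (rule real_sqrt_le_mono)
    with e s show ?thesis by simp
  qed
  have Cau: "\<exists>N. \<forall>n\<ge>N. sq_int (\<lambda>x. f x - u n x) \<and> norm (to_L2 (\<lambda>x. f x - u n x)) \<le> e" if "e > 0" for e
  proof -
    from C that obtain N where "\<forall>m\<ge>N. \<forall>n\<ge>N. dist (X m) (X n) < e"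
      unfolding Cauchy_def by blast
    then show ?thesis using sqd[OF that, of N] by blast
  qed
  obtain n0 where "sq_int (\<lambda>x. f x - u n0 x)" using Cau[of 1] by auto
  from sq_int_add[OF this u(1)[of n0]] have sf: "sq_int f" by simp
  have "X \<longlonglongrightarrow> to_L2 f"
  proof (rule metric_LIMSEQ_I)
    fix e :: real assume "e > 0"
    then obtain N where N: "\<And>n. n \<ge> N \<Longrightarrow> norm (to_L2 (\<lambda>x. f x - u n x)) \<le> e / 2"
      using Cau[of "e/2"] by auto
    have "dist (X n) (to_L2 f) < e" if "n \<ge> N" for n
      using N[OF that] \<open>e > 0\<close> by (simp add: dist_commute[of "X n"]) (simp add: dist_norm u to_L2_diff sf)
    then show "\<exists>N. \<forall>n\<ge>N. dist (X n) (to_L2 f) < e" by blast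
  qed
  then show "convergent X" by (auto simp: convergent_def)
qed

instance L2 :: banach ..


lemma to_L2_dominated:
  assumes w: "sq_int w" and f: "f \<in> borel_measurable unit_leb"
    and s: "\<And>i. s i \<in> borel_measurable unit_leb"
    and lim: "\<And>x. x \<in> {0..1} \<Longrightarrow> (\<lambda>i. s i x) \<longlonglongrightarrow> f x"
    and bd: "\<And>i x. x \<in> {0..1} \<Longrightarrow> \<bar>s i x\<bar> \<le> w x"
  shows "sq_int f" "sq_int (s i)" "(\<lambda>i. to_L2 (s i)) \<longlonglongrightarrow> to_L2 f"
proof -
  note [measurable] = f s
  have [measurable]: "w \<in> borel_measurable unit_leb" using w by (simp add: sq_int_def)
  have bdf: "\<bar>f x\<bar> \<le> w x" if "x \<in> {0..1}" for x
  proof (rule LIMSEQ_le_const2)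
    show "(\<lambda>i. \<bar>s i x\<bar>) \<longlonglongrightarrow> \<bar>f x\<bar>" by (rule tendsto_rabs[OF lim[OF that]])
    show "\<exists>N. \<forall>n\<ge>N. \<bar>s n x\<bar> \<le> w x" using bd[OF that] by blast
  qed
  have aux: "sq_int g" if [measurable]: "g \<in> borel_measurable unit_leb"
    and g: "\<And>x. x \<in> {0..1} \<Longrightarrow> \<bar>g x\<bar> \<le> w x" for g
  proof -
    have "integrable unit_leb (\<lambda>x. (g x)\<^sup>2)"
    proof (rule Bochner_Integration.integrable_bound)
      show "integrable unit_leb (\<lambda>x. (w x)\<^sup>2)" using w by (simp add: sq_int_def)
      show "(\<lambda>x. (g x)\<^sup>2) \<in> borel_measurable unit_leb" by simp
      show "AE x in unit_leb. norm ((g x)\<^sup>2) \<le> norm ((w x)\<^sup>2)"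
      proof (rule AE_I2)
        fix x assume "x \<in> space unit_leb"
        then have "\<bar>g x\<bar> \<le> \<bar>w x\<bar>" using g[of x] by auto
        then show "norm ((g x)\<^sup>2) \<le> norm ((w x)\<^sup>2)"
          by (simp add: abs_le_square_iff)
      qed
    qed
    then show ?thesis by (simp add: sq_int_def)
  qed
  show sf: "sq_int f" by (rule aux[OF f bdf])
  show ss: "sq_int (s i)" for i by (rule aux[OF s bd])
  have "(\<lambda>i. LINT x|unit_leb. (s i x - f x)\<^sup>2) \<longlonglongrightarrow> (LINT x|unit_leb. (0::real))"
  proof (rule integral_dominated_convergence[where w="\<lambda>x. 4 * (w x)\<^sup>2"])
    show "integrable unit_leb (\<lambda>x. 4 * (w x)\<^sup>2)" using w by (simp add: sq_int_def)
    show "AE x in unit_leb. (\<lambda>i. (s i x - f x)\<^sup>2) \<longlonglongrightarrow> 0"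
    proof (rule AE_I2)
      fix x assume "x \<in> space unit_leb"
      then have "(\<lambda>i. (s i x - f x)\<^sup>2) \<longlonglongrightarrow> (f x - f x)\<^sup>2"
        by (intro tendsto_intros lim) auto
      then show "(\<lambda>i. (s i x - f x)\<^sup>2) \<longlonglongrightarrow> 0" by simp
    qed
    show "AE x in unit_leb. norm ((s i x - f x)\<^sup>2) \<le> 4 * (w x)\<^sup>2" for i
    proof (rule AE_I2)
      fix x assume "x \<in> space unit_leb"
      then have "\<bar>s i x - f x\<bar> \<le> \<bar>2 * w x\<bar>" using bd[of x i] bdf[of x] by auto
      then have "(s i x - f x)\<^sup>2 \<le> (2 * w x)\<^sup>2" by (simp only: abs_le_square_iff)
      then show "norm ((s i x - f x)\<^sup>2) \<le> 4 * (w x)\<^sup>2" by (simp add: power_mult_distrib)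
    qed
  qed simp_all
  then have "(\<lambda>i. sqrt (LINT x|unit_leb. (s i x - f x)\<^sup>2)) \<longlonglongrightarrow> 0"
    using tendsto_real_sqrt by fastforce
  then have "(\<lambda>i. norm (to_L2 (s i) - to_L2 f)) \<longlonglongrightarrow> 0"
    by (simp add: to_L2_diff ss sf norm_to_L2 sq_int_diff)
  then show "(\<lambda>i. to_L2 (s i)) \<longlonglongrightarrow> to_L2 f"
    by (simp add: tendsto_iff dist_norm)
qed

lemma sq_int_indicator: "A \<in> sets borel \<Longrightarrow> sq_int (indicator A)"
  unfolding sq_int_def
proof (intro conjI)
  assume [measurable]: "A \<in> sets borel"
  show m: "(indicator A :: real \<Rightarrow> real) \<in> borel_measurable unit_leb"
    by (rule measurable_restrict_space1) simp
  interpret finite_measure unit_leb by (rule finite_measure_unit_leb)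
  show "integrable unit_leb (\<lambda>x. (indicator A x :: real)\<^sup>2)"
  proof (rule integrable_const_bound[where B=1])
    show "(\<lambda>x. (indicator A x :: real)\<^sup>2) \<in> borel_measurable unit_leb"
      using m by simp
  qed (auto simp: indicator_def)
qed

lemma countable_dense_L2: "\<exists>Q :: L2 set. countable Q \<and> closure Q = UNIV"
proof -
  define comb :: "(rat \<times> rat) list \<Rightarrow> L2" where
    "comb xs = (\<Sum>(q, a)\<leftarrow>xs. real_of_rat q *\<^sub>R to_L2 (indicator {..real_of_rat a}))" for xs
  define C where "C = closure (range comb)"
  have closedC: "x \<in> C" if "\<And>i. s i \<in> C" "s \<longlonglongrightarrow> x" for s x
    using that closed_sequentially[of C s x] by (simp add: C_def)
  have combC: "comb xs \<in> C" for xs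
    unfolding C_def by (rule subsetD[OF closure_subset]) simp
  have add: "x + y \<in> C" if "x \<in> C" "y \<in> C" for x y
  proof -
    from that obtain s t where s: "\<And>i. s i \<in> range comb" "s \<longlonglongrightarrow> x"
      and t: "\<And>i. t i \<in> range comb" "t \<longlonglongrightarrow> y"
      unfolding C_def closure_sequential by blast
    have "s i + t i \<in> C" for i
    proof -
      obtain xs ys where "s i = comb xs" "t i = comb ys" using s(1)[of i] t(1)[of i] by blast
      then have "s i + t i = comb (xs @ ys)" by (simp add: comb_def)
      then show ?thesis using combC by simp
    qed
    then show ?thesis using closedC[of "\<lambda>i. s i + t i"] tendsto_add[OF s(2) t(2)] by simp
  qed
  have scale: "c *\<^sub>R x \<in> C" if "x \<in> C" for c x
  proof -
    from that obtain s where s: "\<And>i. s i \<in> range comb" "s \<longlonglongrightarrow> x"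
      unfolding C_def closure_sequential by blast
    have "\<exists>q. c < real_of_rat q \<and> real_of_rat q < c + inverse (real (Suc i))" for i
      by (rule of_rat_dense) simp
    then obtain p where p: "\<And>i. c < real_of_rat (p i)"
      "\<And>i. real_of_rat (p i) < c + inverse (real (Suc i))" by metis
    define q where "q i = real_of_rat (p i)" for i
    have q: "q \<longlonglongrightarrow> c"
    proof (rule tendsto_sandwich[OF _ _ tendsto_const LIMSEQ_inverse_real_of_nat_add])
      show "\<forall>\<^sub>F i in sequentially. c \<le> q i" using p(1) by (simp add: q_def less_imp_le)
      show "\<forall>\<^sub>F i in sequentially. q i \<le> c + inverse (real (Suc i))"
        using p(2) by (intro always_eventually) (simp add: q_def less_imp_le)
    qed
    have "q i *\<^sub>R s i \<in> C" for i
    proof -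
      obtain xs where xs: "s i = comb xs" using s(1)[of i] by blast
      define r where "r = p i"
      then have r: "q i = real_of_rat r" by (simp add: q_def)
      have "q i *\<^sub>R comb xs = comb (map (\<lambda>(p, a). (r * p, a)) xs)"
        unfolding r comb_def by (induction xs) (auto simp: scaleR_add_right of_rat_mult)
      then show ?thesis using combC xs by simp
    qed
    then show ?thesis using closedC[of "\<lambda>i. q i *\<^sub>R s i"] tendsto_scaleR[OF q s(2)] by simp
  qed
  have diff: "x - y \<in> C" if "x \<in> C" "y \<in> C" for x y
    using add[OF that(1) scale[OF that(2), of "-1"]] by simp
  have zero: "0 \<in> C" using combC[of "[]"] by (simp add: comb_def)
  have one: "sq_int (\<lambda>_. 1)"
    using finite_measure.integrable_const[OF finite_measure_unit_leb, of "1 :: real"]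
    by (simp add: sq_int_def)
  have atMost: "to_L2 (indicator {..a}) \<in> C" for a :: real
  proof -
    have "\<exists>q. a < real_of_rat q \<and> real_of_rat q < a + inverse (real (Suc i))" for i
      by (rule of_rat_dense) simp
    then obtain q where q: "\<And>i. a < real_of_rat (q i)"
      "\<And>i. real_of_rat (q i) < a + inverse (real (Suc i))" by metis
    have qC: "to_L2 (indicator {..real_of_rat (q i)}) \<in> C" for i
      using combC[of "[(1, q i)]"] by (simp add: comb_def)
    have "(\<lambda>i. to_L2 (indicator {..real_of_rat (q i)})) \<longlonglongrightarrow> to_L2 (indicator {..a})"
    proof (rule to_L2_dominated(3)[OF one])
      show "(indicator {..a} :: real \<Rightarrow> real) \<in> borel_measurable unit_leb"
        using sq_int_indicator[of "{..a}"] by (simp add: sq_int_def)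
      show "(indicator {..real_of_rat (q i)} :: real \<Rightarrow> real) \<in> borel_measurable unit_leb" for i
        using sq_int_indicator[of "{..real_of_rat (q i)}"] by (simp add: sq_int_def)
      fix x :: real
      show "(\<lambda>i. indicator {..real_of_rat (q i)} x :: real) \<longlonglongrightarrow> indicator {..a} x"
      proof (cases "x \<le> a")
        case True
        then have "x \<le> real_of_rat (q i)" for i using q(1)[of i] by simp
        with True show ?thesis by (simp add: indicator_def)
      next
        case False
        then obtain n where n: "inverse (real (Suc n)) < x - a"
          using reals_Archimedean[of "x - a"] by auto
        have "\<not> x \<le> real_of_rat (q i)" if "i \<ge> n" for i
        proof -
          have "inverse (real (Suc i)) \<le> inverse (real (Suc n))"
            using that by (simp add: le_imp_inverse_le)
          then show ?thesis using q(2)[of i] n by linarith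
        qed
        with False show ?thesis
          by (intro tendsto_eventually eventually_sequentiallyI[of n]) (simp add: indicator_def)
      qed
    qed (auto simp: indicator_def)
    then show ?thesis by (rule closedC[OF qC])
  qed
  have oneC: "to_L2 (\<lambda>_. 1) \<in> C"
  proof -
    have "to_L2 (\<lambda>_. 1) = to_L2 (indicator {..1})"
      by (subst to_L2_eq_iff) (auto simp: one sq_int_indicator indicator_def intro!: AE_I2)
    then show ?thesis using atMost by simp
  qed
  have ind: "to_L2 (indicator A) \<in> C" if A: "A \<in> sets borel" for A :: "real set"
  proof -
    have bs: "sets (borel :: real measure) = sigma_sets UNIV (range atMost)"
      by (subst borel_eq_atMost) (simp add: sets_measure_of)
    have "Int_stable (range (atMost :: real \<Rightarrow> real set))"
      by (auto simp: Int_stable_def image_iff intro!: exI[of _ "min _ _"])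
    moreover have "range (atMost :: real \<Rightarrow> real set) \<subseteq> Pow UNIV" by simp
    moreover have "A \<in> sigma_sets UNIV (range atMost)" using A bs by simp
    ultimately show ?thesis
    proof (induction rule: sigma_sets_induct_disjoint)
      case (basic A)
      then show ?case using atMost by auto
    next
      case empty
      have "to_L2 (indicator {}) = (0 :: L2)"
        by (simp add: zero_L2_def to_L2_def indicator_def[abs_def])
      with zero show ?case by metis
    next
      case (compl A)
      then have "A \<in> sets borel" using bs by simp
      then have "to_L2 (\<lambda>_. 1) - to_L2 (indicator A) = to_L2 (indicator (UNIV - A))"
        by (subst to_L2_diff)
          (auto simp: one sq_int_indicator indicator_def intro!: arg_cong[of _ _ to_L2])
      then show ?case using diff[OF oneC compl(2)] by simp
    next
      case (union A)
      have A: "A i \<in> sets borel" for i using union(2) bs by auto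
      define S where "S n x = (\<Sum>i<n. indicator (A i) x :: real)" for n x
      have S: "S n = indicator (\<Union>i<n. A i)" for n
      proof
        fix x
        have "disjoint_family_on A {..<n}"
          using union(1) by (auto simp: disjoint_family_on_def)
        then have "(indicator (\<Union>i<n. A i) x :: real) = (\<Sum>i<n. indicator (A i) x)"
          by (intro indicator_UN_disjoint) auto
        then show "S n x = indicator (\<Union>i<n. A i) x" by (simp add: S_def)
      qed
      have SC: "to_L2 (S n) \<in> C \<and> sq_int (S n)" for n
      proof (induction n)
        case 0
        have "to_L2 (S 0) = (0 :: L2)"
          by (simp add: zero_L2_def to_L2_def S_def[abs_def])
        then show ?case using zero sq_int_zero by (simp add: S_def[abs_def])
      next
        case (Suc n)
        have "S (Suc n) = (\<lambda>x. S n x + indicator (A n) x)" by (simp add: S_def fun_eq_iff)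
        moreover have "to_L2 (\<lambda>x. S n x + indicator (A n) x) = to_L2 (S n) + to_L2 (indicator (A n))"
          by (subst to_L2_add) (use Suc sq_int_indicator[OF A] in auto)
        ultimately show ?case
          using Suc add union(3)[of n] sq_int_add[OF _ sq_int_indicator[OF A[of n]], of "S n"] by auto
      qed
      have "(\<lambda>n. to_L2 (S n)) \<longlonglongrightarrow> to_L2 (indicator (\<Union>i. A i))"
      proof (rule to_L2_dominated(3)[OF one])
        show "S n \<in> borel_measurable unit_leb" for n using SC by (auto simp: sq_int_def)
        have "(\<Union>i. A i) \<in> sets borel" using A by blast
        from sq_int_indicator[OF this]
        show "(indicator (\<Union>i. A i) :: real \<Rightarrow> real) \<in> borel_measurable unit_leb" by (simp add: sq_int_def)
        show "(\<lambda>n. S n x) \<longlonglongrightarrow> indicator (\<Union>i. A i) x" for x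
          unfolding S by (rule LIMSEQ_indicator_UN)
        show "\<bar>S n x\<bar> \<le> 1" for n x by (simp add: S indicator_def)
      qed
      then show ?case using closedC[of "\<lambda>n. to_L2 (S n)"] SC by simp
    qed
  qed
  have all: "x \<in> C" for x
  proof -
    obtain f where f: "sq_int f" "x = to_L2 f" by (rule L2_cases)
    then have fm: "f \<in> borel_measurable unit_leb" by (simp add: sq_int_def)
    from borel_measurable_implies_sequence_metric[OF fm, of 0] obtain s where
      s': "\<forall>i. simple_function unit_leb (s i)"
        "\<forall>x\<in>space unit_leb. (\<lambda>i. s i x) \<longlonglongrightarrow> f x"
        "\<forall>i. \<forall>x\<in>space unit_leb. dist (s i x) 0 \<le> 2 * dist (f x) 0"
      by blast
    have s: "simple_function unit_leb (s i)" for i using s'(1) by blast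
    have lim: "(\<lambda>i. s i x) \<longlonglongrightarrow> f x" if "x \<in> {0..1}" for x using s'(2) that by simp
    have bd: "\<bar>s i x\<bar> \<le> 2 * \<bar>f x\<bar>" if "x \<in> {0..1}" for i x using s'(3) that by simp
    have w: "sq_int (\<lambda>x. 2 * \<bar>f x\<bar>)" using f by (auto simp: sq_int_def power_mult_distrib)
    note dom = to_L2_dominated[OF w fm borel_measurable_simple_function[OF s] lim bd]
    have "to_L2 (s i) \<in> C" for i
    proof -
      let ?Y = "s i ` {0..1}"
      let ?A = "\<lambda>y. s i -` {y} \<inter> {0..1}"
      have fin: "finite ?Y" using s[of i] by (simp add: simple_function_def)
      have A: "?A y \<in> sets borel" for y
      proof -
        have "?A y \<in> sets unit_leb"
          using measurable_sets[OF borel_measurable_simple_function[OF s[of i]], of "{y}"] by simp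
        then show ?thesis by (simp add: sets_restrict_space_iff)
      qed
      have part: "to_L2 (\<lambda>x. \<Sum>y\<in>Y. y * indicator (?A y) x) \<in> C \<and>
          sq_int (\<lambda>x. \<Sum>y\<in>Y. y * indicator (?A y) x)" if "finite Y" for Y
        using that
      proof (induction Y)
        case empty
        have "to_L2 (\<lambda>_. 0) = (0 :: L2)" by (simp add: zero_L2_def to_L2_def)
        then show ?case using zero sq_int_zero by simp
      next
        case (insert y Y)
        let ?f = "\<lambda>x. y * indicator (?A y) x :: real" and ?g = "\<lambda>x. \<Sum>y\<in>Y. y * indicator (?A y) x"
        have f: "sq_int ?f" by (rule sq_int_scale[OF sq_int_indicator[OF A]])
        have "to_L2 ?f \<in> C"
          using scale[OF ind[OF A], of y y] by (simp add: to_L2_scale sq_int_indicator[OF A])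
        then have "to_L2 ?f + to_L2 ?g \<in> C" using insert add by blast
        then have "to_L2 (\<lambda>x. ?f x + ?g x) \<in> C" using insert f by (simp add: to_L2_add)
        moreover have "sq_int (\<lambda>x. ?f x + ?g x)" using insert f by (intro sq_int_add) blast+
        moreover have "(\<lambda>x. \<Sum>y\<in>insert y Y. y * indicator (?A y) x) = (\<lambda>x. ?f x + ?g x)"
          using insert by (simp only: sum.insert not_False_eq_True)
        ultimately show ?case by (simp only:)
      qed
      have eq: "s i x = (\<Sum>y\<in>?Y. y * indicator (?A y) x)" if "x \<in> {0..1}" for x
      proof -
        have "(\<Sum>y\<in>?Y. y * indicator (?A y) x) = (\<Sum>y\<in>?Y. if y = s i x then y else 0)"
          using that by (intro sum.cong) (auto simp: indicator_def)
        also have "\<dots> = s i x" using fin that by (subst sum.delta) auto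
        finally show ?thesis by simp
      qed
      have G: "sq_int (\<lambda>x. \<Sum>y\<in>?Y. y * indicator (?A y) x)" using part[OF fin] by blast
      have "AE x in unit_leb. s i x = (\<Sum>y\<in>?Y. y * indicator (?A y) x)"
        by (rule AE_I2, rule eq) (simp only: space_unit_leb)
      then have "to_L2 (s i) = to_L2 (\<lambda>x. \<Sum>y\<in>?Y. y * indicator (?A y) x)"
        using to_L2_eq_iff[OF dom(2) G] by blast
      then show ?thesis using part[OF fin] by metis
    qed
    then have "to_L2 f \<in> C" using closedC[of "\<lambda>i. to_L2 (s i)"] dom(3) by simp
    then show ?thesis using f by simp
  qed
  show ?thesis
    by (intro exI[of _ "range comb"]) (use all in \<open>auto simp: C_def\<close>)
qed

instance L2 :: second_countable_topology
proof
  obtain Q :: "L2 set" where Q: "countable Q" "closure Q = UNIV"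
    using countable_dense_L2 by blast
  define B where "B = (\<lambda>(x, n). ball x (inverse (real (Suc n)))) ` (Q \<times> (UNIV :: nat set))"
  have "topological_basis B"
  proof (rule topological_basisI)
    show "open b" if "b \<in> B" for b using that by (auto simp: B_def)
    fix U and x :: L2 assume U: "open U" "x \<in> U"
    then obtain e where e: "e > 0" "ball x e \<subseteq> U" by (auto simp: open_contains_ball)
    obtain n where n: "inverse (real (Suc n)) < e / 2"
      using reals_Archimedean[of "e / 2"] e by auto
    obtain y where y: "y \<in> Q" "dist y x < inverse (real (Suc n))"
      using Q(2) closure_approachable[of x Q] by (metis UNIV_I inverse_positive_iff_positive of_nat_0_less_iff zero_less_Suc)
    have "ball y (inverse (real (Suc n))) \<subseteq> ball x e"
    proof
      fix z assume "z \<in> ball y (inverse (real (Suc n)))"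
      then show "z \<in> ball x e" using y n dist_triangle[of x z y] by (simp add: dist_commute)
    qed
    moreover have "ball y (inverse (real (Suc n))) \<in> B" using y by (auto simp: B_def)
    moreover have "x \<in> ball y (inverse (real (Suc n)))" using y by simp
    ultimately show "\<exists>B'\<in>B. x \<in> B' \<and> B' \<subseteq> U" using e by blast
  qed
  moreover have "countable B" unfolding B_def using Q(1) by auto
  ultimately show "\<exists>B :: L2 set set. countable B \<and> open = generate_topology B"
    using topological_basis_imp_subbasis by blast
qed

instance L2 :: polish_space ..


section \<open>Cohen--Daubechies--Vial bases\<close>

text \<open>
  Daubechies pair with \<open>N\<close> vanishing moments, translated so that both functions live on
  \<open>[1 - N, N]\<close>; \<open>h\<close> is the scaling filter.
\<close>

definition daubechies_pair :: "nat \<Rightarrow> (real \<Rightarrow> real) \<Rightarrow> (real \<Rightarrow> real) \<Rightarrow> bool" where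
  "daubechies_pair N \<phi> \<omega> \<longleftrightarrow>
     N \<ge> 1 \<and> continuous_on UNIV \<phi> \<and> (\<forall>x. x \<notin> {1 - real N..real N} \<longrightarrow> \<phi> x = 0) \<and>
     (\<integral>x. \<phi> x \<partial>lborel) = 1 \<and>
     (\<forall>m::int. (\<integral>x. \<phi> x * \<phi> (x - of_int m) \<partial>lborel) = of_bool (m = 0)) \<and>
     (\<exists>h :: int \<Rightarrow> real. \<forall>x.
        \<phi> x = sqrt 2 * (\<Sum>n\<in>{1 - int N..int N}. h n * \<phi> (2 * x - of_int n)) \<and>
        \<omega> x = sqrt 2 * (\<Sum>n\<in>{1 - int N..int N}.
          (if even n then 1 else - 1) * h (1 - n) * \<phi> (2 * x - of_int n))) \<and>
     (\<forall>p<N. (\<integral>x. x ^ p * \<omega> x \<partial>lborel) = 0)"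

text \<open>
  Edge scaling functions at the origin: on the half-line, the functions
  \<open>edge_poly N \<phi> i\<close> (\<open>i < N\<close>) together with the translates \<open>\<phi> (x - m)\<close>, \<open>m \<ge> N\<close>, which
  vanish for \<open>x \<le> 0\<close>, reproduce the polynomials of degree less than \<open>N\<close>. The edge functions
  are an orthonormal basis of the span of the former; Gram--Schmidt yields one such choice.
\<close>

definition edge_poly :: "nat \<Rightarrow> (real \<Rightarrow> real) \<Rightarrow> nat \<Rightarrow> real \<Rightarrow> real" where
  "edge_poly N \<phi> i x = (\<Sum>n\<le>2 * N - 2. real (n choose i) * \<phi> (x + real n - real N + 1))"

definition edge_scaling :: "nat \<Rightarrow> (real \<Rightarrow> real) \<Rightarrow> (nat \<Rightarrow> real \<Rightarrow> real) \<Rightarrow> bool" where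
  "edge_scaling N \<phi> e \<longleftrightarrow>
     (\<forall>k<N. \<exists>c. \<forall>x\<ge>0. e k x = (\<Sum>i<N. c i * edge_poly N \<phi> i x)) \<and>
     (\<forall>k<N. \<forall>k'<N. (\<integral>x\<in>{0..}. (e k x * e k' x) \<partial>lborel) = of_bool (k = k'))"

text \<open>
  The \<open>2 ^ j\<close> functions at resolution \<open>j\<close> on \<open>[0, 1]\<close>: \<open>N\<close> at the left edge, then the interior
  dilated translates, then \<open>N\<close> at the right edge, the latter in the reflected variable \<open>1 - x\<close>.
\<close>

definition cdv_level ::
  "nat \<Rightarrow> (real \<Rightarrow> real) \<Rightarrow> (nat \<Rightarrow> real \<Rightarrow> real) \<Rightarrow> (nat \<Rightarrow> real \<Rightarrow> real) \<Rightarrow> nat \<Rightarrow> nat \<Rightarrow> real \<Rightarrow> real"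
  where
  "cdv_level N f eL eR j k x = sqrt (2 ^ j) *
     (if k < N then eL k (2 ^ j * x)
      else if k < 2 ^ j - N then f (2 ^ j * x - real k)
      else eR (2 ^ j - 1 - k) (2 ^ j * (1 - x)))"

text \<open>
  The index \<open>l = J0 - 1\<close> stands for the scaling functions, which are those of resolution \<open>J0\<close>
  (the coarsest wavelet level). There are \<open>2 ^ J0\<close> of them.
\<close>

definition level_size :: "nat \<Rightarrow> nat \<Rightarrow> nat" where
  "level_size J0 l = (if l = J0 - 1 then 2 ^ J0 else 2 ^ l)"

definition idx :: "nat \<Rightarrow> (nat \<times> nat) set" where
  "idx J0 = {(l, k). J0 - 1 \<le> l \<and> k < level_size J0 l}"

definition cdv_system :: "nat \<Rightarrow> (nat \<Rightarrow> nat \<Rightarrow> real \<Rightarrow> real) \<Rightarrow> bool" where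
  "cdv_system J0 \<psi> \<longleftrightarrow>
     (\<exists>N \<phi> \<omega> \<phi>L \<phi>R \<omega>L \<omega>R.
        daubechies_pair N \<phi> \<omega> \<and> 2 * N \<le> 2 ^ J0 \<and>
        edge_scaling N \<phi> \<phi>L \<and> edge_scaling N (\<lambda>x. \<phi> (1 - x)) \<phi>R \<and>
        (\<forall>k<2 ^ J0. \<forall>x\<in>{0..1}. \<psi> (J0 - 1) k x = cdv_level N \<phi> \<phi>L \<phi>R J0 k x) \<and>
        (\<forall>l\<ge>J0. \<forall>k<2 ^ l. \<forall>x\<in>{0..1}. \<psi> l k x = cdv_level N \<omega> \<omega>L \<omega>R l k x) \<and>
        (\<forall>l\<ge>J0. \<forall>k<2 ^ l. \<exists>c. \<forall>x\<in>{0..1}.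
           \<psi> l k x = (\<Sum>m<2 ^ Suc l. c m * cdv_level N \<phi> \<phi>L \<phi>R (Suc l) m x)))"

definition S_regular :: "nat \<Rightarrow> (real \<Rightarrow> real) \<Rightarrow> bool" where
  "S_regular S f \<longleftrightarrow>
     (\<exists>D :: nat \<Rightarrow> real \<Rightarrow> real. (\<forall>x\<in>{0..1}. D 0 x = f x) \<and>
        (\<forall>i<S. \<forall>x\<in>{0..1}. (D i has_real_derivative D (Suc i) x) (at x within {0..1})) \<and>
        (\<forall>i\<le>S. sq_int (D i)))"

definition orthonormal_basis :: "('i \<Rightarrow> L2) \<Rightarrow> 'i set \<Rightarrow> bool" where
  "orthonormal_basis e I \<longleftrightarrow>
     (\<forall>i\<in>I. \<forall>j\<in>I. inner (e i) (e j) = of_bool (i = j)) \<and> closure (span (e ` I)) = UNIV"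

definition cdv_basis :: "nat \<Rightarrow> nat \<Rightarrow> (nat \<Rightarrow> nat \<Rightarrow> real \<Rightarrow> real) \<Rightarrow> bool" where
  "cdv_basis S J0 \<psi> \<longleftrightarrow>
     cdv_system J0 \<psi> \<and> (\<forall>(l, k)\<in>idx J0. S_regular S (\<psi> l k)) \<and>
     orthonormal_basis (\<lambda>(l, k). to_L2 (\<psi> l k)) (idx J0)"

section \<open>Function spaces and norms\<close>

definition coeff :: "(nat \<Rightarrow> nat \<Rightarrow> real \<Rightarrow> real) \<Rightarrow> L2 \<Rightarrow> nat \<times> nat \<Rightarrow> real" where
  "coeff \<psi> f = (\<lambda>(l, k). inner (to_L2 (\<psi> l k)) f)"

definition level_norm :: "nat \<Rightarrow> (nat \<Rightarrow> real) \<Rightarrow> (nat \<times> nat \<Rightarrow> real) \<Rightarrow> ereal" where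
  "level_norm J0 w c =
     (let t = (\<lambda>l. w l * (\<Sum>k<level_size J0 l. (c (l, k))\<^sup>2))
      in if t summable_on {J0 - 1..} then ereal (sqrt (\<Sum>\<^sub>\<infinity>l\<in>{J0 - 1..}. t l)) else \<infinity>)"

definition norm_log_sobolev ::
  "(nat \<Rightarrow> nat \<Rightarrow> real \<Rightarrow> real) \<Rightarrow> nat \<Rightarrow> real \<Rightarrow> L2 \<Rightarrow> ereal" where
  "norm_log_sobolev \<psi> J0 \<gamma> f =
     level_norm J0 (\<lambda>l. (2 ^ l) powr (2 * \<gamma>) * ln (2 ^ l) powr (- 2)) (coeff \<psi> f)"

text \<open>
  The elements of \<open>H(\<delta>)\<close> are identified with their coefficients. For \<open>\<delta> > 1/2\<close> the norm is finite
  on the coefficients of every \<open>f\<close> in \<open>L2\<close>.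
\<close>

definition norm_H :: "nat \<Rightarrow> real \<Rightarrow> (nat \<times> nat \<Rightarrow> real) \<Rightarrow> ereal" where
  "norm_H J0 \<delta> = level_norm J0 (\<lambda>l. (2 ^ l) powr (- 1) * ln (2 ^ l) powr (- 2 * \<delta>))"

definition holder_space ::
  "(nat \<Rightarrow> nat \<Rightarrow> real \<Rightarrow> real) \<Rightarrow> nat \<Rightarrow> real \<Rightarrow> (real \<Rightarrow> real) set" where
  "holder_space \<psi> J0 \<gamma> = {f. continuous_on {0..1} f \<and>
     bdd_above ((\<lambda>(l, k). 2 powr (real l * (\<gamma> + 1 / 2)) * \<bar>coeff \<psi> (to_L2 f) (l, k)\<bar>) ` idx J0)}"

section \<open>The white noise model\<close>

text \<open>
  Observations are represented by their coefficients in the basis. The laws below give full measure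
  to \<open>{x. norm_H J0 \<delta> x < \<infinity>}\<close> for every \<open>\<delta> > 1/2\<close>, and on this set the product
  \<open>\<sigma>\<close>-algebra is the Borel \<open>\<sigma>\<close>-algebra of \<open>H(\<delta>)\<close>.
\<close>

definition white_noise :: "nat \<Rightarrow> (nat \<times> nat \<Rightarrow> real) measure" where
  "white_noise J0 = PiM (idx J0) (\<lambda>_. density lborel (\<lambda>x. ennreal (std_normal_density x)))"

definition obs_law ::
  "(nat \<Rightarrow> nat \<Rightarrow> real \<Rightarrow> real) \<Rightarrow> nat \<Rightarrow> L2 \<Rightarrow> nat \<Rightarrow> (nat \<times> nat \<Rightarrow> real) measure" where
  "obs_law \<psi> J0 f n = distr (white_noise J0) (PiM (idx J0) (\<lambda>_. borel))
     (\<lambda>W. \<lambda>i\<in>idx J0. coeff \<psi> f i + W i / sqrt (real n))"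

text \<open>
  \<open>\<langle>f, x\<rangle>\<close> for \<open>f\<close> in \<open>L2\<close>, the limit of the partial sums over levels. For each \<open>f\<close> it exists for
  almost every \<open>x\<close> under each \<open>obs_law\<close>; elsewhere \<open>lim\<close> is an unspecified constant.
\<close>

definition obs_pairing ::
  "(nat \<Rightarrow> nat \<Rightarrow> real \<Rightarrow> real) \<Rightarrow> nat \<Rightarrow> L2 \<Rightarrow> (nat \<times> nat \<Rightarrow> real) \<Rightarrow> real" where
  "obs_pairing \<psi> J0 f x =
     lim (\<lambda>L. \<Sum>l\<in>{J0 - 1..<L}. \<Sum>k<level_size J0 l. coeff \<psi> f (l, k) * x (l, k))"

definition likelihood ::
  "(nat \<Rightarrow> nat \<Rightarrow> real \<Rightarrow> real) \<Rightarrow> nat \<Rightarrow> nat \<Rightarrow> (nat \<times> nat \<Rightarrow> real) \<Rightarrow> L2 \<Rightarrow> real" where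
  "likelihood \<psi> J0 n x f = exp (real n * obs_pairing \<psi> J0 f x - real n / 2 * (norm f)\<^sup>2)"

definition posterior ::
  "(nat \<Rightarrow> nat \<Rightarrow> real \<Rightarrow> real) \<Rightarrow> nat \<Rightarrow> L2 measure \<Rightarrow> nat \<Rightarrow> (nat \<times> nat \<Rightarrow> real) \<Rightarrow> L2 measure" where
  "posterior \<psi> J0 prior n x = density prior (\<lambda>f.
     ennreal (likelihood \<psi> J0 n x f) / (\<integral>\<^sup>+ f'. ennreal (likelihood \<psi> J0 n x f') \<partial>prior))"

definition posterior_mean ::
  "(nat \<Rightarrow> nat \<Rightarrow> real \<Rightarrow> real) \<Rightarrow> nat \<Rightarrow> L2 measure \<Rightarrow> nat \<Rightarrow> (nat \<times> nat \<Rightarrow> real) \<Rightarrow> L2" where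
  "posterior_mean \<psi> J0 prior n x = (\<integral>f. f \<partial>posterior \<psi> J0 prior n x)"

definition series_prior ::
  "(nat \<Rightarrow> nat \<Rightarrow> real \<Rightarrow> real) \<Rightarrow> nat \<Rightarrow> real \<Rightarrow> 'w measure \<Rightarrow> (nat \<times> nat \<Rightarrow> 'w \<Rightarrow> real) \<Rightarrow> L2 measure"
  where
  "series_prior \<psi> J0 \<gamma> \<Omega> g = distr \<Omega> borel
     (\<lambda>v. \<Sum>\<^sub>\<infinity>(l, k)\<in>idx J0. (2 powr (- real l * (\<gamma> + 1 / 2)) * g (l, k) v) *\<^sub>R to_L2 (\<psi> l k))"

section \<open>The credible set\<close>

text \<open>\<open>H_ball\<close> and \<open>credible_set\<close> are written as subsets of \<open>L2\<close>; for \<open>\<gamma> > 0\<close> every form with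
  finite \<open>norm_log_sobolev\<close> lies in \<open>L2\<close>.\<close>

definition H_ball ::
  "(nat \<Rightarrow> nat \<Rightarrow> real \<Rightarrow> real) \<Rightarrow> nat \<Rightarrow> real \<Rightarrow> L2 \<Rightarrow> real \<Rightarrow> L2 set" where
  "H_ball \<psi> J0 \<delta> m r = {f. norm_H J0 \<delta> (coeff \<psi> (f - m)) \<le> ereal r}"

definition smoothness_radius ::
  "(nat \<Rightarrow> nat \<Rightarrow> real \<Rightarrow> real) \<Rightarrow> nat \<Rightarrow> L2 measure \<Rightarrow> real \<Rightarrow> real \<Rightarrow> nat \<Rightarrow>
   (nat \<times> nat \<Rightarrow> real) \<Rightarrow> ereal" where
  "smoothness_radius \<psi> J0 prior \<gamma> \<eta> n x = Inf (ereal ` {M. M > 0 \<and>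
     measure (posterior \<psi> J0 prior n x) {f. \<bar>norm_log_sobolev \<psi> J0 \<gamma> f - ereal M\<bar> \<le> ereal \<eta>}
       \<ge> 1 - ln (real n) powr (- 1 / 4)})"

definition credible_set ::
  "(nat \<Rightarrow> nat \<Rightarrow> real \<Rightarrow> real) \<Rightarrow> nat \<Rightarrow> L2 measure \<Rightarrow> real \<Rightarrow> real \<Rightarrow> real \<Rightarrow>
   (nat \<Rightarrow> (nat \<times> nat \<Rightarrow> real) \<Rightarrow> real) \<Rightarrow> nat \<Rightarrow> (nat \<times> nat \<Rightarrow> real) \<Rightarrow> L2 set" where
  "credible_set \<psi> J0 prior \<gamma> \<delta> \<eta> R n x =
     {f. norm_log_sobolev \<psi> J0 \<gamma> f \<le> smoothness_radius \<psi> J0 prior \<gamma> \<eta> n x + ereal (4 * \<eta>)} \<inter>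
     H_ball \<psi> J0 \<delta> (posterior_mean \<psi> J0 prior n x) (R n x / sqrt (real n))"

text \<open>Unlike \<open>diameter\<close>, this is \<open>\<infinity>\<close> on unbounded sets.\<close>

definition ediameter :: "'a::metric_space set \<Rightarrow> ereal" where
  "ediameter A = (if A = {} then 0 else (SUP f\<in>A. SUP g\<in>A. ereal (dist f g)))"

section \<open>Stochastic order symbols\<close>

text \<open>
  Outer measure avoids measurability side conditions; on measurable events it is the probability.
  \<open>bounded_in_prob P Y r\<close> is \<open>Y n = O\<^sub>P(r n)\<close>.
\<close>

definition bounded_in_prob ::
  "(nat \<Rightarrow> 'a measure) \<Rightarrow> (nat \<Rightarrow> 'a \<Rightarrow> ereal) \<Rightarrow> (nat \<Rightarrow> real) \<Rightarrow> bool" where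
  "bounded_in_prob P Y r \<longleftrightarrow> (\<forall>\<epsilon>>0. \<exists>K. \<forall>\<^sub>F n in sequentially.
     outer_measure_of (P n) {x \<in> space (P n). \<bar>Y n x\<bar> > ereal (K * r n)} < ennreal \<epsilon>)"

definition tendsto_in_prob ::
  "(nat \<Rightarrow> 'a measure) \<Rightarrow> (nat \<Rightarrow> 'a \<Rightarrow> real) \<Rightarrow> real \<Rightarrow> bool" where
  "tendsto_in_prob P Y c \<longleftrightarrow> (\<forall>\<epsilon>>0.
     (\<lambda>n. outer_measure_of (P n) {x \<in> space (P n). \<bar>Y n x - c\<bar> > \<epsilon>}) \<longlonglongrightarrow> 0)"

end

theory Submission
  imports Defs "HOL-Real_Asymp.Real_Asymp"
begin

text \<open>
  In the wavelet basis the prior, the noise and hence the posterior are product measures, so the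
  analysis reduces to one coordinate \<open>\<theta> = \<sigma> g\<close> observed with noise \<open>y / \<surd>n\<close>. There, dominated
  convergence shows that \<open>\<surd>n (\<theta> - posterior mean)\<close> is asymptotically standard normal, and the
  posterior second moments around the truth are \<open>O(min (1 / n) (\<sigma>\<^sup>2))\<close>, uniformly over the coordinates.

  Summing the second moments with the weights of \<open>H(\<delta>)\<close> makes the tails of the posterior in \<open>H(\<delta>)\<close>
  negligible; together with the limit of the finite sections, the radius \<open>R n\<close> is squeezed between
  quantiles of \<open>\<parallel>W\<parallel>\<close> in \<open>H(\<delta>)\<close>. The centre satisfies \<open>\<surd>n (posterior mean - f0) - W \<longlonglongrightarrow> 0\<close> in \<open>H(\<delta>)\<close>, and the
  law of \<open>\<parallel>W\<parallel>\<close> has no atoms, which gives the coverage of the \<open>H(\<delta>)\<close>-ball. Summing with the weights of the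
  logarithmic Sobolev norm gives posterior consistency at rate \<open>o((log n) powr (- 1 / 4))\<close> in that norm, so
  the smoothness constraint is asymptotically void for \<open>f0\<close> and for the posterior. Interpolating between the two
  norms bounds the diameter.
\<close>

section \<open>The posterior in one coordinate\<close>

text \<open>The coordinate bounds must survive integration over the noise. Bounding
  \<open>\<phi>\<close> by \<open>K\<close> in the numerator and the normalising mass below by a
  constant only gives (1 + y^2) exp (y^2 / 2): the Gaussian density of y cancels the exponential and
  leaves no decay. The mass, however, grows at least like exp (|y| / 2) when the prior spread
  exceeds the noise level, since the kernel may be integrated over the side where u and y have the
  same sign. When the noise dominates, Fubini is used instead: the tilt is a likelihood ratio and
  averages to one, so only the second moment of the prior remains. The Hoelder bound keeps the
  rescaled truth \<open>b\<close> in a compact set, near which \<open>\<phi>\<close> has a positive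
  minimum; this makes the constants uniform over the coordinates.

  All observations are written as functions of one noise sequence \<open>W\<close>. Statements in
  probability can then be deduced from limits for almost every fixed \<open>W\<close>, although the
  observation laws vary with n.\<close>

definition tilt :: "real \<Rightarrow> real \<Rightarrow> real" where
  "tilt y u = exp (u * y - u\<^sup>2 / 2)"

lemma tilt_pos [simp]: "tilt y u > 0" by (simp add: tilt_def)

lemma tilt_nonneg [simp]: "tilt y u \<ge> 0" by (simp add: tilt_def)

lemma tilt_measurable1 [measurable]: "tilt y \<in> borel_measurable borel"
  by (simp add: tilt_def[abs_def])

lemma tilt_measurable [measurable]: "(\<lambda>p. tilt (fst p) (snd p)) \<in> borel_measurable (borel \<Otimes>\<^sub>M borel)"
  by (simp add: tilt_def[abs_def])

lemma tilt_eq_normal: "tilt y u = (sqrt (2 * pi) * exp (y\<^sup>2 / 2)) * normal_density y 1 u"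
proof -
  have "u * y - u\<^sup>2 / 2 = y\<^sup>2 / 2 + - (u - y)\<^sup>2 / 2" by (simp add: power2_eq_square field_simps)
  then show ?thesis
    unfolding tilt_def normal_density_def by (simp only: exp_add) simp
qed

text \<open>The Cameron-Martin identity in dimension one: \<open>tilt y u\<close> is the likelihood
  ratio of N(u, 1) to N(0, 1) at y. Read as a function of u it is a multiple of a Gaussian density
  centred at y, which is why the limiting posterior is N(y, 1).\<close>

lemma std_normal_tilt: "std_normal_density y * tilt y u = normal_density u 1 y"
proof -
  have "- y\<^sup>2 / 2 + (u * y - u\<^sup>2 / 2) = - (y - u)\<^sup>2 / 2" by (simp add: power2_eq_square field_simps)
  then show ?thesis
    unfolding tilt_def normal_density_def by (simp add: exp_add[symmetric] mult.assoc)
qed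

lemma normal_second_moment:
  "integrable lborel (\<lambda>u. normal_density y 1 u * u\<^sup>2)" (is ?I)
  "(\<integral>u. normal_density y 1 u * u\<^sup>2 \<partial>lborel) = 1 + y\<^sup>2"
proof -
  have 1: "has_bochner_integral lborel (\<lambda>u. normal_density y 1 u * (u - y) ^ 2) 1"
    using normal_moment_even[of 1 y 1] by (simp add: fact_numeral)
  have 2: "has_bochner_integral lborel (\<lambda>u. normal_density y 1 u * u) y"
    by (rule normal_moment_nz_1) simp
  have 3: "has_bochner_integral lborel (normal_density y 1) 1"
    by (simp add: has_bochner_integral_iff)
  have "has_bochner_integral lborel (\<lambda>u. normal_density y 1 u * (u - y) ^ 2
      + (2 * y) * (normal_density y 1 u * u) - y\<^sup>2 * normal_density y 1 u) (1 + (2 * y) * y - y\<^sup>2 * 1)"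
    by (intro has_bochner_integral_add has_bochner_integral_diff has_bochner_integral_mult_right 1 2 3)
  then have "has_bochner_integral lborel (\<lambda>u. normal_density y 1 u * u\<^sup>2) (1 + y\<^sup>2)"
    by (rule has_bochner_integral_cong[THEN iffD1, rotated -1])
      (auto simp: power2_eq_square algebra_simps)
  then show ?I "(\<integral>u. normal_density y 1 u * u\<^sup>2 \<partial>lborel) = 1 + y\<^sup>2"
    by (auto simp: has_bochner_integral_iff)
qed

lemma tilt_integrable:
  "integrable lborel (tilt y)" "integrable lborel (\<lambda>u. u\<^sup>2 * tilt y u)"
  "integrable lborel (\<lambda>u. \<bar>u\<bar> * tilt y u)"
proof -
  show 0: "integrable lborel (tilt y)"
    unfolding tilt_eq_normal[abs_def] by simp
  show 2: "integrable lborel (\<lambda>u. u\<^sup>2 * tilt y u)"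
    using integrable_mult_right[OF normal_second_moment(1)[of y], of "sqrt (2 * pi) * exp (y\<^sup>2 / 2)"]
    by (simp add: tilt_eq_normal ac_simps)
  have [measurable]: "tilt y \<in> borel_measurable borel" by (simp add: tilt_def[abs_def])
  show "integrable lborel (\<lambda>u. \<bar>u\<bar> * tilt y u)"
  proof (rule Bochner_Integration.integrable_bound)
    show "integrable lborel (\<lambda>u. u\<^sup>2 * tilt y u + tilt y u)" using 0 2 by simp
    have "\<bar>u\<bar> \<le> u\<^sup>2 + 1" for u :: real
      using zero_le_square[of "\<bar>u\<bar> - 1"] by (simp add: power2_eq_square algebra_simps abs_mult_self_eq)
    then have "\<bar>u\<bar> * tilt y u \<le> (u\<^sup>2 + 1) * tilt y u" for u
      by (rule mult_right_mono) simp
    then show "AE u in lborel. norm (\<bar>u\<bar> * tilt y u) \<le> norm (u\<^sup>2 * tilt y u + tilt y u)"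
      by (intro AE_I2) (simp add: abs_mult distrib_right)
  qed simp
qed

lemma integral_tilt: "(\<integral>u. tilt y u \<partial>lborel) = sqrt (2 * pi) * exp (y\<^sup>2 / 2)"
  by (simp add: tilt_eq_normal)

lemma integral_sq_tilt: "(\<integral>u. u\<^sup>2 * tilt y u \<partial>lborel) = sqrt (2 * pi) * exp (y\<^sup>2 / 2) * (1 + y\<^sup>2)"
proof -
  have "(\<integral>u. u\<^sup>2 * tilt y u \<partial>lborel) =
      (\<integral>u. (sqrt (2 * pi) * exp (y\<^sup>2 / 2)) * (normal_density y 1 u * u\<^sup>2) \<partial>lborel)"
    by (intro Bochner_Integration.integral_cong) (auto simp: tilt_eq_normal)
  then show ?thesis by (simp only: integral_mult_right_zero normal_second_moment(2))
qed

locale coord_density =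
  fixes \<phi> :: "real \<Rightarrow> real" and K :: real
  assumes \<phi>_pos: "\<phi> t > 0" and \<phi>_le: "\<phi> t \<le> K" and \<phi>_cont: "continuous_on UNIV \<phi>"
    and \<phi>_int: "integrable lborel \<phi>" and \<phi>_sq_int: "integrable lborel (\<lambda>t. t\<^sup>2 * \<phi> t)"
begin

lemma \<phi>_meas [measurable]: "\<phi> \<in> borel_measurable borel"
  using \<phi>_cont by (rule borel_measurable_continuous_onI)

lemma K_pos: "K > 0" using \<phi>_pos[of 0] \<phi>_le[of 0] by simp

text \<open>Up to normalisation, the density of the posterior law of \<open>u = \<surd>n (\<theta> - \<theta>\<^sub>0)\<close> for
  \<open>\<theta> = \<sigma> g\<close>, \<open>g\<close> of density \<open>\<phi>\<close>, \<open>\<tau> = \<surd>n \<sigma>\<close>, \<open>b = \<theta>\<^sub>0 / \<sigma>\<close>, observed with noise \<open>y / \<surd>n\<close>.\<close>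

definition kern :: "real \<Rightarrow> real \<Rightarrow> real \<Rightarrow> real \<Rightarrow> real" where
  "kern \<tau> b y u = \<phi> (b + u / \<tau>) * tilt y u"

definition kern_mass :: "real \<Rightarrow> real \<Rightarrow> real \<Rightarrow> real" where
  "kern_mass \<tau> b y = (\<integral>u. kern \<tau> b y u \<partial>lborel)"

definition coord_post :: "real \<Rightarrow> real \<Rightarrow> real \<Rightarrow> real measure" where
  "coord_post \<tau> b y = density lborel (\<lambda>u. ennreal (kern \<tau> b y u / kern_mass \<tau> b y))"

definition coord_mean :: "real \<Rightarrow> real \<Rightarrow> real \<Rightarrow> real" where
  "coord_mean \<tau> b y = (\<integral>u. u \<partial>coord_post \<tau> b y)"

lemma kern_measurable [measurable]: "(\<lambda>p. kern \<tau> b (fst p) (snd p)) \<in> borel_measurable (borel \<Otimes>\<^sub>M borel)"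
  unfolding kern_def[abs_def] by measurable

lemma kern_measurable2 [measurable]:
  "f \<in> borel_measurable M \<Longrightarrow> g \<in> borel_measurable M \<Longrightarrow> (\<lambda>x. kern \<tau> b (f x) (g x)) \<in> borel_measurable M"
  using measurable_compose[of "\<lambda>x. (f x, g x)" M "borel \<Otimes>\<^sub>M borel" "\<lambda>p. kern \<tau> b (fst p) (snd p)" borel] by simp

lemma kern_pos [simp]: "kern \<tau> b y u > 0" by (simp add: kern_def \<phi>_pos)

lemma kern_nonneg [simp]: "kern \<tau> b y u \<ge> 0" using kern_pos[of \<tau> b y u] by linarith

lemma kern_le: "kern \<tau> b y u \<le> K * tilt y u"
  unfolding kern_def by (intro mult_right_mono \<phi>_le) simp

lemma kern_integrable: "integrable lborel (kern \<tau> b y)"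
  by (rule Bochner_Integration.integrable_bound[OF integrable_mult_right[OF tilt_integrable(1)[of y], of K]])
    (use kern_le K_pos in \<open>auto simp: less_imp_le\<close>)

lemma kern_sq_integrable: "integrable lborel (\<lambda>u. u\<^sup>2 * kern \<tau> b y u)"
proof (rule Bochner_Integration.integrable_bound[OF integrable_mult_right[OF tilt_integrable(2), of K]])
  show "AE u in lborel. norm (u\<^sup>2 * kern \<tau> b y u) \<le> norm (K * (u\<^sup>2 * tilt y u))"
  proof (rule AE_I2)
    fix u
    have "u\<^sup>2 * kern \<tau> b y u \<le> u\<^sup>2 * (K * tilt y u)" by (intro mult_left_mono kern_le) simp
    then show "norm (u\<^sup>2 * kern \<tau> b y u) \<le> norm (K * (u\<^sup>2 * tilt y u))"
      using K_pos by (simp add: ac_simps)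
  qed
qed simp

lemma kern_mass_pos: "kern_mass \<tau> b y > 0"
proof -
  have "kern_mass \<tau> b y \<ge> 0" unfolding kern_mass_def by (rule Bochner_Integration.integral_nonneg) simp
  moreover have "kern_mass \<tau> b y \<noteq> 0"
  proof
    assume "kern_mass \<tau> b y = 0"
    then have "AE u in lborel. kern \<tau> b y u = 0"
      unfolding kern_mass_def by (subst (asm) integral_nonneg_eq_0_iff_AE[OF kern_integrable]) auto
    then have "AE u in (lborel :: real measure). False"
      by eventually_elim (use kern_pos in \<open>metis less_irrefl\<close>)
    then have "ae_filter (lborel :: real measure) = bot" by (simp add: trivial_limit_def)
    then show False by (simp add: ae_filter_eq_bot_iff)
  qed
  ultimately show ?thesis by simp
qed

lemma kern_mass_measurable [measurable]: "kern_mass \<tau> b \<in> borel_measurable borel"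
  unfolding kern_mass_def[abs_def] by measurable

lemma sets_coord_post [simp, measurable_cong]: "sets (coord_post \<tau> b y) = sets borel"
  by (simp add: coord_post_def)

lemma space_coord_post [simp]: "space (coord_post \<tau> b y) = UNIV"
  by (simp add: coord_post_def)

lemma prob_space_coord_post: "prob_space (coord_post \<tau> b y)"
proof
  have "emeasure (coord_post \<tau> b y) (space (coord_post \<tau> b y)) =
      (\<integral>\<^sup>+u. ennreal (kern \<tau> b y u / kern_mass \<tau> b y) \<partial>lborel)"
    by (simp add: coord_post_def emeasure_density)
  also have "\<dots> = ennreal (\<integral>u. kern \<tau> b y u / kern_mass \<tau> b y \<partial>lborel)"
    by (intro nn_integral_eq_integral) (auto simp: kern_integrable less_imp_le kern_mass_pos)
  also have "(\<integral>u. kern \<tau> b y u / kern_mass \<tau> b y \<partial>lborel) = 1"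
    using kern_mass_pos[of \<tau> b y] by (simp flip: kern_mass_def)
  finally show "emeasure (coord_post \<tau> b y) (space (coord_post \<tau> b y)) = 1" by simp
qed

lemma emeasure_coord_post:
  "A \<in> sets borel \<Longrightarrow> emeasure (coord_post \<tau> b y) A =
     (\<integral>\<^sup>+u. ennreal (kern \<tau> b y u) * indicator A u \<partial>lborel) / ennreal (kern_mass \<tau> b y)"
  using kern_mass_pos[of \<tau> b y]
  by (simp add: coord_post_def emeasure_density divide_ennreal[symmetric] nn_integral_divide[symmetric])
   (auto intro!: nn_integral_cong simp: divide_ennreal[symmetric] ennreal_times_divide split: split_indicator)

lemma integral_coord_post:
  fixes h :: "real \<Rightarrow> 'a::{banach, second_countable_topology}"
  assumes [measurable]: "h \<in> borel_measurable borel"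
  shows "(\<integral>u. h u \<partial>coord_post \<tau> b y) = (1 / kern_mass \<tau> b y) *\<^sub>R (\<integral>u. kern \<tau> b y u *\<^sub>R h u \<partial>lborel)"
proof -
  have "(\<integral>u. h u \<partial>coord_post \<tau> b y) = (\<integral>u. (kern \<tau> b y u / kern_mass \<tau> b y) *\<^sub>R h u \<partial>lborel)"
    unfolding coord_post_def
    by (intro integral_density) (auto simp: less_imp_le kern_mass_pos)
  also have "\<dots> = (\<integral>u. (1 / kern_mass \<tau> b y) *\<^sub>R (kern \<tau> b y u *\<^sub>R h u) \<partial>lborel)"
    by (intro Bochner_Integration.integral_cong) auto
  also have "\<dots> = (1 / kern_mass \<tau> b y) *\<^sub>R (\<integral>u. kern \<tau> b y u *\<^sub>R h u \<partial>lborel)"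
    by (rule integral_scaleR_right)
  finally show ?thesis .
qed

lemma coord_post_sq_integrable: "integrable (coord_post \<tau> b y) (\<lambda>u. u\<^sup>2)"
  unfolding coord_post_def
  by (subst integrable_density)
    (use kern_sq_integrable[of \<tau> b y] in \<open>auto simp: less_imp_le kern_mass_pos ac_simps\<close>)

definition coord_msq :: "real \<Rightarrow> real \<Rightarrow> real \<Rightarrow> real" where
  "coord_msq \<tau> b y = (\<integral>u. u\<^sup>2 \<partial>coord_post \<tau> b y)"

lemma coord_msq_eq: "coord_msq \<tau> b y = (\<integral>u. u\<^sup>2 * kern \<tau> b y u \<partial>lborel) / kern_mass \<tau> b y"
  by (simp add: coord_msq_def integral_coord_post mult.commute)

lemma coord_mean_eq: "coord_mean \<tau> b y = (\<integral>u. u * kern \<tau> b y u \<partial>lborel) / kern_mass \<tau> b y"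
  by (simp add: coord_mean_def integral_coord_post mult.commute)

lemma coord_msq_measurable [measurable]: "coord_msq \<tau> b \<in> borel_measurable borel"
  unfolding coord_msq_eq[abs_def] by measurable

lemma coord_mean_measurable [measurable]: "coord_mean \<tau> b \<in> borel_measurable borel"
  unfolding coord_mean_eq[abs_def] by measurable

lemma coord_msq_nonneg: "coord_msq \<tau> b y \<ge> 0"
  by (simp add: coord_msq_def)

lemma coord_post_integrable: "integrable (coord_post \<tau> b y) (\<lambda>u. u)"
proof -
  interpret prob_space "coord_post \<tau> b y" by (rule prob_space_coord_post)
  show ?thesis by (rule square_integrable_imp_integrable[OF _ coord_post_sq_integrable]) simp
qed

lemma coord_mean_sq_le: "(coord_mean \<tau> b y)\<^sup>2 \<le> coord_msq \<tau> b y"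
proof -
  interpret prob_space "coord_post \<tau> b y" by (rule prob_space_coord_post)
  have "variance (\<lambda>u. u) \<ge> 0" by simp
  then show ?thesis
    using variance_eq[OF coord_post_integrable coord_post_sq_integrable]
    by (simp add: coord_mean_def coord_msq_def)
qed

section \<open>Second-moment bounds for one coordinate, integrated over the noise\<close>

lemma \<phi>_lower:
  obtains m where "m > 0" "\<And>b t. \<bar>b\<bar> \<le> B \<Longrightarrow> \<bar>t\<bar> \<le> 1 \<Longrightarrow> m \<le> \<phi> (b + t)"
proof (cases "B \<ge> 0")
  case False
  then show ?thesis by (intro that[of 1]) auto
next
  case True
  have "compact {-B-1..B+1}" "{-B-1..B+1} \<noteq> {}" using True by auto
  moreover have "continuous_on {-B-1..B+1} \<phi>" using \<phi>_cont continuous_on_subset by blast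
  ultimately obtain x where x: "\<And>t. t \<in> {-B-1..B+1} \<Longrightarrow> \<phi> x \<le> \<phi> t"
    using continuous_attains_inf by metis
  show ?thesis
  proof (rule that[of "\<phi> x"])
    fix b t :: real assume "\<bar>b\<bar> \<le> B" "\<bar>t\<bar> \<le> 1"
    then show "\<phi> x \<le> \<phi> (b + t)" by (intro x) auto
  qed (rule \<phi>_pos)
qed

text \<open>It suffices to integrate over an interval of length c / 2, with c = min 1 \<tau>, on the
  side of the origin where u has the sign of y. There u y is at least c |y| / 2, while u^2 / 2 is at
  most 1 / 2 and the argument of \<open>\<phi>\<close> stays within distance one of
  \<open>b\<close>. The factor min 1 \<tau> is the length of the interval.\<close>

lemma kern_mass_lower:
  assumes m: "m > 0" "\<And>t. \<bar>t\<bar> \<le> 1 \<Longrightarrow> m \<le> \<phi> (b + t)" and \<tau>: "\<tau> > 0"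
  shows "kern_mass \<tau> b y \<ge> (m * exp (- 1 / 2) / 2) * min 1 \<tau> * exp (min 1 \<tau> * \<bar>y\<bar> / 2)"
proof -
  define c where "c = min 1 \<tau>"
  have c: "0 < c" "c \<le> 1" "c \<le> \<tau>" using \<tau> by (auto simp: c_def)
  define A where "A = (if y \<ge> 0 then {c / 2..c} else {- c..- c / 2})"
  have A: "A \<in> sets lborel" "emeasure lborel A = ennreal (c / 2)"
    using c by (auto simp: A_def)
  have mA: "measure lborel A = c / 2" using A(2) c by (simp add: measure_def)
  let ?h = "m * exp (- 1 / 2) * exp (c * \<bar>y\<bar> / 2)"
  have low: "?h \<le> kern \<tau> b y u" if "u \<in> A" for u
  proof -
    have u: "\<bar>u\<bar> \<le> c" "u * y = \<bar>u\<bar> * \<bar>y\<bar>" "\<bar>u\<bar> \<ge> c / 2"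
      using that c by (auto simp: A_def split: if_splits)
    have "\<bar>u / \<tau>\<bar> \<le> 1" using u c \<tau> by (simp add: abs_divide)
    then have 1: "m \<le> \<phi> (b + u / \<tau>)" by (rule m)
    have "u\<^sup>2 \<le> 1" using u c by (simp add: abs_square_le_1)
    moreover have "c * \<bar>y\<bar> / 2 \<le> \<bar>u\<bar> * \<bar>y\<bar>" using mult_right_mono[OF u(3), of "\<bar>y\<bar>"] by simp
    ultimately have "- 1 / 2 + c * \<bar>y\<bar> / 2 \<le> u * y - u\<^sup>2 / 2" using u(2) by linarith
    then have "exp (- 1 / 2) * exp (c * \<bar>y\<bar> / 2) \<le> tilt y u"
      by (simp add: tilt_def exp_add[symmetric])
    with 1 show ?thesis unfolding kern_def using m(1)
      by (simp only: mult.assoc) (intro mult_mono, auto)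
  qed
  have "?h * (c / 2) = (\<integral>u. ?h * indicator A u \<partial>lborel)"
    using A mA by simp
  also have "\<dots> \<le> kern_mass \<tau> b y" unfolding kern_mass_def
  proof (rule integral_mono[OF _ kern_integrable])
    show "integrable lborel (\<lambda>u. ?h * indicator A u)" using A by (intro integrable_mult_right integrable_real_indicator) auto
    show "?h * indicator A u \<le> kern \<tau> b y u" for u using low[of u] by (auto split: split_indicator)
  qed
  finally show ?thesis by (simp add: c_def ac_simps)
qed

end

text \<open>The Gaussian factors cancel and (1 + y^2) exp (- |y| / 2) is left, which lies below a
  multiple of the Cauchy density.\<close>

lemma dominating_integrable:
  "integrable lborel (\<lambda>y::real. std_normal_density y * ((1 + y\<^sup>2) * exp (y\<^sup>2 / 2 - \<bar>y\<bar> / 2)))"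
proof (rule Bochner_Integration.integrable_bound)
  show "integrable lborel (\<lambda>y::real. 4096 * inverse (1 + y\<^sup>2))"
    using integrable_inverse_1_plus_square by (simp add: einterval_eq set_integrable_def)
  have "norm (std_normal_density y * ((1 + y\<^sup>2) * exp (y\<^sup>2 / 2 - \<bar>y\<bar> / 2))) \<le> norm (4096 * inverse (1 + y\<^sup>2))" for y :: real
  proof -
    \<comment> \<open>The constant 64 is chosen so that squaring produces the fourth power of 1 +
      (|y| / 2) / 4, the fourth compound-interest lower bound for exp (|y| / 2); 4096 is 64
      squared.\<close>
    have "(1 + y\<^sup>2) \<le> 64 * (1 + \<bar>y\<bar> / 8)\<^sup>2"
      by (simp add: power2_eq_square algebra_simps)
    then have "(1 + y\<^sup>2)\<^sup>2 \<le> (64 * (1 + \<bar>y\<bar> / 8)\<^sup>2)\<^sup>2" by (intro power_mono) auto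
    also have "\<dots> = 4096 * (1 + (\<bar>y\<bar> / 2) / real 4) ^ 4" by (simp add: power_mult_distrib)
    also have "\<dots> \<le> 4096 * exp (\<bar>y\<bar> / 2)"
      by (intro mult_left_mono exp_ge_one_plus_x_over_n_power_n) auto
    finally have 1: "(1 + y\<^sup>2) * ((1 + y\<^sup>2) * exp (- \<bar>y\<bar> / 2)) \<le> 4096"
      by (simp add: power2_eq_square exp_minus field_simps)
    have "exp (- y\<^sup>2 / 2) * exp (y\<^sup>2 / 2 - \<bar>y\<bar> / 2) = exp (- \<bar>y\<bar> / 2)" by (simp flip: exp_add)
    then have "std_normal_density y * ((1 + y\<^sup>2) * exp (y\<^sup>2 / 2 - \<bar>y\<bar> / 2)) =
        1 / sqrt (2 * pi) * ((1 + y\<^sup>2) * exp (- \<bar>y\<bar> / 2))"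
      unfolding std_normal_density_def by (simp add: mult.left_commute mult.assoc)
    also have "\<dots> \<le> 1 * ((1 + y\<^sup>2) * exp (- \<bar>y\<bar> / 2))"
    proof (intro mult_right_mono)
      have "1 \<le> 2 * pi" using pi_ge_two by simp
      then show "1 / sqrt (2 * pi) \<le> 1" by simp
    qed auto
    also have "\<dots> \<le> 4096 * inverse (1 + y\<^sup>2)"
      using 1 by (simp add: field_simps add_pos_nonneg)
    finally show ?thesis by (simp add: abs_mult)
  qed
  then show "AE y in lborel. norm (std_normal_density y * ((1 + y\<^sup>2) * exp (y\<^sup>2 / 2 - \<bar>y\<bar> / 2))) \<le>
      norm (4096 * inverse (1 + y\<^sup>2))" by simp
qed simp

lemma nn_integral_std_normal:
  assumes "f \<in> borel_measurable borel" "\<And>y. f y \<ge> 0"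
  shows "(\<integral>\<^sup>+y. ennreal (f y) \<partial>density lborel (\<lambda>x. ennreal (std_normal_density x))) =
    (\<integral>\<^sup>+y. ennreal (std_normal_density y * f y) \<partial>lborel)"
  using assms by (simp add: nn_integral_density ennreal_mult)

context coord_density
begin

text \<open>The numerator is bounded by \<open>\<phi>_le\<close>, the mass from below by
  \<open>kern_mass_lower\<close> with min 1 \<tau> = 1. The bound is free of \<tau> and
  \<open>b\<close>, so it also serves as the dominating function when \<tau> tends to
  infinity.\<close>

lemma coord_msq_dominated:
  obtains C where "C > 0" "\<And>\<tau> b y. \<tau> \<ge> 1 \<Longrightarrow> \<bar>b\<bar> \<le> B \<Longrightarrow>
    coord_msq \<tau> b y \<le> C * ((1 + y\<^sup>2) * exp (y\<^sup>2 / 2 - \<bar>y\<bar> / 2))"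
proof -
  obtain m where m: "m > 0" "\<And>b t. \<bar>b\<bar> \<le> B \<Longrightarrow> \<bar>t\<bar> \<le> 1 \<Longrightarrow> m \<le> \<phi> (b + t)"
    using \<phi>_lower[of B] by blast
  define c where "c = m * exp (- 1 / 2) / 2"
  have c: "c > 0" using m by (simp add: c_def)
  let ?C = "K * sqrt (2 * pi) / c"
  show ?thesis
  proof (rule that[of ?C])
    show "?C > 0" using K_pos c by simp
    fix \<tau> b y :: real assume \<tau>: "\<tau> \<ge> 1" and b: "\<bar>b\<bar> \<le> B"
    have mass: "c * exp (\<bar>y\<bar> / 2) \<le> kern_mass \<tau> b y"
      using kern_mass_lower[of m b \<tau> y] m b \<tau> by (simp add: c_def min_absorb1)
    have "(\<integral>u. u\<^sup>2 * kern \<tau> b y u \<partial>lborel) \<le> (\<integral>u. K * (u\<^sup>2 * tilt y u) \<partial>lborel)"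
    proof (rule integral_mono[OF kern_sq_integrable])
      show "integrable lborel (\<lambda>u. K * (u\<^sup>2 * tilt y u))" by (intro integrable_mult_right tilt_integrable)
      fix u
      have "u\<^sup>2 * kern \<tau> b y u \<le> u\<^sup>2 * (K * tilt y u)" by (intro mult_left_mono kern_le) simp
      then show "u\<^sup>2 * kern \<tau> b y u \<le> K * (u\<^sup>2 * tilt y u)" by (simp add: ac_simps)
    qed
    then have num: "(\<integral>u. u\<^sup>2 * kern \<tau> b y u \<partial>lborel) \<le> K * (sqrt (2 * pi) * exp (y\<^sup>2 / 2) * (1 + y\<^sup>2))"
      by (simp add: integral_sq_tilt)
    have "coord_msq \<tau> b y \<le> K * (sqrt (2 * pi) * exp (y\<^sup>2 / 2) * (1 + y\<^sup>2)) / (c * exp (\<bar>y\<bar> / 2))"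
      unfolding coord_msq_eq using num mass c K_pos kern_mass_pos[of \<tau> b y]
      by (intro frac_le) (auto intro!: mult_nonneg_nonneg)
    also have "\<dots> = ?C * ((1 + y\<^sup>2) * exp (y\<^sup>2 / 2 - \<bar>y\<bar> / 2))"
      by (simp add: exp_diff)
    finally show "coord_msq \<tau> b y \<le> \<dots>" .
  qed
qed

text \<open>A coordinate drowned in noise must contribute of the order of its prior variance in
  noise units, \<tau>^2. Integrating the tilt over standard normal y gives one, and the substitution
  u = \<tau> (t - b) in the remaining integral yields \<tau>^3 times a second moment of the prior;
  one power is lost to the lower bound of the mass.\<close>

lemma coord_msq_mean_small:
  assumes m: "m > 0" "\<And>t. \<bar>t\<bar> \<le> 1 \<Longrightarrow> m \<le> \<phi> (b + t)" and \<tau>: "0 < \<tau>" "\<tau> \<le> 1" and B: "\<bar>b\<bar> \<le> B"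
  shows "(\<integral>\<^sup>+y. ennreal (coord_msq \<tau> b y) \<partial>density lborel (\<lambda>x. ennreal (std_normal_density x)))
    \<le> ennreal ((2 * exp (1 / 2) / m) * (\<integral>t. (2 * t\<^sup>2 + 2 * B\<^sup>2) * \<phi> t \<partial>lborel) * \<tau>\<^sup>2)"
proof -
  define c where "c = m * exp (- 1 / 2) / 2"
  have c: "c > 0" using m by (simp add: c_def)
  define V where "V = (\<integral>t. (2 * t\<^sup>2 + 2 * B\<^sup>2) * \<phi> t \<partial>lborel)"
  have Vint: "integrable lborel (\<lambda>t. (2 * t\<^sup>2 + 2 * B\<^sup>2) * \<phi> t)"
    using \<phi>_int \<phi>_sq_int by (simp add: distrib_right mult.assoc)
  have V0: "V \<ge> 0" unfolding V_def by (rule Bochner_Integration.integral_nonneg) (simp add: less_imp_le[OF \<phi>_pos])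
  have le: "coord_msq \<tau> b y \<le> (\<integral>u. u\<^sup>2 * kern \<tau> b y u \<partial>lborel) / (c * \<tau>)" for y
  proof -
    have "c * \<tau> * 1 \<le> c * \<tau> * exp (\<tau> * \<bar>y\<bar> / 2)" using c \<tau> by (intro mult_left_mono) auto
    also have "\<dots> \<le> kern_mass \<tau> b y"
      using kern_mass_lower[OF m \<tau>(1), of y] \<tau> by (simp add: c_def min_absorb2)
    finally show ?thesis unfolding coord_msq_eq using c \<tau> kern_mass_pos[of \<tau> b y]
      by (intro divide_left_mono) (auto intro!: Bochner_Integration.integral_nonneg)
  qed
  have "(\<integral>\<^sup>+y. ennreal (coord_msq \<tau> b y) \<partial>density lborel (\<lambda>x. ennreal (std_normal_density x)))
    = (\<integral>\<^sup>+y. ennreal (std_normal_density y * coord_msq \<tau> b y) \<partial>lborel)"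
    by (rule nn_integral_std_normal) (auto simp: coord_msq_nonneg)
  also have "\<dots> \<le> (\<integral>\<^sup>+y. ennreal (1 / (c * \<tau>)) * (\<integral>\<^sup>+u. ennreal (std_normal_density y * (u\<^sup>2 * kern \<tau> b y u)) \<partial>lborel) \<partial>lborel)"
  proof (rule nn_integral_mono)
    fix y :: real
    have "std_normal_density y * coord_msq \<tau> b y \<le> std_normal_density y * ((\<integral>u. u\<^sup>2 * kern \<tau> b y u \<partial>lborel) / (c * \<tau>))"
      by (intro mult_left_mono le) simp
    also have "\<dots> = 1 / (c * \<tau>) * (\<integral>u. std_normal_density y * (u\<^sup>2 * kern \<tau> b y u) \<partial>lborel)" by simp
    finally have "ennreal (std_normal_density y * coord_msq \<tau> b y) \<le>
        ennreal (1 / (c * \<tau>)) * ennreal (\<integral>u. std_normal_density y * (u\<^sup>2 * kern \<tau> b y u) \<partial>lborel)"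
      using c \<tau> by (subst ennreal_mult[symmetric])
        (auto intro!: ennreal_leI mult_nonneg_nonneg Bochner_Integration.integral_nonneg)
    also have "ennreal (\<integral>u. std_normal_density y * (u\<^sup>2 * kern \<tau> b y u) \<partial>lborel) =
        (\<integral>\<^sup>+u. ennreal (std_normal_density y * (u\<^sup>2 * kern \<tau> b y u)) \<partial>lborel)"
      by (intro nn_integral_eq_integral[symmetric] integrable_mult_right kern_sq_integrable) auto
    finally show "ennreal (std_normal_density y * coord_msq \<tau> b y) \<le>
        ennreal (1 / (c * \<tau>)) * (\<integral>\<^sup>+u. ennreal (std_normal_density y * (u\<^sup>2 * kern \<tau> b y u)) \<partial>lborel)" .
  qed
  also have "\<dots> = ennreal (1 / (c * \<tau>)) * (\<integral>\<^sup>+y. \<integral>\<^sup>+u. ennreal (std_normal_density y * (u\<^sup>2 * kern \<tau> b y u)) \<partial>lborel \<partial>lborel)"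
    by (rule nn_integral_cmult) measurable
  also have "(\<integral>\<^sup>+y. \<integral>\<^sup>+u. ennreal (std_normal_density y * (u\<^sup>2 * kern \<tau> b y u)) \<partial>lborel \<partial>lborel)
     = (\<integral>\<^sup>+u. \<integral>\<^sup>+y. ennreal (std_normal_density y * (u\<^sup>2 * kern \<tau> b y u)) \<partial>lborel \<partial>lborel)"
    by (rule lborel_pair.Fubini') measurable
  also have "\<dots> = (\<integral>\<^sup>+u. ennreal (u\<^sup>2 * \<phi> (b + u / \<tau>)) \<partial>lborel)"
  proof (rule nn_integral_cong)
    fix u :: real
    have eq: "std_normal_density y * (u\<^sup>2 * kern \<tau> b y u) = u\<^sup>2 * \<phi> (b + u / \<tau>) * normal_density u 1 y" for y
      unfolding std_normal_tilt[of y u, symmetric] kern_def by (simp only: mult.assoc mult.left_commute)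
    have "(\<integral>\<^sup>+y. ennreal (std_normal_density y * (u\<^sup>2 * kern \<tau> b y u)) \<partial>lborel) =
       (\<integral>\<^sup>+y. ennreal (u\<^sup>2 * \<phi> (b + u / \<tau>)) * ennreal (normal_density u 1 y) \<partial>lborel)"
      by (intro nn_integral_cong, subst eq, subst ennreal_mult) (auto simp: less_imp_le[OF \<phi>_pos])
    also have "\<dots> = ennreal (u\<^sup>2 * \<phi> (b + u / \<tau>)) * (\<integral>\<^sup>+y. ennreal (normal_density u 1 y) \<partial>lborel)"
      by (rule nn_integral_cmult) simp
    also have "(\<integral>\<^sup>+y. ennreal (normal_density u 1 y) \<partial>lborel) = 1"
      by (subst nn_integral_eq_integral) auto
    finally show "(\<integral>\<^sup>+y. ennreal (std_normal_density y * (u\<^sup>2 * kern \<tau> b y u)) \<partial>lborel) =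
       ennreal (u\<^sup>2 * \<phi> (b + u / \<tau>))" by simp
  qed
  also have "\<dots> = ennreal \<bar>\<tau>\<bar> * (\<integral>\<^sup>+t. ennreal ((- \<tau> * b + \<tau> * t)\<^sup>2 * \<phi> (b + (- \<tau> * b + \<tau> * t) / \<tau>)) \<partial>lborel)"
    using \<tau> by (intro nn_integral_real_affine) auto
  also have "\<dots> \<le> ennreal \<bar>\<tau>\<bar> * (\<integral>\<^sup>+t. ennreal (\<tau>\<^sup>2 * ((2 * t\<^sup>2 + 2 * B\<^sup>2) * \<phi> t)) \<partial>lborel)"
  proof (intro mult_left_mono nn_integral_mono ennreal_leI)
    fix t :: real
    have eq: "b + (- \<tau> * b + \<tau> * t) / \<tau> = t" using \<tau> by (simp add: field_simps)
    have "(t - b)\<^sup>2 \<le> 2 * t\<^sup>2 + 2 * b\<^sup>2"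
      using zero_le_power2[of "t + b"] by (simp add: power2_eq_square algebra_simps)
    also have "b\<^sup>2 \<le> B\<^sup>2" using B by (metis abs_ge_zero abs_le_square_iff abs_of_nonneg order_trans)
    finally have "(t - b)\<^sup>2 * \<phi> t \<le> (2 * t\<^sup>2 + 2 * B\<^sup>2) * \<phi> t"
      by (intro mult_right_mono) (auto simp: less_imp_le[OF \<phi>_pos])
    moreover have "(- \<tau> * b + \<tau> * t)\<^sup>2 = \<tau>\<^sup>2 * (t - b)\<^sup>2" by (simp add: power2_eq_square algebra_simps)
    ultimately show "(- \<tau> * b + \<tau> * t)\<^sup>2 * \<phi> (b + (- \<tau> * b + \<tau> * t) / \<tau>) \<le> \<tau>\<^sup>2 * ((2 * t\<^sup>2 + 2 * B\<^sup>2) * \<phi> t)"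
      unfolding eq by (simp add: mult.assoc mult_left_mono)
  qed simp
  also have "(\<integral>\<^sup>+t. ennreal (\<tau>\<^sup>2 * ((2 * t\<^sup>2 + 2 * B\<^sup>2) * \<phi> t)) \<partial>lborel) = ennreal (\<tau>\<^sup>2 * V)"
    unfolding V_def using Vint
    by (subst nn_integral_eq_integral) (auto simp: less_imp_le[OF \<phi>_pos])
  also have "ennreal (1 / (c * \<tau>)) * (ennreal \<bar>\<tau>\<bar> * ennreal (\<tau>\<^sup>2 * V)) = ennreal (1 / (c * \<tau>) * (\<tau> * (\<tau>\<^sup>2 * V)))"
    using c \<tau> V0 by (simp add: ennreal_mult[symmetric])
  also have "1 / (c * \<tau>) * (\<tau> * (\<tau>\<^sup>2 * V)) = (2 * exp (1 / 2) / m) * V * \<tau>\<^sup>2"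
    using \<tau> m by (simp add: c_def exp_minus field_simps)
  finally show ?thesis by (simp add: V_def mult_left_mono)
qed

lemma coord_msq_mean:
  obtains C where "C > 0" "\<And>\<tau> b. \<tau> > 0 \<Longrightarrow> \<bar>b\<bar> \<le> B \<Longrightarrow>
    (\<integral>\<^sup>+y. ennreal (coord_msq \<tau> b y) \<partial>density lborel (\<lambda>x. ennreal (std_normal_density x)))
      \<le> ennreal (C * min 1 (\<tau>\<^sup>2))"
proof -
  obtain m where m: "m > 0" "\<And>b t. \<bar>b\<bar> \<le> B \<Longrightarrow> \<bar>t\<bar> \<le> 1 \<Longrightarrow> m \<le> \<phi> (b + t)"
    using \<phi>_lower[of B] by blast
  obtain C0 where C0: "C0 > 0" "\<And>\<tau> b y. \<tau> \<ge> 1 \<Longrightarrow> \<bar>b\<bar> \<le> B \<Longrightarrow>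
    coord_msq \<tau> b y \<le> C0 * ((1 + y\<^sup>2) * exp (y\<^sup>2 / 2 - \<bar>y\<bar> / 2))"
    using coord_msq_dominated[of B] by blast
  define C1 where "C1 = (\<integral>y. C0 * (std_normal_density y * ((1 + y\<^sup>2) * exp (y\<^sup>2 / 2 - \<bar>y\<bar> / 2))) \<partial>lborel)"
  define C2 where "C2 = (2 * exp (1 / 2) / m) * (\<integral>t. (2 * t\<^sup>2 + 2 * B\<^sup>2) * \<phi> t \<partial>lborel)"
  have C10: "C1 \<ge> 0" unfolding C1_def using C0 by (intro Bochner_Integration.integral_nonneg) simp
  have C20: "C2 \<ge> 0" unfolding C2_def using m
    by (intro mult_nonneg_nonneg Bochner_Integration.integral_nonneg) (auto simp: less_imp_le[OF \<phi>_pos])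
  show ?thesis
  proof (rule that[of "C1 + C2 + 1"])
    show "C1 + C2 + 1 > 0" using C10 C20 by simp
    fix \<tau> b :: real assume \<tau>: "\<tau> > 0" and b: "\<bar>b\<bar> \<le> B"
    let ?I = "\<integral>\<^sup>+y. ennreal (coord_msq \<tau> b y) \<partial>density lborel (\<lambda>x. ennreal (std_normal_density x))"
    show "?I \<le> ennreal ((C1 + C2 + 1) * min 1 (\<tau>\<^sup>2))"
    proof (cases "\<tau> \<ge> 1")
      case True
      have "?I = (\<integral>\<^sup>+y. ennreal (std_normal_density y * coord_msq \<tau> b y) \<partial>lborel)"
        by (rule nn_integral_std_normal) (auto simp: coord_msq_nonneg)
      also have "\<dots> \<le> (\<integral>\<^sup>+y. ennreal (C0 * (std_normal_density y * ((1 + y\<^sup>2) * exp (y\<^sup>2 / 2 - \<bar>y\<bar> / 2)))) \<partial>lborel)"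
      proof (intro nn_integral_mono ennreal_leI)
        fix y
        show "std_normal_density y * coord_msq \<tau> b y \<le> C0 * (std_normal_density y * ((1 + y\<^sup>2) * exp (y\<^sup>2 / 2 - \<bar>y\<bar> / 2)))"
          using mult_left_mono[OF C0(2)[OF True b, of y], of "std_normal_density y"] by (simp add: ac_simps)
      qed
      also have "\<dots> = ennreal C1" unfolding C1_def using C0
        by (intro nn_integral_eq_integral integrable_mult_right dominating_integrable) auto
      also have "\<dots> \<le> ennreal ((C1 + C2 + 1) * min 1 (\<tau>\<^sup>2))"
      proof (rule ennreal_leI)
        have "min 1 (\<tau>\<^sup>2) = 1" using True by (simp add: min_def)
        then show "C1 \<le> (C1 + C2 + 1) * min 1 (\<tau>\<^sup>2)" using C20 by simp
      qed
      finally show ?thesis .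
    next
      case False
      then have "?I \<le> ennreal (C2 * \<tau>\<^sup>2)"
        unfolding C2_def using \<tau> b m by (intro coord_msq_mean_small) auto
      also have "\<dots> \<le> ennreal ((C1 + C2 + 1) * min 1 (\<tau>\<^sup>2))"
      proof (rule ennreal_leI)
        have "min 1 (\<tau>\<^sup>2) = \<tau>\<^sup>2" using False \<tau> power_le_one[of \<tau> 2] by simp
        then show "C2 * \<tau>\<^sup>2 \<le> (C1 + C2 + 1) * min 1 (\<tau>\<^sup>2)" using C10 by (simp add: mult_right_mono)
      qed
      finally show ?thesis .
    qed
  qed
qed

section \<open>Large-signal limit in one coordinate\<close>

lemma kern_scaleR_limit:
  fixes h :: "real \<Rightarrow> 'a::{banach, second_countable_topology}"
  assumes \<tau>: "filterlim \<tau> at_top sequentially"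
    and [measurable]: "\<And>n. hn n \<in> borel_measurable borel" "h \<in> borel_measurable borel"
    and lim: "\<And>u. (\<lambda>n. hn n u) \<longlonglongrightarrow> h u" and bd: "\<And>n u. norm (hn n u) \<le> 1 + \<bar>u\<bar>"
  shows "(\<lambda>n. \<integral>u. kern (\<tau> n) b y u *\<^sub>R hn n u \<partial>lborel) \<longlonglongrightarrow> (\<integral>u. (\<phi> b * tilt y u) *\<^sub>R h u \<partial>lborel)"
proof (rule integral_dominated_convergence)
  have [measurable]: "tilt y \<in> borel_measurable borel" by (simp add: tilt_def[abs_def])
  show "(\<lambda>u. (\<phi> b * tilt y u) *\<^sub>R h u) \<in> borel_measurable lborel" by measurable
  show "(\<lambda>u. kern (\<tau> n) b y u *\<^sub>R hn n u) \<in> borel_measurable lborel" for n by measurable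
  show "integrable lborel (\<lambda>u. K * (tilt y u + \<bar>u\<bar> * tilt y u))"
    by (intro integrable_mult_right Bochner_Integration.integrable_add tilt_integrable)
  show "AE u in lborel. (\<lambda>n. kern (\<tau> n) b y u *\<^sub>R hn n u) \<longlonglongrightarrow> (\<phi> b * tilt y u) *\<^sub>R h u"
  proof (rule AE_I2)
    fix u
    have "(\<lambda>n. b + u / \<tau> n) \<longlonglongrightarrow> b + 0"
      by (intro tendsto_add tendsto_const tendsto_divide_0[OF tendsto_const] filterlim_at_top_imp_at_infinity \<tau>)
    then have "(\<lambda>n. \<phi> (b + u / \<tau> n)) \<longlonglongrightarrow> \<phi> b"
      using \<phi>_cont by (intro isCont_tendsto_compose[of b \<phi>]) (auto simp: continuous_on_eq_continuous_at)
    then show "(\<lambda>n. kern (\<tau> n) b y u *\<^sub>R hn n u) \<longlonglongrightarrow> (\<phi> b * tilt y u) *\<^sub>R h u"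
      unfolding kern_def by (intro tendsto_intros lim)
  qed
  show "AE u in lborel. norm (kern (\<tau> n) b y u *\<^sub>R hn n u) \<le> K * (tilt y u + \<bar>u\<bar> * tilt y u)" for n
  proof (rule AE_I2)
    fix u
    have "norm (kern (\<tau> n) b y u *\<^sub>R hn n u) = kern (\<tau> n) b y u * norm (hn n u)" by simp
    also have "\<dots> \<le> (K * tilt y u) * (1 + \<bar>u\<bar>)"
      using K_pos by (intro mult_mono kern_le bd) auto
    finally show "norm (kern (\<tau> n) b y u *\<^sub>R hn n u) \<le> K * (tilt y u + \<bar>u\<bar> * tilt y u)"
      by (simp add: algebra_simps)
  qed
qed

text \<open>Bernstein-von Mises in one coordinate for a fixed noise value: for large \<tau> the
  prior density is nearly constant on the scale of u, and the factor \<open>\<phi> b\<close> cancels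
  on normalising. Linear growth is allowed so as to include the mean, values in a Banach space cover
  characteristic functions, and \<open>hn\<close> varies with n to admit a moving centre.\<close>

lemma coord_post_limit:
  fixes h :: "real \<Rightarrow> 'a::{banach, second_countable_topology}"
  assumes \<tau>: "filterlim \<tau> at_top sequentially"
    and [measurable]: "\<And>n. hn n \<in> borel_measurable borel" "h \<in> borel_measurable borel"
    and lim: "\<And>u. (\<lambda>n. hn n u) \<longlonglongrightarrow> h u" and bd: "\<And>n u. norm (hn n u) \<le> 1 + \<bar>u\<bar>"
  shows "(\<lambda>n. \<integral>u. hn n u \<partial>coord_post (\<tau> n) b y) \<longlonglongrightarrow> (\<integral>u. normal_density y 1 u *\<^sub>R h u \<partial>lborel)"
proof -
  define c where "c = sqrt (2 * pi) * exp (y\<^sup>2 / 2)"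
  have c: "c > 0" by (simp add: c_def)
  have "(\<lambda>n. \<integral>u. kern (\<tau> n) b y u *\<^sub>R (1::real) \<partial>lborel) \<longlonglongrightarrow> (\<integral>u. (\<phi> b * tilt y u) *\<^sub>R 1 \<partial>lborel)"
    by (rule kern_scaleR_limit[OF \<tau>]) auto
  then have mass: "(\<lambda>n. kern_mass (\<tau> n) b y) \<longlonglongrightarrow> \<phi> b * c"
    by (simp add: kern_mass_def integral_tilt c_def)
  have "(\<lambda>n. (1 / kern_mass (\<tau> n) b y) *\<^sub>R (\<integral>u. kern (\<tau> n) b y u *\<^sub>R hn n u \<partial>lborel))
      \<longlonglongrightarrow> (1 / (\<phi> b * c)) *\<^sub>R (\<integral>u. (\<phi> b * tilt y u) *\<^sub>R h u \<partial>lborel)"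
    using c \<phi>_pos[of b] by (intro tendsto_intros mass kern_scaleR_limit[OF \<tau>] lim bd) auto
  also have "(\<integral>u. (\<phi> b * tilt y u) *\<^sub>R h u \<partial>lborel) = (\<integral>u. (\<phi> b * c) *\<^sub>R (normal_density y 1 u *\<^sub>R h u) \<partial>lborel)"
    by (intro Bochner_Integration.integral_cong) (auto simp: tilt_eq_normal c_def)
  also have "\<dots> = (\<phi> b * c) *\<^sub>R (\<integral>u. normal_density y 1 u *\<^sub>R h u \<partial>lborel)"
    by (rule integral_scaleR_right)
  finally show ?thesis using c \<phi>_pos[of b]
    by (simp add: integral_coord_post)
qed

lemma coord_mean_limit:
  assumes \<tau>: "filterlim \<tau> at_top sequentially"
  shows "(\<lambda>n. coord_mean (\<tau> n) b y) \<longlonglongrightarrow> y"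
proof -
  have "(\<integral>u. normal_density y 1 u * u \<partial>lborel) = y"
    by (rule integral_normal_moment_nz_1) simp
  then show ?thesis
    using coord_post_limit[OF \<tau>, of "\<lambda>n u. u" "\<lambda>u. u" b y] by (simp add: coord_mean_def)
qed

text \<open>Dominated convergence over the noise: the squared mean is at most the second moment,
  which \<open>coord_msq_dominated\<close> bounds by a function integrable against the normal
  law.\<close>

lemma coord_mean_L2_limit:
  assumes \<tau>: "filterlim \<tau> at_top sequentially"
  shows "(\<lambda>n. \<integral>\<^sup>+y. ennreal ((coord_mean (\<tau> n) b y - y)\<^sup>2) \<partial>density lborel (\<lambda>x. ennreal (std_normal_density x))) \<longlonglongrightarrow> 0"
proof -
  let ?N = "density lborel (\<lambda>x. ennreal (std_normal_density x))"
  obtain C0 where C0: "C0 > 0" "\<And>\<tau> b' y. \<tau> \<ge> 1 \<Longrightarrow> \<bar>b'\<bar> \<le> \<bar>b\<bar> \<Longrightarrow>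
    coord_msq \<tau> b' y \<le> C0 * ((1 + y\<^sup>2) * exp (y\<^sup>2 / 2 - \<bar>y\<bar> / 2))"
    using coord_msq_dominated[of "\<bar>b\<bar>"] by blast
  \<comment> \<open>The dominating bound asks for \<tau> \<ge> 1 at every n; the truncation alters
    only finitely many terms.\<close>
  define \<tau>' where "\<tau>' n = max 1 (\<tau> n)" for n
  have ev: "eventually (\<lambda>n. \<tau>' n = \<tau> n) sequentially"
    using \<tau>[unfolded filterlim_at_top, rule_format, of 1] by eventually_elim (simp add: \<tau>'_def)
  have \<tau>': "filterlim \<tau>' at_top sequentially"
    using filterlim_cong[OF refl refl ev] \<tau> by simp
  let ?w = "\<lambda>y::real. 2 * C0 * ((1 + y\<^sup>2) * exp (y\<^sup>2 / 2 - \<bar>y\<bar> / 2)) + 2 * y\<^sup>2"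
  have "(\<lambda>n. \<integral>\<^sup>+y. ennreal ((coord_mean (\<tau>' n) b y - y)\<^sup>2) \<partial>?N) \<longlonglongrightarrow> (\<integral>\<^sup>+y. ennreal 0 \<partial>?N)"
  proof (rule nn_integral_dominated_convergence)
    show "AE y in ?N. ennreal ((coord_mean (\<tau>' n) b y - y)\<^sup>2) \<le> ennreal (?w y)" for n
    proof (intro AE_I2 ennreal_leI)
      fix y
      have "(coord_mean (\<tau>' n) b y - y)\<^sup>2 \<le> 2 * (coord_mean (\<tau>' n) b y)\<^sup>2 + 2 * y\<^sup>2"
        using zero_le_power2[of "coord_mean (\<tau>' n) b y + y"] by (simp add: power2_eq_square algebra_simps)
      also have "(coord_mean (\<tau>' n) b y)\<^sup>2 \<le> coord_msq (\<tau>' n) b y" by (rule coord_mean_sq_le)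
      also have "\<dots> \<le> C0 * ((1 + y\<^sup>2) * exp (y\<^sup>2 / 2 - \<bar>y\<bar> / 2))" by (rule C0) (simp_all add: \<tau>'_def)
      finally show "(coord_mean (\<tau>' n) b y - y)\<^sup>2 \<le> ?w y" by simp
    qed
    have "(\<integral>\<^sup>+y. ennreal (?w y) \<partial>?N) = (\<integral>\<^sup>+y. ennreal (std_normal_density y * ?w y) \<partial>lborel)"
      using C0(1) by (intro nn_integral_std_normal) (auto intro!: add_nonneg_nonneg mult_nonneg_nonneg)
    also have "\<dots> = (\<integral>y. std_normal_density y * ?w y \<partial>lborel)"
    proof (intro nn_integral_eq_integral)
      have *: "std_normal_density y * ?w y = 2 * C0 * (std_normal_density y * ((1 + y\<^sup>2) * exp (y\<^sup>2 / 2 - \<bar>y\<bar> / 2)))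
          + 2 * (std_normal_density y * y\<^sup>2)" for y
        by (simp only: distrib_left[of "std_normal_density y"] mult.assoc mult.left_commute[of "std_normal_density y"])
      show "integrable lborel (\<lambda>y. std_normal_density y * ?w y)"
        unfolding * by (intro Bochner_Integration.integrable_add integrable_mult_right dominating_integrable integrable_std_normal_moment)
    qed (use C0(1) in \<open>auto intro!: AE_I2 add_nonneg_nonneg mult_nonneg_nonneg\<close>)
    finally show "(\<integral>\<^sup>+y. ennreal (?w y) \<partial>?N) < \<infinity>" by simp
    show "AE y in ?N. (\<lambda>n. ennreal ((coord_mean (\<tau>' n) b y - y)\<^sup>2)) \<longlonglongrightarrow> ennreal 0"
    proof (intro AE_I2 tendsto_ennrealI)
      fix y
      have "(\<lambda>n. (coord_mean (\<tau>' n) b y - y)\<^sup>2) \<longlonglongrightarrow> (y - y)\<^sup>2"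
        by (intro tendsto_intros coord_mean_limit \<tau>')
      then show "(\<lambda>n. (coord_mean (\<tau>' n) b y - y)\<^sup>2) \<longlonglongrightarrow> 0" by simp
    qed
  qed simp_all
  then have "(\<lambda>n. \<integral>\<^sup>+y. ennreal ((coord_mean (\<tau>' n) b y - y)\<^sup>2) \<partial>?N) \<longlonglongrightarrow> 0" by simp
  then show ?thesis
    by (rule Lim_transform_eventually) (use ev in eventually_elim, simp)
qed

end

section \<open>Weighted sums over the wavelet levels\<close>

text \<open>The slice is empty below \<open>J0 - 1\<close>, so sums over levels can run over all
  natural numbers.\<close>

definition lev :: "nat \<Rightarrow> nat \<Rightarrow> nat set" where
  "lev J0 l = {k. (l, k) \<in> idx J0}"

lemma lev_eq: "lev J0 l = (if J0 - 1 \<le> l then {..<level_size J0 l} else {})"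
  by (auto simp: lev_def idx_def)

lemma finite_lev [simp]: "finite (lev J0 l)"
  by (simp add: lev_eq)

text \<open>The factor 2 pays for level \<open>J0 - 1\<close>, which carries the 2 ^ J0 scaling
  functions.\<close>

lemma card_lev_le:
  assumes "J0 \<ge> 1" shows "real (card (lev J0 l)) \<le> 2 * 2 ^ l"
proof -
  have "real (2 ^ J0) = 2 * 2 ^ (J0 - 1)" using assms by (cases J0) auto
  then show ?thesis by (auto simp: lev_eq level_size_def)
qed

definition idx_below :: "nat \<Rightarrow> nat \<Rightarrow> (nat \<times> nat) set" where
  "idx_below J0 L = Sigma {..<L} (lev J0)"

lemma finite_idx_below [simp]: "finite (idx_below J0 L)"
  by (simp add: idx_below_def)

lemma idx_below_subset: "idx_below J0 L \<subseteq> idx J0"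
  by (auto simp: idx_below_def lev_def)

lemma idx_below_mono: "L \<le> M \<Longrightarrow> idx_below J0 L \<subseteq> idx_below J0 M"
  by (auto simp: idx_below_def)

lemma mem_idx_below: "(l, k) \<in> idx_below J0 L \<longleftrightarrow> l < L \<and> (l, k) \<in> idx J0"
  by (auto simp: idx_below_def lev_def)

lemma finite_subset_idx_below:
  assumes "finite F" "F \<subseteq> idx J0" obtains L where "F \<subseteq> idx_below J0 L"
proof (rule that[of "Suc (Max (insert 0 (fst ` F)))"], rule subsetI)
  fix x assume x: "x \<in> F"
  then have "fst x \<le> Max (insert 0 (fst ` F))" using assms by (intro Max_ge) auto
  then show "x \<in> idx_below J0 (Suc (Max (insert 0 (fst ` F))))"
    using x assms by (cases x) (auto simp: mem_idx_below)
qed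

lemma sum_idx_below: "(\<Sum>i\<in>idx_below J0 L. f i) = (\<Sum>l<L. \<Sum>k\<in>lev J0 l. f (l, k))"
  unfolding idx_below_def by (subst sum.Sigma) (auto simp: case_prod_beta)

lemma idx_nonempty: "idx J0 \<noteq> {}"
proof -
  have "(J0 - 1, 0) \<in> idx J0" by (simp add: idx_def level_size_def)
  then show ?thesis by blast
qed

text \<open>The squared level norm with infinite values allowed: monotone convergence, Fubini and
  Markov's inequality then apply without summability conditions.\<close>

definition wsum :: "nat \<Rightarrow> (nat \<Rightarrow> real) \<Rightarrow> (nat \<times> nat \<Rightarrow> real) \<Rightarrow> ennreal" where
  "wsum J0 w c = (\<Sum>l. ennreal (w l * (\<Sum>k\<in>lev J0 l. (c (l, k))\<^sup>2)))"

lemma wsum_measurable [measurable (raw)]: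
  assumes [measurable]: "\<And>i. i \<in> idx J0 \<Longrightarrow> (\<lambda>x. c x i) \<in> borel_measurable M"
  shows "(\<lambda>x. wsum J0 w (c x)) \<in> borel_measurable M"
proof -
  have "(\<lambda>x. \<Sum>k\<in>lev J0 l. (c x (l, k))\<^sup>2) \<in> borel_measurable M" for l
    by (intro borel_measurable_sum borel_measurable_power assms) (simp add: lev_def)
  then show ?thesis unfolding wsum_def by measurable
qed

lemma wsum_cong: "(\<And>i. i \<in> idx J0 \<Longrightarrow> (c i)\<^sup>2 = (d i)\<^sup>2) \<Longrightarrow> wsum J0 w c = wsum J0 w d"
  unfolding wsum_def by (intro suminf_cong arg_cong[where f=ennreal] arg_cong2[where f="(*)"] sum.cong) (auto simp: lev_def)

lemma wsum_SUP:
  assumes w: "\<And>l. w l \<ge> 0"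
  shows "wsum J0 w c = (SUP L. ennreal (\<Sum>i\<in>idx_below J0 L. w (fst i) * (c i)\<^sup>2))"
proof -
  have "wsum J0 w c = (SUP L. \<Sum>l<L. ennreal (w l * (\<Sum>k\<in>lev J0 l. (c (l, k))\<^sup>2)))"
    unfolding wsum_def by (rule suminf_eq_SUP)
  also have "(\<lambda>L. \<Sum>l<L. ennreal (w l * (\<Sum>k\<in>lev J0 l. (c (l, k))\<^sup>2))) =
      (\<lambda>L. ennreal (\<Sum>i\<in>idx_below J0 L. w (fst i) * (c i)\<^sup>2))"
    using w by (intro ext, subst sum_ennreal) (auto simp: sum_idx_below sum_distrib_left sum_nonneg)
  finally show ?thesis .
qed

lemma wsum_ge:
  assumes w: "\<And>l. w l \<ge> 0" and F: "finite F" "F \<subseteq> idx J0"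
  shows "ennreal (\<Sum>i\<in>F. w (fst i) * (c i)\<^sup>2) \<le> wsum J0 w c"
proof -
  obtain L where L: "F \<subseteq> idx_below J0 L" using finite_subset_idx_below[OF F] .
  have "(\<Sum>i\<in>F. w (fst i) * (c i)\<^sup>2) \<le> (\<Sum>i\<in>idx_below J0 L. w (fst i) * (c i)\<^sup>2)"
    using L w by (intro sum_mono2) auto
  then have "ennreal (\<Sum>i\<in>F. w (fst i) * (c i)\<^sup>2) \<le> ennreal (\<Sum>i\<in>idx_below J0 L. w (fst i) * (c i)\<^sup>2)"
    by (rule ennreal_leI)
  also have "\<dots> \<le> wsum J0 w c" unfolding wsum_SUP[OF w] by (rule SUP_upper) simp
  finally show ?thesis .
qed

lemma wsum_le:
  assumes w: "\<And>l. w l \<ge> 0" and le: "\<And>L. (\<Sum>i\<in>idx_below J0 L. w (fst i) * (c i)\<^sup>2) \<le> B"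
  shows "wsum J0 w c \<le> ennreal B"
  unfolding wsum_SUP[OF w] by (intro SUP_least ennreal_leI le)

lemma wsum_scale:
  assumes w: "\<And>l. w l \<ge> 0"
  shows "wsum J0 w (\<lambda>i. a * c i) = ennreal (a\<^sup>2) * wsum J0 w c"
proof -
  have "w l * (\<Sum>k\<in>lev J0 l. (a * c (l, k))\<^sup>2) = a\<^sup>2 * (w l * (\<Sum>k\<in>lev J0 l. (c (l, k))\<^sup>2))" for l
    by (simp add: power_mult_distrib sum_distrib_left[symmetric])
  then have "ennreal (w l * (\<Sum>k\<in>lev J0 l. (a * c (l, k))\<^sup>2)) = ennreal (a\<^sup>2) * ennreal (w l * (\<Sum>k\<in>lev J0 l. (c (l, k))\<^sup>2))" for l
    using w by (simp only:) (intro ennreal_mult, auto intro!: mult_nonneg_nonneg sum_nonneg)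
  then show ?thesis unfolding wsum_def by (simp only: ennreal_suminf_cmult)
qed

text \<open>Minkowski's inequality on finite sections, passed to the supremum. Phrasing it with
  squared bounds avoids square roots of extended nonnegative numbers.\<close>

lemma wsum_triangle:
  assumes w: "\<And>l. w l \<ge> 0" and x: "wsum J0 w c \<le> ennreal (x\<^sup>2)" "x \<ge> 0"
    and y: "wsum J0 w d \<le> ennreal (y\<^sup>2)" "y \<ge> 0"
  shows "wsum J0 w (\<lambda>i. c i + d i) \<le> ennreal ((x + y)\<^sup>2)"
proof (rule wsum_le[OF w])
  fix L
  let ?F = "idx_below J0 L"
  have eq: "(\<Sum>i\<in>?F. w (fst i) * (f i)\<^sup>2) = (L2_set (\<lambda>i. sqrt (w (fst i)) * f i) ?F)\<^sup>2" for f
    using w by (simp add: L2_set_def sum_nonneg power_mult_distrib)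
  have le: "L2_set (\<lambda>i. sqrt (w (fst i)) * f i) ?F \<le> z"
    if "wsum J0 w f \<le> ennreal (z\<^sup>2)" "z \<ge> 0" for f z
  proof -
    have "ennreal (\<Sum>i\<in>?F. w (fst i) * (f i)\<^sup>2) \<le> ennreal (z\<^sup>2)"
      using wsum_ge[OF w finite_idx_below idx_below_subset] that(1) by (rule order_trans)
    then show ?thesis
      using that(2) by (auto simp: eq ennreal_le_iff power2_le_iff_abs_le L2_set_nonneg)
  qed
  have "L2_set (\<lambda>i. sqrt (w (fst i)) * (c i + d i)) ?F =
      L2_set (\<lambda>i. sqrt (w (fst i)) * c i + sqrt (w (fst i)) * d i) ?F"
    by (simp add: distrib_left)
  also have "\<dots> \<le> x + y"
    using L2_set_triangle_ineq le[OF x] le[OF y] by (rule order_trans[OF _ add_mono])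
  finally show "(\<Sum>i\<in>?F. w (fst i) * (c i + d i)\<^sup>2) \<le> (x + y)\<^sup>2"
    by (simp add: eq power_mono L2_set_nonneg)
qed

text \<open>Links the unordered real sum in \<open>level_norm\<close> to \<open>wsum\<close>; every
  later use of the two norms passes through this identity.\<close>

lemma level_norm_eq:
  assumes w: "\<And>l. l \<ge> J0 - 1 \<Longrightarrow> w l \<ge> 0"
  shows "level_norm J0 w c = (if wsum J0 w c = \<infinity> then \<infinity> else ereal (sqrt (enn2real (wsum J0 w c))))"
proof -
  define t where "t l = w l * (\<Sum>k<level_size J0 l. (c (l, k))\<^sup>2)" for l
  define s where "s l = w l * (\<Sum>k\<in>lev J0 l. (c (l, k))\<^sup>2)" for l
  have s0: "s l \<ge> 0" for l using w by (auto simp: s_def lev_eq sum_nonneg)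
  have st: "l \<ge> J0 - 1 \<Longrightarrow> t l = s l" "l < J0 - 1 \<Longrightarrow> s l = 0" for l
    by (auto simp: s_def t_def lev_eq)
  have ws: "wsum J0 w c = (\<Sum>l. ennreal (s l))" by (simp add: wsum_def s_def)
  have 1: "t summable_on {J0 - 1..} \<longleftrightarrow> s summable_on UNIV"
    by (rule summable_on_cong_neutral) (auto simp: st)
  also have "\<dots> \<longleftrightarrow> summable s" by (rule summable_on_UNIV_nonneg_real_iff) (rule s0)
  also have "\<dots> \<longleftrightarrow> wsum J0 w c \<noteq> \<infinity>"
    unfolding ws infinity_ennreal_def
  proof
    assume "summable s" then show "(\<Sum>l. ennreal (s l)) \<noteq> top" using s0 by (rule ennreal_suminf_neq_top)
  next
    assume "(\<Sum>l. ennreal (s l)) \<noteq> top" then show "summable s" by (rule summable_suminf_not_top[OF s0])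
  qed
  finally have summ: "t summable_on {J0 - 1..} \<longleftrightarrow> wsum J0 w c \<noteq> \<infinity>" .
  have val: "infsum t {J0 - 1..} = enn2real (wsum J0 w c)" if "wsum J0 w c \<noteq> \<infinity>"
  proof -
    have "summable s" using that unfolding ws infinity_ennreal_def by (rule summable_suminf_not_top[OF s0])
    then have "(s has_sum suminf s) UNIV" by (intro sums_nonneg_imp_has_sum summable_sums s0)
    then have "infsum s UNIV = suminf s" by (rule infsumI)
    moreover have "infsum t {J0 - 1..} = infsum s UNIV" by (rule infsum_cong_neutral) (auto simp: st)
    moreover have "wsum J0 w c = ennreal (suminf s)" using that unfolding ws infinity_ennreal_def
      by (rule suminf_ennreal[OF s0])
    moreover have "suminf s \<ge> 0" using \<open>summable s\<close> s0 by (rule suminf_nonneg)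
    ultimately show ?thesis by simp
  qed
  have "level_norm J0 w c = (if t summable_on {J0 - 1..} then ereal (sqrt (infsum t {J0 - 1..})) else \<infinity>)"
    unfolding level_norm_def Let_def t_def[abs_def] by (rule refl)
  then show ?thesis unfolding summ using val by (cases "wsum J0 w c = \<infinity>") (simp_all del: One_nat_def)
qed

lemma level_norm_le_iff:
  assumes w: "\<And>l. l \<ge> J0 - 1 \<Longrightarrow> w l \<ge> 0"
  shows "level_norm J0 w c \<le> ereal r \<longleftrightarrow> 0 \<le> r \<and> wsum J0 w c \<le> ennreal (r\<^sup>2)"
proof (cases "wsum J0 w c")
  case (real x)
  have "sqrt x \<le> r \<longleftrightarrow> 0 \<le> r \<and> x \<le> r\<^sup>2"
    using real(1) by (meson order_trans real_le_lsqrt real_sqrt_ge_zero sqrt_le_D)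
  then show ?thesis using real by (simp add: level_norm_eq[OF w])
next
  case top
  then show ?thesis by (simp add: level_norm_eq[OF w] top_unique)
qed

lemma level_norm_nonneg:
  assumes w: "\<And>l. l \<ge> J0 - 1 \<Longrightarrow> w l \<ge> 0"
  shows "level_norm J0 w c \<ge> 0"
  by (simp add: level_norm_eq[OF w])

section \<open>Orthonormal bases and square-summable expansions\<close>

locale onb =
  fixes J0 :: nat and e :: "nat \<times> nat \<Rightarrow> L2"
  assumes onb: "orthonormal_basis e (idx J0)"
begin

lemma inner_e: "i \<in> idx J0 \<Longrightarrow> j \<in> idx J0 \<Longrightarrow> inner (e i) (e j) = of_bool (i = j)"
  using onb by (simp add: orthonormal_basis_def)

lemma inner_e_sum:
  assumes "finite F" "F \<subseteq> idx J0" "j \<in> idx J0"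
  shows "inner (e j) (\<Sum>i\<in>F. a i *\<^sub>R e i) = (if j \<in> F then a j else 0)"
proof -
  have "inner (e j) (\<Sum>i\<in>F. a i *\<^sub>R e i) = (\<Sum>i\<in>F. if j = i then a i else 0)"
    unfolding inner_sum_right using assms by (intro sum.cong) (auto simp: inner_e subset_iff)
  then show ?thesis using assms(1) by simp
qed

lemma norm_e_sum:
  assumes "finite F" "F \<subseteq> idx J0"
  shows "(norm (\<Sum>i\<in>F. a i *\<^sub>R e i))\<^sup>2 = (\<Sum>i\<in>F. (a i)\<^sup>2)"
proof -
  have "(norm (\<Sum>i\<in>F. a i *\<^sub>R e i))\<^sup>2 = (\<Sum>j\<in>F. a j * inner (e j) (\<Sum>i\<in>F. a i *\<^sub>R e i))"
    by (simp add: power2_norm_eq_inner inner_sum_left)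
  also have "\<dots> = (\<Sum>j\<in>F. (a j)\<^sup>2)"
    using assms by (intro sum.cong) (auto simp: inner_e_sum subset_iff power2_eq_square)
  finally show ?thesis .
qed

text \<open>Pythagoras around the orthogonal projection. Arbitrary coefficients \<open>a\<close> are
  kept because the density of the span provides an approximant whose coefficients are unknown;
  dropping the last sum shows that the projection does at least as well.\<close>

lemma norm_diff_e_sum:
  assumes "finite F" "F \<subseteq> idx J0"
  shows "(norm (f - (\<Sum>i\<in>F. a i *\<^sub>R e i)))\<^sup>2 =
    (norm f)\<^sup>2 - (\<Sum>i\<in>F. (inner (e i) f)\<^sup>2) + (\<Sum>i\<in>F. (inner (e i) f - a i)\<^sup>2)"
proof -
  have "(norm (f - (\<Sum>i\<in>F. a i *\<^sub>R e i)))\<^sup>2 =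
      (norm f)\<^sup>2 - 2 * inner f (\<Sum>i\<in>F. a i *\<^sub>R e i) + (norm (\<Sum>i\<in>F. a i *\<^sub>R e i))\<^sup>2"
    by (simp add: power2_norm_eq_inner inner_diff_left inner_diff_right inner_commute)
  also have "inner f (\<Sum>i\<in>F. a i *\<^sub>R e i) = (\<Sum>i\<in>F. a i * inner (e i) f)"
    by (simp add: inner_sum_right inner_commute)
  also note norm_e_sum[OF assms]
  finally have 1: "(norm (f - (\<Sum>i\<in>F. a i *\<^sub>R e i)))\<^sup>2 =
      (norm f)\<^sup>2 - 2 * (\<Sum>i\<in>F. a i * inner (e i) f) + (\<Sum>i\<in>F. (a i)\<^sup>2)" .
  have "(\<Sum>i\<in>F. (inner (e i) f - a i)\<^sup>2) =
      (\<Sum>i\<in>F. (inner (e i) f)\<^sup>2) - 2 * (\<Sum>i\<in>F. a i * inner (e i) f) + (\<Sum>i\<in>F. (a i)\<^sup>2)"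
    by (simp add: power2_diff sum.distrib sum_subtractf sum_distrib_left ac_simps)
  with 1 show ?thesis by simp
qed

lemma bessel:
  assumes "finite F" "F \<subseteq> idx J0" shows "(\<Sum>i\<in>F. (inner (e i) f)\<^sup>2) \<le> (norm f)\<^sup>2"
proof -
  have "(norm (f - (\<Sum>i\<in>F. inner (e i) f *\<^sub>R e i)))\<^sup>2 = (norm f)\<^sup>2 - (\<Sum>i\<in>F. (inner (e i) f)\<^sup>2)"
    using norm_diff_e_sum[OF assms, of f "\<lambda>i. inner (e i) f"] by simp
  then show ?thesis using zero_le_power2[of "norm (f - (\<Sum>i\<in>F. inner (e i) f *\<^sub>R e i))"] by linarith
qed

text \<open>One inequality is Bessel's. For the other, any element of the span close to f is at
  least as far from f as the projection onto the same finitely many basis vectors.\<close>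

lemma parseval: "wsum J0 (\<lambda>_. 1) (\<lambda>i. inner (e i) f) = ennreal ((norm f)\<^sup>2)"
proof (rule antisym)
  show "wsum J0 (\<lambda>_. 1) (\<lambda>i. inner (e i) f) \<le> ennreal ((norm f)\<^sup>2)"
    using bessel[OF finite_idx_below idx_below_subset] by (intro wsum_le) auto
  show "ennreal ((norm f)\<^sup>2) \<le> wsum J0 (\<lambda>_. 1) (\<lambda>i. inner (e i) f)"
  proof (rule ennreal_le_epsilon)
    fix d :: real assume d: "d > 0"
    have "f \<in> closure (span (e ` idx J0))" using onb by (simp add: orthonormal_basis_def)
    then obtain g where g: "g \<in> span (e ` idx J0)" "dist g f < sqrt d"
      using d unfolding closure_approachable by (meson real_sqrt_gt_zero)
    from g(1) obtain T r where T: "finite T" "T \<subseteq> e ` idx J0" "g = (\<Sum>b\<in>T. r b *\<^sub>R b)"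
      unfolding span_explicit by blast
    from T obtain F where F: "finite F" "F \<subseteq> idx J0" "T = e ` F" by (meson finite_subset_image)
    have "inj_on e F"
    proof (rule inj_onI)
      fix x y assume xy: "x \<in> F" "y \<in> F" "e x = e y"
      then have "inner (e x) (e x) = inner (e x) (e y)" by simp
      then show "x = y" using xy F(2) inner_e[of x x] inner_e[of x y] by (auto split: if_splits)
    qed
    then have g': "g = (\<Sum>i\<in>F. r (e i) *\<^sub>R e i)" by (simp add: T(3) F(3) sum.reindex)
    have "(norm f)\<^sup>2 - (\<Sum>i\<in>F. (inner (e i) f)\<^sup>2) \<le> (norm (f - g))\<^sup>2"
      unfolding g' norm_diff_e_sum[OF F(1,2)] by (simp add: sum_nonneg)
    also have "\<dots> \<le> (sqrt d)\<^sup>2"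
      using g(2) by (intro power_mono) (auto simp: dist_norm norm_minus_commute)
    finally have "(norm f)\<^sup>2 \<le> (\<Sum>i\<in>F. (inner (e i) f)\<^sup>2) + d" using d by simp
    then have "ennreal ((norm f)\<^sup>2) \<le> ennreal (\<Sum>i\<in>F. (inner (e i) f)\<^sup>2) + ennreal d"
      using d by (subst ennreal_plus[symmetric]) (auto simp: sum_nonneg intro!: ennreal_leI simp del: ennreal_plus)
    also have "ennreal (\<Sum>i\<in>F. (inner (e i) f)\<^sup>2) \<le> wsum J0 (\<lambda>_. 1) (\<lambda>i. inner (e i) f)"
      using wsum_ge[of "\<lambda>_. 1" F J0 "\<lambda>i. inner (e i) f"] F by simp
    finally show "ennreal ((norm f)\<^sup>2) \<le> wsum J0 (\<lambda>_. 1) (\<lambda>i. inner (e i) f) + ennreal d"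
      by (simp add: add_right_mono)
  qed
qed

text \<open>Riesz-Fischer. A finite partial sum containing the first L levels differs from the L-th
  section by at most the square root of the remaining mass, which gives unordered convergence;
  convergence along the levels is recorded too, for measurability.\<close>

lemma expansion_has_sum:
  assumes fin: "wsum J0 (\<lambda>_. 1) a < \<infinity>"
  obtains f where "((\<lambda>i. a i *\<^sub>R e i) has_sum f) (idx J0)"
    "(\<lambda>L. \<Sum>i\<in>idx_below J0 L. a i *\<^sub>R e i) \<longlonglongrightarrow> f"
proof -
  define q where "q L = (\<Sum>i\<in>idx_below J0 L. (a i)\<^sup>2)" for L
  define s where "s L = (\<Sum>i\<in>idx_below J0 L. a i *\<^sub>R e i)" for L
  have q_le: "(\<Sum>i\<in>F. (a i)\<^sup>2) \<le> enn2real (wsum J0 (\<lambda>_. 1) a)" if "finite F" "F \<subseteq> idx J0" for F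
  proof -
    have 1: "ennreal (\<Sum>i\<in>F. (a i)\<^sup>2) \<le> wsum J0 (\<lambda>_. 1) a"
      using wsum_ge[of "\<lambda>_. 1" F J0 a] that by simp
    obtain A where A: "A \<ge> 0" "wsum J0 (\<lambda>_. 1) a = ennreal A"
      using fin by (cases "wsum J0 (\<lambda>_. 1) a") auto
    show ?thesis using 1 A(1) unfolding A(2) by (simp only: ennreal_le_iff enn2real_ennreal)
  qed
  have "incseq q" unfolding q_def
    by (intro incseq_SucI sum_mono2) (auto simp: mem_idx_below)
  have "bdd_above (range q)" unfolding q_def
    by (rule bdd_aboveI2[where M=\<open>enn2real (wsum J0 (\<lambda>_. 1) a)\<close>]) (intro q_le idx_below_subset finite_idx_below)
  define Q where "Q = (SUP L. q L)"
  have Q: "q \<longlonglongrightarrow> Q" unfolding Q_def by (rule LIMSEQ_incseq_SUP) fact+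
  have Q': "q L \<le> Q" for L unfolding Q_def by (rule cSUP_upper) (use \<open>bdd_above (range q)\<close> in auto)
  have tail: "(\<Sum>i\<in>F. (a i)\<^sup>2) \<le> Q - q L" if F: "finite F" "F \<subseteq> idx J0" "F \<inter> idx_below J0 L = {}" for F L
  proof -
    obtain M where M: "F \<union> idx_below J0 L \<subseteq> idx_below J0 M"
      using finite_subset_idx_below[of "F \<union> idx_below J0 L" J0] F idx_below_subset by auto
    have "(\<Sum>i\<in>F. (a i)\<^sup>2) + q L = (\<Sum>i\<in>F \<union> idx_below J0 L. (a i)\<^sup>2)"
      unfolding q_def using F by (subst sum.union_disjoint) auto
    also have "\<dots> \<le> q M" unfolding q_def using M by (intro sum_mono2) auto
    also have "\<dots> \<le> Q" by (rule Q')
    finally show ?thesis by simp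
  qed
  have ntail: "norm ((\<Sum>i\<in>F. a i *\<^sub>R e i) - s L) \<le> sqrt (Q - q L)"
    if F: "finite F" "F \<subseteq> idx J0" "idx_below J0 L \<subseteq> F" for F L
  proof -
    have "(\<Sum>i\<in>F. a i *\<^sub>R e i) - s L = (\<Sum>i\<in>F - idx_below J0 L. a i *\<^sub>R e i)"
      unfolding s_def using F by (simp add: sum_diff)
    then have "(norm ((\<Sum>i\<in>F. a i *\<^sub>R e i) - s L))\<^sup>2 \<le> Q - q L"
      using tail[of "F - idx_below J0 L" L] norm_e_sum[of "F - idx_below J0 L" a]
        finite_Diff[OF F(1)] subset_trans[OF Diff_subset F(2)] by (simp add: Diff_disjoint Int_commute)
    then show ?thesis by (rule real_le_rsqrt)
  qed
  have small: "\<exists>L. \<forall>M\<ge>L. sqrt (Q - q M) < d" if "d > 0" for d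
  proof -
    have "(\<lambda>M. sqrt (Q - q M)) \<longlonglongrightarrow> sqrt (Q - Q)" by (intro tendsto_intros Q)
    from order_tendstoD(2)[OF this, of d] that show ?thesis by (simp add: eventually_sequentially)
  qed
  have "Cauchy s"
  proof (rule metric_CauchyI)
    fix d :: real assume "d > 0"
    then obtain L where L: "\<And>M. M \<ge> L \<Longrightarrow> sqrt (Q - q M) < d / 2" using small[of "d / 2"] by auto
    have "dist (s M) (s L) < d / 2" if "M \<ge> L" for M
      using ntail[OF finite_idx_below idx_below_subset idx_below_mono[OF that]] L[of L]
      by (simp add: dist_norm s_def)
    then have "dist (s M) (s N) < d" if "M \<ge> L" "N \<ge> L" for M N
      using that by (meson dist_triangle_half_l)
    then show "\<exists>M. \<forall>m\<ge>M. \<forall>n\<ge>M. dist (s m) (s n) < d" by blast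
  qed
  then obtain f where f: "s \<longlonglongrightarrow> f" using Cauchy_convergent convergent_def by blast
  have "((\<lambda>i. a i *\<^sub>R e i) has_sum f) (idx J0)"
    unfolding has_sum_def tendsto_iff eventually_finite_subsets_at_top
  proof (intro allI impI)
    fix d :: real assume d: "d > 0"
    obtain L1 where L1: "\<And>M. M \<ge> L1 \<Longrightarrow> sqrt (Q - q M) < d / 2" using small[of "d / 2"] d by auto
    obtain L2 where L2: "\<And>M. M \<ge> L2 \<Longrightarrow> dist (s M) f < d / 2"
      using metric_LIMSEQ_D[OF f, of "d / 2"] d by auto
    define L where "L = max L1 L2"
    have "dist (\<Sum>i\<in>F. a i *\<^sub>R e i) f < d" if F: "finite F" "idx_below J0 L \<subseteq> F" "F \<subseteq> idx J0" for F
    proof -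
      have "dist (\<Sum>i\<in>F. a i *\<^sub>R e i) (s L) < d / 2"
        using ntail[OF F(1,3,2)] L1[of L] by (simp add: dist_norm L_def)
      moreover have "dist (s L) f < d / 2" by (rule L2) (simp add: L_def)
      ultimately show ?thesis using dist_triangle[of "\<Sum>i\<in>F. a i *\<^sub>R e i" f "s L"] by linarith
    qed
    then show "\<exists>X. finite X \<and> X \<subseteq> idx J0 \<and> (\<forall>Y. finite Y \<and> X \<subseteq> Y \<and> Y \<subseteq> idx J0 \<longrightarrow> dist (\<Sum>i\<in>Y. a i *\<^sub>R e i) f < d)"
      by (intro exI[of _ "idx_below J0 L"]) (simp add: idx_below_subset)
  qed
  then show ?thesis using that f by (simp add: s_def[abs_def])
qed

lemma has_sum_coeff:
  assumes "((\<lambda>i. a i *\<^sub>R e i) has_sum f) (idx J0)" "j \<in> idx J0"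
  shows "inner (e j) f = a j"
proof -
  have "((\<lambda>i. inner (e j) (a i *\<^sub>R e i)) has_sum inner (e j) f) (idx J0)"
    by (rule has_sum_bounded_linear[OF bounded_linear_inner_right assms(1)])
  moreover have "((\<lambda>i. inner (e j) (a i *\<^sub>R e i)) has_sum a j) (idx J0)"
    by (rule has_sum_finite_neutralI[of "{j}"]) (use assms(2) in \<open>auto simp: inner_e\<close>)
  ultimately show ?thesis by (rule has_sum_unique)
qed

lemma summable_iff_wsum: "(\<lambda>i. a i *\<^sub>R e i) summable_on idx J0 \<longleftrightarrow> wsum J0 (\<lambda>_. 1) a < \<infinity>"
proof
  assume "(\<lambda>i. a i *\<^sub>R e i) summable_on idx J0"
  then obtain f where f: "((\<lambda>i. a i *\<^sub>R e i) has_sum f) (idx J0)" by (auto simp: summable_on_def)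
  have "wsum J0 (\<lambda>_. 1) a = wsum J0 (\<lambda>_. 1) (\<lambda>i. inner (e i) f)"
    by (rule wsum_cong) (simp add: has_sum_coeff[OF f])
  then show "wsum J0 (\<lambda>_. 1) a < \<infinity>" by (simp add: parseval)
next
  assume "wsum J0 (\<lambda>_. 1) a < \<infinity>"
  then show "(\<lambda>i. a i *\<^sub>R e i) summable_on idx J0"
    by (rule expansion_has_sum) (auto simp: summable_on_def)
qed

lemma coeff_infsum:
  assumes "wsum J0 (\<lambda>_. 1) a < \<infinity>" "j \<in> idx J0"
  shows "inner (e j) (\<Sum>\<^sub>\<infinity>i\<in>idx J0. a i *\<^sub>R e i) = a j"
  using assms summable_iff_wsum has_sum_coeff has_sum_infsum by blast

lemma infsum_measurable:
  assumes [measurable]: "\<And>i. i \<in> idx J0 \<Longrightarrow> (\<lambda>v. a v i) \<in> borel_measurable M"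
  shows "(\<lambda>v. \<Sum>\<^sub>\<infinity>i\<in>idx J0. a v i *\<^sub>R e i) \<in> borel_measurable M"
proof -
  \<comment> \<open>\<open>infsum\<close> is 0 where the series is not summable. The conditional
    reproduces this default, so that the map is a pointwise limit of measurable functions
    everywhere.\<close>
  have eq: "(\<Sum>\<^sub>\<infinity>i\<in>idx J0. a v i *\<^sub>R e i) = lim (\<lambda>L. if wsum J0 (\<lambda>_. 1) (a v) < \<infinity> then \<Sum>i\<in>idx_below J0 L. a v i *\<^sub>R e i else 0)" for v
  proof (cases "wsum J0 (\<lambda>_. 1) (a v) < \<infinity>")
    case True
    then obtain f where f: "((\<lambda>i. a v i *\<^sub>R e i) has_sum f) (idx J0)" "(\<lambda>L. \<Sum>i\<in>idx_below J0 L. a v i *\<^sub>R e i) \<longlonglongrightarrow> f"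
      by (rule expansion_has_sum)
    then show ?thesis using True by (simp add: infsumI limI)
  next
    case False
    then show ?thesis using summable_iff_wsum[of "a v"] by (simp add: infsum_not_exists)
  qed
  have [measurable]: "(\<lambda>v. \<Sum>i\<in>idx_below J0 L. a v i *\<^sub>R e i) \<in> borel_measurable M" for L
    using idx_below_subset by (intro borel_measurable_sum borel_measurable_scaleR) (auto intro: assms)
  have [measurable]: "(\<lambda>v. wsum J0 (\<lambda>_. 1) (a v)) \<in> borel_measurable M" by measurable
  show ?thesis unfolding eq by (rule borel_measurable_lim_metric) measurable
qed

end

text \<open>Carries an almost sure implication about the noise to an outer probability of the
  observation. The event \<open>Q\<close> is covered by the preimage of \<open>B\<close> and a null
  set under the inverse \<open>Y\<close>, and this cover is measurable.\<close>

lemma outer_measure_distr_le: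
  assumes X: "X \<in> measurable M N" and Y: "\<And>x. x \<in> space N \<Longrightarrow> Y x \<in> space M \<and> X (Y x) = x"
    and Ym: "Y \<in> measurable N M" and YX: "\<And>w. w \<in> space M \<Longrightarrow> Y (X w) = w"
    and B: "B \<in> sets M" and AE: "AE w in M. Q (X w) \<longrightarrow> w \<in> B"
  shows "outer_measure_of (distr M N X) {x \<in> space (distr M N X). Q x} \<le> emeasure M B"
proof -
  from AE obtain Z where Z: "Z \<in> null_sets M" "{w \<in> space M. \<not> (Q (X w) \<longrightarrow> w \<in> B)} \<subseteq> Z"
    by (auto elim!: AE_E intro: that)
  let ?S = "Y -` (B \<union> Z) \<inter> space N"
  have S: "?S \<in> sets N" using Ym B Z by (intro measurable_sets) auto
  have "{x \<in> space (distr M N X). Q x} \<subseteq> ?S"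
    using Y Z(2) by fastforce
  then have "outer_measure_of (distr M N X) {x \<in> space (distr M N X). Q x} \<le> outer_measure_of (distr M N X) ?S"
    by (rule outer_measure_of_mono)
  also have "\<dots> = emeasure M (X -` ?S \<inter> space M)" using S X by (simp add: emeasure_distr)
  also have "X -` ?S \<inter> space M \<subseteq> B \<union> Z" using YX by auto
  then have "emeasure M (X -` ?S \<inter> space M) \<le> emeasure M (B \<union> Z)"
    using B Z by (intro emeasure_mono) auto
  also have "\<dots> = emeasure M B" using B Z by (simp add: emeasure_Un_null_set)
  finally show ?thesis .
qed

section \<open>White noise\<close>

lemma (in product_prob_space) indep_vars_components:
  "P.indep_vars M (\<lambda>i x. x i) I"
proof (cases "I = {}")
  case True
  then show ?thesis unfolding P.indep_vars_def P.indep_sets_def by auto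
next
  case False
  have "distr (PiM I M) (PiM I M) (\<lambda>x. \<lambda>i\<in>I. x i) = distr (PiM I M) (PiM I M) (\<lambda>x. x)"
    by (intro distr_cong) (auto simp: space_PiM intro!: PiE_restrict)
  also have "\<dots> = PiM I M" by (rule distr_id)
  also have "PiM I M = PiM I (\<lambda>i. distr (PiM I M) (M i) (\<lambda>x. x i))"
    by (intro PiM_cong) (auto simp: PiM_component)
  finally show ?thesis
    using False by (subst P.indep_vars_iff_distr_eq_PiM') auto
qed

lemma (in product_prob_space) nn_integral_PiM_prod:
  assumes "finite F" "F \<subseteq> I" and h: "\<And>i. i \<in> F \<Longrightarrow> h i \<in> borel_measurable (M i)"
  shows "(\<integral>\<^sup>+x. (\<Prod>i\<in>F. h i (x i)) \<partial>PiM I M) = (\<Prod>i\<in>F. \<integral>\<^sup>+y. h i y \<partial>M i)"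
proof -
  have "P.indep_vars (\<lambda>_. borel) (\<lambda>i x. h i (x i)) F"
    by (rule P.indep_vars_compose2[OF P.indep_vars_subset[OF indep_vars_components assms(2)] h])
  then have "(\<integral>\<^sup>+x. (\<Prod>i\<in>F. h i (x i)) \<partial>PiM I M) = (\<Prod>i\<in>F. \<integral>\<^sup>+x. h i (x i) \<partial>PiM I M)"
    by (intro P.indep_vars_nn_integral assms(1)) auto
  also have "\<dots> = (\<Prod>i\<in>F. \<integral>\<^sup>+y. h i y \<partial>M i)"
  proof (rule prod.cong[OF refl])
    fix i assume i: "i \<in> F"
    then have "i \<in> I" using assms(2) by auto
    have "(\<integral>\<^sup>+y. h i y \<partial>M i) = (\<integral>\<^sup>+y. h i y \<partial>distr (PiM I M) (M i) (\<lambda>x. x i))"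
      using \<open>i \<in> I\<close> by (simp add: PiM_component)
    also have "\<dots> = (\<integral>\<^sup>+x. h i (x i) \<partial>PiM I M)"
      using \<open>i \<in> I\<close> h[OF i] by (intro nn_integral_distr) auto
    finally show "(\<integral>\<^sup>+x. h i (x i) \<partial>PiM I M) = (\<integral>\<^sup>+y. h i y \<partial>M i)" by simp
  qed
  finally show ?thesis .
qed

lemma (in product_prob_space) nn_integral_PiM_component:
  assumes "i \<in> I" "h \<in> borel_measurable (M i)"
  shows "(\<integral>\<^sup>+x. h (x i) \<partial>PiM I M) = (\<integral>\<^sup>+y. h y \<partial>M i)"
  using nn_integral_PiM_prod[of "{i}" "\<lambda>_. h"] assms by simp

abbreviation std_normal :: "real measure" where
  "std_normal \<equiv> density lborel (\<lambda>x. ennreal (std_normal_density x))"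

lemma prob_space_std_normal: "prob_space std_normal"
  by (rule prob_space_normal_density) simp

lemma std_normal_moments:
  "integrable std_normal (\<lambda>x. x)" "(\<integral>x. x \<partial>std_normal) = 0"
  "integrable std_normal (\<lambda>x. x\<^sup>2)" "(\<integral>x. x\<^sup>2 \<partial>std_normal) = 1"
proof -
  show "integrable std_normal (\<lambda>x. x)"
    using integrable_std_normal_moment[of 1] by (subst integrable_density) auto
  show "(\<integral>x. x \<partial>std_normal) = 0"
    using integral_std_normal_moment_odd[of 0] by (subst integral_density) auto
  show "integrable std_normal (\<lambda>x. x\<^sup>2)"
    using integrable_std_normal_moment[of 2] by (subst integrable_density) auto
  show "(\<integral>x. x\<^sup>2 \<partial>std_normal) = 1"
    using integral_std_normal_moment_even[of 1] by (subst integral_density) (auto simp: fact_numeral)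
qed

interpretation WN: product_prob_space "\<lambda>_::nat \<times> nat. std_normal" "idx J0" for J0
  by (simp add: product_prob_space_def product_prob_space_axioms_def product_sigma_finite_def
      prob_space_std_normal prob_space_imp_sigma_finite)

lemma white_noise_eq: "white_noise J0 = PiM (idx J0) (\<lambda>_. std_normal)"
  by (simp add: white_noise_def)

lemma sets_white_noise [simp, measurable_cong]: "sets (white_noise J0) = sets (PiM (idx J0) (\<lambda>_. borel))"
  unfolding white_noise_eq by (intro sets_PiM_cong) auto

lemma space_white_noise: "space (white_noise J0) = PiE (idx J0) (\<lambda>_. UNIV)"
  unfolding white_noise_eq by (simp add: space_PiM)

lemma prob_space_white_noise: "prob_space (white_noise J0)"
  unfolding white_noise_eq by (rule WN.P.prob_space_axioms)

lemma white_noise_component [measurable]: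
  "i \<in> idx J0 \<Longrightarrow> (\<lambda>W. W i) \<in> borel_measurable (white_noise J0)"
  by (simp add: measurable_cong_sets[OF sets_white_noise refl])

lemma white_noise_sum_sq:
  assumes F: "finite F" "F \<subseteq> idx J0"
  shows "(\<integral>\<^sup>+W. ennreal ((\<Sum>i\<in>F. a i * W i)\<^sup>2) \<partial>white_noise J0) = ennreal (\<Sum>i\<in>F. (a i)\<^sup>2)"
proof -
  let ?M = "white_noise J0"
  interpret prob_space ?M by (rule prob_space_white_noise)
  have distr: "distr ?M std_normal (\<lambda>W. W i) = std_normal" if "i \<in> idx J0" for i
    unfolding white_noise_eq using that by (rule WN.PiM_component)
  have comp: "(\<integral>W. h (W i) \<partial>?M) = (\<integral>x. h x \<partial>std_normal)" "integrable ?M (\<lambda>W. h (W i)) \<longleftrightarrow> integrable std_normal h"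
    if "i \<in> idx J0" "h \<in> borel_measurable borel" for i and h :: "real \<Rightarrow> real"
    using integral_distr[of "\<lambda>W. W i" ?M std_normal h] integrable_distr_eq[of "\<lambda>W. W i" ?M std_normal h]
      distr[OF that(1)] that by simp_all
  have ind: "indep_vars (\<lambda>_. std_normal) (\<lambda>i W. W i) (idx J0)"
    using WN.indep_vars_components[of J0] unfolding white_noise_eq .
  have ij: "integrable ?M (\<lambda>W. W i * W j) \<and> (\<integral>W. W i * W j \<partial>?M) = of_bool (i = j)"
    if i: "i \<in> idx J0" and j: "j \<in> idx J0" for i j
  proof (cases "i = j")
    case True
    have m: "(\<lambda>x::real. x\<^sup>2) \<in> borel_measurable borel" by simp
    have "integrable ?M (\<lambda>W. (W i)\<^sup>2)" by (rule comp(2)[OF i m, THEN iffD2]) (rule std_normal_moments)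
    moreover have "(\<integral>W. (W i)\<^sup>2 \<partial>?M) = 1" by (rule trans[OF comp(1)[OF i m]]) (rule std_normal_moments)
    ultimately show ?thesis unfolding True[symmetric] power2_eq_square by simp
  next
    case False
    have "indep_vars (\<lambda>_. borel) (\<lambda>i W. W i) {i, j}"
      using indep_vars_compose2[OF indep_vars_subset[OF ind, of "{i, j}"], of "\<lambda>_ x. x" "\<lambda>_. borel"] i j by simp
    moreover have "integrable ?M (\<lambda>W. W k)" if "k \<in> {i, j}" for k
    proof -
      have "k \<in> idx J0" using that i j by auto
      then show ?thesis by (rule comp(2)[THEN iffD2]) (simp, rule std_normal_moments)
    qed
    moreover have "(\<integral>W. W i \<partial>?M) = 0" by (rule trans[OF comp(1)[OF i]]) (simp, rule std_normal_moments)
    moreover note Wi = this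
    ultimately have "(\<integral>W. (\<Prod>k\<in>{i, j}. W k) \<partial>?M) = (\<Prod>k\<in>{i, j}. \<integral>W. W k \<partial>?M)"
        "integrable ?M (\<lambda>W. (\<Prod>k\<in>{i, j}. W k))"
      by (intro indep_vars_lebesgue_integral indep_vars_integrable; simp)+
    then show ?thesis using False Wi by simp
  qed
  have sq: "(\<Sum>i\<in>F. a i * W i)\<^sup>2 = (\<Sum>i\<in>F. \<Sum>j\<in>F. (a i * a j) * (W i * W j))" for W
    by (simp add: power2_eq_square sum_product ac_simps)
  have ij': "integrable ?M (\<lambda>W. (a i * a j) * (W i * W j))"
    "(\<integral>W. (a i * a j) * (W i * W j) \<partial>?M) = (a i * a j) * of_bool (i = j)" if "i \<in> F" "j \<in> F" for i j
  proof -
    have "i \<in> idx J0" "j \<in> idx J0" using that F(2) by auto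
    from ij[OF this] show "integrable ?M (\<lambda>W. (a i * a j) * (W i * W j))"
      "(\<integral>W. (a i * a j) * (W i * W j) \<partial>?M) = (a i * a j) * of_bool (i = j)"
      by (simp_all only: integral_mult_right_zero integrable_mult_right)
  qed
  have int: "integrable ?M (\<lambda>W. (\<Sum>i\<in>F. a i * W i)\<^sup>2)"
    unfolding sq by (intro Bochner_Integration.integrable_sum ij')
  have "(\<integral>W. (\<Sum>i\<in>F. a i * W i)\<^sup>2 \<partial>?M) = (\<Sum>i\<in>F. \<integral>W. (\<Sum>j\<in>F. (a i * a j) * (W i * W j)) \<partial>?M)"
    unfolding sq by (intro Bochner_Integration.integral_sum Bochner_Integration.integrable_sum ij')
  also have "\<dots> = (\<Sum>i\<in>F. \<Sum>j\<in>F. (a i * a j) * of_bool (i = j))"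
  proof (rule sum.cong[OF refl])
    fix i assume i: "i \<in> F"
    have "(\<integral>W. (\<Sum>j\<in>F. (a i * a j) * (W i * W j)) \<partial>?M) = (\<Sum>j\<in>F. \<integral>W. (a i * a j) * (W i * W j) \<partial>?M)"
      by (rule Bochner_Integration.integral_sum) (rule ij'(1)[OF i])
    also have "\<dots> = (\<Sum>j\<in>F. (a i * a j) * of_bool (i = j))"
      by (rule sum.cong[OF refl]) (rule ij'(2)[OF i])
    finally show "(\<integral>W. (\<Sum>j\<in>F. (a i * a j) * (W i * W j)) \<partial>?M) = (\<Sum>j\<in>F. (a i * a j) * of_bool (i = j))" .
  qed
  also have "\<dots> = (\<Sum>i\<in>F. (a i)\<^sup>2)"
  proof (rule sum.cong[OF refl])
    fix i assume i: "i \<in> F"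
    have "(\<Sum>j\<in>F. (a i * a j) * of_bool (i = j)) = (\<Sum>j\<in>F. if i = j then a i * a j else 0)"
      by (intro sum.cong) simp_all
    then show "(\<Sum>j\<in>F. (a i * a j) * of_bool (i = j)) = (a i)\<^sup>2"
      using i F(1) by (simp add: power2_eq_square)
  qed
  finally show ?thesis using int by (subst nn_integral_eq_integral) auto
qed

text \<open>Based on |x| \<le> r + x^2 / r. The free parameter allows each level to be charged a
  summable amount r, with no square root of the second moment.\<close>

lemma white_noise_sum_abs:
  assumes F: "finite F" "F \<subseteq> idx J0" and r: "r > 0"
  shows "(\<integral>\<^sup>+W. ennreal \<bar>\<Sum>i\<in>F. a i * W i\<bar> \<partial>white_noise J0) \<le> ennreal (r + (\<Sum>i\<in>F. (a i)\<^sup>2) / r)"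
proof -
  interpret prob_space "white_noise J0" by (rule prob_space_white_noise)
  have m: "(\<lambda>W. (\<Sum>i\<in>F. a i * W i)) \<in> borel_measurable (white_noise J0)"
    using F by (intro borel_measurable_sum borel_measurable_times white_noise_component) auto
  have "\<bar>x\<bar> \<le> r + 1 / r * x\<^sup>2" for x :: real
  proof -
    have "0 \<le> (\<bar>x\<bar> - r)\<^sup>2" by simp
    then have "2 * (r * \<bar>x\<bar>) \<le> r * r + x\<^sup>2" by (simp add: power2_eq_square algebra_simps)
    moreover have "0 \<le> r * \<bar>x\<bar>" using r by simp
    ultimately have "r * \<bar>x\<bar> \<le> r * r + x\<^sup>2" by linarith
    also have "\<dots> = r * (r + 1 / r * x\<^sup>2)" using r by (simp add: field_simps)
    finally show ?thesis using r by simp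
  qed
  then have "(\<integral>\<^sup>+W. ennreal \<bar>\<Sum>i\<in>F. a i * W i\<bar> \<partial>white_noise J0) \<le>
      (\<integral>\<^sup>+W. ennreal r + ennreal (1 / r) * ennreal ((\<Sum>i\<in>F. a i * W i)\<^sup>2) \<partial>white_noise J0)"
    using r by (intro nn_integral_mono) (simp add: ennreal_mult[symmetric] ennreal_plus[symmetric] del: ennreal_plus)
  also have "\<dots> = ennreal r + ennreal (1 / r) * ennreal (\<Sum>i\<in>F. (a i)\<^sup>2)"
    using m by (subst nn_integral_add) (auto simp: nn_integral_cmult white_noise_sum_sq[OF F] emeasure_space_1)
  also have "\<dots> = ennreal (r + (\<Sum>i\<in>F. (a i)\<^sup>2) / r)"
    using r by (simp add: ennreal_mult[symmetric] ennreal_plus[symmetric] sum_nonneg del: ennreal_plus)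
  finally show ?thesis .
qed

lemma nn_integral_std_normal_tilt: "(\<integral>\<^sup>+y. ennreal (tilt y u) \<partial>std_normal) = 1"
proof -
  have "(\<integral>\<^sup>+y. ennreal (tilt y u) \<partial>std_normal) = (\<integral>\<^sup>+y. ennreal (std_normal_density y * tilt y u) \<partial>lborel)"
    by (rule nn_integral_std_normal) (simp_all add: tilt_def[abs_def])
  also have "\<dots> = (\<integral>\<^sup>+y. ennreal (normal_density u 1 y) \<partial>lborel)"
    by (simp only: std_normal_tilt)
  also have "\<dots> = 1" by (subst nn_integral_eq_integral) auto
  finally show ?thesis .
qed

lemma white_noise_tilt:
  assumes F: "finite F" "F \<subseteq> idx J0"
  shows "(\<integral>\<^sup>+W. ennreal (exp (\<Sum>i\<in>F. u i * W i - (u i)\<^sup>2 / 2)) \<partial>white_noise J0) = 1"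
proof -
  have "(\<integral>\<^sup>+W. ennreal (exp (\<Sum>i\<in>F. u i * W i - (u i)\<^sup>2 / 2)) \<partial>white_noise J0) =
      (\<integral>\<^sup>+W. (\<Prod>i\<in>F. ennreal (tilt (W i) (u i))) \<partial>white_noise J0)"
    using F(1) by (simp add: exp_sum tilt_def prod_ennreal)
  also have "\<dots> = (\<Prod>i\<in>F. \<integral>\<^sup>+y. ennreal (tilt y (u i)) \<partial>std_normal)"
    unfolding white_noise_eq by (rule WN.nn_integral_PiM_prod[OF F]) (simp add: tilt_def[abs_def])
  finally show ?thesis by (simp add: nn_integral_std_normal_tilt)
qed

section \<open>The posterior as a product measure\<close>

lemma suminf_ennreal_finite:
  assumes "summable f" "\<And>i. 0 \<le> f i" shows "(\<Sum>i. ennreal (f i)) < \<infinity>"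
  unfolding infinity_ennreal_def using ennreal_suminf_neq_top[OF assms] by (simp only: less_top)

locale series_model = coord_density \<phi> K + Omega: prob_space \<Omega>
  for \<phi> :: "real \<Rightarrow> real" and K :: real and \<Omega> :: "'w measure" +
  fixes \<gamma> :: real and J0 :: nat and \<psi> :: "nat \<Rightarrow> nat \<Rightarrow> real \<Rightarrow> real"
    and g :: "nat \<times> nat \<Rightarrow> 'w \<Rightarrow> real" and F0 :: L2 and B :: real
  assumes \<gamma>_pos: "\<gamma> > 0" and J0_ge: "J0 - 1 \<ge> 1"
    and basis: "orthonormal_basis (\<lambda>(l, k). to_L2 (\<psi> l k)) (idx J0)"
    and g_indep: "Omega.indep_vars (\<lambda>_. borel) g (idx J0)"
    and g_distributed: "\<And>i. i \<in> idx J0 \<Longrightarrow> distributed \<Omega> lborel (g i) (\<lambda>t. ennreal (\<phi> t))"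
    and F0_bound: "\<And>i. i \<in> idx J0 \<Longrightarrow> \<bar>coeff \<psi> F0 i\<bar> \<le> B * 2 powr (- real (fst i) * (\<gamma> + 1 / 2))"
begin

sublocale onb J0 "\<lambda>(l, k). to_L2 (\<psi> l k)"
  by unfold_locales (rule basis)

definition sg :: "nat \<times> nat \<Rightarrow> real" where "sg i = 2 powr (- real (fst i) * (\<gamma> + 1 / 2))"

abbreviation \<theta>0 :: "nat \<times> nat \<Rightarrow> real" where "\<theta>0 \<equiv> coeff \<psi> F0"

definition b :: "nat \<times> nat \<Rightarrow> real" where "b i = \<theta>0 i / sg i"

definition \<tau> :: "nat \<Rightarrow> nat \<times> nat \<Rightarrow> real" where "\<tau> n i = sqrt (real n) * sg i"

text \<open>The local parameter of a prior draw: its deviation from the truth in units of the noise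
  level, as \<open>U_eq\<close> makes explicit.\<close>

definition U :: "nat \<Rightarrow> nat \<times> nat \<Rightarrow> real \<Rightarrow> real" where "U n i t = \<tau> n i * (t - b i)"

text \<open>The root of the prior mass of a level, up to constants: about 2 ^ l coordinates of
  variance of order \<open>(sg i)\<^sup>2\<close>. It decays geometrically for every \<gamma> >
  0.\<close>

definition rt :: "nat \<Rightarrow> real" where "rt l = 2 powr (- real l * \<gamma>)"

abbreviation pri :: "L2 measure" where "pri \<equiv> series_prior \<psi> J0 \<gamma> \<Omega> g"

definition G :: "'w \<Rightarrow> L2" where
  "G v = (\<Sum>\<^sub>\<infinity>(l, k)\<in>idx J0. (2 powr (- real l * (\<gamma> + 1 / 2)) * g (l, k) v) *\<^sub>R to_L2 (\<psi> l k))"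

definition X :: "nat \<Rightarrow> (nat \<times> nat \<Rightarrow> real) \<Rightarrow> nat \<times> nat \<Rightarrow> real" where
  "X n W = (\<lambda>i\<in>idx J0. \<theta>0 i + W i / sqrt (real n))"

definition resc :: "nat \<Rightarrow> L2 \<Rightarrow> nat \<times> nat \<Rightarrow> real" where
  "resc n f i = sqrt (real n) * (coeff \<psi> f i - \<theta>0 i)"

abbreviation WN :: "(nat \<times> nat \<Rightarrow> real) measure" where "WN \<equiv> white_noise J0"

abbreviation post :: "nat \<Rightarrow> (nat \<times> nat \<Rightarrow> real) \<Rightarrow> L2 measure" where
  "post n W \<equiv> posterior \<psi> J0 pri n (X n W)"

text \<open>Log-likelihood ratio of the prior draw against the truth \<open>F0\<close> when the data
  are \<open>X n W\<close>. Recentring at the truth leaves a tilt in each coordinate.\<close>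

definition loglik :: "nat \<Rightarrow> (nat \<times> nat \<Rightarrow> real) \<Rightarrow> 'w \<Rightarrow> real" where
  "loglik n W v = lim (\<lambda>L. \<Sum>i\<in>idx_below J0 L. U n i (g i v) * W i - (U n i (g i v))\<^sup>2 / 2)"

lemma coeff_inner: "coeff \<psi> f i = inner ((\<lambda>(l, k). to_L2 (\<psi> l k)) i) f"
  by (simp add: coeff_def case_prod_beta)

lemma coeff_diff: "coeff \<psi> (f - h) i = coeff \<psi> f i - coeff \<psi> h i"
  by (simp add: coeff_inner inner_diff_right)

lemma coeff_measurable [measurable]: "(\<lambda>f. coeff \<psi> f i) \<in> borel_measurable borel"
  unfolding coeff_inner by (intro borel_measurable_continuous_onI continuous_intros)

lemma sg_pos [simp]: "sg i > 0" by (simp add: sg_def)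

lemma \<tau>_pos: "n > 0 \<Longrightarrow> \<tau> n i > 0" by (simp add: \<tau>_def)

lemma b_bound: "i \<in> idx J0 \<Longrightarrow> \<bar>b i\<bar> \<le> B"
  using F0_bound[of i] by (simp add: b_def sg_def abs_divide pos_divide_le_eq)

lemma B_nonneg: "B \<ge> 0"
proof -
  obtain i where "i \<in> idx J0" using idx_nonempty by blast
  then show ?thesis using b_bound[of i] by linarith
qed

lemma U_eq: "U n i t = sqrt (real n) * (sg i * t - \<theta>0 i)"
proof -
  have "sg i \<noteq> 0" using sg_pos[of i] by linarith
  then show ?thesis by (simp add: U_def \<tau>_def b_def field_simps)
qed

lemma rt_pos [simp]: "rt l > 0" by (simp add: rt_def)

lemma sg_sq: "(sg (l, k))\<^sup>2 * 2 ^ l = (rt l)\<^sup>2"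
proof -
  have "(sg (l, k))\<^sup>2 * 2 ^ l = 2 powr (2 * (- real l * (\<gamma> + 1 / 2)) + real l)"
    by (simp add: sg_def powr_add powr_realpow[symmetric] powr_powr[symmetric] power2_eq_square algebra_simps flip: powr_add)
  also have "\<dots> = (rt l)\<^sup>2"
    by (simp add: rt_def power2_eq_square algebra_simps flip: powr_add)
  finally show ?thesis .
qed

lemma sum_sg_sq_lev: "(\<Sum>k\<in>lev J0 l. (sg (l, k))\<^sup>2) \<le> 2 * (rt l)\<^sup>2"
proof -
  have "(\<Sum>k\<in>lev J0 l. (sg (l, k))\<^sup>2) = real (card (lev J0 l)) * (sg (l, 0))\<^sup>2"
    by (simp add: sg_def)
  also have "\<dots> \<le> (2 * 2 ^ l) * (sg (l, 0))\<^sup>2"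
    using J0_ge by (intro mult_right_mono card_lev_le) auto
  also have "\<dots> = 2 * (rt l)\<^sup>2" using sg_sq[of l 0] by (simp add: mult_ac)
  finally show ?thesis .
qed

lemma rt_eq_power: "rt l = (2 powr - \<gamma>) ^ l"
  by (simp add: rt_def powr_powr flip: powr_realpow) (simp add: mult.commute)

lemma base_less_1: "(2::real) powr - \<gamma> < 1"
proof -
  have "(2::real) powr - \<gamma> < 2 powr 0" using \<gamma>_pos by (intro powr_less_mono) auto
  then show ?thesis by simp
qed

lemma summable_rt: "summable rt"
proof -
  have "summable (\<lambda>l. (2 powr - \<gamma>) ^ l :: real)" using base_less_1 by (intro summable_geometric) simp
  then show ?thesis by (simp add: rt_eq_power[abs_def])
qed

lemma rt_le_1: "rt l \<le> 1"
  unfolding rt_eq_power using base_less_1 by (intro power_le_one) auto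

lemma summable_rt_sq: "summable (\<lambda>l. (rt l)\<^sup>2)"
proof (rule summable_comparison_test'[OF summable_rt])
  show "norm ((rt l)\<^sup>2) \<le> rt l" for l
    using rt_le_1[of l] rt_pos[of l] mult_left_mono[of "rt l" 1 "rt l"] by (simp add: power2_eq_square)
qed

lemma g_measurable [measurable]: "i \<in> idx J0 \<Longrightarrow> g i \<in> borel_measurable \<Omega>"
  using distributed_measurable[OF g_distributed] by simp

lemma nn_integral_g:
  assumes "i \<in> idx J0" "h \<in> borel_measurable borel"
  shows "(\<integral>\<^sup>+v. h (g i v) \<partial>\<Omega>) = (\<integral>\<^sup>+t. ennreal (\<phi> t) * h t \<partial>lborel)"
  using distributed_nn_integral[OF g_distributed[OF assms(1)], of h] assms by simp

definition V :: real where "V = (\<integral>t. (2 * t\<^sup>2 + 2 * B\<^sup>2) * \<phi> t \<partial>lborel)"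

lemma V_nonneg: "V \<ge> 0"
  unfolding V_def by (rule Bochner_Integration.integral_nonneg) (simp add: less_imp_le[OF \<phi>_pos])

lemma second_moment_g:
  assumes i: "i \<in> idx J0" and c: "\<bar>c\<bar> \<le> B"
  shows "(\<integral>\<^sup>+v. ennreal ((s * (g i v - c))\<^sup>2) \<partial>\<Omega>) \<le> ennreal (s\<^sup>2 * V)"
proof -
  have Vint: "integrable lborel (\<lambda>t. (2 * t\<^sup>2 + 2 * B\<^sup>2) * \<phi> t)"
    using \<phi>_int \<phi>_sq_int by (simp add: distrib_right mult.assoc)
  have "(\<integral>\<^sup>+v. ennreal ((s * (g i v - c))\<^sup>2) \<partial>\<Omega>) = (\<integral>\<^sup>+t. ennreal (\<phi> t) * ennreal ((s * (t - c))\<^sup>2) \<partial>lborel)"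
    using i by (rule nn_integral_g) simp
  also have "\<dots> \<le> (\<integral>\<^sup>+t. ennreal (s\<^sup>2 * ((2 * t\<^sup>2 + 2 * B\<^sup>2) * \<phi> t)) \<partial>lborel)"
  proof (rule nn_integral_mono)
    fix t
    have "(t - c)\<^sup>2 \<le> 2 * t\<^sup>2 + 2 * c\<^sup>2"
      using zero_le_power2[of "t + c"] by (simp add: power2_eq_square algebra_simps)
    also have "c\<^sup>2 \<le> B\<^sup>2" using c power_mono[of "\<bar>c\<bar>" B 2] by simp
    finally have "s\<^sup>2 * ((t - c)\<^sup>2 * \<phi> t) \<le> s\<^sup>2 * ((2 * t\<^sup>2 + 2 * B\<^sup>2) * \<phi> t)"
      by (intro mult_left_mono mult_right_mono) (auto simp: less_imp_le[OF \<phi>_pos])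
    then show "ennreal (\<phi> t) * ennreal ((s * (t - c))\<^sup>2) \<le> ennreal (s\<^sup>2 * ((2 * t\<^sup>2 + 2 * B\<^sup>2) * \<phi> t))"
      by (subst ennreal_mult[symmetric]) (auto simp: less_imp_le[OF \<phi>_pos] power_mult_distrib ac_simps intro!: ennreal_leI)
  qed
  also have "\<dots> = ennreal (s\<^sup>2 * V)"
    unfolding V_def using Vint by (subst nn_integral_eq_integral) (auto simp: less_imp_le[OF \<phi>_pos])
  finally show ?thesis .
qed

lemma lev_second_moment:
  assumes "\<And>i. i \<in> idx J0 \<Longrightarrow> \<bar>c i\<bar> \<le> B"
  shows "(\<integral>\<^sup>+v. ennreal (\<Sum>k\<in>lev J0 l. (s * sg (l, k) * (g (l, k) v - c (l, k)))\<^sup>2) \<partial>\<Omega>) \<le> ennreal (2 * s\<^sup>2 * V * (rt l)\<^sup>2)"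
proof -
  have idx: "(l, k) \<in> idx J0" if "k \<in> lev J0 l" for k using that by (simp add: lev_def)
  have "(\<integral>\<^sup>+v. ennreal (\<Sum>k\<in>lev J0 l. (s * sg (l, k) * (g (l, k) v - c (l, k)))\<^sup>2) \<partial>\<Omega>) =
      (\<Sum>k\<in>lev J0 l. \<integral>\<^sup>+v. ennreal ((s * sg (l, k) * (g (l, k) v - c (l, k)))\<^sup>2) \<partial>\<Omega>)"
    using idx by (subst nn_integral_sum[symmetric]) (auto simp: sum_ennreal)
  also have "\<dots> \<le> (\<Sum>k\<in>lev J0 l. ennreal ((s * sg (l, k))\<^sup>2 * V))"
    using idx assms by (intro sum_mono second_moment_g) auto
  also have "\<dots> = ennreal (\<Sum>k\<in>lev J0 l. (s * sg (l, k))\<^sup>2 * V)"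
    using V_nonneg by (intro sum_ennreal) auto
  also have "(\<Sum>k\<in>lev J0 l. (s * sg (l, k))\<^sup>2 * V) = (s\<^sup>2 * V) * (\<Sum>k\<in>lev J0 l. (sg (l, k))\<^sup>2)"
    by (simp add: sum_distrib_left power_mult_distrib ac_simps)
  also have "\<dots> \<le> (s\<^sup>2 * V) * (2 * (rt l)\<^sup>2)"
    using V_nonneg by (intro mult_left_mono sum_sg_sq_lev) auto
  finally show ?thesis by (simp add: ac_simps ennreal_leI order_trans)
qed

lemma AE_wsum_finite:
  assumes c: "\<And>i. i \<in> idx J0 \<Longrightarrow> \<bar>c i\<bar> \<le> B"
  shows "AE v in \<Omega>. wsum J0 (\<lambda>_. 1) (\<lambda>i. s * sg i * (g i v - c i)) < \<infinity>"
proof -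
  have [measurable]: "(\<lambda>v. \<Sum>k\<in>lev J0 l. (s * sg (l, k) * (g (l, k) v - c (l, k)))\<^sup>2) \<in> borel_measurable \<Omega>" for l
    by (intro borel_measurable_sum) (simp add: lev_def)
  have "(\<integral>\<^sup>+v. wsum J0 (\<lambda>_. 1) (\<lambda>i. s * sg i * (g i v - c i)) \<partial>\<Omega>) =
    (\<Sum>l. \<integral>\<^sup>+v. ennreal (\<Sum>k\<in>lev J0 l. (s * sg (l, k) * (g (l, k) v - c (l, k)))\<^sup>2) \<partial>\<Omega>)"
    unfolding wsum_def mult_1 by (rule nn_integral_suminf) measurable
  also have "\<dots> \<le> (\<Sum>l. ennreal (2 * s\<^sup>2 * V * (rt l)\<^sup>2))"
    by (intro suminf_le summableI lev_second_moment c)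
  also have "\<dots> < \<infinity>"
    using V_nonneg by (intro suminf_ennreal_finite summable_mult summable_rt_sq) simp
  finally have fin: "(\<integral>\<^sup>+v. wsum J0 (\<lambda>_. 1) (\<lambda>i. s * sg i * (g i v - c i)) \<partial>\<Omega>) \<noteq> \<infinity>"
    by (rule less_imp_neq)
  have "(\<lambda>v. wsum J0 (\<lambda>_. 1) (\<lambda>i. s * sg i * (g i v - c i))) \<in> borel_measurable \<Omega>"
    by (rule wsum_measurable) measurable
  from nn_integral_PInf_AE[OF this fin] show ?thesis
    by eventually_elim (simp only: infinity_ennreal_def less_top[symmetric] not_False_eq_True)
qed

lemma \<theta>0_lev: "(\<Sum>k\<in>lev J0 l. (\<theta>0 (l, k))\<^sup>2) \<le> 2 * B\<^sup>2 * (rt l)\<^sup>2"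
proof -
  have "(\<Sum>k\<in>lev J0 l. (\<theta>0 (l, k))\<^sup>2) \<le> (\<Sum>k\<in>lev J0 l. B\<^sup>2 * (sg (l, k))\<^sup>2)"
  proof (rule sum_mono)
    fix k assume "k \<in> lev J0 l"
    then have "\<bar>\<theta>0 (l, k)\<bar> \<le> B * sg (l, k)" using F0_bound[of "(l, k)"] by (simp add: lev_def sg_def)
    from power_mono[OF this, of 2] show "(\<theta>0 (l, k))\<^sup>2 \<le> B\<^sup>2 * (sg (l, k))\<^sup>2" by (simp add: power_mult_distrib)
  qed
  also have "\<dots> = B\<^sup>2 * (\<Sum>k\<in>lev J0 l. (sg (l, k))\<^sup>2)" by (simp add: sum_distrib_left)
  also have "\<dots> \<le> B\<^sup>2 * (2 * (rt l)\<^sup>2)" by (intro mult_left_mono sum_sg_sq_lev) simp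
  finally show ?thesis by (simp add: ac_simps)
qed

text \<open>The choice r = \<open>rt l\<close> balances the two terms: both are of order
  \<open>rt l\<close>, hence summable, whenever the coefficients of the level have squared sum of
  order \<open>(rt l)\<^sup>2\<close>.\<close>

lemma level_noise_bound:
  "(\<integral>\<^sup>+W. ennreal \<bar>\<Sum>k\<in>lev J0 l. a k * W (l, k)\<bar> \<partial>WN) \<le> ennreal (rt l) + ennreal (1 / rt l) * ennreal (\<Sum>k\<in>lev J0 l. (a k)\<^sup>2)"
proof -
  have inj: "inj_on (Pair l) A" for A :: "nat set" by (auto simp: inj_on_def)
  have F: "finite (Pair l ` lev J0 l)" "Pair l ` lev J0 l \<subseteq> idx J0"
    by (rule finite_imageI[OF finite_lev]) (auto simp: lev_def)
  have "(\<integral>\<^sup>+W. ennreal \<bar>\<Sum>i\<in>Pair l ` lev J0 l. a (snd i) * W i\<bar> \<partial>WN) \<le> ennreal (rt l + (\<Sum>i\<in>Pair l ` lev J0 l. (a (snd i))\<^sup>2) / rt l)"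
    by (rule white_noise_sum_abs[OF F rt_pos])
  then show ?thesis
    by (simp add: sum.reindex[OF inj] ennreal_mult[symmetric] ennreal_plus[symmetric] sum_nonneg less_imp_le del: ennreal_plus)
qed

lemma lev_noise_measurable:
  "(\<lambda>W. \<Sum>k\<in>lev J0 l. a k * W (l, k)) \<in> borel_measurable WN"
  by (intro borel_measurable_sum borel_measurable_times white_noise_component) (auto simp: lev_def)

lemma U_measurable [measurable]: "U n i \<in> borel_measurable borel"
  unfolding U_def[abs_def] by measurable

lemma pair_sum_measurable:
  fixes h :: "nat \<times> nat \<Rightarrow> real \<Rightarrow> real \<Rightarrow> real"
  assumes "F \<subseteq> idx J0" and [measurable]: "\<And>i. (\<lambda>q. h i (fst q) (snd q)) \<in> borel_measurable (borel \<Otimes>\<^sub>M borel)"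
  shows "(\<lambda>p. \<Sum>i\<in>F. h i (fst p i) (g i (snd p))) \<in> borel_measurable (WN \<Otimes>\<^sub>M \<Omega>)"
proof (rule borel_measurable_sum)
  fix i assume "i \<in> F"
  then have i: "i \<in> idx J0" using assms by auto
  have "(\<lambda>p. (fst p i, g i (snd p))) \<in> measurable (WN \<Otimes>\<^sub>M \<Omega>) (borel \<Otimes>\<^sub>M borel)"
    by (intro measurable_Pair measurable_compose[OF measurable_fst white_noise_component[OF i]]
        measurable_compose[OF measurable_snd g_measurable[OF i]])
  from measurable_compose[OF this assms(2)]
  show "(\<lambda>p. h i (fst p i) (g i (snd p))) \<in> borel_measurable (WN \<Otimes>\<^sub>M \<Omega>)" by simp
qed

section \<open>Almost sure convergence of the likelihood series\<close>

lemma convergent_partial_sums: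
  assumes s: "(\<Sum>l. ennreal \<bar>\<Sum>k\<in>lev J0 l. a (l, k) * W (l, k)\<bar>) < \<infinity>"
  shows "convergent (\<lambda>L. \<Sum>i\<in>idx_below J0 L. a i * W i)"
proof -
  have "summable (\<lambda>l. \<bar>\<Sum>k\<in>lev J0 l. a (l, k) * W (l, k)\<bar>)"
    using s by (intro summable_suminf_not_top) auto
  then have "summable (\<lambda>l. \<Sum>k\<in>lev J0 l. a (l, k) * W (l, k))" by (rule summable_rabs_cancel)
  then show ?thesis
    unfolding sum_idx_below summable_iff_convergent .
qed

lemma sq_sums_tendsto:
  assumes "wsum J0 (\<lambda>_. 1) a = ennreal s" "s \<ge> 0"
  shows "(\<lambda>L. \<Sum>i\<in>idx_below J0 L. (a i)\<^sup>2) \<longlonglongrightarrow> s"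
proof -
  have "(\<lambda>l. ennreal (\<Sum>k\<in>lev J0 l. (a (l, k))\<^sup>2)) sums ennreal s"
    using summable_sums[OF summableI, of "\<lambda>l. ennreal (\<Sum>k\<in>lev J0 l. (a (l, k))\<^sup>2)"] assms(1)
    unfolding wsum_def mult_1 by simp
  then have "(\<lambda>l. \<Sum>k\<in>lev J0 l. (a (l, k))\<^sup>2) sums s"
    using assms(2) by (subst (asm) sums_ennreal) (auto simp: sum_nonneg)
  then show ?thesis by (simp add: sums_def sum_idx_below)
qed

lemma convergent_tilt_sums:
  assumes s: "(\<Sum>l. ennreal \<bar>\<Sum>k\<in>lev J0 l. a (l, k) * W (l, k)\<bar>) < \<infinity>"
    and w: "wsum J0 (\<lambda>_. 1) a < \<infinity>"
  shows "convergent (\<lambda>L. \<Sum>i\<in>idx_below J0 L. a i * W i - (a i)\<^sup>2 / 2)"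
proof -
  obtain q where "q \<ge> 0" "wsum J0 (\<lambda>_. 1) a = ennreal q" using w by (cases "wsum J0 (\<lambda>_. 1) a") auto
  then have "convergent (\<lambda>L. \<Sum>i\<in>idx_below J0 L. (a i)\<^sup>2)" using sq_sums_tendsto convergentI by blast
  then have "convergent (\<lambda>L. (\<Sum>i\<in>idx_below J0 L. a i * W i) - (\<Sum>i\<in>idx_below J0 L. (a i)\<^sup>2) * (1 / 2))"
    by (intro convergent_diff convergent_partial_sums[OF s] convergent_mult convergent_const)
  then show ?thesis by (simp add: sum_subtractf sum_divide_distrib)
qed

sublocale WNO: pair_prob_space WN \<Omega>
  by (simp add: pair_prob_space_def pair_sigma_finite_def prob_space_white_noise Omega.prob_space_axioms
      prob_space_imp_sigma_finite)

text \<open>Absolute values are taken after summing within a level. Coordinatewise absolute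
  convergence may fail for small \<gamma>, whereas cancellation inside a level gives a geometrically
  decaying bound for every \<gamma> > 0.\<close>

definition noise_series :: "nat \<Rightarrow> (nat \<times> nat \<Rightarrow> real) \<Rightarrow> 'w \<Rightarrow> ennreal" where
  "noise_series n W v = (\<Sum>l. ennreal \<bar>\<Sum>k\<in>lev J0 l. U n (l, k) (g (l, k) v) * W (l, k)\<bar>)"

lemma noise_series_measurable: "case_prod (noise_series n) \<in> borel_measurable (WN \<Otimes>\<^sub>M \<Omega>)"
proof -
  have "(\<lambda>p. \<Sum>i\<in>Pair l ` lev J0 l. U n i (g i (snd p)) * fst p i) \<in> borel_measurable (WN \<Otimes>\<^sub>M \<Omega>)" for l
    by (rule pair_sum_measurable[where h="\<lambda>i W t. U n i t * W"]) (auto simp: lev_def)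
  then have [measurable]: "(\<lambda>p. \<Sum>k\<in>lev J0 l. U n (l, k) (g (l, k) (snd p)) * fst p (l, k)) \<in> borel_measurable (WN \<Otimes>\<^sub>M \<Omega>)" for l
    by (subst (asm) sum.reindex) (auto simp: inj_on_def)
  show ?thesis unfolding noise_series_def case_prod_beta by measurable
qed

lemma noise_series_integral: "(\<integral>\<^sup>+v. \<integral>\<^sup>+W. noise_series n W v \<partial>WN \<partial>\<Omega>) < \<infinity>"
proof -
  define M where "M = 2 * real n * V"
  have M: "M \<ge> 0" using V_nonneg by (simp add: M_def)
  have Ueq: "U n i t = sqrt (real n) * sg i * (t - b i)" for i t by (simp add: U_def \<tau>_def)
  have [measurable]: "(\<lambda>v. \<Sum>k\<in>lev J0 l. (U n (l, k) (g (l, k) v))\<^sup>2) \<in> borel_measurable \<Omega>" for l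
    by (intro borel_measurable_sum borel_measurable_power measurable_compose[OF g_measurable U_measurable]) (simp add: lev_def)
  have lm [measurable]: "(\<lambda>W. ennreal \<bar>\<Sum>k\<in>lev J0 l. U n (l, k) (g (l, k) v) * W (l, k)\<bar>) \<in> borel_measurable WN" for l v
    by (intro measurable_compose[OF lev_noise_measurable]) simp
  have "(\<integral>\<^sup>+v. \<integral>\<^sup>+W. noise_series n W v \<partial>WN \<partial>\<Omega>) =
      (\<integral>\<^sup>+v. (\<Sum>l. \<integral>\<^sup>+W. ennreal \<bar>\<Sum>k\<in>lev J0 l. U n (l, k) (g (l, k) v) * W (l, k)\<bar> \<partial>WN) \<partial>\<Omega>)"
    unfolding noise_series_def by (intro nn_integral_cong nn_integral_suminf lm)
  also have "\<dots> \<le> (\<integral>\<^sup>+v. (\<Sum>l. ennreal (rt l) + ennreal (1 / rt l) * ennreal (\<Sum>k\<in>lev J0 l. (U n (l, k) (g (l, k) v))\<^sup>2)) \<partial>\<Omega>)"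
    by (intro nn_integral_mono suminf_le summableI level_noise_bound)
  also have "\<dots> = (\<Sum>l. \<integral>\<^sup>+v. ennreal (rt l) + ennreal (1 / rt l) * ennreal (\<Sum>k\<in>lev J0 l. (U n (l, k) (g (l, k) v))\<^sup>2) \<partial>\<Omega>)"
    by (rule nn_integral_suminf) measurable
  also have "\<dots> \<le> (\<Sum>l. ennreal ((1 + M) * rt l))"
  proof (intro suminf_le summableI)
    fix l
    have "(\<integral>\<^sup>+v. ennreal (rt l) + ennreal (1 / rt l) * ennreal (\<Sum>k\<in>lev J0 l. (U n (l, k) (g (l, k) v))\<^sup>2) \<partial>\<Omega>) =
       ennreal (rt l) + ennreal (1 / rt l) * (\<integral>\<^sup>+v. ennreal (\<Sum>k\<in>lev J0 l. (U n (l, k) (g (l, k) v))\<^sup>2) \<partial>\<Omega>)"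
      by (subst nn_integral_add) (auto simp: nn_integral_cmult Omega.emeasure_space_1)
    also have "\<dots> \<le> ennreal (rt l) + ennreal (1 / rt l) * ennreal (M * (rt l)\<^sup>2)"
      unfolding Ueq M_def using lev_second_moment[of b "sqrt (real n)" l, OF b_bound]
      by (intro add_left_mono mult_left_mono) auto
    also have "\<dots> = ennreal (rt l + 1 / rt l * (M * (rt l)\<^sup>2))"
      using M by (simp add: ennreal_mult[symmetric] ennreal_plus[symmetric] less_imp_le del: ennreal_plus)
    also have "rt l + 1 / rt l * (M * (rt l)\<^sup>2) = (1 + M) * rt l"
      using rt_pos[of l] by (simp add: power2_eq_square algebra_simps del: rt_pos)
    finally show "(\<integral>\<^sup>+v. ennreal (rt l) + ennreal (1 / rt l) * ennreal (\<Sum>k\<in>lev J0 l. (U n (l, k) (g (l, k) v))\<^sup>2) \<partial>\<Omega>) \<le> ennreal ((1 + M) * rt l)" .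
  qed
  also have "\<dots> < \<infinity>"
    using M by (intro suminf_ennreal_finite summable_mult summable_rt) (simp add: less_imp_le)
  finally show ?thesis .
qed

text \<open>Both orders of the quantifiers are used: a fixed prior draw for Fatou's lemma in the
  normalising constant, a fixed noise sequence for the posterior itself.\<close>

lemma AE_noise_series:
  "AE v in \<Omega>. AE W in WN. noise_series n W v < \<infinity>"
  "AE W in WN. AE v in \<Omega>. noise_series n W v < \<infinity>"
proof -
  note m = noise_series_measurable[of n]
  have m1: "(\<lambda>W. noise_series n W v) \<in> borel_measurable WN" if "v \<in> space \<Omega>" for v
    using measurable_compose[OF measurable_Pair2'[OF that] m] by simp
  have m2: "noise_series n W \<in> borel_measurable \<Omega>" if "W \<in> space WN" for W
    using measurable_compose[OF measurable_Pair1'[OF that] m] by simp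
  have "AE v in \<Omega>. (\<integral>\<^sup>+W. noise_series n W v \<partial>WN) \<noteq> \<infinity>"
  proof (rule nn_integral_PInf_AE)
    have "(\<lambda>(v, W). noise_series n W v) \<in> borel_measurable (\<Omega> \<Otimes>\<^sub>M WN)"
      using measurable_pair_swap[OF m] by (simp add: case_prod_beta)
    then show "(\<lambda>v. \<integral>\<^sup>+W. noise_series n W v \<partial>WN) \<in> borel_measurable \<Omega>"
      by (rule WNO.M1.borel_measurable_nn_integral)
    show "(\<integral>\<^sup>+v. \<integral>\<^sup>+W. noise_series n W v \<partial>WN \<partial>\<Omega>) \<noteq> \<infinity>"
      by (rule less_imp_neq) (rule noise_series_integral)
  qed
  moreover have "AE v in \<Omega>. (\<integral>\<^sup>+W. noise_series n W v \<partial>WN) \<noteq> \<infinity> \<longrightarrow> (AE W in WN. noise_series n W v < \<infinity>)"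
  proof (rule AE_I2, rule impI)
    fix v assume "v \<in> space \<Omega>" "(\<integral>\<^sup>+W. noise_series n W v \<partial>WN) \<noteq> \<infinity>"
    then have "AE W in WN. noise_series n W v \<noteq> \<infinity>" by (intro nn_integral_PInf_AE m1)
    then show "AE W in WN. noise_series n W v < \<infinity>"
      by (simp only: infinity_ennreal_def less_top[symmetric])
  qed
  ultimately show "AE v in \<Omega>. AE W in WN. noise_series n W v < \<infinity>" by (rule AE_mp)
  have "(\<integral>\<^sup>+W. \<integral>\<^sup>+v. noise_series n W v \<partial>\<Omega> \<partial>WN) < \<infinity>"
    using noise_series_integral[of n] WNO.Fubini'[OF m] by (simp only:)
  then have "AE W in WN. (\<integral>\<^sup>+v. noise_series n W v \<partial>\<Omega>) \<noteq> \<infinity>"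
    by (intro nn_integral_PInf_AE less_imp_neq Omega.borel_measurable_nn_integral[OF m])
  moreover have "AE W in WN. (\<integral>\<^sup>+v. noise_series n W v \<partial>\<Omega>) \<noteq> \<infinity> \<longrightarrow> (AE v in \<Omega>. noise_series n W v < \<infinity>)"
  proof (rule AE_I2, rule impI)
    fix W assume "W \<in> space WN" "(\<integral>\<^sup>+v. noise_series n W v \<partial>\<Omega>) \<noteq> \<infinity>"
    then have "AE v in \<Omega>. noise_series n W v \<noteq> \<infinity>" by (intro nn_integral_PInf_AE m2)
    then show "AE v in \<Omega>. noise_series n W v < \<infinity>"
      by (simp only: infinity_ennreal_def less_top[symmetric])
  qed
  ultimately show "AE W in WN. AE v in \<Omega>. noise_series n W v < \<infinity>" by (rule AE_mp)
qed

lemma G_eq: "G v = (\<Sum>\<^sub>\<infinity>i\<in>idx J0. (sg i * g i v) *\<^sub>R (\<lambda>(l, k). to_L2 (\<psi> l k)) i)"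
  unfolding G_def by (rule infsum_cong) (simp add: sg_def case_prod_beta)

lemma G_measurable [measurable]: "G \<in> borel_measurable \<Omega>"
  unfolding G_eq[abs_def] by (rule infsum_measurable) measurable

lemma pri_eq: "pri = distr \<Omega> borel G"
  by (simp add: series_prior_def G_def[abs_def])

lemma AE_G_finite: "AE v in \<Omega>. wsum J0 (\<lambda>_. 1) (\<lambda>i. sg i * g i v) < \<infinity>"
  using AE_wsum_finite[of "\<lambda>_. 0" 1] B_nonneg by simp

lemma AE_U_finite: "AE v in \<Omega>. wsum J0 (\<lambda>_. 1) (\<lambda>i. U n i (g i v)) < \<infinity>"
  using AE_wsum_finite[of b "sqrt (real n)"] b_bound by (simp add: U_def \<tau>_def)

lemma coeff_G:
  assumes "wsum J0 (\<lambda>_. 1) (\<lambda>i. sg i * g i v) < \<infinity>" "i \<in> idx J0"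
  shows "coeff \<psi> (G v) i = sg i * g i v"
  unfolding coeff_inner G_eq using assms by (rule coeff_infsum)

lemma resc_G:
  assumes "wsum J0 (\<lambda>_. 1) (\<lambda>i. sg i * g i v) < \<infinity>" "i \<in> idx J0"
  shows "resc n (G v) i = U n i (g i v)"
  by (simp add: resc_def coeff_G[OF assms] U_eq)

definition F0_noise :: "(nat \<times> nat \<Rightarrow> real) \<Rightarrow> ennreal" where
  "F0_noise W = (\<Sum>l. ennreal \<bar>\<Sum>k\<in>lev J0 l. \<theta>0 (l, k) * W (l, k)\<bar>)"

lemma AE_F0_noise: "AE W in WN. F0_noise W < \<infinity>"
proof -
  have m [measurable]: "(\<lambda>W. ennreal \<bar>\<Sum>k\<in>lev J0 l. \<theta>0 (l, k) * W (l, k)\<bar>) \<in> borel_measurable WN" for l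
    by (intro measurable_compose[OF lev_noise_measurable]) simp
  have "(\<integral>\<^sup>+W. F0_noise W \<partial>WN) = (\<Sum>l. \<integral>\<^sup>+W. ennreal \<bar>\<Sum>k\<in>lev J0 l. \<theta>0 (l, k) * W (l, k)\<bar> \<partial>WN)"
    unfolding F0_noise_def by (rule nn_integral_suminf) (rule m)
  also have "\<dots> \<le> (\<Sum>l. ennreal ((1 + 2 * B\<^sup>2) * rt l))"
  proof (intro suminf_le summableI)
    fix l
    have "(\<integral>\<^sup>+W. ennreal \<bar>\<Sum>k\<in>lev J0 l. \<theta>0 (l, k) * W (l, k)\<bar> \<partial>WN) \<le>
        ennreal (rt l) + ennreal (1 / rt l) * ennreal (\<Sum>k\<in>lev J0 l. (\<theta>0 (l, k))\<^sup>2)"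
      by (rule level_noise_bound)
    also have "\<dots> \<le> ennreal (rt l) + ennreal (1 / rt l) * ennreal (2 * B\<^sup>2 * (rt l)\<^sup>2)"
      by (intro add_left_mono mult_left_mono ennreal_leI \<theta>0_lev) auto
    also have "\<dots> = ennreal (rt l + 1 / rt l * (2 * B\<^sup>2 * (rt l)\<^sup>2))"
      by (simp add: ennreal_mult[symmetric] ennreal_plus[symmetric] less_imp_le del: ennreal_plus)
    also have "rt l + 1 / rt l * (2 * B\<^sup>2 * (rt l)\<^sup>2) = (1 + 2 * B\<^sup>2) * rt l"
      using rt_pos[of l] by (simp add: power2_eq_square algebra_simps del: rt_pos)
    finally show "(\<integral>\<^sup>+W. ennreal \<bar>\<Sum>k\<in>lev J0 l. \<theta>0 (l, k) * W (l, k)\<bar> \<partial>WN) \<le> ennreal ((1 + 2 * B\<^sup>2) * rt l)" .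
  qed
  also have "\<dots> < \<infinity>"
    by (intro suminf_ennreal_finite summable_mult summable_rt) (simp add: less_imp_le)
  finally have "(\<integral>\<^sup>+W. F0_noise W \<partial>WN) \<noteq> \<infinity>" by (rule less_imp_neq)
  moreover have "F0_noise \<in> borel_measurable WN" unfolding F0_noise_def[abs_def] by measurable
  ultimately have "AE W in WN. F0_noise W \<noteq> \<infinity>" by (intro nn_integral_PInf_AE)
  then show ?thesis by eventually_elim (simp only: infinity_ennreal_def less_top[symmetric] not_False_eq_True)
qed

text \<open>The log-likelihood of the truth at the data \<open>X n W\<close>. It does not depend on
  the prior draw and cancels in Bayes' formula.\<close>

definition clik :: "nat \<Rightarrow> (nat \<times> nat \<Rightarrow> real) \<Rightarrow> real" where
  "clik n W = lim (\<lambda>L. \<Sum>i\<in>idx_below J0 L. real n * (\<theta>0 i)\<^sup>2 / 2 + sqrt (real n) * (\<theta>0 i * W i))"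

lemma pairing_sum:
  "(\<Sum>l\<in>{J0 - 1..<L}. \<Sum>k<level_size J0 l. a (l, k)) = (\<Sum>i\<in>idx_below J0 L. a i)"
  for a :: "nat \<times> nat \<Rightarrow> real"
  unfolding sum_idx_below by (rule sum.mono_neutral_cong_left) (auto simp: lev_eq)

text \<open>With a = \<theta>0 + u / \<surd>n and x = \<theta>0 + W / \<surd>n, expanding n a x - n
  a^2 / 2 leaves n \<theta>0^2 / 2 + \<surd>n \<theta>0 W, which is free of u, plus the exponent u W
  - u^2 / 2 of the tilt. The identity is summed over finite sections, where no convergence is at
  stake.\<close>

lemma likelihood_eq:
  assumes n: "n > 0" and W: "F0_noise W < \<infinity>"
    and conv: "(\<lambda>L. \<Sum>i\<in>idx_below J0 L. U n i (g i v) * W i - (U n i (g i v))\<^sup>2 / 2) \<longlonglongrightarrow> ll"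
    and G: "wsum J0 (\<lambda>_. 1) (\<lambda>i. sg i * g i v) < \<infinity>"
  shows "likelihood \<psi> J0 n (X n W) (G v) = exp (clik n W) * exp ll"
proof -
  let ?a = "coeff \<psi> (G v)"
  define s where "s = sqrt (real n)"
  have s: "s > 0" "s\<^sup>2 = real n" using n by (auto simp: s_def)
  have "wsum J0 (\<lambda>_. 1) \<theta>0 = ennreal ((norm F0)\<^sup>2)"
    unfolding coeff_inner[abs_def] by (rule parseval)
  then have q0: "(\<lambda>L. \<Sum>i\<in>idx_below J0 L. (\<theta>0 i)\<^sup>2) \<longlonglongrightarrow> (norm F0)\<^sup>2" by (rule sq_sums_tendsto) simp
  have "convergent (\<lambda>L. (real n / 2) * (\<Sum>i\<in>idx_below J0 L. (\<theta>0 i)\<^sup>2) + s * (\<Sum>i\<in>idx_below J0 L. \<theta>0 i * W i))"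
    using W unfolding F0_noise_def
    by (intro convergent_add convergent_mult convergent_const convergent_partial_sums convergentI[OF q0])
  then have "convergent (\<lambda>L. \<Sum>i\<in>idx_below J0 L. real n * (\<theta>0 i)\<^sup>2 / 2 + s * (\<theta>0 i * W i))"
    by (simp add: sum.distrib sum_distrib_left)
  then have cl: "(\<lambda>L. \<Sum>i\<in>idx_below J0 L. real n * (\<theta>0 i)\<^sup>2 / 2 + s * (\<theta>0 i * W i)) \<longlonglongrightarrow> clik n W"
    unfolding clik_def s_def by (simp add: convergent_LIMSEQ_iff)
  have "wsum J0 (\<lambda>_. 1) ?a = ennreal ((norm (G v))\<^sup>2)"
    unfolding coeff_inner[abs_def] by (rule parseval)
  then have qa: "(\<lambda>L. \<Sum>i\<in>idx_below J0 L. (?a i)\<^sup>2) \<longlonglongrightarrow> (norm (G v))\<^sup>2" by (rule sq_sums_tendsto) simp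
  have term_eq: "?a i * X n W i = (1 / real n) * ((real n * (\<theta>0 i)\<^sup>2 / 2 + s * (\<theta>0 i * W i)) +
      (U n i (g i v) * W i - (U n i (g i v))\<^sup>2 / 2) + (real n / 2) * (?a i)\<^sup>2)" if "i \<in> idx J0" for i
  proof -
    define u where "u = U n i (g i v)"
    have a: "?a i = \<theta>0 i + u / s"
      using s by (simp add: u_def U_eq coeff_G[OF G that] s_def field_simps)
    have x: "X n W i = \<theta>0 i + W i / s" using that by (simp add: X_def s_def)
    have "real n * (?a i * X n W i) = (s * \<theta>0 i + u) * (s * \<theta>0 i + W i)"
      unfolding a x s(2)[symmetric] using s(1) by (simp add: power2_eq_square field_simps)
    moreover have "real n * (?a i)\<^sup>2 = (s * \<theta>0 i + u)\<^sup>2"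
      unfolding a s(2)[symmetric] using s(1) by (simp add: power2_eq_square field_simps)
    ultimately have "real n * (?a i * X n W i) = (real n * (\<theta>0 i)\<^sup>2 / 2 + s * (\<theta>0 i * W i)) +
        (u * W i - u\<^sup>2 / 2) + (real n * (?a i)\<^sup>2) / 2"
      unfolding s(2)[symmetric] by (simp only:) (simp add: power2_eq_square field_simps)
    then show ?thesis using n unfolding u_def by (simp add: field_simps)
  qed
  have "(\<Sum>i\<in>idx_below J0 L. ?a i * X n W i) =
      (1 / real n) * ((\<Sum>i\<in>idx_below J0 L. real n * (\<theta>0 i)\<^sup>2 / 2 + s * (\<theta>0 i * W i)) +
      (\<Sum>i\<in>idx_below J0 L. U n i (g i v) * W i - (U n i (g i v))\<^sup>2 / 2) + (real n / 2) * (\<Sum>i\<in>idx_below J0 L. (?a i)\<^sup>2))" for L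
  proof -
    have "(\<Sum>i\<in>idx_below J0 L. ?a i * X n W i) = (\<Sum>i\<in>idx_below J0 L. (1 / real n) * ((real n * (\<theta>0 i)\<^sup>2 / 2 + s * (\<theta>0 i * W i)) +
      (U n i (g i v) * W i - (U n i (g i v))\<^sup>2 / 2) + (real n / 2) * (?a i)\<^sup>2))"
      using idx_below_subset by (intro sum.cong refl term_eq) auto
    then show ?thesis by (simp only: sum_distrib_left[symmetric] sum.distrib)
  qed
  then have "(\<lambda>L. \<Sum>i\<in>idx_below J0 L. ?a i * X n W i) \<longlonglongrightarrow>
      (1 / real n) * (clik n W + ll + (real n / 2) * (norm (G v))\<^sup>2)"
    by (simp only:) (intro tendsto_intros cl conv qa)
  then have "obs_pairing \<psi> J0 (G v) (X n W) = (1 / real n) * (clik n W + ll + (real n / 2) * (norm (G v))\<^sup>2)"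
    unfolding obs_pairing_def pairing_sum[of "\<lambda>i. ?a i * X n W i"] by (rule limI)
  then show ?thesis
    using n by (simp add: likelihood_def exp_add[symmetric])
qed

lemma loglik_tendsto:
  assumes "noise_series n W v < \<infinity>" "wsum J0 (\<lambda>_. 1) (\<lambda>i. U n i (g i v)) < \<infinity>"
  shows "(\<lambda>L. \<Sum>i\<in>idx_below J0 L. U n i (g i v) * W i - (U n i (g i v))\<^sup>2 / 2) \<longlonglongrightarrow> loglik n W v"
  using convergent_tilt_sums[of "\<lambda>i. U n i (g i v)" W] assms
  unfolding loglik_def noise_series_def by (simp add: convergent_LIMSEQ_iff)

lemma loglik_measurable: "(\<lambda>p. loglik n (fst p) (snd p)) \<in> borel_measurable (WN \<Otimes>\<^sub>M \<Omega>)"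
  unfolding loglik_def
  by (intro borel_measurable_lim_metric pair_sum_measurable[where h="\<lambda>i W t. U n i t * W - (U n i t)\<^sup>2 / 2"] idx_below_subset)
    measurable

lemma loglik_measurable1: "W \<in> space WN \<Longrightarrow> loglik n W \<in> borel_measurable \<Omega>"
  using measurable_compose[OF measurable_Pair1' loglik_measurable[of n], of W] by simp

definition evidence :: "nat \<Rightarrow> (nat \<times> nat \<Rightarrow> real) \<Rightarrow> ennreal" where
  "evidence n W = (\<integral>\<^sup>+v. ennreal (exp (loglik n W v)) \<partial>\<Omega>)"

text \<open>Finiteness of the normalising constant: relative to the density at \<open>F0\<close>, the likelihood has
  mean at most one by Fatou's lemma.\<close>

lemma AE_evidence_finite: "AE W in WN. evidence n W < \<infinity>"
proof -
  have m [measurable]: "(\<lambda>(W, v). ennreal (exp (loglik n W v))) \<in> borel_measurable (WN \<Otimes>\<^sub>M \<Omega>)"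
    using loglik_measurable[of n] unfolding case_prod_beta by measurable
  have "(\<integral>\<^sup>+W. evidence n W \<partial>WN) = (\<integral>\<^sup>+v. \<integral>\<^sup>+W. ennreal (exp (loglik n W v)) \<partial>WN \<partial>\<Omega>)"
    unfolding evidence_def by (rule WNO.Fubini'[OF m, symmetric])
  also have "\<dots> \<le> (\<integral>\<^sup>+v. 1 \<partial>\<Omega>)"
  proof (rule nn_integral_mono_AE)
    show "AE v in \<Omega>. (\<integral>\<^sup>+W. ennreal (exp (loglik n W v)) \<partial>WN) \<le> 1"
      using AE_noise_series(1)[of n] AE_U_finite[of n]
    proof eventually_elim
      case (elim v)
      let ?S = "\<lambda>L W. \<Sum>i\<in>idx_below J0 L. U n i (g i v) * W i - (U n i (g i v))\<^sup>2 / 2"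
      have "(\<integral>\<^sup>+W. ennreal (exp (loglik n W v)) \<partial>WN) = (\<integral>\<^sup>+W. liminf (\<lambda>L. ennreal (exp (?S L W))) \<partial>WN)"
      proof (rule nn_integral_cong_AE)
        show "AE W in WN. ennreal (exp (loglik n W v)) = liminf (\<lambda>L. ennreal (exp (?S L W)))"
          using elim(1)
        proof eventually_elim
          case (elim W)
          have "(\<lambda>L. ennreal (exp (?S L W))) \<longlonglongrightarrow> ennreal (exp (loglik n W v))"
            using elim \<open>wsum J0 (\<lambda>_. 1) (\<lambda>i. U n i (g i v)) < \<infinity>\<close>
            by (intro tendsto_ennrealI tendsto_exp loglik_tendsto)
          from lim_imp_Liminf[OF _ this] show ?case by simp
        qed
      qed
      also have "\<dots> \<le> liminf (\<lambda>L. \<integral>\<^sup>+W. ennreal (exp (?S L W)) \<partial>WN)"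
      proof (rule nn_integral_liminf)
        fix L
        have "?S L \<in> borel_measurable WN"
          using idx_below_subset by (intro borel_measurable_sum borel_measurable_diff borel_measurable_times white_noise_component borel_measurable_const) auto
        then show "(\<lambda>W. ennreal (exp (?S L W))) \<in> borel_measurable WN" by measurable
      qed
      also have "\<dots> = liminf (\<lambda>L::nat. 1)"
        by (simp only: white_noise_tilt[OF finite_idx_below idx_below_subset])
      also have "\<dots> = 1" by (simp add: Liminf_const)
      finally show ?case .
    qed
  qed
  also have "\<dots> < \<infinity>" by (simp add: Omega.emeasure_space_1)
  finally have "(\<integral>\<^sup>+W. evidence n W \<partial>WN) \<noteq> \<infinity>" by (rule less_imp_neq)
  moreover have "evidence n \<in> borel_measurable WN"
    unfolding evidence_def[abs_def] by (rule Omega.borel_measurable_nn_integral[OF m])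
  ultimately have "AE W in WN. evidence n W \<noteq> \<infinity>" by (intro nn_integral_PInf_AE)
  then show ?thesis by eventually_elim (simp only: infinity_ennreal_def less_top[symmetric] not_False_eq_True)
qed

lemma evidence_pos:
  assumes "W \<in> space WN" shows "evidence n W > 0"
proof (rule ccontr)
  assume "\<not> 0 < evidence n W"
  then have "(\<integral>\<^sup>+v. ennreal (exp (loglik n W v)) \<partial>\<Omega>) = 0" by (simp add: evidence_def)
  then have "AE v in \<Omega>. ennreal (exp (loglik n W v)) = 0"
    using loglik_measurable1[OF assms, of n] by (subst (asm) nn_integral_0_iff_AE) auto
  then have "AE v in \<Omega>. False" by eventually_elim (simp add: ennreal_eq_0_iff not_le)
  then have "ae_filter \<Omega> = bot" by (simp add: trivial_limit_def)
  then show False by (simp add: ae_filter_eq_bot_iff Omega.emeasure_space_1)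
qed

text \<open>Noise for which Bayes' formula can be evaluated: the likelihood series converges at
  almost every draw and the normalising constant is finite.\<close>

definition regular :: "nat \<Rightarrow> (nat \<times> nat \<Rightarrow> real) \<Rightarrow> bool" where
  "regular n W \<longleftrightarrow> W \<in> space WN \<and> (AE v in \<Omega>. noise_series n W v < \<infinity>) \<and> F0_noise W < \<infinity> \<and> evidence n W < \<infinity>"

lemma AE_regular: "AE W in WN. regular n W"
  using AE_noise_series(2)[of n] AE_F0_noise AE_evidence_finite[of n] AE_space
  by eventually_elim (simp add: regular_def)

lemma likelihood_measurable:
  "(\<lambda>p. likelihood \<psi> J0 n (fst p) (snd p)) \<in> borel_measurable (PiM (idx J0) (\<lambda>_. borel) \<Otimes>\<^sub>M borel)"
proof -
  have "(\<lambda>p. \<Sum>i\<in>idx_below J0 L. coeff \<psi> (snd p) i * fst p i) \<in> borel_measurable (PiM (idx J0) (\<lambda>_. borel) \<Otimes>\<^sub>M borel)" for L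
    using idx_below_subset
    by (intro borel_measurable_sum borel_measurable_times measurable_compose[OF measurable_snd coeff_measurable]
        measurable_compose[OF measurable_fst measurable_component_singleton]) auto
  then have "(\<lambda>p. obs_pairing \<psi> J0 (snd p) (fst p)) \<in> borel_measurable (PiM (idx J0) (\<lambda>_. borel) \<Otimes>\<^sub>M borel)"
    unfolding obs_pairing_def pairing_sum[of "\<lambda>i. coeff \<psi> _ i * _ i"] by (rule borel_measurable_lim_metric)
  then show ?thesis unfolding likelihood_def by measurable
qed

lemma X_measurable [measurable]: "X n \<in> measurable WN (PiM (idx J0) (\<lambda>_. borel))"
  unfolding X_def[abs_def] by (intro measurable_restrict) simp

lemma likelihood_measurable1: "x \<in> space (PiM (idx J0) (\<lambda>_. borel)) \<Longrightarrow> likelihood \<psi> J0 n x \<in> borel_measurable borel"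
  using measurable_compose[OF measurable_Pair1' likelihood_measurable[of n], of x] by simp

lemma X_space: "X n W \<in> space (PiM (idx J0) (\<lambda>_. borel))"
  by (simp add: space_PiM X_def)

text \<open>The factor exp (\<open>clik n W\<close>) occurs in the likelihood and in its
  normalisation, so the posterior is governed by the likelihood ratio to the truth.\<close>

lemma post_emeasure:
  assumes n: "n > 0" and W: "regular n W" and A: "A \<in> sets borel"
  shows "emeasure (post n W) A = (\<integral>\<^sup>+v. ennreal (exp (loglik n W v)) * indicator A (G v) \<partial>\<Omega>) / evidence n W"
proof -
  have Wr: "W \<in> space WN" "AE v in \<Omega>. noise_series n W v < \<infinity>" "F0_noise W < \<infinity>" "evidence n W < \<infinity>"
    using W by (auto simp: regular_def)
  let ?c = "exp (clik n W)"
  obtain E where E: "E > 0" "evidence n W = ennreal E"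
    using Wr(4) evidence_pos[OF Wr(1), of n] by (cases "evidence n W") auto
  have lik: "AE v in \<Omega>. likelihood \<psi> J0 n (X n W) (G v) = ?c * exp (loglik n W v)"
    using Wr(2) AE_U_finite[of n] AE_G_finite
    by eventually_elim (rule likelihood_eq[OF n Wr(3) loglik_tendsto])
  note [measurable] = A likelihood_measurable1[OF X_space, of n n W] loglik_measurable1[OF Wr(1), of n]
  let ?D = "\<integral>\<^sup>+ f'. ennreal (likelihood \<psi> J0 n (X n W) f') \<partial>pri"
  have "?D = (\<integral>\<^sup>+v. ennreal (likelihood \<psi> J0 n (X n W) (G v)) \<partial>\<Omega>)"
    unfolding pri_eq by (rule nn_integral_distr) measurable
  also have "\<dots> = (\<integral>\<^sup>+v. ennreal ?c * ennreal (exp (loglik n W v)) \<partial>\<Omega>)"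
    by (rule nn_integral_cong_AE) (use lik in \<open>eventually_elim, simp add: ennreal_mult\<close>)
  also have "\<dots> = ennreal ?c * evidence n W"
    unfolding evidence_def by (rule nn_integral_cmult) measurable
  also have "\<dots> = ennreal (?c * E)" using E by (simp add: ennreal_mult)
  finally obtain D where D_def: "?D = D" and D: "D = ennreal (?c * E)" by simp
  have "emeasure (post n W) A = (\<integral>\<^sup>+f. ennreal (likelihood \<psi> J0 n (X n W) f) / D * indicator A f \<partial>pri)"
    unfolding posterior_def D_def using A by (subst emeasure_density) (auto simp: pri_eq)
  also have "\<dots> = (\<integral>\<^sup>+v. ennreal (likelihood \<psi> J0 n (X n W) (G v)) / D * indicator A (G v) \<partial>\<Omega>)"
    unfolding pri_eq using A by (subst nn_integral_distr) auto
  also have "\<dots> = (\<integral>\<^sup>+v. (ennreal (exp (loglik n W v)) * indicator A (G v)) / evidence n W \<partial>\<Omega>)"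
  proof (rule nn_integral_cong_AE)
    show "AE v in \<Omega>. ennreal (likelihood \<psi> J0 n (X n W) (G v)) / D * indicator A (G v) =
       (ennreal (exp (loglik n W v)) * indicator A (G v)) / evidence n W"
      using lik
    proof eventually_elim
      case (elim v)
      have "ennreal (?c * exp (loglik n W v)) / ennreal (?c * E) = ennreal (exp (loglik n W v)) / ennreal E"
        using E by (simp add: divide_ennreal)
      then show ?case unfolding elim D E(2) by (simp add: ennreal_times_divide split: split_indicator)
    qed
  qed
  also have "\<dots> = (\<integral>\<^sup>+v. ennreal (exp (loglik n W v)) * indicator A (G v) \<partial>\<Omega>) / evidence n W"
    by (intro nn_integral_divide) measurable
  finally show ?thesis .
qed

lemma sets_post [simp, measurable_cong]: "sets (post n W) = sets borel"
  by (simp add: posterior_def series_prior_def)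

lemma space_post [simp]: "space (post n W) = UNIV"
  using sets_eq_imp_space_eq[OF sets_post] by simp

lemma prob_space_post:
  assumes n: "n > 0" and W: "regular n W" shows "prob_space (post n W)"
proof
  have "evidence n W > 0" "evidence n W < \<infinity>" using W evidence_pos by (auto simp: regular_def)
  then show "emeasure (post n W) (space (post n W)) = 1"
    using post_emeasure[OF n W, of UNIV] by (simp add: evidence_def[symmetric] ennreal_divide_self)
qed

section \<open>Factorisation of the posterior over the coordinates\<close>

definition coord_mass :: "nat \<Rightarrow> (nat \<times> nat \<Rightarrow> real) \<Rightarrow> nat \<times> nat \<Rightarrow> real set \<Rightarrow> ennreal" where
  "coord_mass n W i A = (\<integral>\<^sup>+v. ennreal (tilt (W i) (U n i (g i v))) * indicator A (U n i (g i v)) \<partial>\<Omega>)"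

lemma coord_mass_eq:
  assumes i: "i \<in> idx J0" and n: "n > 0" and A: "A \<in> sets borel"
  shows "ennreal (\<tau> n i) * coord_mass n W i A = (\<integral>\<^sup>+u. ennreal (kern (\<tau> n i) (b i) (W i) u) * indicator A u \<partial>lborel)"
proof -
  have t: "\<tau> n i > 0" by (rule \<tau>_pos[OF n])
  have Ut: "U n i t = - \<tau> n i * b i + \<tau> n i * t" for t by (simp add: U_def algebra_simps)
  have "(\<integral>\<^sup>+u. ennreal (kern (\<tau> n i) (b i) (W i) u) * indicator A u \<partial>lborel) =
     ennreal \<bar>\<tau> n i\<bar> * (\<integral>\<^sup>+t. ennreal (kern (\<tau> n i) (b i) (W i) (U n i t)) * indicator A (U n i t) \<partial>lborel)"
    unfolding Ut using t A by (intro nn_integral_real_affine) auto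
  also have "(\<integral>\<^sup>+t. ennreal (kern (\<tau> n i) (b i) (W i) (U n i t)) * indicator A (U n i t) \<partial>lborel) =
     (\<integral>\<^sup>+t. ennreal (\<phi> t) * (ennreal (tilt (W i) (U n i t)) * indicator A (U n i t)) \<partial>lborel)"
  proof (rule nn_integral_cong)
    fix x
    have "b i + U n i x / \<tau> n i = x" using t by (simp add: U_def)
    then have "kern (\<tau> n i) (b i) (W i) (U n i x) = \<phi> x * tilt (W i) (U n i x)" by (simp add: kern_def)
    then show "ennreal (kern (\<tau> n i) (b i) (W i) (U n i x)) * indicator A (U n i x) =
        ennreal (\<phi> x) * (ennreal (tilt (W i) (U n i x)) * indicator A (U n i x))"
      by (simp add: ennreal_mult less_imp_le[OF \<phi>_pos] mult.assoc)
  qed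
  also have "\<dots> = coord_mass n W i A"
    unfolding coord_mass_def using A by (subst nn_integral_g[OF i, where h="\<lambda>t. ennreal (tilt (W i) (U n i t)) * indicator A (U n i t)"]) auto
  finally show ?thesis using t by simp
qed

text \<open>Likelihood contribution of the coordinates outside \<open>J\<close>, as a function of
  these coordinates alone; this makes it independent of the coordinates in \<open>J\<close> under
  the prior.\<close>

definition rest :: "nat \<Rightarrow> (nat \<times> nat \<Rightarrow> real) \<Rightarrow> (nat \<times> nat) set \<Rightarrow> (nat \<times> nat \<Rightarrow> real) \<Rightarrow> real" where
  "rest n W J x = lim (\<lambda>L. \<Sum>i\<in>idx_below J0 L - J. U n i (x i) * W i - (U n i (x i))\<^sup>2 / 2)"

lemma rest_measurable: "rest n W J \<in> borel_measurable (PiM (idx J0 - J) (\<lambda>_. borel))"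
  unfolding rest_def[abs_def]
proof (intro borel_measurable_lim_metric borel_measurable_sum)
  fix L i assume "i \<in> idx_below J0 L - J"
  then have "i \<in> idx J0 - J" using idx_below_subset by auto
  then have [measurable]: "(\<lambda>x. U n i (x i)) \<in> borel_measurable (PiM (idx J0 - J) (\<lambda>_. borel))"
    by (intro measurable_compose[OF measurable_component_singleton[of i "idx J0 - J" "\<lambda>_. borel"] U_measurable])
  show "(\<lambda>x. U n i (x i) * W i - (U n i (x i))\<^sup>2 / 2) \<in> borel_measurable (PiM (idx J0 - J) (\<lambda>_. borel))"
    by measurable
qed

lemma loglik_split:
  assumes conv: "(\<lambda>L. \<Sum>i\<in>idx_below J0 L. U n i (g i v) * W i - (U n i (g i v))\<^sup>2 / 2) \<longlonglongrightarrow> ll"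
    and J: "finite J" "J \<subseteq> idx J0"
  shows "ll = (\<Sum>i\<in>J. U n i (g i v) * W i - (U n i (g i v))\<^sup>2 / 2) + rest n W J (restrict (\<lambda>i. g i v) (idx J0 - J))"
proof -
  let ?s = "\<lambda>i. U n i (g i v) * W i - (U n i (g i v))\<^sup>2 / 2"
  obtain L0 where L0: "J \<subseteq> idx_below J0 L0" using finite_subset_idx_below[OF J] .
  have eq: "(\<Sum>i\<in>idx_below J0 L. ?s i) - (\<Sum>i\<in>J. ?s i) = (\<Sum>i\<in>idx_below J0 L - J. ?s i)" if "L \<ge> L0" for L
  proof -
    have "J \<subseteq> idx_below J0 L" using L0 idx_below_mono[OF that] by blast
    then show ?thesis by (simp add: sum_diff)
  qed
  have "(\<lambda>L. (\<Sum>i\<in>idx_below J0 L. ?s i) - (\<Sum>i\<in>J. ?s i)) \<longlonglongrightarrow> ll - (\<Sum>i\<in>J. ?s i)"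
    by (intro tendsto_intros conv)
  then have "(\<lambda>L. \<Sum>i\<in>idx_below J0 L - J. ?s i) \<longlonglongrightarrow> ll - (\<Sum>i\<in>J. ?s i)"
    by (rule Lim_transform_eventually) (use eq in \<open>auto simp: eventually_sequentially\<close>)
  moreover have "(\<Sum>i\<in>idx_below J0 L - J. ?s i) = (\<Sum>i\<in>idx_below J0 L - J. U n i (restrict (\<lambda>i. g i v) (idx J0 - J) i) * W i
      - (U n i (restrict (\<lambda>i. g i v) (idx J0 - J) i))\<^sup>2 / 2)" for L
    using idx_below_subset by (intro sum.cong) auto
  ultimately have "rest n W J (restrict (\<lambda>i. g i v) (idx J0 - J)) = ll - (\<Sum>i\<in>J. ?s i)"
    unfolding rest_def by (simp only:) (rule limI)
  then show ?thesis by simp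
qed

text \<open>Only finitely many coordinates have to be separated from the others, so the infinite product
  of likelihood ratios never has to be integrated factor by factor.\<close>

lemma nn_integral_factor:
  assumes J: "finite J" "J \<subseteq> idx J0" and A: "\<And>i. i \<in> J \<Longrightarrow> A i \<in> sets borel"
    and W: "AE v in \<Omega>. noise_series n W v < \<infinity>"
  shows "(\<integral>\<^sup>+v. ennreal (exp (loglik n W v)) * (\<Prod>i\<in>J. indicator (A i) (U n i (g i v))) \<partial>\<Omega>) =
    (\<Prod>i\<in>J. coord_mass n W i (A i)) * (\<integral>\<^sup>+v. ennreal (exp (rest n W J (restrict (\<lambda>i. g i v) (idx J0 - J)))) \<partial>\<Omega>)"
proof -
  \<comment> \<open>The option index places the block of all remaining coordinates
    (\<open>None\<close>) and the singletons of \<open>J\<close> in one disjoint family, to which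
    independence of blocks applies.\<close>
  define Kx where "Kx j = (case j of None \<Rightarrow> idx J0 - J | Some i \<Rightarrow> {i})" for j
  define Y where "Y j x = (case j of None \<Rightarrow> ennreal (exp (rest n W J x))
     | Some i \<Rightarrow> ennreal (tilt (W i) (U n i (x i))) * indicator (A i) (U n i (x i)))" for j x
  define Z where "Z j v = Y j (restrict (\<lambda>i. g i v) (Kx j))" for j v
  let ?L = "insert None (Some ` J)"
  have ind: "Omega.indep_vars (\<lambda>j. PiM (Kx j) (\<lambda>_. borel)) (\<lambda>j v. restrict (\<lambda>i. g i v) (Kx j)) ?L"
  proof (rule Omega.indep_vars_restrict[OF g_indep])
    show "Kx j \<subseteq> idx J0" if "j \<in> ?L" for j using that J by (auto simp: Kx_def)
    show "disjoint_family_on Kx ?L" by (auto simp: disjoint_family_on_def Kx_def)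
  qed
  have Ym: "Y j \<in> borel_measurable (PiM (Kx j) (\<lambda>_. borel))" if "j \<in> ?L" for j
  proof (cases j)
    case None
    have [measurable]: "rest n W J \<in> borel_measurable (PiM (idx J0 - J) (\<lambda>_. borel))" by (rule rest_measurable)
    show ?thesis unfolding None Y_def Kx_def option.case by measurable
  next
    case (Some i)
    then have [measurable]: "A i \<in> sets borel" using that A by auto
    have [measurable]: "(\<lambda>x. x i) \<in> borel_measurable (PiM {i} (\<lambda>_. borel))" by (rule measurable_component_singleton) simp
    show ?thesis unfolding Some Y_def Kx_def option.case by measurable
  qed
  have "Omega.indep_vars (\<lambda>_. borel) Z ?L"
    unfolding Z_def[abs_def] by (rule Omega.indep_vars_compose2[OF ind Ym])
  then have prod: "(\<integral>\<^sup>+v. (\<Prod>j\<in>?L. Z j v) \<partial>\<Omega>) = (\<Prod>j\<in>?L. \<integral>\<^sup>+v. Z j v \<partial>\<Omega>)"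
    using J by (intro Omega.indep_vars_nn_integral) auto
  have split: "(\<Prod>j\<in>?L. h j) = (\<Prod>i\<in>J. h (Some i)) * h None" for h :: "(nat \<times> nat) option \<Rightarrow> ennreal"
    using J by (subst prod.insert) (auto simp: prod.reindex mult.commute)
  have "(\<integral>\<^sup>+v. ennreal (exp (loglik n W v)) * (\<Prod>i\<in>J. indicator (A i) (U n i (g i v))) \<partial>\<Omega>) = (\<integral>\<^sup>+v. (\<Prod>j\<in>?L. Z j v) \<partial>\<Omega>)"
  proof (rule nn_integral_cong_AE)
    show "AE v in \<Omega>. ennreal (exp (loglik n W v)) * (\<Prod>i\<in>J. indicator (A i) (U n i (g i v))) = (\<Prod>j\<in>?L. Z j v)"
      using W AE_U_finite[of n]
    proof eventually_elim
      case (elim v)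
      have "ennreal (exp (loglik n W v)) = (\<Prod>i\<in>J. ennreal (tilt (W i) (U n i (g i v)))) *
          ennreal (exp (rest n W J (restrict (\<lambda>i. g i v) (idx J0 - J))))"
        unfolding loglik_split[OF loglik_tendsto[OF elim] J] exp_add exp_sum[OF J(1)]
        by (simp add: ennreal_mult prod_nonneg prod_ennreal[symmetric] tilt_def)
      then show ?case unfolding split by (simp add: Z_def Y_def Kx_def prod.distrib ac_simps)
    qed
  qed
  also note prod
  also note split
  finally show ?thesis by (simp add: Z_def Y_def Kx_def coord_mass_def)
qed

text \<open>The contribution \<open>?R\<close> of the remaining coordinates is common to the
  numerator and the evidence. It is never divided out by itself: writing each coordinate mass as
  posterior probability times total mass turns the numerator into the product of probabilities times
  the evidence, and only the evidence has to be finite and positive.\<close>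

lemma post_box:
  assumes n: "n > 0" and W: "regular n W" and J: "finite J" "J \<subseteq> idx J0" and A: "\<And>i. i \<in> J \<Longrightarrow> A i \<in> sets borel"
  shows "emeasure (post n W) {f. \<forall>i\<in>J. resc n f i \<in> A i} = (\<Prod>i\<in>J. emeasure (coord_post (\<tau> n i) (b i) (W i)) (A i))"
proof -
  have Wr: "W \<in> space WN" "AE v in \<Omega>. noise_series n W v < \<infinity>" "evidence n W < \<infinity>"
    using W by (auto simp: regular_def)
  let ?R = "\<integral>\<^sup>+v. ennreal (exp (rest n W J (restrict (\<lambda>i. g i v) (idx J0 - J)))) \<partial>\<Omega>"
  have [measurable]: "(\<lambda>f. resc n f i) \<in> borel_measurable borel" for i
    unfolding resc_def by measurable
  have S: "{f. \<forall>i\<in>J. resc n f i \<in> A i} \<in> sets borel"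
  proof -
    have "{f \<in> space borel. \<forall>i\<in>J. resc n f i \<in> A i} \<in> sets borel"
      using J(1) A by (intro sets.sets_Collect_finite_All) auto
    then show ?thesis by simp
  qed
  have "(\<integral>\<^sup>+v. ennreal (exp (loglik n W v)) * indicator {f. \<forall>i\<in>J. resc n f i \<in> A i} (G v) \<partial>\<Omega>) =
     (\<integral>\<^sup>+v. ennreal (exp (loglik n W v)) * (\<Prod>i\<in>J. indicator (A i) (U n i (g i v))) \<partial>\<Omega>)"
  proof (rule nn_integral_cong_AE)
    show "AE v in \<Omega>. ennreal (exp (loglik n W v)) * indicator {f. \<forall>i\<in>J. resc n f i \<in> A i} (G v) =
      ennreal (exp (loglik n W v)) * (\<Prod>i\<in>J. indicator (A i) (U n i (g i v)))"
      using AE_G_finite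
    proof eventually_elim
      case (elim v)
      have "indicator {f. \<forall>i\<in>J. resc n f i \<in> A i} (G v) = (\<Prod>i\<in>J. indicator (A i) (U n i (g i v)) :: ennreal)"
      proof (cases "\<forall>i\<in>J. U n i (g i v) \<in> A i")
        case True
        then show ?thesis using J(2) by (auto simp: indicator_def resc_G[OF elim] subset_iff)
      next
        case False
        then obtain i where "i \<in> J" "U n i (g i v) \<notin> A i" by blast
        then have "(\<Prod>i\<in>J. indicator (A i) (U n i (g i v)) :: ennreal) = 0"
          by (intro prod_zero[OF J(1)] bexI[of _ i]) auto
        moreover have "resc n (G v) i \<notin> A i"
          using \<open>U n i (g i v) \<notin> A i\<close> by (simp add: resc_G[OF elim subsetD[OF J(2) \<open>i \<in> J\<close>]])
        then have "G v \<notin> {f. \<forall>i\<in>J. resc n f i \<in> A i}"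
          using \<open>i \<in> J\<close> by blast
        ultimately show ?thesis by simp
      qed
      then show ?case by simp
    qed
  qed
  also have "\<dots> = (\<Prod>i\<in>J. coord_mass n W i (A i)) * ?R" by (rule nn_integral_factor[OF J A Wr(2)])
  finally have num: "emeasure (post n W) {f. \<forall>i\<in>J. resc n f i \<in> A i} = (\<Prod>i\<in>J. coord_mass n W i (A i)) * ?R / evidence n W"
    using post_emeasure[OF n W S] by simp
  have den: "evidence n W = (\<Prod>i\<in>J. coord_mass n W i UNIV) * ?R"
    using nn_integral_factor[OF J _ Wr(2), of "\<lambda>_. UNIV"] by (simp add: evidence_def)
  obtain E where E: "E > 0" "evidence n W = ennreal E"
    using Wr(3) evidence_pos[OF Wr(1), of n] by (cases "evidence n W") auto
  have qU: "coord_mass n W i UNIV = ennreal (kern_mass (\<tau> n i) (b i) (W i) / \<tau> n i)" if "i \<in> idx J0" for i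
  proof -
    have "ennreal (\<tau> n i) * coord_mass n W i UNIV = ennreal (kern_mass (\<tau> n i) (b i) (W i))"
      using coord_mass_eq[OF that n, of UNIV W] unfolding kern_mass_def
      by (simp add: nn_integral_eq_integral[OF kern_integrable])
    also have "\<dots> = ennreal (\<tau> n i) * ennreal (kern_mass (\<tau> n i) (b i) (W i) / \<tau> n i)"
      using \<tau>_pos[OF n, of i] kern_mass_pos by (simp add: ennreal_mult[symmetric] less_imp_le)
    finally show ?thesis
      using \<tau>_pos[OF n, of i] by (simp add: ennreal_mult_cancel_left ennreal_eq_0_iff not_le)
  qed
  have q: "coord_mass n W i (A i) = emeasure (coord_post (\<tau> n i) (b i) (W i)) (A i) * coord_mass n W i UNIV" if "i \<in> J" for i
  proof -
    have i: "i \<in> idx J0" using that J by auto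
    have "ennreal (\<tau> n i) * (emeasure (coord_post (\<tau> n i) (b i) (W i)) (A i) * coord_mass n W i UNIV) =
       emeasure (coord_post (\<tau> n i) (b i) (W i)) (A i) * ennreal (kern_mass (\<tau> n i) (b i) (W i))"
      using \<tau>_pos[OF n, of i] kern_mass_pos
      unfolding qU[OF i] by (subst mult.left_commute, subst ennreal_mult[symmetric]) (auto simp: less_imp_le)
    also have "\<dots> = ennreal (\<tau> n i) * coord_mass n W i (A i)"
      unfolding coord_mass_eq[OF i n A[OF that]] emeasure_coord_post[OF A[OF that]]
      using kern_mass_pos by (simp add: ennreal_divide_times mult_divide_eq_ennreal ennreal_eq_0_iff not_le)
    finally show ?thesis
      using \<tau>_pos[OF n, of i] by (simp add: ennreal_mult_cancel_left ennreal_eq_0_iff not_le)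
  qed
  have "(\<Prod>i\<in>J. coord_mass n W i (A i)) * ?R = (\<Prod>i\<in>J. emeasure (coord_post (\<tau> n i) (b i) (W i)) (A i)) * evidence n W"
    unfolding den by (simp add: q prod.distrib mult.assoc)
  then show ?thesis
    unfolding num using E by (simp add: mult_divide_eq_ennreal)
qed

definition coord_law :: "nat \<Rightarrow> (nat \<times> nat \<Rightarrow> real) \<Rightarrow> nat \<times> nat \<Rightarrow> real measure" where
  "coord_law n W i = coord_post (\<tau> n i) (b i) (W i)"

lemma resc_measurable [measurable]: "(\<lambda>f. resc n f i) \<in> borel_measurable borel"
  unfolding resc_def by measurable

lemma product_prob_space_coord_law: "product_prob_space (coord_law n W)"
  unfolding coord_law_def product_prob_space_def product_prob_space_axioms_def product_sigma_finite_def
  by (simp add: prob_space_coord_post prob_space_imp_sigma_finite)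

text \<open>Equality of the laws is tested on cylinder sets with finitely many constraints. Since it
  holds for each regular noise sequence, the posterior can afterwards be handled as a product of
  explicit laws on the line.\<close>

theorem post_product:
  assumes n: "n > 0" and W: "regular n W"
  shows "distr (post n W) (PiM (idx J0) (\<lambda>_. borel)) (\<lambda>f. \<lambda>i\<in>idx J0. resc n f i) = PiM (idx J0) (coord_law n W)"
proof -
  interpret C: product_prob_space "coord_law n W" "idx J0" by (rule product_prob_space_coord_law)
  have sets: "sets (coord_law n W i) = sets borel" for i by (simp add: coord_law_def)
  have m: "(\<lambda>f. \<lambda>i\<in>idx J0. resc n f i) \<in> measurable (post n W) (PiM (idx J0) (\<lambda>_. borel))"
    by (intro measurable_restrict) measurable
  show ?thesis
  proof (rule C.PiM_eq)
    show "sets (distr (post n W) (PiM (idx J0) (\<lambda>_. borel)) (\<lambda>f. \<lambda>i\<in>idx J0. resc n f i)) = sets (PiM (idx J0) (coord_law n W))"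
      by (simp add: sets cong: sets_PiM_cong)
    fix J F assume J: "finite J" "J \<subseteq> idx J0" and F: "\<And>j. j \<in> J \<Longrightarrow> F j \<in> sets (coord_law n W j)"
    have emb: "prod_emb (idx J0) (coord_law n W) J (PiE J F) = prod_emb (idx J0) (\<lambda>_. borel) J (PiE J F)"
      by (simp add: prod_emb_def coord_law_def)
    have "emeasure (distr (post n W) (PiM (idx J0) (\<lambda>_. borel)) (\<lambda>f. \<lambda>i\<in>idx J0. resc n f i))
        (prod_emb (idx J0) (coord_law n W) J (PiE J F)) =
      emeasure (post n W) ((\<lambda>f. \<lambda>i\<in>idx J0. resc n f i) -` prod_emb (idx J0) (\<lambda>_. borel) J (PiE J F) \<inter> space (post n W))"
      unfolding emb using m J F by (intro emeasure_distr sets_PiM_I) (auto simp: sets)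
    also have "(\<lambda>f. \<lambda>i\<in>idx J0. resc n f i) -` prod_emb (idx J0) (\<lambda>_. borel) J (PiE J F) \<inter> space (post n W) =
        {f. \<forall>i\<in>J. resc n f i \<in> F i}"
      using Int_absorb1[OF J(2)] by (auto simp: prod_emb_def PiE_iff restrict_restrict)
    also have "emeasure (post n W) \<dots> = (\<Prod>j\<in>J. emeasure (coord_law n W j) (F j))"
      unfolding coord_law_def using F by (intro post_box[OF n W J]) (simp add: sets)
    finally show "emeasure (distr (post n W) (PiM (idx J0) (\<lambda>_. borel)) (\<lambda>f. \<lambda>i\<in>idx J0. resc n f i))
        (prod_emb (idx J0) (coord_law n W) J (PiE J F)) = (\<Prod>j\<in>J. emeasure (coord_law n W j) (F j))" .
  qed
qed

end

section \<open>Posterior moments\<close>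

context series_model
begin

lemma nn_integral_post_PiM:
  assumes n: "n > 0" and W: "regular n W" and h: "h \<in> borel_measurable (PiM (idx J0) (\<lambda>_. borel))"
  shows "(\<integral>\<^sup>+f. h (\<lambda>i\<in>idx J0. resc n f i) \<partial>post n W) = (\<integral>\<^sup>+x. h x \<partial>PiM (idx J0) (coord_law n W))"
proof -
  have m: "(\<lambda>f. \<lambda>i\<in>idx J0. resc n f i) \<in> measurable (post n W) (PiM (idx J0) (\<lambda>_. borel))"
    by (intro measurable_restrict) measurable
  show ?thesis unfolding post_product[OF n W, symmetric] by (subst nn_integral_distr[OF m]) (use h in auto)
qed

lemma nn_integral_post_coord:
  assumes n: "n > 0" and W: "regular n W" and i: "i \<in> idx J0" and h: "h \<in> borel_measurable borel"
  shows "(\<integral>\<^sup>+f. h (resc n f i) \<partial>post n W) = (\<integral>\<^sup>+u. h u \<partial>coord_post (\<tau> n i) (b i) (W i))"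
proof -
  interpret C: product_prob_space "coord_law n W" "idx J0" by (rule product_prob_space_coord_law)
  have "(\<integral>\<^sup>+f. h (resc n f i) \<partial>post n W) = (\<integral>\<^sup>+f. h ((\<lambda>i\<in>idx J0. resc n f i) i) \<partial>post n W)"
    using i by simp
  also have "\<dots> = (\<integral>\<^sup>+x. h (x i) \<partial>PiM (idx J0) (coord_law n W))"
    using h i by (intro nn_integral_post_PiM[OF n W]) (rule measurable_compose[OF measurable_component_singleton[of i "idx J0" "\<lambda>_. borel"]], auto)
  also have "\<dots> = (\<integral>\<^sup>+u. h u \<partial>coord_law n W i)"
    using h i by (intro C.nn_integral_PiM_component) (auto simp: coord_law_def measurable_cong_sets[OF sets_coord_post refl])
  finally show ?thesis by (simp add: coord_law_def)
qed

definition msq :: "nat \<Rightarrow> (nat \<times> nat \<Rightarrow> real) \<Rightarrow> nat \<times> nat \<Rightarrow> real" where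
  "msq n W i = coord_msq (\<tau> n i) (b i) (W i)"

definition vmean :: "nat \<Rightarrow> (nat \<times> nat \<Rightarrow> real) \<Rightarrow> nat \<times> nat \<Rightarrow> real" where
  "vmean n W i = coord_mean (\<tau> n i) (b i) (W i)"

text \<open>Bound for the posterior mean of a weighted square norm, kept as a function of the noise:
  Markov's inequality is applied under the posterior and once more under the noise.\<close>

definition pmsq :: "nat \<Rightarrow> (nat \<Rightarrow> real) \<Rightarrow> (nat \<times> nat \<Rightarrow> real) \<Rightarrow> ennreal" where
  "pmsq n w W = (\<Sum>l. ennreal (w l * (\<Sum>k\<in>lev J0 l. msq n W (l, k))))"

lemma msq_measurable [measurable]: "i \<in> idx J0 \<Longrightarrow> (\<lambda>W. msq n W i) \<in> borel_measurable WN"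
  unfolding msq_def by (rule measurable_compose[OF white_noise_component coord_msq_measurable])

lemma vmean_measurable [measurable]: "i \<in> idx J0 \<Longrightarrow> (\<lambda>W. vmean n W i) \<in> borel_measurable WN"
  unfolding vmean_def by (rule measurable_compose[OF white_noise_component coord_mean_measurable])

lemma msq_nonneg [simp]: "msq n W i \<ge> 0" by (simp add: msq_def coord_msq_nonneg)

lemma pmsq_measurable [measurable]: "pmsq n w \<in> borel_measurable WN"
proof -
  have [measurable]: "(\<lambda>W. \<Sum>k\<in>lev J0 l. msq n W (l, k)) \<in> borel_measurable WN" for l
    by (intro borel_measurable_sum msq_measurable) (simp add: lev_def)
  show ?thesis unfolding pmsq_def[abs_def] by measurable
qed

lemma post_coord_sq:
  assumes "n > 0" "regular n W" "i \<in> idx J0"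
  shows "(\<integral>\<^sup>+f. ennreal ((resc n f i)\<^sup>2) \<partial>post n W) = ennreal (msq n W i)"
  using nn_integral_post_coord[OF assms, of "\<lambda>u. ennreal (u\<^sup>2)"]
  by (simp add: msq_def coord_msq_def nn_integral_eq_integral[OF coord_post_sq_integrable])

text \<open>A variance is at most any second moment. Thus \<open>pmsq\<close> controls both
  centrings: at the truth for the smoothness norm, at the posterior mean for the ball in
  H(\<delta>).\<close>

lemma post_coord_sq_centered:
  assumes "n > 0" "regular n W" "i \<in> idx J0"
  shows "(\<integral>\<^sup>+f. ennreal ((resc n f i - vmean n W i)\<^sup>2) \<partial>post n W) \<le> ennreal (msq n W i)"
proof -
  interpret prob_space "coord_post (\<tau> n i) (b i) (W i)" by (rule prob_space_coord_post)
  note int = coord_post_integrable[of "\<tau> n i" "b i" "W i"] coord_post_sq_integrable[of "\<tau> n i" "b i" "W i"]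
  have "(\<integral>\<^sup>+f. ennreal ((resc n f i - vmean n W i)\<^sup>2) \<partial>post n W) =
      (\<integral>\<^sup>+u. ennreal ((u - vmean n W i)\<^sup>2) \<partial>coord_post (\<tau> n i) (b i) (W i))"
    by (rule nn_integral_post_coord[OF assms]) simp
  also have "\<dots> = ennreal (variance (\<lambda>u. u))"
    unfolding vmean_def coord_mean_def
  proof (intro nn_integral_eq_integral)
    show "integrable (coord_post (\<tau> n i) (b i) (W i)) (\<lambda>u. (u - expectation (\<lambda>u. u))\<^sup>2)"
      unfolding power2_diff
      by (intro Bochner_Integration.integrable_add Bochner_Integration.integrable_diff int integrable_mult_left integrable_mult_right) auto
  qed simp
  also have "variance (\<lambda>u. u) \<le> msq n W i"
    using variance_eq[OF int] by (simp add: msq_def coord_msq_def)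
  finally show ?thesis by (simp add: ennreal_leI order_trans)
qed

lemma post_wsum_le:
  assumes w: "\<And>l. w l \<ge> 0"
    and [measurable]: "\<And>i. i \<in> idx J0 \<Longrightarrow> (\<lambda>f. c f i) \<in> borel_measurable borel"
    and le: "\<And>i. i \<in> idx J0 \<Longrightarrow> (\<integral>\<^sup>+f. ennreal ((c f i)\<^sup>2) \<partial>post n W) \<le> ennreal (msq n W i)"
  shows "(\<integral>\<^sup>+f. wsum J0 w (c f) \<partial>post n W) \<le> pmsq n w W"
proof -
  have idx: "(l, k) \<in> idx J0" if "k \<in> lev J0 l" for l k using that by (simp add: lev_def)
  have [measurable]: "(\<lambda>f. \<Sum>k\<in>lev J0 l. (c f (l, k))\<^sup>2) \<in> borel_measurable borel" for l
    by (intro borel_measurable_sum borel_measurable_power) (use idx in auto)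
  have "(\<integral>\<^sup>+f. wsum J0 w (c f) \<partial>post n W) = (\<Sum>l. \<integral>\<^sup>+f. ennreal (w l * (\<Sum>k\<in>lev J0 l. (c f (l, k))\<^sup>2)) \<partial>post n W)"
    unfolding wsum_def by (rule nn_integral_suminf) measurable
  also have "\<dots> \<le> pmsq n w W" unfolding pmsq_def
  proof (intro suminf_le summableI)
    fix l
    have "(\<integral>\<^sup>+f. ennreal (w l * (\<Sum>k\<in>lev J0 l. (c f (l, k))\<^sup>2)) \<partial>post n W) =
        (\<integral>\<^sup>+f. ennreal (w l) * (\<Sum>k\<in>lev J0 l. ennreal ((c f (l, k))\<^sup>2)) \<partial>post n W)"
      using w by (simp add: ennreal_mult sum_nonneg)
    also have "\<dots> = ennreal (w l) * (\<Sum>k\<in>lev J0 l. \<integral>\<^sup>+f. ennreal ((c f (l, k))\<^sup>2) \<partial>post n W)"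
      using idx by (subst nn_integral_cmult, simp, subst nn_integral_sum) auto
    also have "\<dots> \<le> ennreal (w l) * (\<Sum>k\<in>lev J0 l. ennreal (msq n W (l, k)))"
      by (intro mult_left_mono sum_mono le idx) auto
    also have "\<dots> = ennreal (w l * (\<Sum>k\<in>lev J0 l. msq n W (l, k)))"
      using w by (simp add: ennreal_mult sum_nonneg)
    finally show "(\<integral>\<^sup>+f. ennreal (w l * (\<Sum>k\<in>lev J0 l. (c f (l, k))\<^sup>2)) \<partial>post n W) \<le>
        ennreal (w l * (\<Sum>k\<in>lev J0 l. msq n W (l, k)))" .
  qed
  finally show ?thesis .
qed

definition Cm :: real where
  "Cm = (SOME C. C > 0 \<and> (\<forall>\<tau> b. \<tau> > 0 \<longrightarrow> \<bar>b\<bar> \<le> B \<longrightarrow>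
    (\<integral>\<^sup>+y. ennreal (coord_msq \<tau> b y) \<partial>std_normal) \<le> ennreal (C * min 1 (\<tau>\<^sup>2))))"

lemma Cm: "Cm > 0" "\<tau>' > 0 \<Longrightarrow> \<bar>b'\<bar> \<le> B \<Longrightarrow> (\<integral>\<^sup>+y. ennreal (coord_msq \<tau>' b' y) \<partial>std_normal) \<le> ennreal (Cm * min 1 (\<tau>'\<^sup>2))"
proof -
  have "\<exists>C. C > 0 \<and> (\<forall>\<tau> b. \<tau> > 0 \<longrightarrow> \<bar>b\<bar> \<le> B \<longrightarrow>
    (\<integral>\<^sup>+y. ennreal (coord_msq \<tau> b y) \<partial>std_normal) \<le> ennreal (C * min 1 (\<tau>\<^sup>2)))"
    using coord_msq_mean[of B] by metis
  from someI_ex[OF this, folded Cm_def]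
  show "Cm > 0" "\<tau>' > 0 \<Longrightarrow> \<bar>b'\<bar> \<le> B \<Longrightarrow> (\<integral>\<^sup>+y. ennreal (coord_msq \<tau>' b' y) \<partial>std_normal) \<le> ennreal (Cm * min 1 (\<tau>'\<^sup>2))"
    by auto
qed

lemma nn_integral_WN_component:
  assumes "i \<in> idx J0" "h \<in> borel_measurable borel"
  shows "(\<integral>\<^sup>+W. h (W i) \<partial>WN) = (\<integral>\<^sup>+y. h y \<partial>std_normal)"
  unfolding white_noise_eq by (rule WN.nn_integral_PiM_component) (use assms in auto)

lemma mean_msq:
  assumes n: "n > 0" and i: "i \<in> idx J0"
  shows "(\<integral>\<^sup>+W. ennreal (msq n W i) \<partial>WN) \<le> ennreal (Cm * min 1 ((\<tau> n i)\<^sup>2))"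
  unfolding msq_def using nn_integral_WN_component[OF i, of "\<lambda>y. ennreal (coord_msq (\<tau> n i) (b i) y)"]
    Cm(2)[OF \<tau>_pos[OF n, of i] b_bound[OF i]] by simp

lemma \<tau>_sq: "(\<tau> n i)\<^sup>2 = real n * (sg i)\<^sup>2"
  by (simp add: \<tau>_def power_mult_distrib)

lemma mean_pmsq:
  assumes n: "n > 0" and w: "\<And>l. w l \<ge> 0"
  shows "(\<integral>\<^sup>+W. pmsq n w W \<partial>WN) \<le> (\<Sum>l. ennreal (w l * (2 * 2 ^ l * (Cm * min 1 (real n * (sg (l, 0))\<^sup>2)))))"
proof -
  have idx: "(l, k) \<in> idx J0" if "k \<in> lev J0 l" for l k using that by (simp add: lev_def)
  have [measurable]: "(\<lambda>W. \<Sum>k\<in>lev J0 l. msq n W (l, k)) \<in> borel_measurable WN" for l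
    by (intro borel_measurable_sum msq_measurable idx)
  have "(\<integral>\<^sup>+W. pmsq n w W \<partial>WN) = (\<Sum>l. \<integral>\<^sup>+W. ennreal (w l * (\<Sum>k\<in>lev J0 l. msq n W (l, k))) \<partial>WN)"
    unfolding pmsq_def by (rule nn_integral_suminf) measurable
  also have "\<dots> \<le> (\<Sum>l. ennreal (w l * (2 * 2 ^ l * (Cm * min 1 (real n * (sg (l, 0))\<^sup>2)))))"
  proof (intro suminf_le summableI)
    fix l
    let ?m = "Cm * min 1 (real n * (sg (l, 0))\<^sup>2)"
    have m0: "?m \<ge> 0" using Cm(1) by simp
    have "(\<integral>\<^sup>+W. ennreal (w l * (\<Sum>k\<in>lev J0 l. msq n W (l, k))) \<partial>WN) =
        (\<integral>\<^sup>+W. ennreal (w l) * (\<Sum>k\<in>lev J0 l. ennreal (msq n W (l, k))) \<partial>WN)"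
      using w by (simp add: ennreal_mult sum_nonneg)
    also have "\<dots> = ennreal (w l) * (\<Sum>k\<in>lev J0 l. \<integral>\<^sup>+W. ennreal (msq n W (l, k)) \<partial>WN)"
    proof -
      have [measurable]: "(\<lambda>W. ennreal (msq n W (l, k))) \<in> borel_measurable WN" if "k \<in> lev J0 l" for k
        using msq_measurable[OF idx[OF that]] by measurable
      show ?thesis by (subst nn_integral_cmult, measurable, subst nn_integral_sum) (simp_all add: msq_measurable idx)
    qed
    also have "\<dots> \<le> ennreal (w l) * (\<Sum>k\<in>lev J0 l. ennreal ?m)"
    proof (intro mult_left_mono sum_mono)
      fix k assume k: "k \<in> lev J0 l"
      have "(\<tau> n (l, k))\<^sup>2 = real n * (sg (l, 0))\<^sup>2" by (simp add: \<tau>_sq sg_def)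
      then show "(\<integral>\<^sup>+W. ennreal (msq n W (l, k)) \<partial>WN) \<le> ennreal ?m"
        using mean_msq[OF n idx[OF k]] by simp
    qed simp
    also have "\<dots> = ennreal (w l * (real (card (lev J0 l)) * ?m))"
      using w m0 by (simp add: ennreal_mult ennreal_of_nat_eq_real_of_nat)
    also have "\<dots> \<le> ennreal (w l * (2 * 2 ^ l * ?m))"
      using w m0 J0_ge by (intro ennreal_leI mult_left_mono mult_right_mono card_lev_le) auto
    finally show "(\<integral>\<^sup>+W. ennreal (w l * (\<Sum>k\<in>lev J0 l. msq n W (l, k))) \<partial>WN) \<le> ennreal (w l * (2 * 2 ^ l * ?m))" .
  qed
  finally show ?thesis .
qed

text \<open>Replacing min 1 (n sg^2) by n sg^2 is wasteful in n but leaves a geometric series in the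
  level; only finiteness at each n is at stake.\<close>

lemma AE_pmsq_one: assumes n: "n > 0" shows "AE W in WN. pmsq n (\<lambda>_. 1) W < \<infinity>"
proof -
  have "(\<integral>\<^sup>+W. pmsq n (\<lambda>_. 1) W \<partial>WN) \<le> (\<Sum>l. ennreal (1 * (2 * 2 ^ l * (Cm * min 1 (real n * (sg (l, 0))\<^sup>2)))))"
    by (rule mean_pmsq[OF n]) simp
  also have "\<dots> \<le> (\<Sum>l. ennreal (2 * Cm * real n * (rt l)\<^sup>2))"
  proof (intro suminf_le summableI ennreal_leI)
    fix l
    have "1 * (2 * 2 ^ l * (Cm * min 1 (real n * (sg (l, 0))\<^sup>2))) \<le> 2 * 2 ^ l * (Cm * (real n * (sg (l, 0))\<^sup>2))"
      using Cm(1) by (simp add: mult_left_mono)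
    also have "\<dots> = 2 * Cm * real n * (rt l)\<^sup>2" by (simp add: sg_sq[of l 0, symmetric] ac_simps)
    finally show "1 * (2 * 2 ^ l * (Cm * min 1 (real n * (sg (l, 0))\<^sup>2))) \<le> 2 * Cm * real n * (rt l)\<^sup>2" .
  qed
  also have "\<dots> < \<infinity>"
    using Cm(1) by (intro suminf_ennreal_finite summable_mult summable_rt_sq) (simp add: less_imp_le)
  finally have "(\<integral>\<^sup>+W. pmsq n (\<lambda>_. 1) W \<partial>WN) \<noteq> \<infinity>" by (rule less_imp_neq)
  then have "AE W in WN. pmsq n (\<lambda>_. 1) W \<noteq> \<infinity>" by (intro nn_integral_PInf_AE) measurable
  then show ?thesis by eventually_elim (simp only: infinity_ennreal_def less_top[symmetric] not_False_eq_True)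
qed

text \<open>On regular noise the posterior is an explicit product; the finite second moment makes
  its Bochner mean a convergent integral.\<close>

definition good :: "nat \<Rightarrow> (nat \<times> nat \<Rightarrow> real) \<Rightarrow> bool" where
  "good n W \<longleftrightarrow> regular n W \<and> pmsq n (\<lambda>_. 1) W < \<infinity>"

lemma AE_good: "n > 0 \<Longrightarrow> AE W in WN. good n W"
  using AE_regular[of n] AE_pmsq_one[of n] by (auto simp: good_def)

lemma norm_diff_F0:
  assumes n: "n > 0"
  shows "ennreal ((norm (f - F0))\<^sup>2) = ennreal (1 / real n) * wsum J0 (\<lambda>_. 1) (resc n f)"
proof -
  have "ennreal ((norm (f - F0))\<^sup>2) = wsum J0 (\<lambda>_. 1) (coeff \<psi> (f - F0))"
    unfolding coeff_inner[abs_def] by (rule parseval[symmetric])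
  also have "\<dots> = wsum J0 (\<lambda>_. 1) (\<lambda>i. (1 / sqrt (real n)) * resc n f i)"
    using n by (intro wsum_cong) (simp add: coeff_diff resc_def)
  also have "\<dots> = ennreal ((1 / sqrt (real n))\<^sup>2) * wsum J0 (\<lambda>_. 1) (resc n f)"
    by (rule wsum_scale) simp
  finally show ?thesis using n by (simp add: power_divide)
qed

lemma post_integrable:
  assumes n: "n > 0" and W: "good n W"
  shows "integrable (post n W) (\<lambda>f. f)"
proof -
  have Wr: "regular n W" "pmsq n (\<lambda>_. 1) W < \<infinity>" using W by (auto simp: good_def)
  interpret prob_space "post n W" by (rule prob_space_post[OF n Wr(1)])
  have "(\<integral>\<^sup>+f. ennreal ((norm (f - F0))\<^sup>2) \<partial>post n W) = ennreal (1 / real n) * (\<integral>\<^sup>+f. wsum J0 (\<lambda>_. 1) (resc n f) \<partial>post n W)"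
    unfolding norm_diff_F0[OF n] by (rule nn_integral_cmult) measurable
  also have "(\<integral>\<^sup>+f. wsum J0 (\<lambda>_. 1) (resc n f) \<partial>post n W) \<le> pmsq n (\<lambda>_. 1) W"
    by (rule post_wsum_le) (auto simp: post_coord_sq[OF n Wr(1)])
  then have "ennreal (1 / real n) * (\<integral>\<^sup>+f. wsum J0 (\<lambda>_. 1) (resc n f) \<partial>post n W) < \<infinity>"
    using Wr(2) by (auto simp: ennreal_mult_less_top)
  finally have "(\<integral>\<^sup>+f. ennreal ((norm (f - F0))\<^sup>2) \<partial>post n W) < \<infinity>" .
  then have "integrable (post n W) (\<lambda>f. (norm (f - F0))\<^sup>2)"
    by (intro integrableI_bounded) auto
  then have "integrable (post n W) (\<lambda>f. norm (f - F0))"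
    by (rule square_integrable_imp_integrable[rotated]) measurable
  then have "integrable (post n W) (\<lambda>f. norm (f - F0) + norm F0)" by simp
  then show ?thesis
  proof (rule Bochner_Integration.integrable_bound)
    show "AE f in post n W. norm f \<le> norm (norm (f - F0) + norm F0)"
    proof (rule AE_I2)
      fix f
      show "norm f \<le> norm (norm (f - F0) + norm F0)"
        using norm_triangle_ineq[of "f - F0" F0] by simp
    qed
  qed measurable
qed

text \<open>Coefficients are continuous functionals and commute with the Bochner integral, so the
  centre of the credible ball is computed one coordinate at a time.\<close>

lemma resc_posterior_mean:
  assumes n: "n > 0" and W: "good n W" and i: "i \<in> idx J0"
  shows "resc n (posterior_mean \<psi> J0 pri n (X n W)) i = vmean n W i"
proof -
  have Wr: "regular n W" using W by (auto simp: good_def)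
  interpret prob_space "post n W" by (rule prob_space_post[OF n Wr])
  interpret C: product_prob_space "coord_law n W" "idx J0" by (rule product_prob_space_coord_law)
  note int = post_integrable[OF n W]
  have "coeff \<psi> (posterior_mean \<psi> J0 pri n (X n W)) i = (\<integral>f. coeff \<psi> f i \<partial>post n W)"
    unfolding coeff_inner posterior_mean_def by (rule integral_inner_right[symmetric]) (rule int)
  moreover have "integrable (post n W) (\<lambda>f. coeff \<psi> f i)"
    unfolding coeff_inner by (rule integrable_inner_right) (rule int)
  ultimately have "resc n (posterior_mean \<psi> J0 pri n (X n W)) i = (\<integral>f. resc n f i \<partial>post n W)"
    unfolding resc_def using prob_space by simp
  also have "\<dots> = (\<integral>f. (\<lambda>i\<in>idx J0. resc n f i) i \<partial>post n W)" using i by simp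
  also have "\<dots> = (\<integral>x. x i \<partial>distr (post n W) (PiM (idx J0) (\<lambda>_. borel)) (\<lambda>f. \<lambda>i\<in>idx J0. resc n f i))"
    using i by (intro integral_distr[symmetric] measurable_restrict measurable_component_singleton) (auto simp: resc_measurable)
  also have "\<dots> = (\<integral>x. x i \<partial>PiM (idx J0) (coord_law n W))" unfolding post_product[OF n Wr] ..
  also have "\<dots> = (\<integral>u. u \<partial>distr (PiM (idx J0) (coord_law n W)) (coord_law n W i) (\<lambda>x. x i))"
    by (rule integral_distr[symmetric, OF measurable_component_singleton[OF i]])
      (simp add: coord_law_def measurable_cong_sets[OF sets_coord_post refl])
  also have "\<dots> = vmean n W i" unfolding C.PiM_component[OF i] by (simp add: coord_law_def vmean_def coord_mean_def)
  finally show ?thesis .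
qed

section \<open>The weights of the two norms\<close>

definition wS :: "nat \<Rightarrow> real" where
  "wS l = (2 ^ l) powr (2 * \<gamma>) * ln (2 ^ l) powr (- 2)"

definition wH :: "real \<Rightarrow> nat \<Rightarrow> real" where
  "wH \<delta> l = (2 ^ l) powr (- 1) * ln (2 ^ l) powr (- 2 * \<delta>)"

lemma wS_nonneg [simp]: "wS l \<ge> 0" by (simp add: wS_def)

lemma wH_nonneg [simp]: "wH \<delta> l \<ge> 0" by (simp add: wH_def)

lemma wH_size: "wH \<delta> l * 2 ^ l = ln 2 powr (- 2 * \<delta>) * real l powr (- 2 * \<delta>)"
proof -
  have "(2 ^ l :: real) powr (- 1) * 2 ^ l = 1" by (simp add: powr_minus)
  moreover have "ln (2 ^ l :: real) powr (- 2 * \<delta>) = ln 2 powr (- 2 * \<delta>) * real l powr (- 2 * \<delta>)"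
    by (simp add: ln_realpow powr_mult mult.commute)
  ultimately show ?thesis unfolding wH_def by (simp add: mult.commute mult.left_commute)
qed

text \<open>The 2 ^ l coordinates of a level cancel the power weight and leave l powr (- 2
  \<delta>). This is where \<delta> > 1 / 2 enters: white noise has finite mean square norm in
  H(\<delta>).\<close>

lemma summable_wH:
  assumes "\<delta> > 1 / 2" shows "summable (\<lambda>l. wH \<delta> l * 2 ^ l)"
  unfolding wH_size using assms by (intro summable_mult) (simp add: summable_real_powr_iff)

lemma wH_pos: "l \<ge> 1 \<Longrightarrow> wH \<delta> l > 0"
  by (simp add: wH_def ln_realpow)

lemma sg0_sq: "(sg (l, 0))\<^sup>2 = 2 powr (- real l * (2 * \<gamma> + 1))"
proof -
  have "- real l * (\<gamma> + 1 / 2) + - real l * (\<gamma> + 1 / 2) = - real l * (2 * \<gamma> + 1)" by (simp add: algebra_simps)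
  then show ?thesis unfolding sg_def power2_eq_square by (simp only: fst_conv powr_add[symmetric])
qed

text \<open>Prior variance, level size and smoothness weight cancel exactly; the squared logarithm
  in the norm is what makes the sum over levels converge.\<close>

lemma wS_size: "wS l * 2 ^ l * (sg (l, 0))\<^sup>2 = ln 2 powr (- 2) * real l powr (- 2)"
proof -
  have "(2 ^ l :: real) powr (2 * \<gamma>) * 2 ^ l * (sg (l, 0))\<^sup>2 = 1"
    by (simp add: sg0_sq powr_powr algebra_simps flip: powr_realpow powr_add)
  moreover have "ln (2 ^ l :: real) powr (- 2) = ln 2 powr (- 2) * real l powr (- 2)"
    by (simp add: ln_realpow powr_mult mult.commute)
  moreover have "wS l * 2 ^ l * (sg (l, 0))\<^sup>2 = ((2 ^ l) powr (2 * \<gamma>) * 2 ^ l * (sg (l, 0))\<^sup>2) * ln (2 ^ l) powr (- 2)"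
    by (simp add: wS_def ac_simps)
  ultimately show ?thesis by simp
qed

lemma summable_wS: "summable (\<lambda>l. wS l * 2 ^ l * (sg (l, 0))\<^sup>2)"
  unfolding wS_size by (intro summable_mult) (simp add: summable_real_powr_iff)

text \<open>Splitting at \<open>2 ^ (l (2 \<gamma> + 1)) = \<surd>n\<close> costs half a power of the logarithm but needs no
  optimisation of the cut-off.\<close>

lemma wS_split:
  assumes n: "n \<ge> 3"
  shows "wS l * 2 ^ l * min (1 / real n) ((sg (l, 0))\<^sup>2) \<le>
    ln 2 powr (- 2) * real l powr (- 3 / 2) * (real n powr (- 1 / 2) + sqrt (2 * (2 * \<gamma> + 1) * ln 2 / ln (real n)))"
proof (cases "l = 0")
  case True
  \<comment> \<open>At l = 0 the logarithm is 0 and \<open>0 powr _\<close> is 0, so both sides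
    vanish.\<close>
  then show ?thesis by (simp add: wS_def)
next
  case False
  define q where "q = 2 * \<gamma> + 1"
  have q: "q > 0" using \<gamma>_pos by (simp add: q_def)
  have l: "real l \<ge> 1" using False by simp
  have lnn: "ln (real n) > 0" using n by simp
  let ?s = "(sg (l, 0))\<^sup>2"
  have s: "?s > 0" by (rule zero_less_power) simp
  have eq: "wS l * 2 ^ l * min (1 / real n) ?s = ln 2 powr (- 2) * real l powr (- 2) * min (1 / (real n * ?s)) 1"
  proof -
    have "min (1 / real n) ?s = ?s * min (1 / (real n * ?s)) 1"
      using s by (simp add: min_mult_distrib_left less_imp_le)
    then show ?thesis using wS_size[of l] by (simp add: mult.assoc[symmetric])
  qed
  \<comment> \<open>The exponent - 3 / 2 is kept for summability. The spare factor l powr (- 1 / 2)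
    is at most 1 on low levels, where the minimum is already of order n powr (- 1 / 2), and is of
    order 1 / sqrt (ln n) on high levels.\<close>
  have l32: "real l powr (- 2) = real l powr (- 3 / 2) * real l powr (- 1 / 2)" by (simp flip: powr_add)
  have "real l powr (- 1 / 2) * min (1 / (real n * ?s)) 1 \<le> real n powr (- 1 / 2) + sqrt (2 * q * ln 2 / ln (real n))"
  proof (cases "real l * q * ln 2 \<le> ln (real n) / 2")
    case True
    have "1 / ?s = exp (real l * q * ln 2)"
      unfolding sg0_sq q_def[symmetric] by (simp add: powr_def exp_minus field_simps)
    also have "\<dots> \<le> exp (ln (real n) / 2)" using True by simp
    also have "\<dots> = real n powr (1 / 2)" using n by (simp add: powr_def)
    finally have "(1 / ?s) / real n \<le> real n powr (1 / 2) / real n"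
      by (rule divide_right_mono) simp
    then have "1 / (real n * ?s) \<le> real n powr (1 / 2) / real n" by (simp add: mult.commute)
    also have "\<dots> = real n powr (- 1 / 2)" using n powr_diff[of "real n" "1/2" 1] by simp
    finally have 1: "min (1 / (real n * ?s)) 1 \<le> real n powr (- 1 / 2)" by simp
    have "real l powr (- 1 / 2) \<le> 1" using powr_mono[of "- 1 / 2" 0 "real l"] l by simp
    then have "real l powr (- 1 / 2) * min (1 / (real n * ?s)) 1 \<le> 1 * real n powr (- 1 / 2)"
      using 1 s by (intro mult_mono) auto
    then show ?thesis using q lnn by (simp add: add_increasing2)
  next
    case False
    then have "ln (real n) / (2 * q * ln 2) \<le> real l" using q by (simp add: field_simps)
    then have "1 / real l \<le> 1 / (ln (real n) / (2 * q * ln 2))"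
      using lnn q l by (intro divide_left_mono) auto
    then have "sqrt (1 / real l) \<le> sqrt (2 * q * ln 2 / ln (real n))" by (intro real_sqrt_le_mono) simp
    moreover have "real l powr (- 1 / 2) = sqrt (1 / real l)"
      using l by (simp add: powr_minus powr_half_sqrt real_sqrt_divide inverse_eq_divide)
    moreover have "min (1 / (real n * ?s)) 1 \<le> 1" by simp
    ultimately have "real l powr (- 1 / 2) * min (1 / (real n * ?s)) 1 \<le> sqrt (2 * q * ln 2 / ln (real n)) * 1"
      using s q lnn by (intro mult_mono) (auto intro!: divide_nonneg_pos mult_nonneg_nonneg)
    then show ?thesis by (simp add: add_increasing)
  qed
  then show ?thesis unfolding eq l32 q_def
    by (simp only: mult.assoc) (intro mult_left_mono, auto)
qed

definition rS :: "nat \<Rightarrow> real" where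
  "rS n = 2 * Cm * ln 2 powr (- 2) * (\<Sum>l. real l powr (- 3 / 2)) *
     (real n powr (- 1 / 2) + sqrt (2 * (2 * \<gamma> + 1) * ln 2 / ln (real n)))"

lemma summable_powr_three_halves: "summable (\<lambda>l. real l powr (- 3 / 2))"
  by (simp add: summable_real_powr_iff)

lemma mean_pmsq_S:
  assumes n: "n \<ge> 3"
  shows "(\<integral>\<^sup>+W. ennreal (1 / real n) * pmsq n wS W \<partial>WN) \<le> ennreal (rS n)"
proof -
  let ?c = "real n powr (- 1 / 2) + sqrt (2 * (2 * \<gamma> + 1) * ln 2 / ln (real n))"
  have c: "?c \<ge> 0" using n \<gamma>_pos by (intro add_nonneg_nonneg) auto
  have "(\<integral>\<^sup>+W. ennreal (1 / real n) * pmsq n wS W \<partial>WN) = ennreal (1 / real n) * (\<integral>\<^sup>+W. pmsq n wS W \<partial>WN)"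
    by (rule nn_integral_cmult) measurable
  also have "\<dots> \<le> ennreal (1 / real n) * (\<Sum>l. ennreal (wS l * (2 * 2 ^ l * (Cm * min 1 (real n * (sg (l, 0))\<^sup>2)))))"
    using n by (intro mult_left_mono mean_pmsq) auto
  also have "\<dots> = (\<Sum>l. ennreal (1 / real n) * ennreal (wS l * (2 * 2 ^ l * (Cm * min 1 (real n * (sg (l, 0))\<^sup>2)))))"
    by (rule ennreal_suminf_cmult[symmetric])
  also have "\<dots> \<le> (\<Sum>l. ennreal ((2 * Cm * ln 2 powr (- 2) * ?c) * real l powr (- 3 / 2)))"
  proof (intro suminf_le summableI)
    fix l
    have "1 / real n * (wS l * (2 * 2 ^ l * (Cm * min 1 (real n * (sg (l, 0))\<^sup>2)))) =
        2 * Cm * (wS l * 2 ^ l * (1 / real n * min 1 (real n * (sg (l, 0))\<^sup>2)))"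
      by (simp add: ac_simps)
    also have "1 / real n * min 1 (real n * (sg (l, 0))\<^sup>2) = min (1 / real n) ((sg (l, 0))\<^sup>2)"
      using n by (auto simp: min_def field_simps)
    also have "2 * Cm * (wS l * 2 ^ l * min (1 / real n) ((sg (l, 0))\<^sup>2)) \<le>
        2 * Cm * (ln 2 powr (- 2) * real l powr (- 3 / 2) * ?c)"
      using Cm(1) by (intro mult_left_mono wS_split n) auto
    finally have le: "1 / real n * (wS l * (2 * 2 ^ l * (Cm * min 1 (real n * (sg (l, 0))\<^sup>2)))) \<le>
        (2 * Cm * ln 2 powr (- 2) * ?c) * real l powr (- 3 / 2)" by (simp only: ac_simps)
    have "wS l * (2 * 2 ^ l * (Cm * min 1 (real n * (sg (l, 0))\<^sup>2))) \<ge> 0"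
      using Cm(1) by simp
    then show "ennreal (1 / real n) * ennreal (wS l * (2 * 2 ^ l * (Cm * min 1 (real n * (sg (l, 0))\<^sup>2)))) \<le>
        ennreal ((2 * Cm * ln 2 powr (- 2) * ?c) * real l powr (- 3 / 2))"
      using le by (subst ennreal_mult[symmetric]) (auto intro: ennreal_leI)
  qed
  also have "\<dots> = ennreal (\<Sum>l. (2 * Cm * ln 2 powr (- 2) * ?c) * real l powr (- 3 / 2))"
  proof (rule suminf_ennreal)
    show nn: "0 \<le> (2 * Cm * ln 2 powr (- 2) * ?c) * real l powr (- 3 / 2)" for l
      using c Cm(1) by (intro mult_nonneg_nonneg) auto
    show "(\<Sum>l. ennreal ((2 * Cm * ln 2 powr (- 2) * ?c) * real l powr (- 3 / 2))) \<noteq> top"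
      by (rule ennreal_suminf_neq_top[OF summable_mult[OF summable_powr_three_halves] nn])
  qed
  also have "(\<Sum>l. (2 * Cm * ln 2 powr (- 2) * ?c) * real l powr (- 3 / 2)) = rS n"
    unfolding rS_def by (subst suminf_mult[OF summable_powr_three_halves]) (simp only: ac_simps)
  finally show ?thesis .
qed

text \<open>The bound \<open>rS\<close> is of order (ln n) powr (- 1 / 2), negligible against the
  tolerance (ln n) powr (- 1 / 4) in the smoothness radius; the choice of that tolerance is what
  this limit needs.\<close>

lemma rS_limit: "(\<lambda>n. rS n / ln (real n) powr (- 1 / 4)) \<longlonglongrightarrow> 0"
proof -
  define q where "q = 2 * (2 * \<gamma> + 1) * ln 2"
  have q: "q > 0" using \<gamma>_pos by (simp add: q_def)
  have 1: "(\<lambda>n. real n powr (- 1 / 2) / ln (real n) powr (- 1 / 4)) \<longlonglongrightarrow> 0" by real_asymp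
  have 2: "(\<lambda>n. sqrt (q / ln (real n)) / ln (real n) powr (- 1 / 4)) \<longlonglongrightarrow> 0" using q by real_asymp
  define k where "k = 2 * Cm * ln 2 powr (- 2) * (\<Sum>l. real l powr (- 3 / 2))"
  have "(\<lambda>n. k * (real n powr (- 1 / 2) / ln (real n) powr (- 1 / 4) + sqrt (q / ln (real n)) / ln (real n) powr (- 1 / 4)))
      \<longlonglongrightarrow> k * (0 + 0)"
    by (intro tendsto_intros 1 2)
  then show ?thesis unfolding rS_def k_def[symmetric] q_def[symmetric] by (simp add: add_divide_distrib[symmetric])
qed

end

section \<open>Finite sections\<close>

lemma wsum_add:
  assumes "\<And>l. w l \<ge> 0" "\<And>l. w' l \<ge> 0"
  shows "wsum J0 (\<lambda>l. w l + w' l) c = wsum J0 w c + wsum J0 w' c"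
  unfolding wsum_def using assms
  by (simp add: distrib_right sum_nonneg suminf_add[symmetric])

lemma wsum_truncate:
  assumes w: "\<And>l. w l \<ge> 0"
  shows "wsum J0 (\<lambda>l. if l < L then w l else 0) c = ennreal (\<Sum>i\<in>idx_below J0 L. w (fst i) * (c i)\<^sup>2)"
proof -
  have "wsum J0 (\<lambda>l. if l < L then w l else 0) c =
      (\<Sum>l\<in>{..<L}. ennreal ((if l < L then w l else 0) * (\<Sum>k\<in>lev J0 l. (c (l, k))\<^sup>2)))"
    unfolding wsum_def by (rule suminf_finite) auto
  also have "\<dots> = ennreal (\<Sum>l<L. w l * (\<Sum>k\<in>lev J0 l. (c (l, k))\<^sup>2))"
    using w by (subst sum_ennreal[symmetric]) (auto simp: sum_nonneg intro!: sum.cong)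
  also have "(\<Sum>l<L. w l * (\<Sum>k\<in>lev J0 l. (c (l, k))\<^sup>2)) = (\<Sum>i\<in>idx_below J0 L. w (fst i) * (c i)\<^sup>2)"
    by (simp add: sum_idx_below sum_distrib_left)
  finally show ?thesis .
qed

lemma wsum_update:
  assumes w: "\<And>l. w l \<ge> 0" and i: "i \<in> idx J0"
  shows "wsum J0 w c = ennreal (w (fst i) * (c i)\<^sup>2) + wsum J0 w (c(i := 0))"
proof -
  obtain l0 k0 where i': "i = (l0, k0)" by (cases i)
  have k0: "k0 \<in> lev J0 l0" using i by (simp add: i' lev_def)
  have "(\<Sum>k\<in>lev J0 l. (c (l, k))\<^sup>2) = (if l = l0 then (c i)\<^sup>2 else 0) + (\<Sum>k\<in>lev J0 l. ((c(i := 0)) (l, k))\<^sup>2)" for l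
  proof (cases "l = l0")
    case True
    have "(\<Sum>k\<in>lev J0 l0. (c (l0, k))\<^sup>2) = (c i)\<^sup>2 + (\<Sum>k\<in>lev J0 l0 - {k0}. (c (l0, k))\<^sup>2)"
      using k0 by (simp add: sum.remove i')
    also have "(\<Sum>k\<in>lev J0 l0 - {k0}. (c (l0, k))\<^sup>2) = (\<Sum>k\<in>lev J0 l0. ((c(i := 0)) (l0, k))\<^sup>2)"
      using k0 by (subst (2) sum.remove[of _ k0]) (auto simp: i' intro!: sum.cong)
    finally show ?thesis using True by simp
  next
    case False
    then show ?thesis by (auto simp: i' intro!: sum.cong)
  qed
  then have "wsum J0 w c = (\<Sum>l. ennreal (if l = l0 then w l * (c i)\<^sup>2 else 0) +
      ennreal (w l * (\<Sum>k\<in>lev J0 l. ((c(i := 0)) (l, k))\<^sup>2)))"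
    unfolding wsum_def using w
    by (intro suminf_cong) (auto simp: distrib_left sum_nonneg simp flip: ennreal_plus)
  also have "\<dots> = (\<Sum>l. ennreal (if l = l0 then w l * (c i)\<^sup>2 else 0)) + wsum J0 w (c(i := 0))"
    unfolding wsum_def by (rule suminf_add[symmetric]) auto
  also have "(\<Sum>l. ennreal (if l = l0 then w l * (c i)\<^sup>2 else 0)) = ennreal (w (fst i) * (c i)\<^sup>2)"
    by (subst suminf_finite[of "{l0}"]) (auto simp: i')
  finally show ?thesis .
qed

text \<open>Conditionally on all other coordinates, the equation is quadratic in coordinate i with
  positive leading weight. It has at most two roots, a null set for the normal law, and Fubini
  concludes.\<close>

lemma white_noise_wsum_atom:
  assumes w: "\<And>l. w l \<ge> 0" and i: "i \<in> idx J0" "w (fst i) > 0"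
  shows "emeasure (white_noise J0) {W \<in> space (white_noise J0). wsum J0 w W = ennreal r} = 0"
proof -
  let ?M = "white_noise J0" and ?P = "PiM (idx J0 - {i}) (\<lambda>_. std_normal)"
  interpret N: prob_space std_normal by (rule prob_space_std_normal)
  interpret P: prob_space ?P by (intro prob_space_PiM prob_space_std_normal)
  interpret NP: pair_sigma_finite std_normal ?P by unfold_locales
  have ins: "insert i (idx J0 - {i}) = idx J0" using i by auto
  have M: "?M = distr (std_normal \<Otimes>\<^sub>M ?P) ?M (\<lambda>(x, Y). Y(i := x))"
    using distr_pair_PiM_eq_PiM[of "idx J0 - {i}" "\<lambda>_. std_normal" i] prob_space_std_normal
    unfolding ins white_noise_eq by simp
  let ?S = "{W \<in> space ?M. wsum J0 w W = ennreal r}"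
  have "(\<lambda>W. wsum J0 w W) \<in> borel_measurable ?M"
    by (rule wsum_measurable) simp
  then have S: "?S \<in> sets ?M" by measurable
  have upd: "(\<lambda>(x, Y). Y(i := x)) \<in> measurable (std_normal \<Otimes>\<^sub>M ?P) ?M"
  proof -
    have "(\<lambda>p. (snd p)(i := fst p)) \<in> measurable (std_normal \<Otimes>\<^sub>M ?P) (PiM (insert i (idx J0 - {i})) (\<lambda>_. std_normal))"
      by (rule measurable_fun_upd[where J="idx J0 - {i}"]) auto
    then show ?thesis unfolding ins white_noise_eq case_prod_beta .
  qed
  let ?Q = "(\<lambda>(x, Y). Y(i := x)) -` ?S \<inter> space (std_normal \<Otimes>\<^sub>M ?P)"
  have Q: "?Q \<in> sets (std_normal \<Otimes>\<^sub>M ?P)" using upd S by (rule measurable_sets)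
  have "emeasure ?M ?S = emeasure (std_normal \<Otimes>\<^sub>M ?P) ?Q"
    by (subst M, subst emeasure_distr[OF upd S]) (rule refl)
  also have "\<dots> = (\<integral>\<^sup>+Y. emeasure std_normal ((\<lambda>x. (x, Y)) -` ?Q) \<partial>?P)"
    by (rule NP.emeasure_pair_measure_alt2[OF Q])
  also have "\<dots> = (\<integral>\<^sup>+Y. 0 \<partial>?P)"
  proof (rule nn_integral_cong)
    fix Y
    let ?a = "w (fst i)" and ?R = "enn2real (wsum J0 w (Y(i := 0)))"
    \<comment> \<open>\<open>ennreal r\<close> is 0 for negative r, whence
      \<open>max 0 r\<close>.\<close>
    have "(\<lambda>x. (x, Y)) -` ?Q \<subseteq> {x. x\<^sup>2 = (max 0 r - ?R) / ?a}"
    proof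
      fix x assume "x \<in> (\<lambda>x. (x, Y)) -` ?Q"
      then have "wsum J0 w (Y(i := x)) = ennreal r" by simp
      then have eq: "ennreal (?a * x\<^sup>2) + wsum J0 w (Y(i := 0)) = ennreal r"
        using wsum_update[OF w i(1), where c="Y(i := x)"] by simp
      have "wsum J0 w (Y(i := 0)) \<le> ennreal (?a * x\<^sup>2) + wsum J0 w (Y(i := 0))"
        by (simp add: add_increasing)
      also note eq
      also have "ennreal r < top" by simp
      finally have "wsum J0 w (Y(i := 0)) < top" .
      then obtain q where q: "q \<ge> 0" "wsum J0 w (Y(i := 0)) = ennreal q"
        by (cases "wsum J0 w (Y(i := 0))") auto
      have "ennreal (?a * x\<^sup>2 + q) = ennreal (max 0 r)"
        using eq i(2) q by (simp add: ennreal_plus[symmetric] max_def ennreal_neg del: ennreal_plus)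
      then have "?a * x\<^sup>2 + q = max 0 r" using i(2) q(1) by (subst (asm) ennreal_inj) auto
      then show "x \<in> {x. x\<^sup>2 = (max 0 r - ?R) / ?a}" using i(2) q by (simp add: field_simps)
    qed
    moreover have "finite {x::real. x\<^sup>2 = c}" for c
    proof (rule finite_subset)
      show "{x::real. x\<^sup>2 = c} \<subseteq> {sqrt c, - sqrt c}"
        using real_sqrt_abs by (auto simp: abs_if split: if_splits)
    qed simp
    ultimately have fin: "finite ((\<lambda>x. (x, Y)) -` ?Q)" by (rule finite_subset)
    then have "(\<lambda>x. (x, Y)) -` ?Q \<in> null_sets lborel" by (rule finite_imp_null_set_lborel)
    then have "(\<lambda>x. (x, Y)) -` ?Q \<in> null_sets std_normal"
      using absolutely_continuousI_density[of "\<lambda>x. ennreal (std_normal_density x)" lborel]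
      by (auto simp: absolutely_continuous_def)
    then show "emeasure std_normal ((\<lambda>x. (x, Y)) -` ?Q) = 0" by auto
  qed
  finally show ?thesis by simp
qed

lemma nn_integral_white_noise_wsum:
  assumes w: "\<And>l. w l \<ge> 0" and J0: "J0 \<ge> 1"
  shows "(\<integral>\<^sup>+W. wsum J0 w W \<partial>white_noise J0) \<le> (\<Sum>l. ennreal (w l * (2 * 2 ^ l)))"
proof -
  have idx: "(l, k) \<in> idx J0" if "k \<in> lev J0 l" for l k using that by (simp add: lev_def)
  have m [measurable]: "(\<lambda>W. \<Sum>k\<in>lev J0 l. (W (l, k))\<^sup>2) \<in> borel_measurable (white_noise J0)" for l
    by (intro borel_measurable_sum borel_measurable_power white_noise_component idx)
  have "(\<integral>\<^sup>+y. ennreal (y\<^sup>2) \<partial>std_normal) = ennreal 1"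
    using nn_integral_eq_integral[OF std_normal_moments(3)] std_normal_moments(4) by simp
  then have one: "(\<integral>\<^sup>+W. ennreal ((W i)\<^sup>2) \<partial>white_noise J0) = 1" if "i \<in> idx J0" for i
    using WN.nn_integral_PiM_component[OF that, of "\<lambda>y. ennreal (y\<^sup>2)"] unfolding white_noise_eq by simp
  have "(\<integral>\<^sup>+W. wsum J0 w W \<partial>white_noise J0) = (\<Sum>l. \<integral>\<^sup>+W. ennreal (w l * (\<Sum>k\<in>lev J0 l. (W (l, k))\<^sup>2)) \<partial>white_noise J0)"
    unfolding wsum_def by (rule nn_integral_suminf) measurable
  also have "\<dots> \<le> (\<Sum>l. ennreal (w l * (2 * 2 ^ l)))"
  proof (intro suminf_le summableI)
    fix l
    have "(\<integral>\<^sup>+W. ennreal (w l * (\<Sum>k\<in>lev J0 l. (W (l, k))\<^sup>2)) \<partial>white_noise J0) =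
        (\<integral>\<^sup>+W. ennreal (w l) * (\<Sum>k\<in>lev J0 l. ennreal ((W (l, k))\<^sup>2)) \<partial>white_noise J0)"
      using w by (simp add: ennreal_mult sum_nonneg)
    also have "\<dots> = ennreal (w l) * (\<Sum>k\<in>lev J0 l. \<integral>\<^sup>+W. ennreal ((W (l, k))\<^sup>2) \<partial>white_noise J0)"
    proof -
      have *: "(\<lambda>W. ennreal ((W (l, k))\<^sup>2)) \<in> borel_measurable (white_noise J0)" if "k \<in> lev J0 l" for k
        using white_noise_component[OF idx[OF that]] by measurable
      have "(\<lambda>W. \<Sum>k\<in>lev J0 l. ennreal ((W (l, k))\<^sup>2)) \<in> borel_measurable (white_noise J0)"
        by (intro borel_measurable_sum *)
      then show ?thesis by (simp only: nn_integral_cmult nn_integral_sum[OF *])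
    qed
    also have "\<dots> = ennreal (w l * real (card (lev J0 l)))"
      using w by (simp add: one idx ennreal_mult ennreal_of_nat_eq_real_of_nat)
    also have "\<dots> \<le> ennreal (w l * (2 * 2 ^ l))"
      using w J0 by (intro ennreal_leI mult_left_mono card_lev_le) auto
    finally show "(\<integral>\<^sup>+W. ennreal (w l * (\<Sum>k\<in>lev J0 l. (W (l, k))\<^sup>2)) \<partial>white_noise J0) \<le> ennreal (w l * (2 * 2 ^ l))" .
  qed
  finally show ?thesis .
qed

lemma (in finite_measure) emeasure_eventually_tendsto_0:
  assumes S: "\<And>n. {x \<in> space M. P n x} \<in> sets M" and ev: "AE x in M. eventually (\<lambda>n. \<not> P n x) sequentially"
  shows "(\<lambda>n. emeasure M {x \<in> space M. P n x}) \<longlonglongrightarrow> 0"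
proof -
  have "(\<lambda>n. \<integral>\<^sup>+x. indicator {x \<in> space M. P n x} x \<partial>M) \<longlonglongrightarrow> (\<integral>\<^sup>+x. 0 \<partial>M)"
  proof (rule nn_integral_dominated_convergence[where w="\<lambda>_. 1"])
    show "AE x in M. (\<lambda>n. indicator {x \<in> space M. P n x} x :: ennreal) \<longlonglongrightarrow> 0"
      using ev
    proof eventually_elim
      case (elim x)
      then show ?case
        by (intro tendsto_eventually) (auto elim!: eventually_mono simp: indicator_def)
    qed
    show "(\<integral>\<^sup>+x. 1 \<partial>M) < \<infinity>" by (simp add: less_top[symmetric])
  qed (use S in \<open>auto simp: indicator_def\<close>)
  then show ?thesis using S by simp
qed

context series_model
begin

section \<open>Measurable dependence of the posterior on the data\<close>

lemma prob_space_pri: "prob_space pri"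
  unfolding pri_eq by (rule Omega.prob_space_distr) measurable

lemma posterior_eq_density:
  assumes "S \<in> sets borel" and x: "x \<in> space (PiM (idx J0) (\<lambda>_. borel))"
  shows "emeasure (posterior \<psi> J0 pri n x) S = (\<integral>\<^sup>+f. ennreal (likelihood \<psi> J0 n x f) /
    (\<integral>\<^sup>+f'. ennreal (likelihood \<psi> J0 n x f') \<partial>pri) * indicator S f \<partial>pri)"
proof -
  have [measurable]: "likelihood \<psi> J0 n x \<in> borel_measurable borel" by (rule likelihood_measurable1[OF x])
  define D where "D = (\<integral>\<^sup>+f'. ennreal (likelihood \<psi> J0 n x f') \<partial>pri)"
  show ?thesis unfolding posterior_def D_def[symmetric] using assms(1)
    by (subst emeasure_density) (auto simp: pri_eq)
qed

lemma pri_sets [measurable_cong, simp]: "sets pri = sets borel"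
  by (simp add: series_prior_def)

lemma pri_space [simp]: "space pri = UNIV"
  using sets_eq_imp_space_eq[OF pri_sets] by simp

text \<open>Posterior masses of sections are themselves random variables in the events below. A
  general map \<open>Y\<close> lets the same result serve for the noise, through \<open>X n\<close>,
  and for the observation, through the identity.\<close>

lemma kernel_measurable:
  assumes Y: "Y \<in> measurable N (PiM (idx J0) (\<lambda>_. borel))" and A: "A \<in> sets (N \<Otimes>\<^sub>M borel)"
  shows "(\<lambda>y. emeasure (posterior \<psi> J0 pri n (Y y)) {f. (y, f) \<in> A}) \<in> borel_measurable N"
proof -
  interpret pri: prob_space pri by (rule prob_space_pri)
  have lm [measurable]: "(\<lambda>p. likelihood \<psi> J0 n (Y (fst p)) (snd p)) \<in> borel_measurable (N \<Otimes>\<^sub>M pri)"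
  proof -
    have "(\<lambda>p. (Y (fst p), snd p)) \<in> measurable (N \<Otimes>\<^sub>M pri) (PiM (idx J0) (\<lambda>_. borel) \<Otimes>\<^sub>M borel)"
      using Y by measurable
    from measurable_compose[OF this likelihood_measurable] show ?thesis by simp
  qed
  have [measurable]: "A \<in> sets (N \<Otimes>\<^sub>M pri)" using A by (simp cong: sets_pair_measure_cong)
  define D where "D y = (\<integral>\<^sup>+f'. ennreal (likelihood \<psi> J0 n (Y y) f') \<partial>pri)" for y
  have [measurable]: "D \<in> borel_measurable N"
    unfolding D_def[abs_def] by (rule pri.borel_measurable_nn_integral) (simp add: case_prod_beta, measurable)
  have "(\<lambda>y. \<integral>\<^sup>+f. ennreal (likelihood \<psi> J0 n (Y y) f) / D y * indicator A (y, f) \<partial>pri) \<in> borel_measurable N"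
    by (rule pri.borel_measurable_nn_integral) (simp add: case_prod_beta, measurable)
  moreover have "emeasure (posterior \<psi> J0 pri n (Y y)) {f. (y, f) \<in> A} =
      (\<integral>\<^sup>+f. ennreal (likelihood \<psi> J0 n (Y y) f) / D y * indicator A (y, f) \<partial>pri)" if "y \<in> space N" for y
  proof -
    have "{f. (y, f) \<in> A} = Pair y -` A" by auto
    then have "{f. (y, f) \<in> A} \<in> sets borel" using sets_Pair1[OF A] by simp
    moreover have "Y y \<in> space (PiM (idx J0) (\<lambda>_. borel))" using Y that by (rule measurable_space)
    ultimately show ?thesis
      by (subst posterior_eq_density) (auto simp: D_def indicator_def intro!: nn_integral_cong)
  qed
  ultimately show ?thesis by (simp cong: measurable_cong)
qed

lemma posterior_mean_measurable: "posterior_mean \<psi> J0 pri n \<in> borel_measurable (PiM (idx J0) (\<lambda>_. borel))"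
proof -
  let ?N = "PiM (idx J0) (\<lambda>_. borel :: real measure)"
  interpret pri: prob_space pri by (rule prob_space_pri)
  have lm: "(\<lambda>p. likelihood \<psi> J0 n (fst p) (snd p)) \<in> borel_measurable (?N \<Otimes>\<^sub>M pri)"
    using likelihood_measurable[of n] by (simp cong: measurable_cong_sets sets_pair_measure_cong)
  note [measurable] = lm
  define D where "D x = (\<integral>\<^sup>+f'. ennreal (likelihood \<psi> J0 n x f') \<partial>pri)" for x
  have [measurable]: "D \<in> borel_measurable ?N"
    unfolding D_def[abs_def] by (rule pri.borel_measurable_nn_integral) (simp add: case_prod_beta, measurable)
  have "(\<lambda>x. \<integral>f. (likelihood \<psi> J0 n x f / enn2real (D x)) *\<^sub>R f \<partial>pri) \<in> borel_measurable ?N"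
    by (rule pri.borel_measurable_lebesgue_integral) (simp add: case_prod_beta, measurable)
  moreover have "posterior_mean \<psi> J0 pri n x = (\<integral>f. (likelihood \<psi> J0 n x f / enn2real (D x)) *\<^sub>R f \<partial>pri)"
    if x: "x \<in> space ?N" for x
  proof -
    have lm1 [measurable]: "likelihood \<psi> J0 n x \<in> borel_measurable borel" by (rule likelihood_measurable1[OF x])
    have pos: "likelihood \<psi> J0 n x f > 0" for f by (simp add: likelihood_def)
    have D0: "D x \<noteq> 0"
    proof
      assume "D x = 0"
      then have "AE f in pri. ennreal (likelihood \<psi> J0 n x f) = 0"
        unfolding D_def by (subst (asm) nn_integral_0_iff_AE) auto
      then have "AE f in pri. False" by eventually_elim (use pos in \<open>metis ennreal_eq_0_iff not_le\<close>)
      then have "ae_filter pri = bot" by (simp add: trivial_limit_def)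
      then show False using pri.emeasure_space_1 by (simp add: ae_filter_eq_bot_iff)
    qed
    \<comment> \<open>If the normaliser is infinite, both quotients are 0: division by top on the
      left, by the real number 0 on the right.\<close>
    have "ennreal (likelihood \<psi> J0 n x f) / D x = ennreal (likelihood \<psi> J0 n x f / enn2real (D x))" for f
    proof (cases "D x")
      case (real d)
      then have "d > 0" using D0 by (cases "d = 0") auto
      then show ?thesis using real less_imp_le[OF pos] by (simp add: divide_ennreal)
    next
      case top then show ?thesis by simp
    qed
    then have "posterior \<psi> J0 pri n x = density pri (\<lambda>f. ennreal (likelihood \<psi> J0 n x f / enn2real (D x)))"
      unfolding posterior_def D_def[symmetric] by simp
    then show ?thesis unfolding posterior_mean_def
      using less_imp_le[OF pos] by (simp only:) (subst integral_density, auto)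
  qed
  ultimately show ?thesis by (simp cong: measurable_cong)
qed

lemma emeasure_post_PiM:
  assumes n: "n > 0" and W: "regular n W" and S: "S \<in> sets (PiM (idx J0) (\<lambda>_. borel))"
  shows "emeasure (post n W) {f. (\<lambda>i\<in>idx J0. resc n f i) \<in> S} = emeasure (PiM (idx J0) (coord_law n W)) S"
proof -
  have m: "(\<lambda>f. \<lambda>i\<in>idx J0. resc n f i) \<in> measurable (post n W) (PiM (idx J0) (\<lambda>_. borel))"
    by (intro measurable_restrict) measurable
  show ?thesis unfolding post_product[OF n W, symmetric]
    by (subst emeasure_distr[OF m S]) (auto intro!: arg_cong2[where f=emeasure])
qed

lemma \<tau>_limit: "filterlim (\<lambda>n. \<tau> (Suc n) i) at_top sequentially"
proof -
  have "filterlim (\<lambda>n. sqrt (real (Suc n))) at_top sequentially" by real_asymp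
  from filterlim_tendsto_pos_mult_at_top[OF tendsto_const[of "sg i"] sg_pos this]
  show ?thesis unfolding \<tau>_def mult.commute[of _ "sg i"] .
qed

text \<open>The noise is held fixed. Under the product posterior the characteristic function of a
  finite section factorises, each factor converges by \<open>coord_post_limit\<close>, and Levy's
  theorem gives weak convergence; absence of an atom turns this into convergence at r.\<close>

lemma finite_section_cdf:
  assumes W: "\<And>n. n > 0 \<Longrightarrow> regular n W"
    and atom: "emeasure WN {Z \<in> space WN. (\<Sum>i\<in>idx_below J0 L. w i * (Z i)\<^sup>2) = r} = 0"
  shows "(\<lambda>n. measure (post n W) {f. (\<Sum>i\<in>idx_below J0 L. w i * (resc n f i - vmean n W i)\<^sup>2) \<le> r})
    \<longlonglongrightarrow> measure WN {Z \<in> space WN. (\<Sum>i\<in>idx_below J0 L. w i * (Z i)\<^sup>2) \<le> r}"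
proof -
  let ?F = "idx_below J0 L"
  let ?P = "\<lambda>n. PiM (idx J0) (coord_law n W)"
  let ?h = "\<lambda>n i u. w i * (u - vmean n W i)\<^sup>2"
  let ?M = "\<lambda>n. distr (?P n) borel (\<lambda>x. \<Sum>i\<in>?F. ?h n i (x i))"
  let ?M' = "distr WN borel (\<lambda>Z. \<Sum>i\<in>?F. w i * (Z i)\<^sup>2)"
  have F: "i \<in> idx J0" if "i \<in> ?F" for i using that idx_below_subset by blast
  have sets_P: "sets (?P n) = sets (PiM (idx J0) (\<lambda>_. borel))" for n
    by (intro sets_PiM_cong) (simp_all add: coord_law_def)
  have space_P: "space (?P n) = space (PiM (idx J0) (\<lambda>_. borel))" for n
    by (rule sets_eq_imp_space_eq[OF sets_P])
  have compP: "(\<lambda>x. x i) \<in> borel_measurable (?P n)" if "i \<in> idx J0" for i n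
    using that by (subst measurable_cong_sets[OF sets_P refl]) simp
  have mP [measurable]: "(\<lambda>x. \<Sum>i\<in>?F. ?h n i (x i)) \<in> borel_measurable (?P n)" for n
    by (intro borel_measurable_sum borel_measurable_times borel_measurable_power borel_measurable_diff compP F borel_measurable_const)
  have mB: "(\<lambda>x. \<Sum>i\<in>?F. ?h n i (x i)) \<in> borel_measurable (PiM (idx J0) (\<lambda>_. borel))" for n
    using mP[of n] by (subst (asm) measurable_cong_sets[OF sets_P refl])
  have mW [measurable]: "(\<lambda>Z. \<Sum>i\<in>?F. w i * (Z i)\<^sup>2) \<in> borel_measurable WN"
    by (intro borel_measurable_sum borel_measurable_times borel_measurable_power white_noise_component F borel_measurable_const)
  have psP: "prob_space (?P n)" for n
    using product_prob_space_coord_law[of n W] by (intro prob_space_PiM) (simp add: product_prob_space.prob_space coord_law_def prob_space_coord_post)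
  have rd: "real_distribution (?M n)" for n
    by (rule prob_space.real_distribution_distr[OF psP mP])
  interpret M': real_distribution ?M'
    by (rule prob_space.real_distribution_distr[OF prob_space_white_noise mW])
  have meas_eq: "measure (post n W) {f. (\<Sum>i\<in>?F. ?h n i (resc n f i)) \<le> r} = cdf (?M n) r" if n: "n > 0" for n
  proof -
    let ?S = "{x \<in> space (PiM (idx J0) (\<lambda>_. borel)). (\<Sum>i\<in>?F. ?h n i (x i)) \<le> r}"
    have S: "?S \<in> sets (PiM (idx J0) (\<lambda>_. borel))" using mB[of n] by measurable
    have "{f. (\<Sum>i\<in>?F. ?h n i (resc n f i)) \<le> r} = {f. (\<lambda>i\<in>idx J0. resc n f i) \<in> ?S}"
      using F by (auto simp: space_PiM intro!: sum.cong arg_cong2[where f="(\<le>)"] cong: sum.cong)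
    then have "measure (post n W) {f. (\<Sum>i\<in>?F. ?h n i (resc n f i)) \<le> r} = measure (?P n) ?S"
      using emeasure_post_PiM[OF n W[OF n] S] by (simp add: measure_def)
    also have "\<dots> = cdf (?M n) r"
      unfolding cdf_def by (subst measure_distr[OF mP]) (auto simp: space_P intro!: arg_cong2[where f=measure])
    finally show ?thesis .
  qed
  have "weak_conv_m (\<lambda>n. ?M (Suc n)) ?M'"
  proof (rule levy_continuity)
    fix t
    have char_P: "char (?M n) t = (\<Prod>i\<in>?F. \<integral>u. iexp (t * ?h n i u) \<partial>coord_post (\<tau> n i) (b i) (W i))" for n
    proof -
      interpret C: product_prob_space "coord_law n W" "idx J0" by (rule product_prob_space_coord_law)
      have "C.P.indep_vars (\<lambda>_. borel) (\<lambda>i x. ?h n i (x i)) ?F"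
        by (rule C.P.indep_vars_compose2[OF C.P.indep_vars_subset[OF C.indep_vars_components idx_below_subset]])
          (simp add: coord_law_def measurable_cong_sets[OF sets_coord_post refl])
      then have "char (?M n) t = (\<Prod>i\<in>?F. char (distr (?P n) borel (\<lambda>x. ?h n i (x i))) t)"
        by (rule C.P.char_distr_sum)
      also have "\<dots> = (\<Prod>i\<in>?F. \<integral>u. iexp (t * ?h n i u) \<partial>coord_post (\<tau> n i) (b i) (W i))"
      proof (rule prod.cong[OF refl])
        fix i assume i: "i \<in> ?F"
        have hm: "(\<lambda>x. ?h n i (x i)) \<in> borel_measurable (?P n)"
          by (intro borel_measurable_times borel_measurable_power borel_measurable_diff compP F i borel_measurable_const)
        have "char (distr (?P n) borel (\<lambda>x. ?h n i (x i))) t = (\<integral>x. iexp (t * ?h n i (x i)) \<partial>?P n)"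
          unfolding char_def by (subst integral_distr[OF hm]) auto
        also have "\<dots> = (\<integral>u. iexp (t * ?h n i u) \<partial>distr (?P n) (coord_law n W i) (\<lambda>x. x i))"
          by (rule integral_distr[symmetric, OF measurable_component_singleton[OF F[OF i]]])
            (unfold coord_law_def measurable_cong_sets[OF sets_coord_post refl], measurable)
        finally show "char (distr (?P n) borel (\<lambda>x. ?h n i (x i))) t = (\<integral>u. iexp (t * ?h n i u) \<partial>coord_post (\<tau> n i) (b i) (W i))"
          unfolding C.PiM_component[OF F[OF i]] by (simp add: coord_law_def)
      qed
      finally show ?thesis .
    qed
    have char_W: "char ?M' t = (\<Prod>i\<in>?F. \<integral>u. iexp (t * (w i * u\<^sup>2)) \<partial>std_normal)"
    proof -
      have "WNO.M1.indep_vars (\<lambda>_. std_normal) (\<lambda>i W. W i) (idx J0)"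
        using WN.indep_vars_components[of J0] unfolding white_noise_eq .
      then have "WNO.M1.indep_vars (\<lambda>_. borel) (\<lambda>i x. w i * (x i)\<^sup>2) ?F"
        by (rule WNO.M1.indep_vars_compose2[OF WNO.M1.indep_vars_subset[OF _ idx_below_subset]]) simp
      then have "char ?M' t = (\<Prod>i\<in>?F. char (distr WN borel (\<lambda>x. w i * (x i)\<^sup>2)) t)"
        by (rule WNO.M1.char_distr_sum)
      also have "\<dots> = (\<Prod>i\<in>?F. \<integral>u. iexp (t * (w i * u\<^sup>2)) \<partial>std_normal)"
      proof (rule prod.cong[OF refl])
        fix i assume i: "i \<in> ?F"
        have hm: "(\<lambda>x. w i * (x i)\<^sup>2) \<in> borel_measurable WN"
          by (intro borel_measurable_times borel_measurable_power white_noise_component F i borel_measurable_const)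
        have "char (distr WN borel (\<lambda>x. w i * (x i)\<^sup>2)) t = (\<integral>x. iexp (t * (w i * (x i)\<^sup>2)) \<partial>WN)"
          unfolding char_def by (subst integral_distr[OF hm]) auto
        also have "\<dots> = (\<integral>u. iexp (t * (w i * u\<^sup>2)) \<partial>distr WN std_normal (\<lambda>x. x i))"
          unfolding white_noise_eq
          by (rule integral_distr[symmetric, OF measurable_component_singleton[OF F[OF i]]]) simp
        also have "distr WN std_normal (\<lambda>x. x i) = std_normal"
          unfolding white_noise_eq by (rule WN.PiM_component[OF F[OF i]])
        finally show "char (distr WN borel (\<lambda>x. w i * (x i)\<^sup>2)) t = (\<integral>u. iexp (t * (w i * u\<^sup>2)) \<partial>std_normal)" .
      qed
      finally show ?thesis .
    qed
    show "(\<lambda>n. char (?M (Suc n)) t) \<longlonglongrightarrow> char ?M' t"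
      unfolding char_P char_W
    proof (rule tendsto_prod)
      fix i assume i: "i \<in> ?F"
      let ?y = "W i"
      have v: "(\<lambda>n. vmean (Suc n) W i) \<longlonglongrightarrow> ?y"
        unfolding vmean_def by (rule coord_mean_limit[OF \<tau>_limit])
      have "(\<lambda>n. \<integral>u. iexp (t * ?h (Suc n) i u) \<partial>coord_post (\<tau> (Suc n) i) (b i) ?y)
          \<longlonglongrightarrow> (\<integral>u. normal_density ?y 1 u *\<^sub>R iexp (t * (w i * (u - ?y)\<^sup>2)) \<partial>lborel)"
      proof (rule coord_post_limit[OF \<tau>_limit])
        show "(\<lambda>n. iexp (t * ?h (Suc n) i u)) \<longlonglongrightarrow> iexp (t * (w i * (u - ?y)\<^sup>2))" for u
          by (intro tendsto_intros v)
      qed auto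
      \<comment> \<open>Translating by the noise value removes it: centred at its mean, the limiting
        posterior has the same law for every noise sequence.\<close>
      also have "(\<integral>u. normal_density ?y 1 u *\<^sub>R iexp (t * (w i * (u - ?y)\<^sup>2)) \<partial>lborel) =
          \<bar>1\<bar> *\<^sub>R (\<integral>u. normal_density ?y 1 (?y + 1 * u) *\<^sub>R iexp (t * (w i * ((?y + 1 * u) - ?y)\<^sup>2)) \<partial>lborel)"
        by (rule lborel_integral_real_affine) simp
      also have "\<dots> = (\<integral>u. std_normal_density u *\<^sub>R iexp (t * (w i * u\<^sup>2)) \<partial>lborel)"
        by (simp add: normal_density_def)
      also have "\<dots> = (\<integral>u. iexp (t * (w i * u\<^sup>2)) \<partial>std_normal)"
        by (rule integral_density[symmetric]) auto
      finally show "(\<lambda>n. \<integral>u. iexp (t * ?h (Suc n) i u) \<partial>coord_post (\<tau> (Suc n) i) (b i) ?y)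
          \<longlonglongrightarrow> (\<integral>u. iexp (t * (w i * u\<^sup>2)) \<partial>std_normal)" .
    qed
  qed (rule rd, rule M'.real_distribution_axioms)
  moreover have "isCont (cdf ?M') r"
  proof -
    have "measure ?M' {r} = measure WN {Z \<in> space WN. (\<Sum>i\<in>?F. w i * (Z i)\<^sup>2) = r}"
      by (subst measure_distr[OF mW]) (auto intro!: arg_cong2[where f=measure])
    then show ?thesis using atom by (simp add: M'.isCont_cdf measure_def)
  qed
  ultimately have "(\<lambda>n. cdf (?M (Suc n)) r) \<longlonglongrightarrow> cdf ?M' r"
    by (simp add: weak_conv_m_def weak_conv_def)
  then have "(\<lambda>n. cdf (?M n) r) \<longlonglongrightarrow> cdf ?M' r" by (rule LIMSEQ_imp_Suc[where f="\<lambda>n. cdf (?M n) r"])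
  moreover have "cdf ?M' r = measure WN {Z \<in> space WN. (\<Sum>i\<in>?F. w i * (Z i)\<^sup>2) \<le> r}"
    unfolding cdf_def by (subst measure_distr[OF mW]) (auto intro!: arg_cong2[where f=measure])
  ultimately have "(\<lambda>n. cdf (?M n) r) \<longlonglongrightarrow> measure WN {Z \<in> space WN. (\<Sum>i\<in>?F. w i * (Z i)\<^sup>2) \<le> r}" by simp
  then show ?thesis
    by (rule Lim_transform_eventually) (use eventually_gt_at_top[of 0] in eventually_elim, simp add: meas_eq)
qed

end

section \<open>Weak convergence of the posterior\<close>

lemma nn_integral_Markov_ge:
  assumes [measurable]: "u \<in> borel_measurable M" and e: "e > 0"
  shows "emeasure M {x \<in> space M. ennreal e \<le> u x} \<le> ennreal (1 / e) * (\<integral>\<^sup>+x. u x \<partial>M)"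
proof -
  have "ennreal e * emeasure M {x \<in> space M. ennreal e \<le> u x} =
      (\<integral>\<^sup>+x. ennreal e * indicator {x \<in> space M. ennreal e \<le> u x} x \<partial>M)"
    by (subst nn_integral_cmult_indicator) auto
  also have "\<dots> \<le> (\<integral>\<^sup>+x. u x \<partial>M)"
    by (intro nn_integral_mono) (auto split: split_indicator)
  finally have "ennreal (1 / e) * (ennreal e * emeasure M {x \<in> space M. ennreal e \<le> u x}) \<le> ennreal (1 / e) * (\<integral>\<^sup>+x. u x \<partial>M)"
    by (rule mult_left_mono) simp
  moreover have "ennreal (1 / e) * ennreal e = 1" using e by (simp add: ennreal_mult[symmetric])
  ultimately show ?thesis by (simp add: mult.assoc[symmetric])
qed

lemma ennreal_tendsto_0I:
  fixes f :: "nat \<Rightarrow> ennreal"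
  assumes "\<And>e. e > 0 \<Longrightarrow> eventually (\<lambda>n. f n \<le> ennreal e) sequentially"
  shows "f \<longlonglongrightarrow> 0"
proof (rule order_tendstoI)
  fix a :: ennreal assume "a > 0"
  then obtain e :: ennreal where e: "0 < e" "e < a" using dense by blast
  then obtain r where r: "e = ennreal r" "r > 0" by (cases e) auto
  show "eventually (\<lambda>n. f n < a) sequentially"
    using assms[OF r(2)] by eventually_elim (use e r in auto)
qed simp

lemma ennreal_tendsto_0D:
  fixes f :: "nat \<Rightarrow> ennreal"
  assumes "f \<longlonglongrightarrow> 0" "e > 0" shows "eventually (\<lambda>n. f n < ennreal e) sequentially"
  using order_tendstoD(2)[OF assms(1), of "ennreal e"] assms(2) by simp

locale bvm_model = series_model \<phi> K \<Omega> \<gamma> J0 \<psi> g F0 B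
  for \<phi> :: "real \<Rightarrow> real" and K :: real and \<Omega> :: "'w measure" and \<gamma> :: real and J0 :: nat
    and \<psi> :: "nat \<Rightarrow> nat \<Rightarrow> real \<Rightarrow> real" and g :: "nat \<times> nat \<Rightarrow> 'w \<Rightarrow> real" and F0 :: L2 and B :: real +
  fixes \<delta> :: real
  assumes \<delta>_gt: "\<delta> > 1 / 2"
begin

abbreviation wh :: "nat \<Rightarrow> real" where "wh \<equiv> wH \<delta>"

definition Fq :: "real \<Rightarrow> real" where
  "Fq = cdf (distr WN borel (\<lambda>W. enn2real (wsum J0 wh W)))"

text \<open>The argument r is a squared radius in units of 1 / n, so the credible radius solves Gn n
  W (R^2) = 1 - \<alpha>.\<close>

definition Gn :: "nat \<Rightarrow> (nat \<times> nat \<Rightarrow> real) \<Rightarrow> real \<Rightarrow> real" where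
  "Gn n W r = measure (post n W) {f. wsum J0 wh (\<lambda>i. resc n f i - vmean n W i) \<le> ennreal r}"

lemma i0_idx: "(J0 - 1, 0) \<in> idx J0" by (simp add: idx_def level_size_def)

lemma wh_i0: "wh (J0 - 1) > 0" using J0_ge by (intro wH_pos) simp

lemma summable_wh: "summable (\<lambda>l. wh l * (2 * 2 ^ l))"
  using summable_mult[OF summable_wH[OF \<delta>_gt], of 2] by (simp add: ac_simps)

lemma AE_wsum_WN: "AE W in WN. wsum J0 wh W < \<infinity>"
proof -
  have "(\<integral>\<^sup>+W. wsum J0 wh W \<partial>WN) \<le> (\<Sum>l. ennreal (wh l * (2 * 2 ^ l)))"
    using J0_ge by (intro nn_integral_white_noise_wsum) auto
  also have "\<dots> < \<infinity>" by (intro suminf_ennreal_finite summable_wh) simp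
  finally have "(\<integral>\<^sup>+W. wsum J0 wh W \<partial>WN) \<noteq> \<infinity>" by (rule less_imp_neq)
  then have "AE W in WN. wsum J0 wh W \<noteq> \<infinity>" by (intro nn_integral_PInf_AE) measurable
  then show ?thesis by eventually_elim (simp only: infinity_ennreal_def less_top[symmetric] not_False_eq_True)
qed

section \<open>The distribution function of the squared norm of white noise\<close>

lemma Fq_eq:
  assumes "r \<ge> 0" shows "Fq r = measure WN {W \<in> space WN. wsum J0 wh W \<le> ennreal r}"
proof -
  have "Fq r = measure WN {W \<in> space WN. enn2real (wsum J0 wh W) \<le> r}"
    unfolding Fq_def cdf_def by (subst measure_distr) (auto intro!: arg_cong2[where f=measure])
  also have "\<dots> = measure WN {W \<in> space WN. wsum J0 wh W \<le> ennreal r}"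
  proof (rule measure_eq_AE)
    show "AE W in WN. W \<in> {W \<in> space WN. enn2real (wsum J0 wh W) \<le> r} \<longleftrightarrow> W \<in> {W \<in> space WN. wsum J0 wh W \<le> ennreal r}"
      using AE_wsum_WN
    proof eventually_elim
      case (elim W)
      then obtain q where "q \<ge> 0" "wsum J0 wh W = ennreal q" by (cases "wsum J0 wh W") auto
      then show ?case using assms by simp
    qed
  qed measurable
  finally show ?thesis .
qed

lemma real_distribution_Q: "real_distribution (distr WN borel (\<lambda>W. enn2real (wsum J0 wh W)))"
  by (rule prob_space.real_distribution_distr[OF prob_space_white_noise]) measurable

lemma Fq_neg: "r < 0 \<Longrightarrow> Fq r = 0"
proof -
  assume r: "r < 0"
  have "{W \<in> space WN. enn2real (wsum J0 wh W) \<le> r} = {}"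
  proof -
    have "\<not> enn2real x \<le> r" for x using r enn2real_nonneg[of x] by linarith
    then show ?thesis by blast
  qed
  moreover have "Fq r = measure WN {W \<in> space WN. enn2real (wsum J0 wh W) \<le> r}"
    unfolding Fq_def cdf_def by (subst measure_distr) (auto intro!: arg_cong2[where f=measure])
  ultimately show ?thesis by (simp only: measure_empty)
qed

text \<open>The coordinate (J0 - 1, 0) has positive weight because J0 - 1 \<ge> 1, where the
  logarithm does not vanish; hence the squared norm has no atoms.\<close>

lemma isCont_Fq: "isCont Fq r"
proof -
  interpret Q: real_distribution "distr WN borel (\<lambda>W. enn2real (wsum J0 wh W))" by (rule real_distribution_Q)
  have "measure (distr WN borel (\<lambda>W. enn2real (wsum J0 wh W))) {r} = measure WN {W \<in> space WN. enn2real (wsum J0 wh W) = r}"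
    by (subst measure_distr) (auto intro!: arg_cong2[where f=measure])
  also have "\<dots> \<le> measure WN {W \<in> space WN. wsum J0 wh W = ennreal r}"
  proof (rule WNO.M1.finite_measure_mono_AE)
    show "AE W in WN. W \<in> {W \<in> space WN. enn2real (wsum J0 wh W) = r} \<longrightarrow> W \<in> {W \<in> space WN. wsum J0 wh W = ennreal r}"
      using AE_wsum_WN by eventually_elim auto
  qed measurable
  also have "\<dots> = 0"
    using white_noise_wsum_atom[of wh "(J0 - 1, 0)" J0 r] i0_idx wh_i0 by (simp add: measure_def)
  finally have "measure (distr WN borel (\<lambda>W. enn2real (wsum J0 wh W))) {r} = 0"
    using measure_nonneg[of "distr WN borel (\<lambda>W. enn2real (wsum J0 wh W))" "{r}"] by linarith
  then show ?thesis unfolding Fq_def by (simp add: Q.isCont_cdf)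
qed

lemma Fq_mono: "r \<le> s \<Longrightarrow> Fq r \<le> Fq s"
proof -
  interpret Q: real_distribution "distr WN borel (\<lambda>W. enn2real (wsum J0 wh W))" by (rule real_distribution_Q)
  show "r \<le> s \<Longrightarrow> Fq r \<le> Fq s" unfolding Fq_def by (rule Q.cdf_nondecreasing)
qed

lemma Fq_surj:
  assumes "0 < c" "c < 1" obtains r where "r > 0" "Fq r = c"
proof -
  interpret Q: real_distribution "distr WN borel (\<lambda>W. enn2real (wsum J0 wh W))" by (rule real_distribution_Q)
  have "(Fq \<longlongrightarrow> 1) at_top" unfolding Fq_def by (rule Q.cdf_lim_at_top_prob)
  from order_tendstoD(1)[OF this assms(2)] obtain s where s: "Fq s > c"
    unfolding eventually_at_top_linorder by auto
  have F0: "Fq (- 1) = 0" by (rule Fq_neg) simp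
  have "s \<ge> - 1" using s F0 assms(1) Fq_mono[of s "- 1"] by (cases "s \<le> - 1") auto
  then obtain r where r: "Fq r = c"
    using IVT[of Fq "- 1" c s] F0 s assms(1) isCont_Fq by auto
  have "r \<noteq> 0"
  proof
    assume "r = 0"
    have "Fq 0 = measure WN {W \<in> space WN. wsum J0 wh W = ennreal 0}" by (simp add: Fq_eq)
    also have "\<dots> = 0"
      using white_noise_wsum_atom[of wh "(J0 - 1, 0)" J0 0] i0_idx wh_i0 by (simp add: measure_def)
    finally show False using r assms \<open>r = 0\<close> by simp
  qed
  moreover have "\<not> r < 0" using Fq_neg[of r] r assms by auto
  ultimately show ?thesis using that[of r] r by simp
qed

definition FL :: "nat \<Rightarrow> real \<Rightarrow> real" where
  "FL L r = measure WN {Z \<in> space WN. (\<Sum>i\<in>idx_below J0 L. wh (fst i) * (Z i)\<^sup>2) \<le> r}"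

lemma partial_measurable [measurable]: "(\<lambda>Z. \<Sum>i\<in>idx_below J0 L. wh (fst i) * (Z i)\<^sup>2) \<in> borel_measurable WN"
  using idx_below_subset
  by (intro borel_measurable_sum borel_measurable_times borel_measurable_power white_noise_component borel_measurable_const) auto

lemma FL_limit:
  assumes "r \<ge> 0" shows "(\<lambda>L. FL L r) \<longlonglongrightarrow> Fq r"
proof -
  let ?A = "\<lambda>L. {Z \<in> space WN. (\<Sum>i\<in>idx_below J0 L. wh (fst i) * (Z i)\<^sup>2) \<le> r}"
  have "(\<lambda>L. measure WN (?A L)) \<longlonglongrightarrow> measure WN (\<Inter>L. ?A L)"
  proof (rule WNO.M1.finite_Lim_measure_decseq)
    show "decseq ?A"
    proof (rule decseq_SucI)
      fix L
      have "(\<Sum>i\<in>idx_below J0 L. wh (fst i) * (Z i)\<^sup>2) \<le> (\<Sum>i\<in>idx_below J0 (Suc L). wh (fst i) * (Z i)\<^sup>2)" for Z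
        by (intro sum_mono2 idx_below_mono) auto
      then show "?A (Suc L) \<subseteq> ?A L" using order_trans by blast
    qed
    show "range ?A \<subseteq> sets WN" by (intro image_subsetI) measurable
  qed
  also have "(\<Inter>L. ?A L) = {Z \<in> space WN. wsum J0 wh Z \<le> ennreal r}"
    using assms by (auto simp: wsum_SUP SUP_le_iff)
  finally show ?thesis using assms by (simp add: FL_def Fq_eq)
qed

lemma FL_ge: assumes "r \<ge> 0" shows "Fq r \<le> FL L r"
  unfolding Fq_eq[OF assms] FL_def
proof (rule WNO.M1.finite_measure_mono)
  show "{W \<in> space WN. wsum J0 wh W \<le> ennreal r} \<subseteq> {Z \<in> space WN. (\<Sum>i\<in>idx_below J0 L. wh (fst i) * (Z i)\<^sup>2) \<le> r}"
  proof safe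
    fix W assume "wsum J0 wh W \<le> ennreal r"
    then have "ennreal (\<Sum>i\<in>idx_below J0 L. wh (fst i) * (W i)\<^sup>2) \<le> ennreal r"
      using wsum_ge[of wh "idx_below J0 L" J0 W] idx_below_subset by (meson finite_idx_below order_trans wH_nonneg)
    then show "(\<Sum>i\<in>idx_below J0 L. wh (fst i) * (W i)\<^sup>2) \<le> r" using assms by simp
  qed
qed measurable

text \<open>A truncated weight is again an admissible weight, and L \<ge> J0 keeps level J0 - 1, on
  which it is positive.\<close>

lemma partial_atom:
  assumes "L \<ge> J0"
  shows "emeasure WN {Z \<in> space WN. (\<Sum>i\<in>idx_below J0 L. wh (fst i) * (Z i)\<^sup>2) = r} = 0"
proof -
  let ?w = "\<lambda>l. if l < L then wh l else 0"
  have "emeasure WN {Z \<in> space WN. (\<Sum>i\<in>idx_below J0 L. wh (fst i) * (Z i)\<^sup>2) = r} \<le>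
      emeasure WN {Z \<in> space WN. wsum J0 ?w Z = ennreal r}"
  proof (rule emeasure_mono)
    show "{Z \<in> space WN. wsum J0 ?w Z = ennreal r} \<in> sets WN" by measurable
  qed (auto simp: wsum_truncate)
  also have "\<dots> = 0"
    using assms J0_ge wh_i0 by (intro white_noise_wsum_atom[OF _ i0_idx]) auto
  finally show ?thesis by simp
qed

section \<open>From finite sections to the full norm\<close>

lemma AE_regular_all: "AE W in WN. \<forall>n>0. good n W"
  by (subst AE_all_countable, intro allI) (use AE_good in auto)

definition hn :: "nat \<Rightarrow> nat \<Rightarrow> (nat \<times> nat \<Rightarrow> real) \<Rightarrow> real \<Rightarrow> real" where
  "hn L n W r = measure (post n W) {f. (\<Sum>i\<in>idx_below J0 L. wh (fst i) * (resc n f i - vmean n W i)\<^sup>2) \<le> r}"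

lemma hn_limit:
  assumes L: "L \<ge> J0" shows "AE W in WN. (\<lambda>n. hn L n W r) \<longlonglongrightarrow> FL L r"
  using AE_regular_all
proof eventually_elim
  case (elim W)
  then have "\<And>n. n > 0 \<Longrightarrow> regular n W" by (simp add: good_def)
  from finite_section_cdf[OF this partial_atom[OF L]] show ?case by (simp add: hn_def FL_def)
qed

lemma centred_measurable:
  assumes "i \<in> idx J0"
  shows "(\<lambda>p. resc n (snd p) i - vmean n (fst p) i) \<in> borel_measurable (WN \<Otimes>\<^sub>M borel)"
  by (intro borel_measurable_diff measurable_compose[OF measurable_snd resc_measurable]
      measurable_compose[OF measurable_fst vmean_measurable[OF assms]])

lemma space_pair_borel: "space (WN \<Otimes>\<^sub>M (borel :: L2 measure)) = space WN \<times> UNIV"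
  by (simp add: space_pair_measure)

lemma hn_measurable [measurable]: "(\<lambda>W. hn L n W r) \<in> borel_measurable WN"
proof -
  let ?A = "{p \<in> space (WN \<Otimes>\<^sub>M (borel :: L2 measure)). (\<Sum>i\<in>idx_below J0 L. wh (fst i) * (resc n (snd p) i - vmean n (fst p) i)\<^sup>2) \<le> r}"
  have [measurable]: "(\<lambda>p. \<Sum>i\<in>idx_below J0 L. wh (fst i) * (resc n (snd p) i - vmean n (fst p) i)\<^sup>2) \<in> borel_measurable (WN \<Otimes>\<^sub>M borel)"
    using idx_below_subset
    by (intro borel_measurable_sum borel_measurable_times borel_measurable_power centred_measurable borel_measurable_const) auto
  have "?A \<in> sets (WN \<Otimes>\<^sub>M borel)" by measurable
  from kernel_measurable[OF X_measurable this, of n n]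
  have "(\<lambda>W. enn2real (emeasure (post n W) {f. (W, f) \<in> ?A})) \<in> borel_measurable WN" by measurable
  moreover have "enn2real (emeasure (post n W) {f. (W, f) \<in> ?A}) = hn L n W r" if "W \<in> space WN" for W
    using that by (simp add: hn_def measure_def space_pair_borel)
  ultimately show ?thesis by (simp cong: measurable_cong)
qed

lemma Gn_measurable [measurable]: "(\<lambda>W. Gn n W r) \<in> borel_measurable WN"
proof -
  let ?A = "{p \<in> space (WN \<Otimes>\<^sub>M (borel :: L2 measure)). wsum J0 wh (\<lambda>i. resc n (snd p) i - vmean n (fst p) i) \<le> ennreal r}"
  have [measurable]: "(\<lambda>p. wsum J0 wh (\<lambda>i. resc n (snd p) i - vmean n (fst p) i)) \<in> borel_measurable (WN \<Otimes>\<^sub>M borel)"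
    by (rule wsum_measurable) (rule centred_measurable)
  have "?A \<in> sets (WN \<Otimes>\<^sub>M borel)" by measurable
  from kernel_measurable[OF X_measurable this, of n n]
  have "(\<lambda>W. enn2real (emeasure (post n W) {f. (W, f) \<in> ?A})) \<in> borel_measurable WN" by measurable
  moreover have "enn2real (emeasure (post n W) {f. (W, f) \<in> ?A}) = Gn n W r" if "W \<in> space WN" for W
    using that by (simp add: Gn_def measure_def space_pair_borel)
  ultimately show ?thesis by (simp cong: measurable_cong)
qed

lemma Gn_le_hn:
  assumes n: "n > 0" and W: "good n W" and r: "r \<ge> 0"
  shows "Gn n W r \<le> hn L n W r"
proof -
  interpret prob_space "post n W" using W by (intro prob_space_post n) (simp add: good_def)
  show ?thesis unfolding Gn_def hn_def
  proof (rule finite_measure_mono)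
    show "{f. wsum J0 wh (\<lambda>i. resc n f i - vmean n W i) \<le> ennreal r} \<subseteq>
        {f. (\<Sum>i\<in>idx_below J0 L. wh (fst i) * (resc n f i - vmean n W i)\<^sup>2) \<le> r}"
    proof safe
      fix f assume a: "wsum J0 wh (\<lambda>i. resc n f i - vmean n W i) \<le> ennreal r"
      have "ennreal (\<Sum>i\<in>idx_below J0 L. wh (fst i) * (resc n f i - vmean n W i)\<^sup>2) \<le> wsum J0 wh (\<lambda>i. resc n f i - vmean n W i)"
        by (rule wsum_ge[OF wH_nonneg finite_idx_below idx_below_subset])
      also note a
      finally show "(\<Sum>i\<in>idx_below J0 L. wh (fst i) * (resc n f i - vmean n W i)\<^sup>2) \<le> r" using r by simp
    qed
    have "{f \<in> space borel. (\<Sum>i\<in>idx_below J0 L. wh (fst i) * (resc n f i - vmean n W i)\<^sup>2) \<le> r} \<in> sets borel" by measurable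
    then show "{f. (\<Sum>i\<in>idx_below J0 L. wh (fst i) * (resc n f i - vmean n W i)\<^sup>2) \<le> r} \<in> events" by simp
  qed
qed

text \<open>Truncation only enlarges the ball, so the tails need no control: a section L with
  \<open>FL L r\<close> below c suffices, and its posterior mass converges for almost every noise
  sequence.\<close>

lemma Gn_upper:
  assumes r: "r \<ge> 0" and c: "Fq r < c"
  shows "(\<lambda>n. emeasure WN {W \<in> space WN. c \<le> Gn n W r}) \<longlonglongrightarrow> 0"
proof -
  have "eventually (\<lambda>L. FL L r < c) sequentially" by (rule order_tendstoD(2)[OF FL_limit[OF r] c])
  moreover have "eventually (\<lambda>L. L \<ge> J0) sequentially" by (rule eventually_ge_at_top)
  ultimately have "eventually (\<lambda>L. FL L r < c \<and> L \<ge> J0) sequentially" by (rule eventually_conj)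
  then obtain L where L: "FL L r < c" "L \<ge> J0" by (auto simp: eventually_sequentially)
  show ?thesis
  proof (rule WNO.M1.emeasure_eventually_tendsto_0)
    show "AE W in WN. eventually (\<lambda>n. \<not> c \<le> Gn n W r) sequentially"
      using hn_limit[OF L(2), of r] AE_regular_all
    proof eventually_elim
      case (elim W)
      from order_tendstoD(2)[OF elim(1) L(1)] eventually_gt_at_top[of 0] show ?case
      proof eventually_elim
        case (elim n)
        then show ?case using Gn_le_hn[of n W r L] r \<open>\<forall>n>0. good n W\<close> by auto
      qed
    qed
  qed measurable
qed

definition wtail :: "nat \<Rightarrow> nat \<Rightarrow> real" where
  "wtail L l = (if l < L then 0 else wh l)"

lemma wtail_nonneg [simp]: "wtail L l \<ge> 0" by (simp add: wtail_def)

lemma tail_limit: "(\<lambda>L. \<Sum>l. ennreal (wtail L l * (2 * 2 ^ l) * Cm)) \<longlonglongrightarrow> 0"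
proof -
  have "(\<lambda>L. \<integral>\<^sup>+l. ennreal (wtail L l * (2 * 2 ^ l) * Cm) \<partial>count_space UNIV) \<longlonglongrightarrow> (\<integral>\<^sup>+l. 0 \<partial>(count_space UNIV :: nat measure))"
  proof (rule nn_integral_dominated_convergence[where w="\<lambda>l. ennreal (wh l * (2 * 2 ^ l) * Cm)"])
    show "AE l in count_space UNIV. ennreal (wtail L l * (2 * 2 ^ l) * Cm) \<le> ennreal (wh l * (2 * 2 ^ l) * Cm)" for L
      using Cm(1) by (auto simp: wtail_def intro!: AE_I2 ennreal_leI)
    have "(\<Sum>l. ennreal (wh l * (2 * 2 ^ l) * Cm)) < \<infinity>"
      using Cm(1) by (intro suminf_ennreal_finite summable_mult2 summable_wh) simp
    then show "(\<integral>\<^sup>+l. ennreal (wh l * (2 * 2 ^ l) * Cm) \<partial>count_space UNIV) < \<infinity>"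
      by (simp add: nn_integral_count_space_nat)
    have "eventually (\<lambda>L. ennreal (wtail L l * (2 * 2 ^ l) * Cm) = 0) sequentially" for l
      using eventually_gt_at_top[of l] by eventually_elim (simp add: wtail_def)
    then show "AE l in count_space UNIV. (\<lambda>L. ennreal (wtail L l * (2 * 2 ^ l) * Cm)) \<longlonglongrightarrow> 0"
      by (intro AE_I2 tendsto_eventually)
  qed auto
  then show ?thesis by (simp add: nn_integral_count_space_nat)
qed

lemma mean_pmsq_tail:
  assumes n: "n > 0"
  shows "(\<integral>\<^sup>+W. pmsq n (wtail L) W \<partial>WN) \<le> (\<Sum>l. ennreal (wtail L l * (2 * 2 ^ l) * Cm))"
proof -
  have "(\<integral>\<^sup>+W. pmsq n (wtail L) W \<partial>WN) \<le> (\<Sum>l. ennreal (wtail L l * (2 * 2 ^ l * (Cm * min 1 (real n * (sg (l, 0))\<^sup>2)))))"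
    by (rule mean_pmsq[OF n]) simp
  also have "\<dots> \<le> (\<Sum>l. ennreal (wtail L l * (2 * 2 ^ l) * Cm))"
  proof (intro suminf_le summableI ennreal_leI)
    fix l
    have "Cm * min 1 (real n * (sg (l, 0))\<^sup>2) \<le> Cm * 1" using Cm(1) by (intro mult_left_mono) (auto simp: less_imp_le)
    then have "wtail L l * (2 * 2 ^ l) * (Cm * min 1 (real n * (sg (l, 0))\<^sup>2)) \<le> wtail L l * (2 * 2 ^ l) * (Cm * 1)"
      by (rule mult_left_mono) simp
    then show "wtail L l * (2 * 2 ^ l * (Cm * min 1 (real n * (sg (l, 0))\<^sup>2))) \<le> wtail L l * (2 * 2 ^ l) * Cm"
      by (simp add: mult.assoc)
  qed
  finally show ?thesis .
qed

lemma wh_split: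
  "wsum J0 wh c = ennreal (\<Sum>i\<in>idx_below J0 L. wh (fst i) * (c i)\<^sup>2) + wsum J0 (wtail L) c"
proof -
  have "wh = (\<lambda>l. (if l < L then wh l else 0) + wtail L l)" by (auto simp: wtail_def)
  then have "wsum J0 wh c = wsum J0 (\<lambda>l. (if l < L then wh l else 0) + wtail L l) c" by simp
  also have "\<dots> = wsum J0 (\<lambda>l. if l < L then wh l else 0) c + wsum J0 (wtail L) c"
    by (rule wsum_add) auto
  finally show ?thesis by (simp add: wsum_truncate)
qed

text \<open>A section of size at most r' and a tail below r - r' add up to at most r; Markov's
  inequality bounds the posterior probability of a large tail by a.\<close>

lemma hn_le_Gn:
  assumes n: "n > 0" and W: "good n W" and r: "0 \<le> r'" "r' < r" and a: "a > 0"
    and t: "pmsq n (wtail L) W < ennreal ((r - r') * a)"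
  shows "hn L n W r' \<le> Gn n W r + a"
proof -
  have Wr: "regular n W" using W by (simp add: good_def)
  interpret prob_space "post n W" by (intro prob_space_post n Wr)
  let ?c = "\<lambda>f i. resc n f i - vmean n W i"
  let ?Bad = "{f \<in> space (post n W). ennreal (r - r') \<le> wsum J0 (wtail L) (?c f)}"
  have sb: "{f. P f} \<in> events" if "{f \<in> space borel. P f} \<in> sets borel" for P using that by simp
  have m: "(\<lambda>f. wsum J0 (wtail L) (?c f)) \<in> borel_measurable (post n W)" by measurable
  have "emeasure (post n W) ?Bad \<le> ennreal (1 / (r - r')) * (\<integral>\<^sup>+f. wsum J0 (wtail L) (?c f) \<partial>post n W)"
    using r by (intro nn_integral_Markov_ge m) simp
  also have "\<dots> \<le> ennreal (1 / (r - r')) * pmsq n (wtail L) W"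
    by (intro mult_left_mono post_wsum_le post_coord_sq_centered[OF n Wr]) auto
  also have "\<dots> \<le> ennreal (1 / (r - r')) * ennreal ((r - r') * a)"
    using t by (intro mult_left_mono) auto
  also have "\<dots> = ennreal a" using r a by (simp add: ennreal_mult[symmetric])
  finally have bad: "prob ?Bad \<le> a" using a by (simp add: emeasure_eq_measure)
  have Bad: "?Bad \<in> events" using m by measurable
  have G: "{f. wsum J0 wh (?c f) \<le> ennreal r} \<in> events" by (rule sb) measurable
  have "hn L n W r' \<le> prob ({f. wsum J0 wh (?c f) \<le> ennreal r} \<union> ?Bad)"
    unfolding hn_def
  proof (rule finite_measure_mono)
    show "{f. (\<Sum>i\<in>idx_below J0 L. wh (fst i) * (?c f i)\<^sup>2) \<le> r'} \<subseteq> {f. wsum J0 wh (?c f) \<le> ennreal r} \<union> ?Bad"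
    proof
      fix f assume f: "f \<in> {f. (\<Sum>i\<in>idx_below J0 L. wh (fst i) * (?c f i)\<^sup>2) \<le> r'}"
      show "f \<in> {f. wsum J0 wh (?c f) \<le> ennreal r} \<union> ?Bad"
      proof (cases "ennreal (r - r') \<le> wsum J0 (wtail L) (?c f)")
        case False
        have "wsum J0 wh (?c f) \<le> ennreal r' + ennreal (r - r')"
          unfolding wh_split[of _ L] using f False by (intro add_mono ennreal_leI) auto
        also have "\<dots> = ennreal r" using r by (simp add: ennreal_plus[symmetric] del: ennreal_plus)
        finally show ?thesis by simp
      qed simp
    qed
  qed (use G Bad in auto)
  also have "\<dots> \<le> Gn n W r + prob ?Bad" unfolding Gn_def using G Bad by (rule measure_Un_le)
  finally show ?thesis using bad by simp
qed

text \<open>The gap between r' and r absorbs the tail. A single truncation level L works for all n >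
  0, because the expected tail is bounded uniformly in n by \<open>mean_pmsq_tail\<close>; this is
  the tightness part of the weak convergence.\<close>

lemma Gn_lower:
  assumes r: "0 \<le> r'" "r' < r" and c: "c < Fq r'"
  shows "(\<lambda>n. emeasure WN {W \<in> space WN. Gn n W r \<le> c}) \<longlonglongrightarrow> 0"
proof (rule ennreal_tendsto_0I)
  fix e :: real assume e: "e > 0"
  define a where "a = (Fq r' - c) / 2"
  have a: "a > 0" "c + a < Fq r'" using c by (auto simp: a_def field_simps)
  define d where "d = (r - r') * a"
  have d: "d > 0" using a r by (simp add: d_def)
  have "eventually (\<lambda>L. (\<Sum>l. ennreal (wtail L l * (2 * 2 ^ l) * Cm)) < ennreal (d * e / 2)) sequentially"
    using ennreal_tendsto_0D[OF tail_limit, of "d * e / 2"] d e by simp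
  moreover have "eventually (\<lambda>L. L \<ge> J0) sequentially" by (rule eventually_ge_at_top)
  ultimately have "eventually (\<lambda>L. (\<Sum>l. ennreal (wtail L l * (2 * 2 ^ l) * Cm)) < ennreal (d * e / 2) \<and> L \<ge> J0) sequentially"
    by (rule eventually_conj)
  then obtain L where L: "(\<Sum>l. ennreal (wtail L l * (2 * 2 ^ l) * Cm)) < ennreal (d * e / 2)" "L \<ge> J0"
    by (auto simp: eventually_sequentially)
  have "(\<lambda>n. emeasure WN {W \<in> space WN. hn L n W r' \<le> c + a}) \<longlonglongrightarrow> 0"
  proof (rule WNO.M1.emeasure_eventually_tendsto_0)
    have "c + a < FL L r'" using a(2) FL_ge[OF r(1), of L] by linarith
    then show "AE W in WN. eventually (\<lambda>n. \<not> hn L n W r' \<le> c + a) sequentially"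
      using hn_limit[OF L(2), of r'] by (auto simp: not_le dest: order_tendstoD(1))
  qed measurable
  from ennreal_tendsto_0D[OF this, of "e / 2"] e
  have "eventually (\<lambda>n. emeasure WN {W \<in> space WN. hn L n W r' \<le> c + a} < ennreal (e / 2)) sequentially" by simp
  then show "eventually (\<lambda>n. emeasure WN {W \<in> space WN. Gn n W r \<le> c} \<le> ennreal e) sequentially"
    using eventually_gt_at_top[of 0]
  proof eventually_elim
    case (elim n)
    let ?T = "{W \<in> space WN. ennreal d \<le> pmsq n (wtail L) W}"
    have "emeasure WN ?T \<le> ennreal (1 / d) * (\<integral>\<^sup>+W. pmsq n (wtail L) W \<partial>WN)"
      by (rule nn_integral_Markov_ge) (use d in auto)
    also have "\<dots> \<le> ennreal (1 / d) * ennreal (d * e / 2)"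
      using mean_pmsq_tail[OF elim(2), of L] L(1) by (intro mult_left_mono) auto
    also have "\<dots> = ennreal (e / 2)" using d e by (simp add: ennreal_mult[symmetric])
    finally have T: "emeasure WN ?T \<le> ennreal (e / 2)" .
    have "emeasure WN {W \<in> space WN. Gn n W r \<le> c} \<le> emeasure WN ({W \<in> space WN. hn L n W r' \<le> c + a} \<union> ?T)"
    proof (rule emeasure_mono_AE)
      show "AE W in WN. W \<in> {W \<in> space WN. Gn n W r \<le> c} \<longrightarrow> W \<in> {W \<in> space WN. hn L n W r' \<le> c + a} \<union> ?T"
        using AE_good[OF elim(2)]
      proof eventually_elim
        case (elim W)
        show ?case
        proof (cases "ennreal d \<le> pmsq n (wtail L) W")
          case False
          then have "hn L n W r' \<le> Gn n W r + a"
            using hn_le_Gn[OF \<open>0 < n\<close> elim r a(1), of L] by (simp add: d_def not_le)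
          then show ?thesis by auto
        qed auto
      qed
    qed measurable
    also have "\<dots> \<le> emeasure WN {W \<in> space WN. hn L n W r' \<le> c + a} + emeasure WN ?T"
      by (rule emeasure_subadditive) measurable
    also have "\<dots> \<le> ennreal (e / 2) + ennreal (e / 2)" using elim(1) T by (intro add_mono) auto
    also have "\<dots> = ennreal e" using e by (simp add: ennreal_plus[symmetric] del: ennreal_plus)
    finally show ?case .
  qed
qed

end

text \<open>By continuity from above along nested closed windows, the condition on the real number \<open>m\<close> is a
  countable one; this makes the smoothness radius measurable.\<close>

lemma (in finite_measure) exists_window_iff:
  fixes h :: "'a \<Rightarrow> ereal" and c t \<eta> :: real
  assumes [measurable]: "h \<in> borel_measurable M"
  shows "(\<exists>m. 0 < m \<and> m < c \<and> t \<le> measure M {f \<in> space M. ereal (m - \<eta>) \<le> h f \<and> h f \<le> ereal (m + \<eta>)}) \<longleftrightarrow>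
    (\<exists>k::nat. \<forall>j::nat. \<exists>q\<in>\<rat> \<inter> {1 / real (Suc k)..c - 1 / real (Suc k)}.
       t \<le> measure M {f \<in> space M. ereal (q - \<eta> - 1 / real (Suc j)) \<le> h f \<and> h f \<le> ereal (q + \<eta> + 1 / real (Suc j))})"
    (is "?lhs \<longleftrightarrow> ?rhs")
proof -
  let ?A = "\<lambda>a b. {f \<in> space M. ereal a \<le> h f \<and> h f \<le> ereal b}"
  have S: "?A a b \<in> sets M" for a b by measurable
  have mono: "measure M (?A a b) \<le> measure M (?A a' b')" if "a' \<le> a" "b \<le> b'" for a b a' b'
  proof (rule finite_measure_mono[OF _ S])
    show "?A a b \<subseteq> ?A a' b'"
      using that by (auto intro: order_trans[of "ereal a'" "ereal a"] order_trans[of _ "ereal b" "ereal b'"])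
  qed
  show ?thesis
  proof
    assume ?lhs
    then obtain m where m: "0 < m" "m < c" "t \<le> measure M (?A (m - \<eta>) (m + \<eta>))" by blast
    \<comment> \<open>\<open>k\<close> confines the rational centres to a compact part of the open
      interval from 0 to c, so that limits of centres stay strictly inside.\<close>
    obtain k where k: "1 / real (Suc k) < min m (c - m)"
      using m reals_Archimedean[of "min m (c - m)"] by (auto simp: inverse_eq_divide)
    have "\<exists>q\<in>\<rat> \<inter> {1 / real (Suc k)..c - 1 / real (Suc k)}. t \<le> measure M (?A (q - \<eta> - 1 / real (Suc j)) (q + \<eta> + 1 / real (Suc j)))" for j
    proof -
      have "max (m - 1 / real (Suc j)) (1 / real (Suc k)) < m" using k by simp
      then obtain q where q: "q \<in> \<rat>" "max (m - 1 / real (Suc j)) (1 / real (Suc k)) < q" "q < m"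
        using Rats_dense_in_real by blast
      have "measure M (?A (m - \<eta>) (m + \<eta>)) \<le> measure M (?A (q - \<eta> - 1 / real (Suc j)) (q + \<eta> + 1 / real (Suc j)))"
        using q by (intro mono) (auto simp: max_less_iff_conj)
      moreover have "q \<in> {1 / real (Suc k)..c - 1 / real (Suc k)}" using q k by (auto simp: min_less_iff_conj)
      ultimately show ?thesis using m(3) q(1) by (intro bexI[of _ q]) (linarith, blast)
    qed
    then show ?rhs by blast
  next
    assume ?rhs
    then obtain k where "\<forall>j. \<exists>q\<in>\<rat> \<inter> {1 / real (Suc k)..c - 1 / real (Suc k)}.
       t \<le> measure M (?A (q - \<eta> - 1 / real (Suc j)) (q + \<eta> + 1 / real (Suc j)))" by blast
    then have "\<forall>j. \<exists>q. q \<in> {1 / real (Suc k)..c - 1 / real (Suc k)} \<and>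
       t \<le> measure M (?A (q - \<eta> - 1 / real (Suc j)) (q + \<eta> + 1 / real (Suc j)))" by blast
    from choice[OF this] obtain q where q': "\<forall>j. q j \<in> {1 / real (Suc k)..c - 1 / real (Suc k)} \<and>
       t \<le> measure M (?A (q j - \<eta> - 1 / real (Suc j)) (q j + \<eta> + 1 / real (Suc j)))" ..
    then have q: "\<And>j. q j \<in> {1 / real (Suc k)..c - 1 / real (Suc k)}"
        "\<And>j. t \<le> measure M (?A (q j - \<eta> - 1 / real (Suc j)) (q j + \<eta> + 1 / real (Suc j)))" by blast+
    \<comment> \<open>The rational centres accumulate at a real centre \<open>m\<close>, and each
      fixed enlargement of the window around \<open>m\<close> eventually contains the enlarged
      windows along the subsequence.\<close>
    obtain m s where m: "m \<in> {1 / real (Suc k)..c - 1 / real (Suc k)}" "strict_mono (s :: nat \<Rightarrow> nat)" "(q \<circ> s) \<longlonglongrightarrow> m"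
      using compact_Icc[of "1 / real (Suc k)" "c - 1 / real (Suc k)"] q(1) unfolding compact_def by metis
    have pos: "1 / real (Suc k) > 0" by simp
    have m': "0 < m" "m < c"
    proof -
      have "1 / real (Suc k) \<le> m" "m \<le> c - 1 / real (Suc k)" using m(1) by auto
      then show "0 < m" "m < c" using pos by linarith+
    qed
    let ?B = "\<lambda>p. ?A (m - \<eta> - 1 / real (Suc p)) (m + \<eta> + 1 / real (Suc p))"
    have win: "t \<le> measure M (?B p)" for p
    proof -
      have "(\<lambda>j. \<bar>q (s j) - m\<bar> + 1 / real (Suc (s j))) \<longlonglongrightarrow> \<bar>m - m\<bar> + 0"
      proof (intro tendsto_intros)
        show "(\<lambda>j. q (s j)) \<longlonglongrightarrow> m" using m(3) by (simp add: o_def)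
        have "(\<lambda>j. 1 / real (Suc j)) \<longlonglongrightarrow> 0" using LIMSEQ_Suc[OF lim_1_over_n] by simp
        from LIMSEQ_subseq_LIMSEQ[OF this m(2)] show "(\<lambda>j. 1 / real (Suc (s j))) \<longlonglongrightarrow> 0" by (simp add: o_def)
      qed
      then have "eventually (\<lambda>j. \<bar>q (s j) - m\<bar> + 1 / real (Suc (s j)) < 1 / real (Suc p)) sequentially"
        by (rule order_tendstoD) simp
      then obtain j where j: "\<bar>q (s j) - m\<bar> + 1 / real (Suc (s j)) < 1 / real (Suc p)"
        by (auto simp: eventually_sequentially)
      have j1: "m - 1 / real (Suc p) \<le> q (s j) - 1 / real (Suc (s j))"
        using j abs_ge_minus_self[of "q (s j) - m"] by linarith
      have j2: "q (s j) + 1 / real (Suc (s j)) \<le> m + 1 / real (Suc p)"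
        using j abs_ge_self[of "q (s j) - m"] by linarith
      have "measure M (?A (q (s j) - \<eta> - 1 / real (Suc (s j))) (q (s j) + \<eta> + 1 / real (Suc (s j)))) \<le> measure M (?B p)"
        by (rule mono) (use j1 j2 in linarith)+
      then show ?thesis using q(2)[of "s j"] by (rule order_trans[rotated])
    qed
    have "(\<lambda>p. measure M (?B p)) \<longlonglongrightarrow> measure M (\<Inter>p. ?B p)"
    proof (rule finite_Lim_measure_decseq)
      show "range ?B \<subseteq> sets M" using S by blast
      show "decseq ?B"
      proof (rule decseq_SucI)
        fix p
        have "1 / real (Suc (Suc p)) \<le> 1 / real (Suc p)" by (rule divide_left_mono) auto
        then have "ereal (m - \<eta> - 1 / real (Suc p)) \<le> ereal (m - \<eta> - 1 / real (Suc (Suc p)))"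
          "ereal (m + \<eta> + 1 / real (Suc (Suc p))) \<le> ereal (m + \<eta> + 1 / real (Suc p))" by simp_all
        then show "?B (Suc p) \<subseteq> ?B p" using order_trans by blast
      qed
    qed
    moreover have "(\<Inter>p. ?B p) = ?A (m - \<eta>) (m + \<eta>)"
    proof (intro equalityI subsetI)
      fix f assume f: "f \<in> (\<Inter>p. ?B p)"
      have lim0: "(\<lambda>p. 1 / real (Suc p)) \<longlonglongrightarrow> 0" using LIMSEQ_Suc[OF lim_1_over_n] by simp
      have fp: "ereal (m - \<eta> - 1 / real (Suc p)) \<le> h f" "h f \<le> ereal (m + \<eta> + 1 / real (Suc p))" for p
        using f by blast+
      have "(\<lambda>p. ereal (m - \<eta> - 1 / real (Suc p))) \<longlonglongrightarrow> ereal (m - \<eta> - 0)"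
        by (intro tendsto_ereal tendsto_intros lim0)
      then have "ereal (m - \<eta> - 0) \<le> h f"
        by (rule LIMSEQ_le_const2) (use fp(1) in blast)
      moreover have "(\<lambda>p. ereal (m + \<eta> + 1 / real (Suc p))) \<longlonglongrightarrow> ereal (m + \<eta> + 0)"
        by (intro tendsto_ereal tendsto_intros lim0)
      then have "h f \<le> ereal (m + \<eta> + 0)"
        by (rule LIMSEQ_le_const) (use fp(2) in blast)
      ultimately have "ereal (m - \<eta> - 0) \<le> h f" "h f \<le> ereal (m + \<eta> + 0)" by blast+
      then show "f \<in> ?A (m - \<eta>) (m + \<eta>)" using f by simp
    next
      fix f assume f: "f \<in> ?A (m - \<eta>) (m + \<eta>)"
      have "ereal (m - \<eta> - 1 / real (Suc p)) \<le> ereal (m - \<eta>)" "ereal (m + \<eta>) \<le> ereal (m + \<eta> + 1 / real (Suc p))" for p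
        by simp_all
      then show "f \<in> (\<Inter>p. ?B p)" using f order_trans by blast
    qed
    ultimately have "t \<le> measure M (?A (m - \<eta>) (m + \<eta>))"
      by (intro LIMSEQ_le_const[of "\<lambda>p. measure M (?B p)"]) (use win in auto)
    then show ?lhs using m' by blast
  qed
qed

context bvm_model
begin

section \<open>The posterior mean compared with the noise\<close>

definition aD :: "nat \<Rightarrow> nat \<times> nat \<Rightarrow> ennreal" where
  "aD n i = (\<integral>\<^sup>+y. ennreal ((coord_mean (\<tau> n i) (b i) y - y)\<^sup>2) \<partial>std_normal)"

lemma aD_limit: "(\<lambda>n. aD (Suc n) i) \<longlonglongrightarrow> 0"
  unfolding aD_def by (rule coord_mean_L2_limit[OF \<tau>_limit])

lemma aD_bound:
  assumes n: "n > 0" and i: "i \<in> idx J0" shows "aD n i \<le> ennreal (2 * Cm + 2)"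
proof -
  have "aD n i \<le> (\<integral>\<^sup>+y. ennreal 2 * ennreal (coord_msq (\<tau> n i) (b i) y) + ennreal 2 * ennreal (y\<^sup>2) \<partial>std_normal)"
    unfolding aD_def
  proof (rule nn_integral_mono)
    fix y
    let ?x = "coord_mean (\<tau> n i) (b i) y"
    have "(?x - y)\<^sup>2 \<le> 2 * ?x\<^sup>2 + 2 * y\<^sup>2"
      using zero_le_power2[of "?x + y"] by (simp add: power2_eq_square algebra_simps)
    also have "\<dots> \<le> 2 * coord_msq (\<tau> n i) (b i) y + 2 * y\<^sup>2" by (simp add: coord_mean_sq_le)
    finally have "ennreal ((?x - y)\<^sup>2) \<le> ennreal (2 * coord_msq (\<tau> n i) (b i) y + 2 * y\<^sup>2)" by (rule ennreal_leI)
    also have "\<dots> = ennreal 2 * ennreal (coord_msq (\<tau> n i) (b i) y) + ennreal 2 * ennreal (y\<^sup>2)"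
      by (subst ennreal_plus) (auto simp: ennreal_mult coord_msq_nonneg)
    finally show "ennreal ((?x - y)\<^sup>2) \<le> ennreal 2 * ennreal (coord_msq (\<tau> n i) (b i) y) + ennreal 2 * ennreal (y\<^sup>2)" .
  qed
  also have "\<dots> = ennreal 2 * (\<integral>\<^sup>+y. ennreal (coord_msq (\<tau> n i) (b i) y) \<partial>std_normal) + ennreal 2 * (\<integral>\<^sup>+y. ennreal (y\<^sup>2) \<partial>std_normal)"
    by (subst nn_integral_add) (auto simp: nn_integral_cmult)
  also have "(\<integral>\<^sup>+y. ennreal (y\<^sup>2) \<partial>std_normal) = ennreal 1"
    using nn_integral_eq_integral[OF std_normal_moments(3)] std_normal_moments(4) by simp
  also have "(\<integral>\<^sup>+y. ennreal (coord_msq (\<tau> n i) (b i) y) \<partial>std_normal) \<le> ennreal (Cm * min 1 ((\<tau> n i)\<^sup>2))"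
    by (rule Cm(2)[OF \<tau>_pos[OF n] b_bound[OF i]])
  also have "\<dots> \<le> ennreal Cm"
    using Cm(1) by (intro ennreal_leI) (simp add: mult_le_cancel_left1)
  also have "ennreal 2 * ennreal Cm + ennreal 2 * ennreal 1 = ennreal (2 * Cm + 2)"
    using Cm(1) by (subst ennreal_plus) (auto simp: ennreal_mult)
  finally show ?thesis by (simp add: mult_left_mono add_right_mono)
qed

lemma mean_error: "(\<integral>\<^sup>+W. wsum J0 wh (\<lambda>i. vmean n W i - W i) \<partial>WN) = (\<Sum>l. ennreal (wh l) * (\<Sum>k\<in>lev J0 l. aD n (l, k)))"
proof -
  have idx: "(l, k) \<in> idx J0" if "k \<in> lev J0 l" for l k using that by (simp add: lev_def)
  have m: "(\<lambda>W. ennreal ((vmean n W (l, k) - W (l, k))\<^sup>2)) \<in> borel_measurable WN" if "k \<in> lev J0 l" for l k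
    using vmean_measurable[OF idx[OF that]] white_noise_component[OF idx[OF that]] by measurable
  have m2: "(\<lambda>W. ennreal (wh l * (\<Sum>k\<in>lev J0 l. (vmean n W (l, k) - W (l, k))\<^sup>2))) \<in> borel_measurable WN" for l
  proof -
    have "(\<lambda>W. \<Sum>k\<in>lev J0 l. (vmean n W (l, k) - W (l, k))\<^sup>2) \<in> borel_measurable WN"
      by (intro borel_measurable_sum borel_measurable_power borel_measurable_diff vmean_measurable white_noise_component idx)
    then show ?thesis by measurable
  qed
  have "(\<integral>\<^sup>+W. wsum J0 wh (\<lambda>i. vmean n W i - W i) \<partial>WN) =
      (\<Sum>l. \<integral>\<^sup>+W. ennreal (wh l * (\<Sum>k\<in>lev J0 l. (vmean n W (l, k) - W (l, k))\<^sup>2)) \<partial>WN)"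
    unfolding wsum_def by (rule nn_integral_suminf[OF m2])
  also have "\<dots> = (\<Sum>l. ennreal (wh l) * (\<Sum>k\<in>lev J0 l. aD n (l, k)))"
  proof (rule suminf_cong)
    fix l
    have "(\<integral>\<^sup>+W. ennreal (wh l * (\<Sum>k\<in>lev J0 l. (vmean n W (l, k) - W (l, k))\<^sup>2)) \<partial>WN) =
        (\<integral>\<^sup>+W. ennreal (wh l) * (\<Sum>k\<in>lev J0 l. ennreal ((vmean n W (l, k) - W (l, k))\<^sup>2)) \<partial>WN)"
      by (simp add: ennreal_mult sum_nonneg)
    also have "\<dots> = ennreal (wh l) * (\<integral>\<^sup>+W. (\<Sum>k\<in>lev J0 l. ennreal ((vmean n W (l, k) - W (l, k))\<^sup>2)) \<partial>WN)"
      by (rule nn_integral_cmult) (intro borel_measurable_sum m)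
    also have "(\<integral>\<^sup>+W. (\<Sum>k\<in>lev J0 l. ennreal ((vmean n W (l, k) - W (l, k))\<^sup>2)) \<partial>WN) =
        (\<Sum>k\<in>lev J0 l. \<integral>\<^sup>+W. ennreal ((vmean n W (l, k) - W (l, k))\<^sup>2) \<partial>WN)"
      by (rule nn_integral_sum[OF m])
    also have "\<dots> = (\<Sum>k\<in>lev J0 l. aD n (l, k))"
      unfolding aD_def vmean_def
      by (intro sum.cong refl nn_integral_WN_component[where h="\<lambda>y. ennreal ((coord_mean _ _ y - y)\<^sup>2)"] idx) auto
    finally show "(\<integral>\<^sup>+W. ennreal (wh l * (\<Sum>k\<in>lev J0 l. (vmean n W (l, k) - W (l, k))\<^sup>2)) \<partial>WN) =
        ennreal (wh l) * (\<Sum>k\<in>lev J0 l. aD n (l, k))" .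
  qed
  finally show ?thesis .
qed

text \<open>Every coordinate contributes a vanishing error by \<open>coord_mean_L2_limit\<close>,
  and the uniform bound 2 Cm + 2 times wh l 2 ^ l is summable, so the limit passes through the sum
  over levels. The index is shifted because the uniform bound requires n > 0.\<close>

lemma mean_error_limit: "(\<lambda>n. \<integral>\<^sup>+W. wsum J0 wh (\<lambda>i. vmean n W i - W i) \<partial>WN) \<longlonglongrightarrow> 0"
proof (rule LIMSEQ_imp_Suc)
  let ?c = "2 * Cm + 2"
  have c: "?c \<ge> 0" using Cm(1) by simp
  have "(\<lambda>n. \<integral>\<^sup>+l. ennreal (wh l) * (\<Sum>k\<in>lev J0 l. aD (Suc n) (l, k)) \<partial>count_space UNIV) \<longlonglongrightarrow> (\<integral>\<^sup>+l. 0 \<partial>(count_space UNIV :: nat measure))"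
  proof (rule nn_integral_dominated_convergence[where w="\<lambda>l. ennreal (wh l * (2 * 2 ^ l) * ?c)"])
    show "AE l in count_space UNIV. ennreal (wh l) * (\<Sum>k\<in>lev J0 l. aD (Suc n) (l, k)) \<le> ennreal (wh l * (2 * 2 ^ l) * ?c)" for n
    proof (rule AE_I2)
      fix l
      have "(\<Sum>k\<in>lev J0 l. aD (Suc n) (l, k)) \<le> (\<Sum>k\<in>lev J0 l. ennreal ?c)"
        by (intro sum_mono aD_bound) (auto simp: lev_def)
      also have "\<dots> = ennreal (real (card (lev J0 l)) * ?c)"
        using c by (simp add: ennreal_mult ennreal_of_nat_eq_real_of_nat)
      also have "\<dots> \<le> ennreal ((2 * 2 ^ l) * ?c)"
        using c J0_ge by (intro ennreal_leI mult_right_mono card_lev_le) auto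
      finally have "ennreal (wh l) * (\<Sum>k\<in>lev J0 l. aD (Suc n) (l, k)) \<le> ennreal (wh l) * ennreal ((2 * 2 ^ l) * ?c)"
        by (rule mult_left_mono) simp
      also have "\<dots> = ennreal (wh l * (2 * 2 ^ l) * ?c)"
        using c by (subst ennreal_mult[symmetric]) (auto simp: mult.assoc)
      finally show "ennreal (wh l) * (\<Sum>k\<in>lev J0 l. aD (Suc n) (l, k)) \<le> ennreal (wh l * (2 * 2 ^ l) * ?c)" .
    qed
    have "(\<Sum>l. ennreal (wh l * (2 * 2 ^ l) * ?c)) < \<infinity>"
      using c by (intro suminf_ennreal_finite summable_mult2 summable_wh) simp
    then show "(\<integral>\<^sup>+l. ennreal (wh l * (2 * 2 ^ l) * ?c) \<partial>count_space UNIV) < \<infinity>"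
      by (simp add: nn_integral_count_space_nat)
    show "AE l in count_space UNIV. (\<lambda>n. ennreal (wh l) * (\<Sum>k\<in>lev J0 l. aD (Suc n) (l, k))) \<longlonglongrightarrow> 0"
    proof (rule AE_I2)
      fix l
      have "(\<lambda>n. \<Sum>k\<in>lev J0 l. aD (Suc n) (l, k)) \<longlonglongrightarrow> (\<Sum>k\<in>lev J0 l. 0)"
        by (intro tendsto_sum aD_limit)
      then have "(\<lambda>n. ennreal (wh l) * (\<Sum>k\<in>lev J0 l. aD (Suc n) (l, k))) \<longlonglongrightarrow> ennreal (wh l) * 0"
        by (intro ennreal_tendsto_cmult) auto
      then show "(\<lambda>n. ennreal (wh l) * (\<Sum>k\<in>lev J0 l. aD (Suc n) (l, k))) \<longlonglongrightarrow> 0" by simp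
    qed
  qed auto
  then show "(\<lambda>n. \<integral>\<^sup>+W. wsum J0 wh (\<lambda>i. vmean (Suc n) W i - W i) \<partial>WN) \<longlonglongrightarrow> 0"
    unfolding mean_error by (simp add: nn_integral_count_space_nat)
qed

lemma error_measurable [measurable]: "(\<lambda>W. wsum J0 wh (\<lambda>i. vmean n W i - W i)) \<in> borel_measurable WN"
  by (rule wsum_measurable) (intro borel_measurable_diff vmean_measurable white_noise_component)

lemma vmean_wsum_measurable [measurable]: "(\<lambda>W. wsum J0 wh (vmean n W)) \<in> borel_measurable WN"
  by (rule wsum_measurable) (rule vmean_measurable)

lemma error_limit_in_prob:
  assumes e: "e > 0"
  shows "(\<lambda>n. measure WN {W \<in> space WN. ennreal e \<le> wsum J0 wh (\<lambda>i. vmean n W i - W i)}) \<longlonglongrightarrow> 0"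
proof -
  have "(\<lambda>n. emeasure WN {W \<in> space WN. ennreal e \<le> wsum J0 wh (\<lambda>i. vmean n W i - W i)}) \<longlonglongrightarrow> 0"
  proof (rule tendsto_sandwich[OF _ _ tendsto_const])
    show "eventually (\<lambda>n. emeasure WN {W \<in> space WN. ennreal e \<le> wsum J0 wh (\<lambda>i. vmean n W i - W i)} \<le>
        ennreal (1 / e) * (\<integral>\<^sup>+W. wsum J0 wh (\<lambda>i. vmean n W i - W i) \<partial>WN)) sequentially"
      using e by (intro always_eventually allI nn_integral_Markov_ge error_measurable)
    have "(\<lambda>n. ennreal (1 / e) * (\<integral>\<^sup>+W. wsum J0 wh (\<lambda>i. vmean n W i - W i) \<partial>WN)) \<longlonglongrightarrow> ennreal (1 / e) * 0"
      by (intro ennreal_tendsto_cmult mean_error_limit) auto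
    then show "(\<lambda>n. ennreal (1 / e) * (\<integral>\<^sup>+W. wsum J0 wh (\<lambda>i. vmean n W i - W i) \<partial>WN)) \<longlonglongrightarrow> 0" by simp
  qed auto
  then have "(\<lambda>n. emeasure WN {W \<in> space WN. ennreal e \<le> wsum J0 wh (\<lambda>i. vmean n W i - W i)}) \<longlonglongrightarrow> ennreal 0" by simp
  from tendsto_enn2real[OF this] show ?thesis by (simp add: measure_def)
qed

lemma wsum_shift_le:
  assumes c: "wsum J0 wh c \<le> ennreal (x\<^sup>2)" "x \<ge> 0" and d: "wsum J0 wh (\<lambda>i. c i - d i) \<le> ennreal (y\<^sup>2)" "y \<ge> 0"
  shows "wsum J0 wh d \<le> ennreal ((x + y)\<^sup>2)"
proof -
  have "wsum J0 wh (\<lambda>i. d i - c i) = wsum J0 wh (\<lambda>i. c i - d i)"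
    by (rule wsum_cong) (simp add: power2_commute)
  then have "wsum J0 wh (\<lambda>i. c i + (d i - c i)) \<le> ennreal ((x + y)\<^sup>2)"
    using c d by (intro wsum_triangle) auto
  then show ?thesis by simp
qed

text \<open>A Slutsky argument: the noise has norm at most sqrt r + d unless the centre is off by d,
  and continuity of \<open>Fq\<close> makes the enlargement harmless.\<close>

lemma vmean_cdf_upper:
  assumes r: "r \<ge> 0" and c: "Fq r < c"
  shows "eventually (\<lambda>n. measure WN {W \<in> space WN. wsum J0 wh (vmean n W) \<le> ennreal r} \<le> c) sequentially"
proof -
  have "(\<lambda>k. (sqrt r + 1 / real (Suc k))\<^sup>2) \<longlonglongrightarrow> (sqrt r + 0)\<^sup>2"
    using LIMSEQ_Suc[OF lim_1_over_n] by (intro tendsto_intros) simp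
  from isCont_tendsto_compose[OF isCont_Fq this]
  have "(\<lambda>k. Fq ((sqrt r + 1 / real (Suc k))\<^sup>2)) \<longlonglongrightarrow> Fq r" using r by simp
  from order_tendstoD(2)[OF this c] obtain k where k: "Fq ((sqrt r + 1 / real (Suc k))\<^sup>2) < c"
    by (auto simp: eventually_sequentially)
  define d where "d = 1 / real (Suc k)"
  have d: "d > 0" "Fq ((sqrt r + d)\<^sup>2) < c" using k by (auto simp: d_def)
  have "eventually (\<lambda>n. measure WN {W \<in> space WN. ennreal (d\<^sup>2) \<le> wsum J0 wh (\<lambda>i. vmean n W i - W i)} < c - Fq ((sqrt r + d)\<^sup>2)) sequentially"
    using d by (intro order_tendstoD(2)[OF error_limit_in_prob]) auto
  then show ?thesis
  proof eventually_elim
    case (elim n)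
    let ?D = "{W \<in> space WN. ennreal (d\<^sup>2) \<le> wsum J0 wh (\<lambda>i. vmean n W i - W i)}"
    let ?Q = "{W \<in> space WN. wsum J0 wh W \<le> ennreal ((sqrt r + d)\<^sup>2)}"
    have "measure WN {W \<in> space WN. wsum J0 wh (vmean n W) \<le> ennreal r} \<le> measure WN (?Q \<union> ?D)"
    proof (rule WNO.M1.finite_measure_mono)
      show "{W \<in> space WN. wsum J0 wh (vmean n W) \<le> ennreal r} \<subseteq> ?Q \<union> ?D"
      proof safe
        fix W assume W: "W \<in> space WN" "wsum J0 wh (vmean n W) \<le> ennreal r"
          "\<not> ennreal (d\<^sup>2) \<le> wsum J0 wh (\<lambda>i. vmean n W i - W i)"
        then show "wsum J0 wh W \<le> ennreal ((sqrt r + d)\<^sup>2)"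
          using r d by (intro wsum_shift_le[of "vmean n W"]) auto
      qed
    qed measurable
    also have "\<dots> \<le> measure WN ?Q + measure WN ?D" by (rule measure_Un_le) measurable
    also have "measure WN ?Q = Fq ((sqrt r + d)\<^sup>2)" by (simp add: Fq_eq)
    finally show ?case using elim by linarith
  qed
qed

lemma vmean_cdf_lower:
  assumes r: "r > 0" and c: "c < Fq r"
  shows "eventually (\<lambda>n. c \<le> measure WN {W \<in> space WN. wsum J0 wh (vmean n W) \<le> ennreal r}) sequentially"
proof -
  \<comment> \<open>The perturbation is a fraction of sqrt r, so the shrunken radius stays
    nonnegative and may be squared safely.\<close>
  have "(\<lambda>k. (sqrt r - sqrt r * (1 / real (Suc k)))\<^sup>2) \<longlonglongrightarrow> (sqrt r - sqrt r * 0)\<^sup>2"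
    using LIMSEQ_Suc[OF lim_1_over_n] by (intro tendsto_intros) simp
  from isCont_tendsto_compose[OF isCont_Fq this]
  have "(\<lambda>k. Fq ((sqrt r - sqrt r * (1 / real (Suc k)))\<^sup>2)) \<longlonglongrightarrow> Fq r" using r by simp
  from order_tendstoD(1)[OF this c] obtain k where k: "c < Fq ((sqrt r - sqrt r * (1 / real (Suc k)))\<^sup>2)"
    by (auto simp: eventually_sequentially)
  define d where "d = sqrt r * (1 / real (Suc k))"
  have d: "d > 0" "c < Fq ((sqrt r - d)\<^sup>2)" using k r by (auto simp: d_def)
  have dr: "d \<le> sqrt r" using r unfolding d_def by (intro mult_left_le) auto
  have "eventually (\<lambda>n. measure WN {W \<in> space WN. ennreal (d\<^sup>2) \<le> wsum J0 wh (\<lambda>i. vmean n W i - W i)} < Fq ((sqrt r - d)\<^sup>2) - c) sequentially"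
    using d by (intro order_tendstoD(2)[OF error_limit_in_prob]) auto
  then show ?thesis
  proof eventually_elim
    case (elim n)
    let ?D = "{W \<in> space WN. ennreal (d\<^sup>2) \<le> wsum J0 wh (\<lambda>i. vmean n W i - W i)}"
    let ?Z = "{W \<in> space WN. wsum J0 wh (vmean n W) \<le> ennreal r}"
    have "Fq ((sqrt r - d)\<^sup>2) = measure WN {W \<in> space WN. wsum J0 wh W \<le> ennreal ((sqrt r - d)\<^sup>2)}" by (simp add: Fq_eq)
    also have "\<dots> \<le> measure WN (?Z \<union> ?D)"
    proof (rule WNO.M1.finite_measure_mono)
      show "{W \<in> space WN. wsum J0 wh W \<le> ennreal ((sqrt r - d)\<^sup>2)} \<subseteq> ?Z \<union> ?D"
      proof safe
        fix W assume W: "W \<in> space WN" "wsum J0 wh W \<le> ennreal ((sqrt r - d)\<^sup>2)"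
          "\<not> ennreal (d\<^sup>2) \<le> wsum J0 wh (\<lambda>i. vmean n W i - W i)"
        have "wsum J0 wh (\<lambda>i. W i - vmean n W i) = wsum J0 wh (\<lambda>i. vmean n W i - W i)"
          by (rule wsum_cong) (simp add: power2_commute)
        then have "wsum J0 wh (vmean n W) \<le> ennreal ((sqrt r - d + d)\<^sup>2)"
          using W d dr by (intro wsum_shift_le[of W]) auto
        then show "wsum J0 wh (vmean n W) \<le> ennreal r" using r by simp
      qed
    qed measurable
    also have "\<dots> \<le> measure WN ?Z + measure WN ?D" by (rule measure_Un_le) measurable
    finally show ?case using elim by linarith
  qed
qed

section \<open>The balls in coordinates and interpolation between the norms\<close>

lemma norm_H_eq: "norm_H J0 \<delta> = level_norm J0 wh"
  by (simp add: norm_H_def wH_def[abs_def])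

lemma norm_log_sobolev_eq: "norm_log_sobolev \<psi> J0 \<gamma> f = level_norm J0 wS (coeff \<psi> f)"
  by (simp add: norm_log_sobolev_def wS_def[abs_def])

lemma H_ball_iff:
  assumes n: "n > 0" and W: "good n W"
  shows "f \<in> H_ball \<psi> J0 \<delta> (posterior_mean \<psi> J0 pri n (X n W)) (r / sqrt (real n)) \<longleftrightarrow>
    0 \<le> r \<and> wsum J0 wh (\<lambda>i. resc n f i - vmean n W i) \<le> ennreal (r\<^sup>2)"
proof -
  let ?m = "posterior_mean \<psi> J0 pri n (X n W)"
  have s: "sqrt (real n) > 0" using n by simp
  have "wsum J0 wh (coeff \<psi> (f - ?m)) = wsum J0 wh (\<lambda>i. (1 / sqrt (real n)) * (resc n f i - vmean n W i))"
  proof (rule wsum_cong)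
    fix i assume i: "i \<in> idx J0"
    have "(1 / sqrt (real n)) * (resc n f i - vmean n W i) = coeff \<psi> (f - ?m) i"
      unfolding resc_posterior_mean[OF n W i, symmetric] coeff_diff resc_def using s by (simp add: right_diff_distrib)
    then show "(coeff \<psi> (f - ?m) i)\<^sup>2 = ((1 / sqrt (real n)) * (resc n f i - vmean n W i))\<^sup>2" by simp
  qed
  also have "\<dots> = ennreal (1 / real n) * wsum J0 wh (\<lambda>i. resc n f i - vmean n W i)"
    by (subst wsum_scale) (auto simp: power_divide)
  finally have eq: "wsum J0 wh (coeff \<psi> (f - ?m)) = ennreal (1 / real n) * wsum J0 wh (\<lambda>i. resc n f i - vmean n W i)" .
  have r2: "ennreal ((r / sqrt (real n))\<^sup>2) = ennreal (1 / real n) * ennreal (r\<^sup>2)"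
    by (simp add: power_divide ennreal_mult[symmetric])
  have "ennreal (1 / real n) * x \<le> ennreal (1 / real n) * y \<longleftrightarrow> x \<le> y" for x y
    using n by (subst ennreal_mult_le_mult_iff) auto
  then show ?thesis
    unfolding H_ball_def norm_H_eq mem_Collect_eq level_norm_le_iff[OF wH_nonneg] eq r2
    using s by (simp add: zero_le_divide_iff)
qed

text \<open>Reduces to the inequality 1 \<le> p \<open>wS l\<close> + q \<open>wh l\<close> on every
  level. Below the threshold \<open>x0\<close> the weight of H(\<delta>) alone suffices, above it
  the smoothness weight does; the coefficients p and q express the price.\<close>

lemma interpolation:
  assumes n: "n \<ge> 3" and A: "wsum J0 wS c \<le> ennreal (A\<^sup>2)" and D: "wsum J0 wh c \<le> ennreal (D\<^sup>2 / real n)"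
  shows "wsum J0 (\<lambda>_. 1) c \<le> ennreal ((sqrt (2 * (1 + 1 / \<gamma>\<^sup>2) * A\<^sup>2 + D\<^sup>2) * (real n powr (- \<gamma> / (2 * \<gamma> + 1)) * ln (real n) powr (\<delta> + 1)))\<^sup>2)"
proof -
  define N where "N = ln (real n)"
  \<comment> \<open>n \<ge> 3 makes ln n at least 1, so that powers of N increase with the
    exponent.\<close>
  have "exp 1 < (3::real)" using exp_le by (rule order_le_neq_trans) (use e_less_272 in auto)
  then have "exp 1 \<le> real n" using n by simp
  then have N: "N \<ge> 1" unfolding N_def using n by (subst ln_ge_iff) auto
  \<comment> \<open>In the scale x = l ln 2 this is the level with 2 ^ l = n powr (1 / (2 \<gamma> +
    1)), where squared bias and variance balance.\<close>
  define x0 where "x0 = N / (2 * \<gamma> + 1)"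
  have x0: "0 \<le> x0" "x0 \<le> N" using N \<gamma>_pos by (auto simp: x0_def divide_le_eq mult_le_cancel_left1)
  \<comment> \<open>The constant collects x^2 \<le> 2 (x0^2 + y^2) for x = x0 + y, with x0 \<le> N
    and \<gamma> y \<le> exp (\<gamma> y).\<close>
  define p where "p = 2 * (1 + 1 / \<gamma>\<^sup>2) * exp (- 2 * \<gamma> * x0) * N\<^sup>2"
  define q where "q = exp x0 * N powr (2 * \<delta>)"
  have p0: "p \<ge> 0" and q0: "q \<ge> 0" by (auto simp: p_def q_def intro!: mult_nonneg_nonneg add_nonneg_nonneg)
  have key: "1 \<le> p * wS l + q * wh l" if l: "l \<ge> J0 - 1" for l
  proof -
    define x where "x = real l * ln 2"
    have l1: "real l \<ge> 1" using l J0_ge by simp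
    have x: "x > 0" using l1 by (simp add: x_def)
    have pw: "(2 ^ l :: real) powr a = exp (a * x)" for a
      by (simp add: powr_def ln_realpow x_def)
    have lnl: "ln (2 ^ l :: real) = x" by (simp add: ln_realpow x_def)
    have wS: "wS l = exp (2 * \<gamma> * x) / x\<^sup>2"
      unfolding wS_def pw lnl using x by (simp add: powr_minus powr_numeral divide_inverse)
    have wh: "wh l = exp (- x) / x powr (2 * \<delta>)"
      unfolding wH_def pw lnl using x by (simp add: powr_minus divide_inverse)
    show ?thesis
    proof (cases "x \<le> x0")
      case True
      have "x powr (2 * \<delta>) \<le> N powr (2 * \<delta>)"
        using True x x0 \<delta>_gt by (intro powr_mono2) auto
      then have "exp x * x powr (2 * \<delta>) \<le> q" unfolding q_def using True by (intro mult_mono) auto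
      then have "1 \<le> q * wh l" unfolding wh using x by (simp add: exp_minus field_simps)
      then show ?thesis using p0 by (simp add: add_increasing)
    next
      case False
      define y where "y = x - x0"
      have y: "y > 0" "x = x0 + y" using False by (auto simp: y_def)
      have "x\<^sup>2 \<le> 2 * (x0\<^sup>2 + y\<^sup>2)"
        unfolding y(2) using zero_le_power2[of "x0 - y"] by (simp add: power2_eq_square algebra_simps)
      also have "\<dots> \<le> 2 * (N\<^sup>2 * exp (2 * \<gamma> * y) + (1 / \<gamma>\<^sup>2) * N\<^sup>2 * exp (2 * \<gamma> * y))"
      proof -
        have e1: "1 \<le> exp (2 * \<gamma> * y)" using \<gamma>_pos y by simp
        have N2: "1 \<le> N\<^sup>2" using N by (simp add: one_le_power)
        have "x0\<^sup>2 \<le> N\<^sup>2 * 1" using x0 by (simp add: power_mono)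
        also have "\<dots> \<le> N\<^sup>2 * exp (2 * \<gamma> * y)" using e1 by (intro mult_left_mono) auto
        finally have a: "x0\<^sup>2 \<le> N\<^sup>2 * exp (2 * \<gamma> * y)" .
        have "\<gamma> * y \<le> exp (\<gamma> * y)" using exp_ge_add_one_self[of "\<gamma> * y"] by linarith
        then have "(\<gamma> * y)\<^sup>2 \<le> (exp (\<gamma> * y))\<^sup>2" using \<gamma>_pos y by (intro power_mono) auto
        also have "(exp (\<gamma> * y))\<^sup>2 = exp (2 * \<gamma> * y)" by (simp add: power2_eq_square flip: exp_add)
        finally have "y\<^sup>2 \<le> (1 / \<gamma>\<^sup>2) * 1 * exp (2 * \<gamma> * y)"
          using \<gamma>_pos by (simp add: power_mult_distrib field_simps)
        also have "\<dots> \<le> (1 / \<gamma>\<^sup>2) * N\<^sup>2 * exp (2 * \<gamma> * y)"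
          using N2 by (intro mult_right_mono mult_left_mono) auto
        finally show ?thesis using a by simp
      qed
      also have "\<dots> = p * exp (2 * \<gamma> * x)"
        unfolding p_def y(2) by (simp add: distrib_left exp_add exp_minus field_simps)
      finally have "1 \<le> p * wS l" unfolding wS using x by (simp add: field_simps)
      then show ?thesis using q0 by (simp add: add_increasing2)
    qed
  qed
  have "wsum J0 (\<lambda>_. 1) c \<le> wsum J0 (\<lambda>l. p * wS l + q * wh l) c"
    unfolding wsum_def
  proof (intro suminf_le summableI ennreal_leI)
    fix l
    show "1 * (\<Sum>k\<in>lev J0 l. (c (l, k))\<^sup>2) \<le> (p * wS l + q * wh l) * (\<Sum>k\<in>lev J0 l. (c (l, k))\<^sup>2)"
    proof (cases "l \<ge> J0 - 1")
      case True
      then show ?thesis by (intro mult_right_mono key) (auto simp: sum_nonneg)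
    qed (simp add: lev_eq)
  qed
  also have "\<dots> = wsum J0 (\<lambda>l. p * wS l) c + wsum J0 (\<lambda>l. q * wh l) c"
    using p0 q0 by (intro wsum_add) auto
  also have "\<dots> = ennreal p * wsum J0 wS c + ennreal q * wsum J0 wh c"
    unfolding wsum_def using p0 q0
    by (simp add: mult.assoc ennreal_mult sum_nonneg)
  also have "\<dots> \<le> ennreal p * ennreal (A\<^sup>2) + ennreal q * ennreal (D\<^sup>2 / real n)"
    by (intro add_mono mult_left_mono A D) auto
  also have "\<dots> = ennreal (p * A\<^sup>2 + q * (D\<^sup>2 / real n))"
    using p0 q0 by (simp add: ennreal_mult[symmetric] ennreal_plus[symmetric] del: ennreal_plus)
  also have "\<dots> \<le> ennreal ((2 * (1 + 1 / \<gamma>\<^sup>2) * A\<^sup>2 + D\<^sup>2) * (exp (- 2 * \<gamma> * x0) * N powr (2 * \<delta> + 2)))"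
  proof (rule ennreal_leI)
    have nexp: "real n = exp N" using n by (simp add: N_def)
    have g1: "2 * \<gamma> + 1 > 0" using \<gamma>_pos by simp
    \<comment> \<open>The balance itself: exp x0 / n equals exp (- 2 \<gamma> x0), so both terms
      have the power n powr (- 2 \<gamma> / (2 \<gamma> + 1)).\<close>
    have "x0 - N = - 2 * \<gamma> * x0" unfolding x0_def using g1 by (simp add: field_simps)
    then have e: "exp x0 / exp N = exp (- 2 * \<gamma> * x0)" by (simp only: exp_diff[symmetric])
    have "q / real n = (exp x0 / exp N) * N powr (2 * \<delta>)" unfolding q_def nexp by simp
    then have qn: "q / real n = exp (- 2 * \<gamma> * x0) * N powr (2 * \<delta>)" unfolding e .
    have "N\<^sup>2 = N powr 2" using N by (simp add: powr_numeral)
    also have "\<dots> \<le> N powr (2 * \<delta> + 2)" using N \<delta>_gt by (intro powr_mono) auto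
    finally have a: "p * A\<^sup>2 \<le> 2 * (1 + 1 / \<gamma>\<^sup>2) * A\<^sup>2 * (exp (- 2 * \<gamma> * x0) * N powr (2 * \<delta> + 2))"
    proof -
      assume N2: "N\<^sup>2 \<le> N powr (2 * \<delta> + 2)"
      have "p * A\<^sup>2 = (2 * (1 + 1 / \<gamma>\<^sup>2) * A\<^sup>2 * exp (- 2 * \<gamma> * x0)) * N\<^sup>2" by (simp add: p_def ac_simps)
      also have "\<dots> \<le> (2 * (1 + 1 / \<gamma>\<^sup>2) * A\<^sup>2 * exp (- 2 * \<gamma> * x0)) * N powr (2 * \<delta> + 2)"
        by (rule mult_left_mono[OF N2]) (auto intro!: mult_nonneg_nonneg add_nonneg_nonneg)
      finally show ?thesis by (simp only: mult.assoc)
    qed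
    have "N powr (2 * \<delta>) \<le> N powr (2 * \<delta> + 2)" using N by (intro powr_mono) auto
    then have "D\<^sup>2 * (exp (- 2 * \<gamma> * x0) * N powr (2 * \<delta>)) \<le> D\<^sup>2 * (exp (- 2 * \<gamma> * x0) * N powr (2 * \<delta> + 2))"
      by (intro mult_left_mono) auto
    moreover have "q * (D\<^sup>2 / real n) = D\<^sup>2 * (q / real n)" by simp
    ultimately show "p * A\<^sup>2 + q * (D\<^sup>2 / real n) \<le> (2 * (1 + 1 / \<gamma>\<^sup>2) * A\<^sup>2 + D\<^sup>2) * (exp (- 2 * \<gamma> * x0) * N powr (2 * \<delta> + 2))"
      using a unfolding qn distrib_right by linarith
  qed
  also have "(2 * (1 + 1 / \<gamma>\<^sup>2) * A\<^sup>2 + D\<^sup>2) * (exp (- 2 * \<gamma> * x0) * N powr (2 * \<delta> + 2)) =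
      (sqrt (2 * (1 + 1 / \<gamma>\<^sup>2) * A\<^sup>2 + D\<^sup>2) * (real n powr (- \<gamma> / (2 * \<gamma> + 1)) * ln (real n) powr (\<delta> + 1)))\<^sup>2"
  proof -
    have 1: "(sqrt (2 * (1 + 1 / \<gamma>\<^sup>2) * A\<^sup>2 + D\<^sup>2))\<^sup>2 = 2 * (1 + 1 / \<gamma>\<^sup>2) * A\<^sup>2 + D\<^sup>2"
      by (intro real_sqrt_pow2) (auto intro!: mult_nonneg_nonneg add_nonneg_nonneg)
    have "real n powr (- \<gamma> / (2 * \<gamma> + 1)) = exp (- \<gamma> * x0)"
      using n by (simp add: powr_def x0_def N_def)
    then have 2: "(real n powr (- \<gamma> / (2 * \<gamma> + 1)))\<^sup>2 = exp (- 2 * \<gamma> * x0)"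
      by (simp add: power2_eq_square flip: exp_add)
    have 3: "(N powr (\<delta> + 1))\<^sup>2 = N powr (2 * \<delta> + 2)"
      by (simp add: power2_eq_square flip: powr_add)
    show ?thesis unfolding power_mult_distrib 1 2 N_def[symmetric] 3 by simp
  qed
  finally show ?thesis .
qed

end

section \<open>The credible set\<close>

locale credible_model = bvm_model \<phi> K \<Omega> \<gamma> J0 \<psi> g F0 B \<delta>
  for \<phi> :: "real \<Rightarrow> real" and K :: real and \<Omega> :: "'w measure" and \<gamma> :: real and J0 :: nat
    and \<psi> :: "nat \<Rightarrow> nat \<Rightarrow> real \<Rightarrow> real" and g :: "nat \<times> nat \<Rightarrow> 'w \<Rightarrow> real" and F0 :: L2 and B :: real and \<delta> :: real +
  fixes \<alpha> \<eta> :: real and R :: "nat \<Rightarrow> (nat \<times> nat \<Rightarrow> real) \<Rightarrow> real"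
  assumes \<alpha>: "0 < \<alpha>" "\<alpha> < 1" and \<eta>: "\<eta> > 0"
    and R_measurable: "\<And>n. n > 0 \<Longrightarrow> R n \<in> borel_measurable (obs_law \<psi> J0 F0 n)"
    and R_mass: "\<And>n. n > 0 \<Longrightarrow> AE x in obs_law \<psi> J0 F0 n. measure (posterior \<psi> J0 pri n x)
           (H_ball \<psi> J0 \<delta> (posterior_mean \<psi> J0 pri n x) (R n x / sqrt (real n))) = 1 - \<alpha>"
begin

abbreviation PN :: "(nat \<times> nat \<Rightarrow> real) measure" where "PN \<equiv> PiM (idx J0) (\<lambda>_. borel)"

abbreviation nrm :: "L2 \<Rightarrow> ereal" where "nrm \<equiv> norm_log_sobolev \<psi> J0 \<gamma>"

abbreviation Mr :: "nat \<Rightarrow> (nat \<times> nat \<Rightarrow> real) \<Rightarrow> ereal" where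
  "Mr \<equiv> smoothness_radius \<psi> J0 pri \<gamma> \<eta>"

abbreviation CS :: "nat \<Rightarrow> (nat \<times> nat \<Rightarrow> real) \<Rightarrow> L2 set" where
  "CS \<equiv> credible_set \<psi> J0 pri \<gamma> \<delta> \<eta> R"

definition \<delta>n :: "nat \<Rightarrow> real" where "\<delta>n n = ln (real n) powr (- 1 / 4)"

lemma obs_law_eq: "obs_law \<psi> J0 F0 n = distr WN PN (X n)"
  by (simp add: obs_law_def X_def[abs_def])

lemma space_obs_law [simp]: "space (obs_law \<psi> J0 F0 n) = space PN"
  by (simp add: obs_law_eq)

text \<open>\<open>X n\<close> is a bijection with inverse x to \<surd>n (x - \<theta>0), so every
  bound in outer probability can be proved on the noise space, up to null sets.\<close>

lemma outer_obs_law: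
  assumes n: "n > 0" and S: "S \<in> sets WN" and AE: "AE W in WN. Q (X n W) \<longrightarrow> W \<in> S"
  shows "outer_measure_of (obs_law \<psi> J0 F0 n) {x \<in> space (obs_law \<psi> J0 F0 n). Q x} \<le> emeasure WN S"
  unfolding obs_law_eq
proof -
  define Y where "Y x = (\<lambda>i\<in>idx J0. sqrt (real n) * (x i - \<theta>0 i))" for x
  have "Y \<in> measurable PN PN" unfolding Y_def[abs_def] by (intro measurable_restrict) measurable
  then have Ym: "Y \<in> measurable PN WN" by (simp cong: measurable_cong_sets)
  have Y: "Y x \<in> space WN \<and> X n (Y x) = x" if "x \<in> space PN" for x
    using that n by (auto simp: Y_def X_def space_white_noise space_PiM fun_eq_iff PiE_iff extensional_def)
  have YX: "Y (X n W) = W" if "W \<in> space WN" for W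
    using that n by (auto simp: Y_def X_def space_white_noise fun_eq_iff PiE_iff extensional_def)
  show "outer_measure_of (distr WN PN (X n)) {x \<in> space (distr WN PN (X n)). Q x} \<le> emeasure WN S"
    by (rule outer_measure_distr_le[where Y = Y and Q = Q, OF X_measurable Y Ym YX S AE])
qed

section \<open>Concentration of the smoothness norm at its true value\<close>

lemma nrm_eq: "nrm f = (if wsum J0 wS (coeff \<psi> f) = \<infinity> then \<infinity> else ereal (sqrt (enn2real (wsum J0 wS (coeff \<psi> f)))))"
  unfolding norm_log_sobolev_eq by (rule level_norm_eq) simp

lemma nrm_le_iff: "nrm f \<le> ereal r \<longleftrightarrow> 0 \<le> r \<and> wsum J0 wS (coeff \<psi> f) \<le> ennreal (r\<^sup>2)"
  unfolding norm_log_sobolev_eq by (rule level_norm_le_iff) simp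

lemma nrm_measurable [measurable]: "nrm \<in> borel_measurable borel"
proof -
  have [measurable]: "(\<lambda>f. wsum J0 wS (coeff \<psi> f)) \<in> borel_measurable borel" by measurable
  show ?thesis unfolding nrm_eq[abs_def] by measurable
qed

lemma window_eq: "\<bar>nrm f - ereal M\<bar> \<le> ereal \<eta> \<longleftrightarrow> ereal (M - \<eta>) \<le> nrm f \<and> nrm f \<le> ereal (M + \<eta>)"
  by (cases "nrm f") (auto simp: abs_le_iff)

text \<open>The Hoelder condition gives the truth the same coefficient size as the prior scale, and
  the logarithmic weight again makes the levels summable.\<close>

lemma \<theta>0_smooth: "wsum J0 wS \<theta>0 < \<infinity>"
proof -
  have "wsum J0 wS \<theta>0 \<le> (\<Sum>l. ennreal ((wS l * 2 ^ l * (sg (l, 0))\<^sup>2) * (2 * B\<^sup>2)))"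
    unfolding wsum_def
  proof (intro suminf_le summableI ennreal_leI)
    fix l
    have "wS l * (\<Sum>k\<in>lev J0 l. (\<theta>0 (l, k))\<^sup>2) \<le> wS l * (2 * B\<^sup>2 * (rt l)\<^sup>2)"
      by (intro mult_left_mono \<theta>0_lev) simp
    then show "wS l * (\<Sum>k\<in>lev J0 l. (\<theta>0 (l, k))\<^sup>2) \<le> (wS l * 2 ^ l * (sg (l, 0))\<^sup>2) * (2 * B\<^sup>2)"
      by (simp add: sg_sq[of l 0, symmetric] ac_simps)
  qed
  also have "\<dots> < \<infinity>"
    by (intro suminf_ennreal_finite summable_mult2 summable_wS) simp
  finally show ?thesis .
qed

definition m0 :: real where "m0 = sqrt (enn2real (wsum J0 wS \<theta>0))"

lemma m0_nonneg: "m0 \<ge> 0" by (simp add: m0_def)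

lemma m0_sq: "wsum J0 wS \<theta>0 = ennreal (m0\<^sup>2)"
  using \<theta>0_smooth unfolding m0_def by (cases "wsum J0 wS \<theta>0") auto

lemma nrm_F0: "nrm F0 = ereal m0"
  using \<theta>0_smooth by (simp add: nrm_eq m0_def)

lemma near_F0:
  assumes "wsum J0 wS (\<lambda>i. coeff \<psi> f i - \<theta>0 i) \<le> ennreal ((\<eta> / 2)\<^sup>2)"
  shows "ereal (m0 - \<eta> / 2) \<le> nrm f" "nrm f \<le> ereal (m0 + \<eta> / 2)"
proof -
  have "wsum J0 wS (\<lambda>i. \<theta>0 i + (coeff \<psi> f i - \<theta>0 i)) \<le> ennreal ((m0 + \<eta> / 2)\<^sup>2)"
    using assms m0_sq m0_nonneg \<eta> by (intro wsum_triangle) auto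
  then show "nrm f \<le> ereal (m0 + \<eta> / 2)" using m0_nonneg \<eta> by (simp add: nrm_le_iff)
  show "ereal (m0 - \<eta> / 2) \<le> nrm f"
  proof (rule ccontr)
    assume "\<not> ereal (m0 - \<eta> / 2) \<le> nrm f"
    then have lt: "nrm f < ereal (m0 - \<eta> / 2)" by simp
    moreover have "0 \<le> nrm f" unfolding norm_log_sobolev_eq by (rule level_norm_nonneg) simp
    ultimately obtain s where s: "nrm f = ereal s" "0 \<le> s" "s < m0 - \<eta> / 2" by (cases "nrm f") auto
    then have "wsum J0 wS (coeff \<psi> f) \<le> ennreal (s\<^sup>2)" using nrm_le_iff[of f s] by simp
    moreover have "wsum J0 wS (\<lambda>i. \<theta>0 i - coeff \<psi> f i) = wsum J0 wS (\<lambda>i. coeff \<psi> f i - \<theta>0 i)"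
      by (rule wsum_cong) (simp add: power2_commute)
    ultimately have "wsum J0 wS (\<lambda>i. coeff \<psi> f i + (\<theta>0 i - coeff \<psi> f i)) \<le> ennreal ((s + \<eta> / 2)\<^sup>2)"
      using assms s \<eta> by (intro wsum_triangle) auto
    then have "m0\<^sup>2 \<le> (s + \<eta> / 2)\<^sup>2" using m0_sq by simp
    then have "m0 \<le> s + \<eta> / 2" by (rule power2_le_imp_le) (use s \<eta> in simp)
    then show False using s by simp
  qed
qed

text \<open>Exceptional noise: the bound on the posterior expectation of the squared smoothness
  distance to \<open>F0\<close> is too large for Markov's inequality to leave at most \<delta>n
  outside the ball of radius \<eta> / 2.\<close>

definition Sbad :: "nat \<Rightarrow> (nat \<times> nat \<Rightarrow> real) set" where
  "Sbad n = {W \<in> space WN. ennreal ((\<eta> / 2)\<^sup>2 * \<delta>n n) \<le> ennreal (1 / real n) * pmsq n wS W}"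

lemma Sbad_sets [measurable]: "Sbad n \<in> sets WN"
  unfolding Sbad_def by measurable

lemma \<delta>n_limit: "\<delta>n \<longlonglongrightarrow> 0"
  unfolding \<delta>n_def by real_asymp

lemma \<delta>n_pos: "n \<ge> 3 \<Longrightarrow> \<delta>n n > 0"
  by (simp add: \<delta>n_def)

text \<open>Markov's inequality under the noise gives a bound proportional to rS n / \<delta>n n,
  which tends to zero because \<delta>n decays slowly enough.\<close>

lemma Sbad_limit: "(\<lambda>n. emeasure WN (Sbad n)) \<longlonglongrightarrow> 0"
proof (rule tendsto_sandwich[OF _ _ tendsto_const])
  let ?c = "(\<eta> / 2)\<^sup>2"
  have c: "?c > 0" using \<eta> by simp
  show "eventually (\<lambda>n. emeasure WN (Sbad n) \<le> ennreal (1 / ?c * (rS n / \<delta>n n))) sequentially"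
    using eventually_ge_at_top[of 3]
  proof eventually_elim
    case (elim n)
    have d: "?c * \<delta>n n > 0" using \<delta>n_pos[OF elim] c by simp
    have "emeasure WN (Sbad n) \<le> ennreal (1 / (?c * \<delta>n n)) * (\<integral>\<^sup>+W. ennreal (1 / real n) * pmsq n wS W \<partial>WN)"
      unfolding Sbad_def by (rule nn_integral_Markov_ge[OF _ d]) measurable
    also have "\<dots> \<le> ennreal (1 / (?c * \<delta>n n)) * ennreal (rS n)"
      by (intro mult_left_mono mean_pmsq_S elim) simp
    also have "\<dots> = ennreal (1 / (?c * \<delta>n n) * rS n)"
      using d by (intro ennreal_mult'[symmetric]) simp
    also have "1 / (?c * \<delta>n n) * rS n = 1 / ?c * (rS n / \<delta>n n)" by simp
    finally show ?case .
  qed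
  have "(\<lambda>n. 1 / ?c * (rS n / \<delta>n n)) \<longlonglongrightarrow> 1 / ?c * 0"
    by (intro tendsto_intros rS_limit[folded \<delta>n_def])
  from tendsto_ennrealI[OF this] show "(\<lambda>n. ennreal (1 / ?c * (rS n / \<delta>n n))) \<longlonglongrightarrow> 0" by simp
qed auto

lemma near_F0_mass:
  assumes n: "n \<ge> 3" and W: "good n W" "W \<in> space WN" "W \<notin> Sbad n"
  shows "measure (post n W) {f. wsum J0 wS (\<lambda>i. coeff \<psi> f i - \<theta>0 i) \<le> ennreal ((\<eta> / 2)\<^sup>2)} \<ge> 1 - \<delta>n n"
proof -
  have n0: "n > 0" and Wr: "regular n W" using n W by (auto simp: good_def)
  interpret prob_space "post n W" by (rule prob_space_post[OF n0 Wr])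
  let ?c = "(\<eta> / 2)\<^sup>2"
  have c: "?c > 0" using \<eta> by simp
  let ?u = "\<lambda>f. wsum J0 wS (\<lambda>i. coeff \<psi> f i - \<theta>0 i)"
  have m [measurable]: "?u \<in> borel_measurable borel" by measurable
  have m': "?u \<in> borel_measurable (post n W)" by measurable
  let ?Bad = "{f \<in> space (post n W). ennreal ?c \<le> ?u f}"
  have scale: "?u f = ennreal (1 / real n) * wsum J0 wS (resc n f)" for f
  proof -
    have "?u f = wsum J0 wS (\<lambda>i. (1 / sqrt (real n)) * resc n f i)"
      using n by (intro wsum_cong) (simp add: resc_def)
    also have "\<dots> = ennreal ((1 / sqrt (real n))\<^sup>2) * wsum J0 wS (resc n f)" by (rule wsum_scale) simp
    finally show ?thesis by (simp add: power_divide)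
  qed
  have "emeasure (post n W) ?Bad \<le> ennreal (1 / ?c) * (\<integral>\<^sup>+f. ?u f \<partial>post n W)"
    by (rule nn_integral_Markov_ge[OF m' c])
  also have "(\<integral>\<^sup>+f. ?u f \<partial>post n W) = ennreal (1 / real n) * (\<integral>\<^sup>+f. wsum J0 wS (resc n f) \<partial>post n W)"
    unfolding scale by (rule nn_integral_cmult) measurable
  also have "\<dots> \<le> ennreal (1 / real n) * pmsq n wS W"
    by (intro mult_left_mono post_wsum_le) (auto simp: post_coord_sq[OF n0 Wr])
  also have "\<dots> \<le> ennreal (?c * \<delta>n n)" using W by (auto simp: Sbad_def not_le)
  also have "ennreal (1 / ?c) * ennreal (?c * \<delta>n n) = ennreal (\<delta>n n)"
    using c \<delta>n_pos[OF n] by (subst ennreal_mult[symmetric]) auto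
  finally have bad: "prob ?Bad \<le> \<delta>n n"
    using \<delta>n_pos[OF n] by (simp add: emeasure_eq_measure mult_left_mono)
  have "prob (space (post n W) - ?Bad) = 1 - prob ?Bad"
    by (rule prob_compl) (use m' in measurable)
  then have "1 - \<delta>n n \<le> prob (space (post n W) - ?Bad)" using bad by linarith
  also have "\<dots> \<le> prob {f. ?u f \<le> ennreal ?c}"
  proof (rule finite_measure_mono)
    have "{f \<in> space borel. ?u f \<le> ennreal ?c} \<in> sets borel" by measurable
    then show "{f. ?u f \<le> ennreal ?c} \<in> events" by simp
  qed auto
  finally show ?thesis .
qed

lemma window_sets: "{f. ereal lo \<le> nrm f \<and> nrm f \<le> ereal hi} \<in> sets borel"
proof -
  have "{f \<in> space borel. ereal lo \<le> nrm f \<and> nrm f \<le> ereal hi} \<in> sets borel" by measurable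
  then show ?thesis by simp
qed

lemma Mr_eq: "Mr n x = Inf (ereal ` {M. M > 0 \<and> measure (posterior \<psi> J0 pri n x) {f. ereal (M - \<eta>) \<le> nrm f \<and> nrm f \<le> ereal (M + \<eta>)} \<ge> 1 - \<delta>n n})"
  unfolding smoothness_radius_def window_eq \<delta>n_def by (rule refl)

lemma Mr_nonneg: "0 \<le> Mr n x"
  unfolding Mr_eq by (rule Inf_greatest) auto

text \<open>m0 + \<eta> / 2 is an admissible centre: its window starts at m0 - \<eta> / 2 and
  contains the range of the norm on the ball around \<open>F0\<close>. The shift keeps the centre
  positive even if m0 = 0.\<close>

lemma Mr_upper:
  assumes n: "n \<ge> 3" and W: "good n W" "W \<in> space WN" "W \<notin> Sbad n"
  shows "Mr n (X n W) \<le> ereal (m0 + \<eta> / 2)"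
  unfolding Mr_eq
proof (rule Inf_lower, rule imageI, rule CollectI, rule conjI)
  interpret prob_space "post n W" using n W by (intro prob_space_post) (auto simp: good_def)
  show "0 < m0 + \<eta> / 2" using m0_nonneg \<eta> by simp
  have "1 - \<delta>n n \<le> prob {f. wsum J0 wS (\<lambda>i. coeff \<psi> f i - \<theta>0 i) \<le> ennreal ((\<eta> / 2)\<^sup>2)}"
    by (rule near_F0_mass[OF n W])
  also have "\<dots> \<le> prob {f. ereal (m0 + \<eta> / 2 - \<eta>) \<le> nrm f \<and> nrm f \<le> ereal (m0 + \<eta> / 2 + \<eta>)}"
  proof (rule finite_measure_mono)
    show "{f. wsum J0 wS (\<lambda>i. coeff \<psi> f i - \<theta>0 i) \<le> ennreal ((\<eta> / 2)\<^sup>2)} \<subseteq>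
      {f. ereal (m0 + \<eta> / 2 - \<eta>) \<le> nrm f \<and> nrm f \<le> ereal (m0 + \<eta> / 2 + \<eta>)}"
    proof safe
      fix f assume f: "wsum J0 wS (\<lambda>i. coeff \<psi> f i - \<theta>0 i) \<le> ennreal ((\<eta> / 2)\<^sup>2)"
      show "ereal (m0 + \<eta> / 2 - \<eta>) \<le> nrm f" using near_F0(1)[OF f] by (simp add: algebra_simps)
      have "nrm f \<le> ereal (m0 + \<eta> / 2)" by (rule near_F0(2)[OF f])
      also have "\<dots> \<le> ereal (m0 + \<eta> / 2 + \<eta>)" using \<eta> by simp
      finally show "nrm f \<le> ereal (m0 + \<eta> / 2 + \<eta>)" .
    qed
  qed (simp add: window_sets)
  finally show "1 - \<delta>n n \<le> prob {f. ereal (m0 + \<eta> / 2 - \<eta>) \<le> nrm f \<and> nrm f \<le> ereal (m0 + \<eta> / 2 + \<eta>)}" .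
qed

text \<open>For \<delta>n < 1 / 2 any admissible window and the ball around \<open>F0\<close> both
  have posterior mass above one half, so they share an f. This forces M \<ge> m0 - 3 \<eta> / 2,
  within the slack 4 \<eta>.\<close>

lemma Mr_lower:
  assumes n: "n \<ge> 3" and W: "good n W" "W \<in> space WN" "W \<notin> Sbad n" and d: "\<delta>n n < 1 / 2"
  shows "ereal (m0 - 4 * \<eta>) \<le> Mr n (X n W)"
  unfolding Mr_eq
proof (rule Inf_greatest)
  interpret prob_space "post n W" using n W by (intro prob_space_post) (auto simp: good_def)
  fix z assume "z \<in> ereal ` {M. M > 0 \<and> prob {f. ereal (M - \<eta>) \<le> nrm f \<and> nrm f \<le> ereal (M + \<eta>)} \<ge> 1 - \<delta>n n}"
  then obtain M where M: "z = ereal M" "prob {f. ereal (M - \<eta>) \<le> nrm f \<and> nrm f \<le> ereal (M + \<eta>)} \<ge> 1 - \<delta>n n" by blast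
  let ?A = "{f. wsum J0 wS (\<lambda>i. coeff \<psi> f i - \<theta>0 i) \<le> ennreal ((\<eta> / 2)\<^sup>2)}"
  let ?B = "{f. ereal (M - \<eta>) \<le> nrm f \<and> nrm f \<le> ereal (M + \<eta>)}"
  have A: "?A \<in> events"
  proof -
    have "{f \<in> space borel. wsum J0 wS (\<lambda>i. coeff \<psi> f i - \<theta>0 i) \<le> ennreal ((\<eta> / 2)\<^sup>2)} \<in> sets borel" by measurable
    then show ?thesis by simp
  qed
  have B: "?B \<in> events" by (simp add: window_sets)
  have "?A \<inter> ?B \<noteq> {}"
  proof
    assume "?A \<inter> ?B = {}"
    then have "prob (?A \<union> ?B) = prob ?A + prob ?B" using A B by (intro finite_measure_Union) auto
    moreover have "prob (?A \<union> ?B) \<le> 1" by simp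
    ultimately show False using near_F0_mass[OF n W] M(2) d by linarith
  qed
  then obtain f where f: "f \<in> ?A" "f \<in> ?B" by blast
  have "ereal (m0 - \<eta> / 2) \<le> nrm f" using f(1) by (intro near_F0) simp
  also have "\<dots> \<le> ereal (M + \<eta>)" using f(2) by simp
  finally have "m0 - \<eta> / 2 \<le> M + \<eta>" by simp
  then show "ereal (m0 - 4 * \<eta>) \<le> z" using M(1) \<eta> by simp
qed

text \<open>The infimum need not be attained on the given data; an admissible M below it plus \<eta>
  is taken, whose window ends below the allowance of 4 \<eta>. An infinite radius imposes no
  constraint.\<close>

lemma Mr_mass:
  assumes n: "n \<ge> 3" and W: "good n W"
  shows "measure (post n W) {f. nrm f \<le> Mr n (X n W) + ereal (4 * \<eta>)} \<ge> 1 - \<delta>n n"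
proof -
  interpret prob_space "post n W" using n W by (intro prob_space_post) (auto simp: good_def)
  have S: "{f. nrm f \<le> c} \<in> events" for c
  proof -
    have "{f \<in> space borel. nrm f \<le> c} \<in> sets borel" by measurable
    then show ?thesis by simp
  qed
  show ?thesis
  proof (cases "Mr n (X n W)")
    case (real r)
    have "Mr n (X n W) < ereal (r + \<eta>)" using real \<eta> by simp
    then obtain M where M: "M < r + \<eta>" "1 - \<delta>n n \<le> prob {f. ereal (M - \<eta>) \<le> nrm f \<and> nrm f \<le> ereal (M + \<eta>)}"
      unfolding Mr_eq Inf_less_iff by auto
    note M(2)
    also have "prob {f. ereal (M - \<eta>) \<le> nrm f \<and> nrm f \<le> ereal (M + \<eta>)} \<le> prob {f. nrm f \<le> Mr n (X n W) + ereal (4 * \<eta>)}"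
    proof (rule finite_measure_mono[OF _ S])
      have "ereal (M + \<eta>) \<le> Mr n (X n W) + ereal (4 * \<eta>)" using M(1) \<eta> unfolding real by simp
      then show "{f. ereal (M - \<eta>) \<le> nrm f \<and> nrm f \<le> ereal (M + \<eta>)} \<subseteq> {f. nrm f \<le> Mr n (X n W) + ereal (4 * \<eta>)}"
        by (auto intro: order_trans)
    qed
    finally show ?thesis .
  next
    case PInf
    then show ?thesis using prob_space \<delta>n_pos[OF n] by simp
  next
    case MInf
    then show ?thesis using Mr_nonneg[of n "X n W"] by simp
  qed
qed

section \<open>The credible radius\<close>

lemma Gn_mono:
  assumes n: "n > 0" and W: "good n W" and r: "r \<le> s"
  shows "Gn n W r \<le> Gn n W s"
proof -
  interpret prob_space "post n W" using n W by (intro prob_space_post) (auto simp: good_def)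
  show ?thesis unfolding Gn_def
  proof (rule finite_measure_mono)
    show "{f. wsum J0 wh (\<lambda>i. resc n f i - vmean n W i) \<le> ennreal r} \<subseteq> {f. wsum J0 wh (\<lambda>i. resc n f i - vmean n W i) \<le> ennreal s}"
      using ennreal_leI[OF r] by (auto intro: order_trans)
    have "{f \<in> space borel. wsum J0 wh (\<lambda>i. resc n f i - vmean n W i) \<le> ennreal s} \<in> sets borel" by measurable
    then show "{f. wsum J0 wh (\<lambda>i. resc n f i - vmean n W i) \<le> ennreal s} \<in> events" by simp
  qed
qed

lemma AE_R:
  assumes n: "n > 0"
  shows "AE W in WN. W \<in> space WN \<and> good n W \<and> 0 \<le> R n (X n W) \<and> Gn n W ((R n (X n W))\<^sup>2) = 1 - \<alpha>
    \<and> measure (post n W) (H_ball \<psi> J0 \<delta> (posterior_mean \<psi> J0 pri n (X n W)) (R n (X n W) / sqrt (real n))) = 1 - \<alpha>"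
proof -
  have "AE W in WN. measure (post n W) (H_ball \<psi> J0 \<delta> (posterior_mean \<psi> J0 pri n (X n W)) (R n (X n W) / sqrt (real n))) = 1 - \<alpha>"
    using R_mass[OF n] unfolding obs_law_eq by (rule AE_distrD[OF X_measurable])
  then show ?thesis using AE_good[OF n] AE_space
  proof eventually_elim
    case (elim W)
    let ?r = "R n (X n W)"
    have eq: "H_ball \<psi> J0 \<delta> (posterior_mean \<psi> J0 pri n (X n W)) (?r / sqrt (real n)) =
        {f. 0 \<le> ?r \<and> wsum J0 wh (\<lambda>i. resc n f i - vmean n W i) \<le> ennreal (?r\<^sup>2)}"
      using H_ball_iff[OF n elim(2)] by blast
    \<comment> \<open>A ball of negative radius is empty and cannot have mass 1 - \<alpha>.\<close>
    have "0 \<le> ?r"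
    proof (rule ccontr)
      assume "\<not> 0 \<le> ?r"
      then show False using elim(1) \<alpha> unfolding eq by simp
    qed
    then show ?case using elim eq by (simp add: Gn_def)
  qed
qed

text \<open>Monotonicity of \<open>Gn\<close> locates R^2 by comparing masses at deterministic
  radii; it avoids inverting the posterior distribution function.\<close>

lemma R_less:
  assumes "n > 0" "good n W" "Gn n W ((R n (X n W))\<^sup>2) = 1 - \<alpha>" "\<not> Gn n W r \<le> 1 - \<alpha>"
  shows "(R n (X n W))\<^sup>2 < r"
  using Gn_mono[OF assms(1,2), of r "(R n (X n W))\<^sup>2"] assms(3,4) by (cases "r \<le> (R n (X n W))\<^sup>2") auto

lemma R_greater:
  assumes "n > 0" "good n W" "Gn n W ((R n (X n W))\<^sup>2) = 1 - \<alpha>" "\<not> 1 - \<alpha> \<le> Gn n W r"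
  shows "r < (R n (X n W))\<^sup>2"
  using Gn_mono[OF assms(1,2), of "(R n (X n W))\<^sup>2" r] assms(3,4) by (cases "(R n (X n W))\<^sup>2 \<le> r") auto

text \<open>Leaves room for the levels 1 - \<alpha> + e and 1 - \<alpha> - e inside the open unit
  interval, where \<open>Fq\<close> has positive quantiles.\<close>

definition e0 :: real where "e0 = min \<alpha> (1 - \<alpha>)"

lemma e0_pos: "e0 > 0" using \<alpha> by (simp add: e0_def)

text \<open>\<open>Gn_lower\<close> needs a strictly smaller radius whose limiting mass still
  exceeds 1 - \<alpha>; the quantile at e / 2 supplies it.\<close>

lemma upper_quantile:
  assumes e: "0 < e" "e < e0"
  obtains r where "r > 0" "Fq r = 1 - \<alpha> + e" "(\<lambda>n. emeasure WN {W \<in> space WN. Gn n W r \<le> 1 - \<alpha>}) \<longlonglongrightarrow> 0"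
proof -
  obtain r where r: "r > 0" "Fq r = 1 - \<alpha> + e"
    using Fq_surj[of "1 - \<alpha> + e"] e \<alpha> by (auto simp: e0_def)
  obtain r' where r': "r' > 0" "Fq r' = 1 - \<alpha> + e / 2"
    using Fq_surj[of "1 - \<alpha> + e / 2"] e \<alpha> by (auto simp: e0_def)
  have "r' < r" using Fq_mono[of r r'] r r' e by (cases "r' < r") auto
  then have "(\<lambda>n. emeasure WN {W \<in> space WN. Gn n W r \<le> 1 - \<alpha>}) \<longlonglongrightarrow> 0"
    using r' e by (intro Gn_lower[of r']) auto
  then show ?thesis using that r by blast
qed

lemma lower_quantile:
  assumes e: "0 < e" "e < e0"
  obtains r where "r > 0" "Fq r = 1 - \<alpha> - e" "(\<lambda>n. emeasure WN {W \<in> space WN. 1 - \<alpha> \<le> Gn n W r}) \<longlonglongrightarrow> 0"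
proof -
  obtain r where r: "r > 0" "Fq r = 1 - \<alpha> - e"
    using Fq_surj[of "1 - \<alpha> - e"] e \<alpha> by (auto simp: e0_def)
  moreover have "(\<lambda>n. emeasure WN {W \<in> space WN. 1 - \<alpha> \<le> Gn n W r}) \<longlonglongrightarrow> 0"
    using r e by (intro Gn_upper) auto
  ultimately show ?thesis using that by blast
qed

lemma radius_bounded: "bounded_in_prob (obs_law \<psi> J0 F0) (\<lambda>n x. ereal (R n x)) (\<lambda>_. 1)"
  unfolding bounded_in_prob_def
proof (intro allI impI)
  fix \<epsilon> :: real assume \<epsilon>: "\<epsilon> > 0"
  obtain r where r: "r > 0" "(\<lambda>n. emeasure WN {W \<in> space WN. Gn n W r \<le> 1 - \<alpha>}) \<longlonglongrightarrow> 0"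
    using upper_quantile[of "e0 / 2"] e0_pos by auto
  show "\<exists>K. \<forall>\<^sub>F n in sequentially. outer_measure_of (obs_law \<psi> J0 F0 n)
      {x \<in> space (obs_law \<psi> J0 F0 n). ereal (K * 1) < \<bar>ereal (R n x)\<bar>} < ennreal \<epsilon>"
  proof (rule exI[of _ "sqrt r"])
    show "\<forall>\<^sub>F n in sequentially. outer_measure_of (obs_law \<psi> J0 F0 n)
      {x \<in> space (obs_law \<psi> J0 F0 n). ereal (sqrt r * 1) < \<bar>ereal (R n x)\<bar>} < ennreal \<epsilon>"
      using ennreal_tendsto_0D[OF r(2) \<epsilon>] eventually_gt_at_top[of 0]
    proof eventually_elim
      case (elim n)
      have "outer_measure_of (obs_law \<psi> J0 F0 n) {x \<in> space (obs_law \<psi> J0 F0 n). ereal (sqrt r * 1) < \<bar>ereal (R n x)\<bar>}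
          \<le> emeasure WN {W \<in> space WN. Gn n W r \<le> 1 - \<alpha>}"
      proof (rule outer_obs_law[OF elim(2)])
        show "AE W in WN. ereal (sqrt r * 1) < \<bar>ereal (R n (X n W))\<bar> \<longrightarrow> W \<in> {W \<in> space WN. Gn n W r \<le> 1 - \<alpha>}"
          using AE_R[OF elim(2)]
        proof eventually_elim
          case (elim W)
          show ?case
          proof (intro impI CollectI conjI)
            assume "ereal (sqrt r * 1) < \<bar>ereal (R n (X n W))\<bar>"
            then have "sqrt r < R n (X n W)" using elim by simp
            then have "r < (R n (X n W))\<^sup>2" using real_less_rsqrt[of "R n (X n W)" r] real_le_rsqrt[of "R n (X n W)" r] by (cases "r < (R n (X n W))\<^sup>2") auto
            then show "Gn n W r \<le> 1 - \<alpha>" using R_less[OF \<open>0 < n\<close>, of W r] elim by (cases "Gn n W r \<le> 1 - \<alpha>") auto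
          qed (use elim in simp)
        qed
      qed measurable
      also note elim(1)
      finally show ?case .
    qed
  qed
qed

lemma smoothness_bounded: "bounded_in_prob (obs_law \<psi> J0 F0) Mr (\<lambda>_. 1)"
  unfolding bounded_in_prob_def
proof (intro allI impI)
  fix \<epsilon> :: real assume \<epsilon>: "\<epsilon> > 0"
  show "\<exists>K. \<forall>\<^sub>F n in sequentially. outer_measure_of (obs_law \<psi> J0 F0 n)
      {x \<in> space (obs_law \<psi> J0 F0 n). ereal (K * 1) < \<bar>Mr n x\<bar>} < ennreal \<epsilon>"
  proof (rule exI[of _ "m0 + \<eta> / 2"])
    show "\<forall>\<^sub>F n in sequentially. outer_measure_of (obs_law \<psi> J0 F0 n)
      {x \<in> space (obs_law \<psi> J0 F0 n). ereal ((m0 + \<eta> / 2) * 1) < \<bar>Mr n x\<bar>} < ennreal \<epsilon>"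
      using ennreal_tendsto_0D[OF Sbad_limit \<epsilon>] eventually_ge_at_top[of 3]
    proof eventually_elim
      case (elim n)
      then have n: "n > 0" by simp
      have "outer_measure_of (obs_law \<psi> J0 F0 n) {x \<in> space (obs_law \<psi> J0 F0 n). ereal ((m0 + \<eta> / 2) * 1) < \<bar>Mr n x\<bar>}
          \<le> emeasure WN (Sbad n)"
      proof (rule outer_obs_law[OF n Sbad_sets])
        show "AE W in WN. ereal ((m0 + \<eta> / 2) * 1) < \<bar>Mr n (X n W)\<bar> \<longrightarrow> W \<in> Sbad n"
          using AE_R[OF n]
        proof eventually_elim
          case (elim W)
          show ?case
          proof (rule impI, rule ccontr)
            assume lt: "ereal ((m0 + \<eta> / 2) * 1) < \<bar>Mr n (X n W)\<bar>" and "W \<notin> Sbad n"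
            then have "Mr n (X n W) \<le> ereal (m0 + \<eta> / 2)" using elim by (intro Mr_upper \<open>3 \<le> n\<close>) auto
            then show False using lt Mr_nonneg[of n "X n W"] by (simp add: abs_ereal_ge0)
          qed
        qed
      qed
      also note elim(1)
      finally show ?case .
    qed
  qed
qed

lemma nrm_sets: "{f. nrm f \<le> c} \<in> sets borel"
proof -
  have "{f \<in> space borel. nrm f \<le> c} \<in> sets borel" by measurable
  then show ?thesis by simp
qed

lemma H_ball_sets: "H_ball \<psi> J0 \<delta> m r \<in> sets borel"
proof -
  have [measurable]: "(\<lambda>f. wsum J0 wh (coeff \<psi> (f - m))) \<in> borel_measurable borel"
    unfolding coeff_diff[abs_def] by measurable
  have "{f \<in> space borel. 0 \<le> r \<and> wsum J0 wh (coeff \<psi> (f - m)) \<le> ennreal (r\<^sup>2)} \<in> sets borel" by measurable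
  then show ?thesis unfolding H_ball_def norm_H_eq level_norm_le_iff[OF wH_nonneg] by simp
qed

text \<open>The ball has mass exactly 1 - \<alpha> almost surely and the smoothness constraint
  removes at most \<delta>n, so the outer probability is not merely small but zero for all large
  n.\<close>

lemma posterior_mass: "tendsto_in_prob (obs_law \<psi> J0 F0) (\<lambda>n x. measure (posterior \<psi> J0 pri n x) (CS n x)) (1 - \<alpha>)"
  unfolding tendsto_in_prob_def
proof (intro allI impI)
  fix \<epsilon> :: real assume \<epsilon>: "\<epsilon> > 0"
  have "eventually (\<lambda>n. \<delta>n n < \<epsilon>) sequentially" by (rule order_tendstoD(2)[OF \<delta>n_limit \<epsilon>])
  then have "eventually (\<lambda>n. outer_measure_of (obs_law \<psi> J0 F0 n)
      {x \<in> space (obs_law \<psi> J0 F0 n). \<epsilon> < \<bar>measure (posterior \<psi> J0 pri n x) (CS n x) - (1 - \<alpha>)\<bar>} = 0) sequentially"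
    using eventually_ge_at_top[of 3]
  proof eventually_elim
    case (elim n)
    then have n: "n > 0" by simp
    have "outer_measure_of (obs_law \<psi> J0 F0 n)
        {x \<in> space (obs_law \<psi> J0 F0 n). \<epsilon> < \<bar>measure (posterior \<psi> J0 pri n x) (CS n x) - (1 - \<alpha>)\<bar>} \<le> emeasure WN {}"
    proof (rule outer_obs_law[OF n])
      show "AE W in WN. \<epsilon> < \<bar>measure (post n W) (CS n (X n W)) - (1 - \<alpha>)\<bar> \<longrightarrow> W \<in> {}"
        using AE_R[OF n]
      proof eventually_elim
        case (elim W)
        interpret prob_space "post n W" using n elim by (intro prob_space_post) (auto simp: good_def)
        let ?A = "{f. nrm f \<le> Mr n (X n W) + ereal (4 * \<eta>)}"
        let ?H = "H_ball \<psi> J0 \<delta> (posterior_mean \<psi> J0 pri n (X n W)) (R n (X n W) / sqrt (real n))"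
        have ev: "?A \<in> events" "?H \<in> events" by (simp_all add: nrm_sets H_ball_sets)
        have C: "CS n (X n W) = ?A \<inter> ?H" by (simp add: credible_set_def)
        have "prob (?A \<inter> ?H) \<le> prob ?H" using ev by (intro finite_measure_mono) auto
        moreover have "prob (?A \<union> ?H) = prob ?A + prob ?H - prob (?A \<inter> ?H)"
          using ev by (intro measure_Un3) (simp_all add: fmeasurable_eq_sets)
        moreover have "prob (?A \<union> ?H) \<le> 1" by simp
        moreover have "1 - \<delta>n n \<le> prob ?A" using elim by (intro Mr_mass \<open>3 \<le> n\<close>) simp
        ultimately show ?case using elim \<open>\<delta>n n < \<epsilon>\<close> unfolding C by auto
      qed
    qed simp
    then show ?case by simp
  qed
  then show "(\<lambda>n. outer_measure_of (obs_law \<psi> J0 F0 n)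
      {x \<in> space (obs_law \<psi> J0 F0 n). \<epsilon> < \<bar>measure (posterior \<psi> J0 pri n x) (CS n x) - (1 - \<alpha>)\<bar>}) \<longlonglongrightarrow> 0"
    by (rule tendsto_eventually)
qed

lemma CS_iff:
  assumes n: "n > 0" and W: "good n W"
  shows "f \<in> CS n (X n W) \<longleftrightarrow> nrm f \<le> Mr n (X n W) + ereal (4 * \<eta>) \<and> 0 \<le> R n (X n W) \<and>
    wsum J0 wh (\<lambda>i. resc n f i - vmean n W i) \<le> ennreal ((R n (X n W))\<^sup>2)"
  unfolding credible_set_def using H_ball_iff[OF n W, of f "R n (X n W)"] by auto

text \<open>Differences of two members obey both constraints with doubled radii, 2 (m0 + \<eta> / 2
  + 4 \<eta>) in smoothness and 2 sqrt r / sqrt n in H(\<delta>); Parseval and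
  \<open>interpolation\<close> turn these into a distance in \<open>L2\<close>.\<close>

lemma CS_dist:
  assumes n: "n \<ge> 3" and W: "good n W" "W \<in> space WN" "W \<notin> Sbad n" and R: "(R n (X n W))\<^sup>2 < r"
    and f: "f \<in> CS n (X n W)" and h: "h \<in> CS n (X n W)"
  shows "dist f h \<le> sqrt (2 * (1 + 1 / \<gamma>\<^sup>2) * (2 * (m0 + \<eta> / 2 + 4 * \<eta>))\<^sup>2 + (2 * sqrt r)\<^sup>2) *
    (real n powr (- \<gamma> / (2 * \<gamma> + 1)) * ln (real n) powr (\<delta> + 1))"
    (is "_ \<le> ?b")
proof -
  have n0: "n > 0" using n by simp
  let ?a = "m0 + \<eta> / 2 + 4 * \<eta>"
  let ?r = "R n (X n W)"
  have nrm: "wsum J0 wS (coeff \<psi> f) \<le> ennreal (?a\<^sup>2)" if "f \<in> CS n (X n W)" for f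
  proof -
    have "nrm f \<le> Mr n (X n W) + ereal (4 * \<eta>)" using that CS_iff[OF n0 W(1)] by simp
    also have "\<dots> \<le> ereal (m0 + \<eta> / 2) + ereal (4 * \<eta>)" by (intro add_mono Mr_upper[OF n W]) simp
    finally show ?thesis by (simp add: nrm_le_iff)
  qed
  have a: "?a \<ge> 0" using m0_nonneg \<eta> by simp
  have S: "wsum J0 wS (coeff \<psi> (f - h)) \<le> ennreal ((2 * ?a)\<^sup>2)"
  proof -
    have "wsum J0 wS (\<lambda>i. - coeff \<psi> h i) = wsum J0 wS (coeff \<psi> h)" by (rule wsum_cong) simp
    then have "wsum J0 wS (\<lambda>i. coeff \<psi> f i + - coeff \<psi> h i) \<le> ennreal ((?a + ?a)\<^sup>2)"
      using nrm[OF f] nrm[OF h] a by (intro wsum_triangle) auto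
    then show ?thesis by (simp add: coeff_diff[abs_def])
  qed
  have ball: "0 \<le> ?r" "wsum J0 wh (\<lambda>i. resc n f i - vmean n W i) \<le> ennreal (?r\<^sup>2)"
    "wsum J0 wh (\<lambda>i. resc n h i - vmean n W i) \<le> ennreal (?r\<^sup>2)"
    using f h CS_iff[OF n0 W(1)] by auto
  have Hn: "wsum J0 wh (coeff \<psi> (f - h)) \<le> ennreal ((2 * sqrt r)\<^sup>2 / real n)"
  proof -
    have "wsum J0 wh (\<lambda>i. vmean n W i - resc n h i) = wsum J0 wh (\<lambda>i. resc n h i - vmean n W i)"
      by (rule wsum_cong) (simp add: power2_commute)
    then have "wsum J0 wh (\<lambda>i. (resc n f i - vmean n W i) + (vmean n W i - resc n h i)) \<le> ennreal ((?r + ?r)\<^sup>2)"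
      using ball by (intro wsum_triangle) auto
    also have "(?r + ?r)\<^sup>2 = 4 * ?r\<^sup>2" by (simp add: power2_eq_square)
    also have "ennreal (4 * ?r\<^sup>2) \<le> ennreal ((2 * sqrt r)\<^sup>2)"
    proof (rule ennreal_leI)
      have "0 \<le> r" using R zero_le_power2[of ?r] by linarith
      then show "4 * ?r\<^sup>2 \<le> (2 * sqrt r)\<^sup>2" using R by (simp add: power_mult_distrib)
    qed
    finally have le: "wsum J0 wh (\<lambda>i. resc n f i - resc n h i) \<le> ennreal ((2 * sqrt r)\<^sup>2)" by simp
    have "wsum J0 wh (coeff \<psi> (f - h)) = wsum J0 wh (\<lambda>i. (1 / sqrt (real n)) * (resc n f i - resc n h i))"
      using n0 by (intro wsum_cong) (simp add: coeff_diff resc_def right_diff_distrib[symmetric])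
    also have "\<dots> = ennreal (1 / real n) * wsum J0 wh (\<lambda>i. resc n f i - resc n h i)"
      by (subst wsum_scale) (auto simp: power_divide)
    also have "\<dots> \<le> ennreal (1 / real n) * ennreal ((2 * sqrt r)\<^sup>2)" by (intro mult_left_mono le) simp
    also have "\<dots> = ennreal ((2 * sqrt r)\<^sup>2 / real n)" by (subst ennreal_mult[symmetric]) auto
    finally show ?thesis .
  qed
  have "ennreal ((norm (f - h))\<^sup>2) = wsum J0 (\<lambda>_. 1) (coeff \<psi> (f - h))"
    unfolding coeff_inner[abs_def] by (rule parseval[symmetric])
  also have "\<dots> \<le> ennreal (?b\<^sup>2)" by (rule interpolation[OF n S Hn])
  finally have "(norm (f - h))\<^sup>2 \<le> ?b\<^sup>2" by simp
  moreover have "?b \<ge> 0" by (intro mult_nonneg_nonneg real_sqrt_ge_zero add_nonneg_nonneg) auto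
  ultimately show ?thesis unfolding dist_norm by (rule power2_le_imp_le)
qed

lemma diameter_bounded:
  "bounded_in_prob (obs_law \<psi> J0 F0) (\<lambda>n x. ediameter (CS n x))
     (\<lambda>n. real n powr (- \<gamma> / (2 * \<gamma> + 1)) * ln (real n) powr (\<delta> + 1))"
  unfolding bounded_in_prob_def
proof (intro allI impI)
  fix \<epsilon> :: real assume \<epsilon>: "\<epsilon> > 0"
  obtain r where r: "r > 0" "(\<lambda>n. emeasure WN {W \<in> space WN. Gn n W r \<le> 1 - \<alpha>}) \<longlonglongrightarrow> 0"
    using upper_quantile[of "e0 / 2"] e0_pos by auto
  define k where "k = sqrt (2 * (1 + 1 / \<gamma>\<^sup>2) * (2 * (m0 + \<eta> / 2 + 4 * \<eta>))\<^sup>2 + (2 * sqrt r)\<^sup>2)"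
  let ?rate = "\<lambda>n. real n powr (- \<gamma> / (2 * \<gamma> + 1)) * ln (real n) powr (\<delta> + 1)"
  have k0: "k \<ge> 0" unfolding k_def by (intro real_sqrt_ge_zero add_nonneg_nonneg mult_nonneg_nonneg) auto
  show "\<exists>K. \<forall>\<^sub>F n in sequentially. outer_measure_of (obs_law \<psi> J0 F0 n)
      {x \<in> space (obs_law \<psi> J0 F0 n). ereal (K * ?rate n) < \<bar>ediameter (CS n x)\<bar>} < ennreal \<epsilon>"
  proof (rule exI[of _ k])
    have \<epsilon>2: "\<epsilon> / 2 > 0" using \<epsilon> by simp
    show "\<forall>\<^sub>F n in sequentially. outer_measure_of (obs_law \<psi> J0 F0 n)
      {x \<in> space (obs_law \<psi> J0 F0 n). ereal (k * ?rate n) < \<bar>ediameter (CS n x)\<bar>} < ennreal \<epsilon>"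
      using ennreal_tendsto_0D[OF r(2) \<epsilon>2] ennreal_tendsto_0D[OF Sbad_limit \<epsilon>2] eventually_ge_at_top[of 3]
    proof eventually_elim
      case (elim n)
      then have n: "n > 0" by simp
      let ?S = "{W \<in> space WN. Gn n W r \<le> 1 - \<alpha>}"
      have S: "?S \<in> sets WN" by measurable
      have "outer_measure_of (obs_law \<psi> J0 F0 n) {x \<in> space (obs_law \<psi> J0 F0 n). ereal (k * ?rate n) < \<bar>ediameter (CS n x)\<bar>}
          \<le> emeasure WN (?S \<union> Sbad n)"
      proof (rule outer_obs_law[OF n])
        show "AE W in WN. ereal (k * ?rate n) < \<bar>ediameter (CS n (X n W))\<bar> \<longrightarrow> W \<in> ?S \<union> Sbad n"
          using AE_R[OF n]
        proof eventually_elim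
          case (elim W)
          show ?case
          proof (rule impI, rule ccontr)
            assume lt: "ereal (k * ?rate n) < \<bar>ediameter (CS n (X n W))\<bar>" and "W \<notin> ?S \<union> Sbad n"
            then have nS: "\<not> Gn n W r \<le> 1 - \<alpha>" "W \<notin> Sbad n" using elim by auto
            have R: "(R n (X n W))\<^sup>2 < r" using elim nS by (intro R_less n) auto
            have dist: "ereal (dist f h) \<le> ereal (k * ?rate n)" if "f \<in> CS n (X n W)" "h \<in> CS n (X n W)" for f h
              unfolding k_def using CS_dist[OF \<open>3 \<le> n\<close> _ _ nS(2) R that] elim by simp
            have k1: "0 \<le> ereal (k * ?rate n)" using k0 by simp
            have "\<bar>ediameter (CS n (X n W))\<bar> \<le> ereal (k * ?rate n)"
            proof (cases "CS n (X n W) = {}")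
              case True
              then show ?thesis using k1 by (simp add: ediameter_def)
            next
              case False
              then obtain f where f: "f \<in> CS n (X n W)" by blast
              have "0 \<le> (SUP f\<in>CS n (X n W). SUP h\<in>CS n (X n W). ereal (dist f h))"
                by (rule SUP_upper2[OF f], rule SUP_upper2[OF f]) simp
              moreover have "(SUP f\<in>CS n (X n W). SUP h\<in>CS n (X n W). ereal (dist f h)) \<le> ereal (k * ?rate n)"
                by (intro SUP_least dist)
              ultimately show ?thesis using False by (simp add: ediameter_def abs_ereal_ge0)
            qed
            then show False using lt by simp
          qed
        qed
      qed (rule sets.Un[OF S Sbad_sets])
      also have "\<dots> \<le> emeasure WN ?S + emeasure WN (Sbad n)" using S Sbad_sets by (rule emeasure_subadditive)
      also have "\<dots> < ennreal (\<epsilon> / 2) + ennreal (\<epsilon> / 2)"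
        using elim by (intro add_strict_mono) auto
      also have "\<dots> = ennreal \<epsilon>" using \<epsilon> by (simp add: ennreal_plus[symmetric] del: ennreal_plus)
      finally show ?case .
    qed
  qed
qed

section \<open>Measurability of the coverage event\<close>

lemma finite_measure_posterior:
  assumes x: "x \<in> space PN" shows "finite_measure (posterior \<psi> J0 pri n x)"
proof
  have [measurable]: "likelihood \<psi> J0 n x \<in> borel_measurable borel" by (rule likelihood_measurable1[OF x])
  define D where "D = (\<integral>\<^sup>+f'. ennreal (likelihood \<psi> J0 n x f') \<partial>pri)"
  have "emeasure (posterior \<psi> J0 pri n x) UNIV = (\<integral>\<^sup>+f. ennreal (likelihood \<psi> J0 n x f) / D \<partial>pri)"
    using posterior_eq_density[OF _ x, of UNIV n] by (simp add: D_def)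
  also have "\<dots> = D / D" unfolding D_def by (rule nn_integral_divide) measurable
  also have "\<dots> \<noteq> \<infinity>"
  \<comment> \<open>In \<open>ennreal\<close> both 0 / 0 and top / top are 0, so the posterior has
    finite mass even where Bayes' formula degenerates.\<close>
  proof (cases "D = 0 \<or> D = top")
    case True then show ?thesis by auto
  next
    case False
    then have "D / D = 1" by (intro ennreal_divide_self) (auto simp: less_top[symmetric])
    then show ?thesis by simp
  qed
  finally show "emeasure (posterior \<psi> J0 pri n x) (space (posterior \<psi> J0 pri n x)) \<noteq> \<infinity>"
    by (simp add: posterior_def)
qed

text \<open>The radius is an infimum over uncountably many windows. \<open>exists_window_iff\<close>
  rewrites the condition with countable quantifiers and closed windows, whose posterior masses are
  measurable in the data.\<close>

lemma Mr_less_sets: "{x \<in> space PN. Mr n x < ereal c} \<in> sets PN"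
proof -
  let ?w = "\<lambda>x lo hi. measure (posterior \<psi> J0 pri n x) {f. ereal lo \<le> nrm f \<and> nrm f \<le> ereal hi}"
  have w: "(\<lambda>x. ?w x lo hi) \<in> borel_measurable PN" for lo hi
  proof -
    have "UNIV \<times> {f. ereal lo \<le> nrm f \<and> nrm f \<le> ereal hi} \<inter> space (PN \<Otimes>\<^sub>M borel) \<in> sets (PN \<Otimes>\<^sub>M borel)"
    proof -
      have "space PN \<times> {f. ereal lo \<le> nrm f \<and> nrm f \<le> ereal hi} \<in> sets (PN \<Otimes>\<^sub>M borel)"
        by (intro pair_measureI window_sets) auto
      moreover have "UNIV \<times> {f. ereal lo \<le> nrm f \<and> nrm f \<le> ereal hi} \<inter> space (PN \<Otimes>\<^sub>M borel) =
          space PN \<times> {f. ereal lo \<le> nrm f \<and> nrm f \<le> ereal hi}"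
        by (auto simp: space_pair_measure)
      ultimately show ?thesis by simp
    qed
    from kernel_measurable[OF measurable_ident this, of n]
    have "(\<lambda>x. enn2real (emeasure (posterior \<psi> J0 pri n x) {f. (x, f) \<in> UNIV \<times> {f. ereal lo \<le> nrm f \<and> nrm f \<le> ereal hi} \<inter> space (PN \<Otimes>\<^sub>M borel)})) \<in> borel_measurable PN"
      by simp
    moreover have "enn2real (emeasure (posterior \<psi> J0 pri n x) {f. (x, f) \<in> UNIV \<times> {f. ereal lo \<le> nrm f \<and> nrm f \<le> ereal hi} \<inter> space (PN \<Otimes>\<^sub>M borel)}) = ?w x lo hi"
      if "x \<in> space PN" for x
      using that by (simp add: measure_def space_pair_measure)
    ultimately show ?thesis by (simp cong: measurable_cong)
  qed
  have iff: "Mr n x < ereal c \<longleftrightarrow> (\<exists>k::nat. \<forall>j::nat. \<exists>q\<in>\<rat> \<inter> {1 / real (Suc k)..c - 1 / real (Suc k)}.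
       1 - \<delta>n n \<le> ?w x (q - \<eta> - 1 / real (Suc j)) (q + \<eta> + 1 / real (Suc j)))" if x: "x \<in> space PN" for x
  proof -
    interpret finite_measure "posterior \<psi> J0 pri n x" by (rule finite_measure_posterior[OF x])
    have sp: "space (posterior \<psi> J0 pri n x) = UNIV" by (simp add: posterior_def)
    have m: "nrm \<in> borel_measurable (posterior \<psi> J0 pri n x)"
      using nrm_measurable by (simp add: posterior_def)
    have "Mr n x < ereal c \<longleftrightarrow> (\<exists>M. 0 < M \<and> M < c \<and> 1 - \<delta>n n \<le> ?w x (M - \<eta>) (M + \<eta>))"
      unfolding Mr_eq Inf_less_iff by auto
    then show ?thesis using exists_window_iff[OF m, of c "1 - \<delta>n n" \<eta>] unfolding sp by simp
  qed
  have "{x \<in> space PN. \<exists>k::nat. \<forall>j::nat. \<exists>q\<in>\<rat> \<inter> {1 / real (Suc k)..c - 1 / real (Suc k)}.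
       1 - \<delta>n n \<le> ?w x (q - \<eta> - 1 / real (Suc j)) (q + \<eta> + 1 / real (Suc j))} \<in> sets PN"
  proof (rule sets.sets_Collect_countable_Ex, rule sets.sets_Collect_countable_All)
    fix k j :: nat
    let ?Q = "\<rat> \<inter> {1 / real (Suc k)..c - 1 / real (Suc k)}"
    let ?P = "\<lambda>q x. 1 - \<delta>n n \<le> ?w x (q - \<eta> - 1 / real (Suc j)) (q + \<eta> + 1 / real (Suc j))"
    have "countable ?Q" using countable_rat by (rule countable_subset[rotated]) auto
    moreover have "{x \<in> space PN. ?P q x} \<in> sets PN" for q
      using w[of "q - \<eta> - 1 / real (Suc j)" "q + \<eta> + 1 / real (Suc j)"] by measurable
    moreover have "{x \<in> space PN. \<exists>q\<in>?Q. ?P q x} = (\<Union>q\<in>?Q. {x \<in> space PN. ?P q x})" by blast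
    ultimately show "{x \<in> space PN. \<exists>q\<in>?Q. ?P q x} \<in> sets PN"
      by (simp only:) (rule sets.countable_UN'; blast)
  qed
  then show ?thesis by (simp add: iff cong: conj_cong)
qed

text \<open>The coverage is stated with \<open>measure\<close>, which yields the intended
  probability only on measurable events. As \<open>F0\<close> has the finite norm m0, the smoothness
  constraint is a threshold for the radius.\<close>

lemma coverage_sets:
  assumes n: "n > 0" shows "{x \<in> space PN. F0 \<in> CS n x} \<in> sets PN"
proof -
  have Rm: "R n \<in> borel_measurable PN"
    using R_measurable[OF n] by (simp add: obs_law_eq)
  note [measurable] = posterior_mean_measurable[of n]
  have um: "(\<lambda>x. wsum J0 wh (coeff \<psi> (F0 - posterior_mean \<psi> J0 pri n x))) \<in> borel_measurable PN"
    unfolding coeff_diff[abs_def] by measurable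
  have "{x \<in> space PN. F0 \<in> CS n x} =
      (space PN - {x \<in> space PN. Mr n x < ereal (m0 - 4 * \<eta>)}) \<inter>
      {x \<in> space PN. 0 \<le> R n x / sqrt (real n) \<and>
        wsum J0 wh (coeff \<psi> (F0 - posterior_mean \<psi> J0 pri n x)) \<le> ennreal ((R n x / sqrt (real n))\<^sup>2)}"
  proof -
    have "ereal m0 \<le> z + ereal (4 * \<eta>) \<longleftrightarrow> \<not> z < ereal (m0 - 4 * \<eta>)" for z
      by (cases z) auto
    then show ?thesis
      by (auto simp: credible_set_def H_ball_def norm_H_eq level_norm_le_iff nrm_F0)
  qed
  also have "\<dots> \<in> sets PN"
  proof (rule sets.Int)
    show "space PN - {x \<in> space PN. Mr n x < ereal (m0 - 4 * \<eta>)} \<in> sets PN"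
      by (intro sets.compl_sets Mr_less_sets)
    define \<rho> where "\<rho> x = R n x / sqrt (real n)" for x
    define u where "u x = wsum J0 wh (coeff \<psi> (F0 - posterior_mean \<psi> J0 pri n x))" for x
    have \<rho>m: "\<rho> \<in> borel_measurable PN" unfolding \<rho>_def[abs_def] by (intro borel_measurable_divide Rm) simp
    have um': "u \<in> borel_measurable PN" unfolding u_def[abs_def] by (rule um)
    have "{x \<in> space PN. 0 \<le> \<rho> x} \<inter> {x \<in> space PN. u x \<le> ennreal ((\<rho> x)\<^sup>2)} \<in> sets PN"
      by (intro sets.Int borel_measurable_le measurable_compose[OF _ measurable_ennreal] borel_measurable_power \<rho>m um')
        simp
    also have "{x \<in> space PN. 0 \<le> \<rho> x} \<inter> {x \<in> space PN. u x \<le> ennreal ((\<rho> x)\<^sup>2)} =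
        {x \<in> space PN. 0 \<le> \<rho> x \<and> u x \<le> ennreal ((\<rho> x)\<^sup>2)}" by blast
    finally have "{x \<in> space PN. 0 \<le> \<rho> x \<and> u x \<le> ennreal ((\<rho> x)\<^sup>2)} \<in> sets PN" .
    then show "{x \<in> space PN. 0 \<le> R n x / sqrt (real n) \<and>
        wsum J0 wh (coeff \<psi> (F0 - posterior_mean \<psi> J0 pri n x)) \<le> ennreal ((R n x / sqrt (real n))\<^sup>2)} \<in> sets PN"
      by (simp add: \<rho>_def u_def)
  qed
  finally show ?thesis .
qed

text \<open>The truth lies in the ball exactly when the rescaled centre \<open>vmean n W\<close> has
  norm at most R. Outside small events R^2 lies between the quantiles r1 and r2, so the coverage is
  squeezed between the probabilities that the squared norm of the centre is below r1 or r2. The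
  smoothness constraint matters only for the lower bound, where \<open>Mr_lower\<close> supplies
  it.\<close>

lemma coverage:
  "(\<lambda>n. measure (obs_law \<psi> J0 F0 n) {x \<in> space (obs_law \<psi> J0 F0 n). F0 \<in> CS n x}) \<longlonglongrightarrow> 1 - \<alpha>"
proof (rule LIMSEQ_I)
  fix \<epsilon> :: real assume \<epsilon>: "\<epsilon> > 0"
  \<comment> \<open>The lower bound loses 2 e through the law of the centre and e for each of two
    small events; the fifth e gives the strict inequality.\<close>
  define e where "e = min (e0 / 2) (\<epsilon> / 5)"
  have e: "0 < e" "e < e0" "5 * e \<le> \<epsilon>" using e0_pos \<epsilon> by (auto simp: e_def min_def)
  obtain r1 where r1: "r1 > 0" "Fq r1 = 1 - \<alpha> - e" "(\<lambda>n. emeasure WN {W \<in> space WN. 1 - \<alpha> \<le> Gn n W r1}) \<longlonglongrightarrow> 0"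
    using lower_quantile[OF e(1,2)] .
  obtain r2 where r2: "r2 > 0" "Fq r2 = 1 - \<alpha> + e" "(\<lambda>n. emeasure WN {W \<in> space WN. Gn n W r2 \<le> 1 - \<alpha>}) \<longlonglongrightarrow> 0"
    using upper_quantile[OF e(1,2)] .
  have z1: "eventually (\<lambda>n. 1 - \<alpha> - 2 * e \<le> measure WN {W \<in> space WN. wsum J0 wh (vmean n W) \<le> ennreal r1}) sequentially"
    using r1 e by (intro vmean_cdf_lower) auto
  have z2: "eventually (\<lambda>n. measure WN {W \<in> space WN. wsum J0 wh (vmean n W) \<le> ennreal r2} \<le> 1 - \<alpha> + 2 * e) sequentially"
    using r2 e by (intro vmean_cdf_upper) auto
  have d: "eventually (\<lambda>n. \<delta>n n < 1 / 2) sequentially" by (rule order_tendstoD(2)[OF \<delta>n_limit]) simp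
  have "eventually (\<lambda>n. norm (measure (obs_law \<psi> J0 F0 n) {x \<in> space (obs_law \<psi> J0 F0 n). F0 \<in> CS n x} - (1 - \<alpha>)) < \<epsilon>) sequentially"
    using z1 z2 d ennreal_tendsto_0D[OF r1(3) e(1)] ennreal_tendsto_0D[OF r2(3) e(1)]
      ennreal_tendsto_0D[OF Sbad_limit e(1)] eventually_ge_at_top[of 3]
  proof eventually_elim
    case (elim n)
    then have n: "n > 0" by simp
    let ?Z = "\<lambda>r. {W \<in> space WN. wsum J0 wh (vmean n W) \<le> ennreal r}"
    let ?G1 = "{W \<in> space WN. 1 - \<alpha> \<le> Gn n W r1}" and ?G2 = "{W \<in> space WN. Gn n W r2 \<le> 1 - \<alpha>}"
    let ?E = "{x \<in> space PN. F0 \<in> CS n x}"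
    have ms: "?Z r \<in> sets WN" "?G1 \<in> sets WN" "?G2 \<in> sets WN" for r by measurable
    let ?C = "X n -` ?E \<inter> space WN"
    have C: "?C \<in> sets WN" using X_measurable coverage_sets[OF n] by (rule measurable_sets)
    have eq: "measure (obs_law \<psi> J0 F0 n) {x \<in> space (obs_law \<psi> J0 F0 n). F0 \<in> CS n x} = measure WN ?C"
      unfolding obs_law_eq using coverage_sets[OF n] by (simp add: measure_distr)
    have small: "measure WN ?G1 < e" "measure WN ?G2 < e" "measure WN (Sbad n) < e"
      using elim e by (simp_all add: WNO.M1.emeasure_eq_measure ennreal_less_iff)
    have cs: "F0 \<in> CS n (X n W) \<longleftrightarrow> ereal m0 \<le> Mr n (X n W) + ereal (4 * \<eta>) \<and> 0 \<le> R n (X n W) \<and>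
        wsum J0 wh (vmean n W) \<le> ennreal ((R n (X n W))\<^sup>2)" if "good n W" for W
    proof -
      have "wsum J0 wh (\<lambda>i. resc n F0 i - vmean n W i) = wsum J0 wh (vmean n W)"
        by (rule wsum_cong) (simp add: resc_def)
      then show ?thesis using CS_iff[OF n that, of F0] by (simp add: nrm_F0)
    qed
    have "measure WN ?C \<le> measure WN (?Z r2 \<union> ?G2)"
    proof (rule WNO.M1.finite_measure_mono_AE)
      show "AE W in WN. W \<in> ?C \<longrightarrow> W \<in> ?Z r2 \<union> ?G2"
        using AE_R[OF n]
      proof eventually_elim
        case (elim W)
        show ?case
        proof (intro impI, rule ccontr)
          assume "W \<in> ?C" and no: "W \<notin> ?Z r2 \<union> ?G2"
          then have "wsum J0 wh (vmean n W) \<le> ennreal ((R n (X n W))\<^sup>2)" using cs elim by auto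
          moreover have "(R n (X n W))\<^sup>2 < r2" using elim no by (intro R_less n) auto
          then have "ennreal ((R n (X n W))\<^sup>2) \<le> ennreal r2" by (intro ennreal_leI) simp
          ultimately have "wsum J0 wh (vmean n W) \<le> ennreal r2" by (rule order_trans)
          then show False using no elim by auto
        qed
      qed
    qed (rule sets.Un[OF ms(1) ms(3)])
    also have "\<dots> \<le> measure WN (?Z r2) + measure WN ?G2" using ms by (intro measure_Un_le)
    finally have up: "measure WN ?C \<le> 1 - \<alpha> + 3 * e" using elim small by linarith
    have "measure WN (?Z r1) \<le> measure WN (?C \<union> (?G1 \<union> Sbad n))"
    proof (rule WNO.M1.finite_measure_mono_AE)
      show "AE W in WN. W \<in> ?Z r1 \<longrightarrow> W \<in> ?C \<union> (?G1 \<union> Sbad n)"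
        using AE_R[OF n]
      proof eventually_elim
        case (elim W)
        show ?case
        proof (intro impI, rule ccontr)
          assume z: "W \<in> ?Z r1" and no: "W \<notin> ?C \<union> (?G1 \<union> Sbad n)"
          have "r1 < (R n (X n W))\<^sup>2" using elim no by (intro R_greater n) auto
          then have "ennreal r1 \<le> ennreal ((R n (X n W))\<^sup>2)" by (intro ennreal_leI) simp
          with z have 1: "wsum J0 wh (vmean n W) \<le> ennreal ((R n (X n W))\<^sup>2)" by (auto intro: order_trans)
          have "ereal (m0 - 4 * \<eta>) + ereal (4 * \<eta>) \<le> Mr n (X n W) + ereal (4 * \<eta>)"
            using elim no \<open>\<delta>n n < 1 / 2\<close> by (intro add_mono Mr_lower \<open>3 \<le> n\<close>) auto
          then have "F0 \<in> CS n (X n W)" using cs[of W] elim 1 by simp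
          then show False using no elim X_space[of n W] by auto
        qed
      qed
    qed (rule sets.Un[OF C sets.Un[OF ms(2) Sbad_sets]])
    also have "\<dots> \<le> measure WN ?C + measure WN (?G1 \<union> Sbad n)"
      by (rule measure_Un_le[OF C sets.Un[OF ms(2) Sbad_sets]])
    also have "measure WN (?G1 \<union> Sbad n) \<le> measure WN ?G1 + measure WN (Sbad n)" by (rule measure_Un_le[OF ms(2) Sbad_sets])
    finally have low: "1 - \<alpha> - 4 * e \<le> measure WN ?C" using elim small by linarith
    show ?case unfolding eq using up low e by (simp add: abs_less_iff)
  qed
  then show "\<exists>N. \<forall>n\<ge>N. norm (measure (obs_law \<psi> J0 F0 n) {x \<in> space (obs_law \<psi> J0 F0 n). F0 \<in> CS n x} - (1 - \<alpha>)) < \<epsilon>"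
    by (simp add: eventually_sequentially)
qed

end

theorem corollary2:
  fixes \<gamma> \<alpha> \<delta> \<eta> :: real and S J0 :: nat
    and \<psi> :: "nat \<Rightarrow> nat \<Rightarrow> real \<Rightarrow> real"
    and \<Omega> :: "'w measure" and g :: "nat \<times> nat \<Rightarrow> 'w \<Rightarrow> real" and \<phi> :: "real \<Rightarrow> real"
    and prior :: "L2 measure" and f0 :: "real \<Rightarrow> real"
    and R :: "nat \<Rightarrow> (nat \<times> nat \<Rightarrow> real) \<Rightarrow> real"
    and P :: "nat \<Rightarrow> (nat \<times> nat \<Rightarrow> real) measure"
  assumes "\<gamma> > 0" and "0 < \<alpha>" and "\<alpha> < 1" and "\<delta> > 1 / 2" and "\<eta> > 0"
    and "J0 - 1 \<ge> 1" and "real S > max \<gamma> (1 / 2)" and "cdv_basis S J0 \<psi>"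
    and "prob_space \<Omega>"
    and "prob_space.indep_vars \<Omega> (\<lambda>_. borel) g (idx J0)"
    and "\<And>i. i \<in> idx J0 \<Longrightarrow> distributed \<Omega> lborel (g i) (\<lambda>t. ennreal (\<phi> t))"
    and "\<And>t. \<phi> t > 0" and "bounded (range \<phi>)" and "continuous_on UNIV \<phi>"
    and "\<And>i. i \<in> idx J0 \<Longrightarrow> integrable \<Omega> (\<lambda>v. (g i v)\<^sup>2)"
    and "prior = series_prior \<psi> J0 \<gamma> \<Omega> g"
    and "f0 \<in> holder_space \<psi> J0 \<gamma>"
    and "P = obs_law \<psi> J0 (to_L2 f0)"
    and "\<And>n. n > 0 \<Longrightarrow> R n \<in> borel_measurable (P n)"
    and "\<And>n. n > 0 \<Longrightarrow> AE x in P n. measure (posterior \<psi> J0 prior n x)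
           (H_ball \<psi> J0 \<delta> (posterior_mean \<psi> J0 prior n x) (R n x / sqrt (real n))) = 1 - \<alpha>"
  shows "((\<lambda>n. measure (P n) {x \<in> space (P n). to_L2 f0 \<in> credible_set \<psi> J0 prior \<gamma> \<delta> \<eta> R n x})
           \<longlonglongrightarrow> 1 - \<alpha>) \<and>
         tendsto_in_prob P
           (\<lambda>n x. measure (posterior \<psi> J0 prior n x) (credible_set \<psi> J0 prior \<gamma> \<delta> \<eta> R n x)) (1 - \<alpha>) \<and>
         (\<exists>\<kappa>>0. bounded_in_prob P (\<lambda>n x. ediameter (credible_set \<psi> J0 prior \<gamma> \<delta> \<eta> R n x))
           (\<lambda>n. real n powr (- \<gamma> / (2 * \<gamma> + 1)) * ln (real n) powr \<kappa>)) \<and>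
         bounded_in_prob P (smoothness_radius \<psi> J0 prior \<gamma> \<eta>) (\<lambda>_. 1) \<and>
         bounded_in_prob P (\<lambda>n x. ereal (R n x)) (\<lambda>_. 1)"
proof -
  have J0: "J0 - 1 \<ge> 1" using assms by blast
  let ?i0 = "(J0 - 1, 0) :: nat \<times> nat"
  interpret O: prob_space \<Omega> by fact
  have i0: "?i0 \<in> idx J0" by (simp add: idx_def level_size_def)
  have \<phi>_pos: "\<phi> t > 0" for t by fact
  have dist: "distributed \<Omega> lborel (g ?i0) (\<lambda>t. ennreal (\<phi> t))"
    using assms(11) i0 by blast
  have [measurable]: "\<phi> \<in> borel_measurable borel"
    using assms(14) by (rule borel_measurable_continuous_onI)
  have dist': "distributed \<Omega> lborel (g ?i0) \<phi>" using dist by simp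
  obtain K where K: "\<phi> t \<le> K" for t
    using assms(13) unfolding bounded_iff by (auto intro: that abs_le_D1)
  have \<phi>_int: "integrable lborel \<phi>"
    using distributed_integrable[OF dist', of "\<lambda>_. 1"] \<phi>_pos by (simp add: less_imp_le)
  have sq: "integrable \<Omega> (\<lambda>v. (g ?i0 v)\<^sup>2)" using assms(15) i0 by blast
  have \<phi>_sq_int: "integrable lborel (\<lambda>t. t\<^sup>2 * \<phi> t)"
    using distributed_integrable[OF dist', of "\<lambda>t. t\<^sup>2"] sq \<phi>_pos
    by (simp add: less_imp_le mult.commute)
  obtain B where B: "\<And>i. i \<in> idx J0 \<Longrightarrow>
      2 powr (real (fst i) * (\<gamma> + 1 / 2)) * \<bar>coeff \<psi> (to_L2 f0) i\<bar> \<le> B"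
    using assms(17) unfolding holder_space_def bdd_above_def by (auto simp: split_beta)
  have F0: "\<bar>coeff \<psi> (to_L2 f0) i\<bar> \<le> B * 2 powr (- real (fst i) * (\<gamma> + 1 / 2))"
    if "i \<in> idx J0" for i
  proof -
    have "\<bar>coeff \<psi> (to_L2 f0) i\<bar> \<le> B / 2 powr (real (fst i) * (\<gamma> + 1 / 2))"
      using B[OF that] by (simp add: pos_le_divide_eq mult.commute)
    then show ?thesis by (simp add: powr_minus_divide minus_mult_left[symmetric] del: mult_minus_left)
  qed
  interpret credible_model \<phi> K \<Omega> \<gamma> J0 \<psi> g "to_L2 f0" B \<delta> \<alpha> \<eta> R
  proof unfold_locales
    show "orthonormal_basis (\<lambda>(l, k). to_L2 (\<psi> l k)) (idx J0)"
      using assms(8) by (simp add: cdv_basis_def)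
  qed (use assms K \<phi>_int \<phi>_sq_int F0 in \<open>auto simp del: One_nat_def\<close>)
  \<comment> \<open>\<delta> + 1 is the witness for the exponent \<kappa>: the power of the
    logarithm produced by \<open>interpolation\<close>.\<close>
  have "\<delta> + 1 > 0" using assms(4) by simp
  with coverage posterior_mass diameter_bounded smoothness_bounded radius_bounded
  show ?thesis unfolding assms(16) assms(18) by blast
qed

end
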